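(* For any $\varepsilon>0$ and any $\overline{y}\in H^1([0,T];H^1(\mathcal{D}))$, there exists a unique $u^\varepsilon\in H^1\big([0,T];L^2(\Omega;H^1_{\Gamma_D})\big)$ such that $u^\varepsilon(0)=0$ and, for almost every $(t,\omega)\in[0,T]\times\Omega$, $$\partial\Psi^\varepsilon_{t,\omega}[\dot u^\varepsilon(t,\omega)]+\nabla\Phi^\varepsilon_{t,\omega}[u^\varepsilon(t,\omega)]\ni 0\quad\text{in }(H^1_{\Gamma_D})'.$$
   Context: **Spatial setting.** $T>0$; $\mathcal{D}\subset\mathbb{R}^d$ is a bounded Lipschitz domain, whose boundary is partitioned into relatively open sets $\partial\mathcal{D}=\Gamma_D\cup\Gamma_N$, $\Gamma_D\cap\Gamma_N=\emptyset$, $\Gamma_D\neq\emptyset$, and $\Gamma_D$ has non-zero capacity. $H^1_{\Gamma_D}$ is the closure in $H^1(\mathcal{D})$ of $C^1_0(\mathcal{D}\cup\Gamma_N)$ (real-valued continuously differentiable functions compactly supported in $\mathcal{D}\cup\Gamma_N$). The capacity assumption entails the Poincaré inequality $\|u\|_{L^2(\mathcal{D})}\le C\|D_xu\|_{L^2(\mathcal{D})}$ on $H^1_{\Gamma_D}$, which is normed by $\|u\|_{H^1_{\Gamma_D}}=\|D_xu\|_{L^2(\mathcal{D})}$. $D_x$ is the weak gradient in $x$, and a dot denotes the time derivative. Functions are scalar-valued. **Probability setting.** $(\Omega,\Sigma,\mathbb{P})$ is a probability space with $L^2(\Omega)$ separable, with a $d$-dimensional ergodic dynamical system: measurable invertible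 maps $T(x):\Omega\to\Omega$, $x\in\mathbb{R}^d$, such that $T(0)=\mathrm{id}$ and $T(x)\circ T(y)=T(x+y)$; $\mathbb{P}[T(x)^{-1}E]=\mathbb{P}[E]$ for all $x$ and $E\in\Sigma$; for any $E\in\Sigma$ the set $\{(\omega,x):T(x)\omega\in E\}$ belongs to the sigma-algebra generated by $\Sigma\times\mathcal{M}^d$ ($\mathcal{M}^d$ the Lebesgue sigma-algebra on $\mathbb{R}^d$); and any $E\in\Sigma$ with $\mathbb{P}[T(x)E\,\triangle\,E]=0$ for all $x$ has $\mathbb{P}[E]\in\{0,1\}$. A function $F$ on $\Omega\times\mathbb{R}^d$ is stationary if there is $F_0$ on $\Omega$ with $F(\omega,x)=F_0(T(x)\omega)$ for any $x$ and $\mathbb{P}$-a.e. $\omega$. **Assumptions on $A$.** $A:\Omega\times\mathbb{R}^d\to\mathbb{R}^{d\times d}$ is measurable with respect to the sigma-algebra generated by $\Sigma\times\mathcal{M}^d$, stationary with $A(\omega,x)=A_0(T(x)\omega)$, $A_0$ measurable; $A$ is symmetric a.e.; there are $0<\underline{A}\le\overline{A}<\infty$ with $\underline{A}|\xi|^2\le\xi\cdot A(\omega,x)\xi\le\overline{A}|\xi|^2$ for all $\xi\in\mathbb{R}^d$, a.e. in $\Omega\times\mathbb{R}^d$. **Assumptions on $\psi$.** $\psi:\Omega\times\mathbb{R}^d\times\mathbb{R}^d\to\mathbb{R}$ satisfies: ($\psi$1) for any $\xi$, $(\omega,x)\mapsto\psi(\omega,x,\xi)$ is measurable with respect to the sigma-algebra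 generated by $\Sigma\times\mathcal{M}^d$ and stationary: there is $\psi_0:\Omega\times\mathbb{R}^d\to\mathbb{R}$ with $\psi(\omega,x,\xi)=\psi_0(T(x)\omega,\xi)$ for any $x$ and a.e. $\omega$; ($\psi$2) $\psi\ge0$ and $\psi(\omega,x,0)=0$; ($\psi$3) there is $c>0$ such that $\xi\mapsto\psi(\omega,x,\xi)-c|\xi|^2$ is convex for a.e. $(\omega,x)$; ($\psi$4) there is $C>0$ such that for any $\xi$, $\psi(\omega,x,\xi)\le C(1+|\xi|^2)$ for a.e. $(\omega,x)$. **Functionals.** For $u,v\in H^1_{\Gamma_D}$, $$\Phi^\varepsilon_{t,\omega}[u]=\frac12\int_{\mathcal{D}}D_x(\overline{y}(t)+u)\cdot A(\omega,x/\varepsilon)D_x(\overline{y}(t)+u)\,dx,\qquad \Psi^\varepsilon_{t,\omega}[v]=\int_{\mathcal{D}}\psi\big(\omega,x/\varepsilon,D_x\dot{\overline{y}}(t)+D_xv\big)\,dx.$$ $\nabla\Phi^\varepsilon_{t,\omega}[u]\in(H^1_{\Gamma_D})'$ is the Gâteaux derivative, $\langle\nabla\Phi^\varepsilon_{t,\omega}[u],w\rangle=\int_{\mathcal{D}}A(\omega,x/\varepsilon)D_x(\overline{y}(t)+u)\cdot D_xw\,dx$, and $\partial\Psi^\varepsilon_{t,\omega}[v]\subset(H^1_{\Gamma_D})'$ is the convex subdifferential. Elements of $H^1([0,T];X)$ are identified with their continuous representatives in $C([0,T];X)$ when evaluated at a time. *)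

theory Defs
  imports
    "HOL-Analysis.Analysis"
    "HOL-Probability.Probability_Measure"
    "HOL-Library.Function_Algebras"
begin

text \<open>
  Elements of Lebesgue, Sobolev and Bochner spaces are represented by functions, with the
  pointwise vector space structure; passing to equivalence classes means identifying two
  functions whose difference has seminorm zero.
\<close>

instantiation "fun" :: (type, real_vector) real_vector
begin

definition scaleR_fun_def: "scaleR c f = (\<lambda>x. c *\<^sub>R f x)"

instance
  by standard (auto simp: scaleR_fun_def fun_eq_iff algebra_simps)

end


section \<open>Seminormed spaces and their Bochner spaces\<close>

text \<open>
  A normed space is presented by a linear subspace of representatives and a seminorm on it.
  The types of the library do not suffice here, because the spaces below depend on a domain,
  a part of its boundary and a measure.
\<close>

record 'v nspace =
  carr :: "'v set"
  nrm :: "'v \<Rightarrow> real"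

text \<open>
  The approximation by simple functions is required at every point of \<open>space M\<close>, not only
  almost everywhere, so that norms and sections of strongly measurable functions are measurable
  even if \<open>M\<close> is not complete. Every class of functions modulo equality almost everywhere
  that is strongly measurable in the almost everywhere sense has such a representative.
\<close>

definition strongly_measurable :: "('v::real_vector) nspace \<Rightarrow> 'i measure \<Rightarrow> ('i \<Rightarrow> 'v) \<Rightarrow> bool" where
  "strongly_measurable X M f \<longleftrightarrow>
     (\<forall>x\<in>space M. f x \<in> carr X) \<and>
     (\<exists>s. (\<forall>n. simple_function M (s n) \<and> s n ` space M \<subseteq> carr X) \<and>
          (\<forall>x\<in>space M. (\<lambda>n. nrm X (f x - s n x)) \<longlonglongrightarrow> 0))"

definition bochner_L2 :: "('v::real_vector) nspace \<Rightarrow> 'i measure \<Rightarrow> ('i \<Rightarrow> 'v) nspace" where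
  "bochner_L2 X M =
     \<lparr> carr = {f. strongly_measurable X M f \<and> integrable M (\<lambda>x. (nrm X (f x))\<^sup>2)},
       nrm = (\<lambda>f. sqrt (LINT x|M. (nrm X (f x))\<^sup>2)) \<rparr>"

text \<open>The analogue of \<^const>\<open>has_bochner_integral\<close> for a seminormed space.\<close>

definition has_bochner_integral_in ::
  "('v::real_vector) nspace \<Rightarrow> 'i measure \<Rightarrow> ('i \<Rightarrow> 'v) \<Rightarrow> 'v \<Rightarrow> bool" where
  "has_bochner_integral_in X M f y \<longleftrightarrow>
     strongly_measurable X M f \<and> y \<in> carr X \<and>
     (\<exists>s. (\<forall>n. Bochner_Integration.simple_bochner_integrable M (s n) \<and> s n ` space M \<subseteq> carr X) \<and>
          (\<lambda>n. \<integral>\<^sup>+x. ennreal (nrm X (f x - s n x)) \<partial>M) \<longlonglongrightarrow> 0 \<and>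
          (\<lambda>n. nrm X (Bochner_Integration.simple_bochner_integral M (s n) - y)) \<longlonglongrightarrow> 0)"


section \<open>Test functions and Sobolev spaces\<close>

fun C_k :: "nat \<Rightarrow> ('a::euclidean_space \<Rightarrow> real) \<Rightarrow> bool" where
  "C_k 0 \<phi> \<longleftrightarrow> continuous_on UNIV \<phi>"
| "C_k (Suc k) \<phi> \<longleftrightarrow>
     (\<forall>x. \<phi> differentiable (at x)) \<and>
     (\<forall>i\<in>Basis. C_k k (\<lambda>x. frechet_derivative \<phi> (at x) i))"

definition test_functions :: "'a::euclidean_space set \<Rightarrow> ('a \<Rightarrow> real) set" where
  "test_functions S =
     {\<phi>. (\<forall>k. C_k k \<phi>) \<and> compact (closure {x. \<phi> x \<noteq> 0}) \<and> closure {x. \<phi> x \<noteq> 0} \<subseteq> S}"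

definition square_integrable :: "'i measure \<Rightarrow> ('i \<Rightarrow> 'b::euclidean_space) \<Rightarrow> bool" where
  "square_integrable M f \<longleftrightarrow> f \<in> borel_measurable M \<and> integrable M (\<lambda>x. (norm (f x))\<^sup>2)"

definition has_weak_gradient ::
  "(real^'n) set \<Rightarrow> (real^'n \<Rightarrow> real) \<Rightarrow> (real^'n \<Rightarrow> real^'n) \<Rightarrow> bool" where
  "has_weak_gradient D u g \<longleftrightarrow>
     (\<forall>\<phi>\<in>test_functions D. \<forall>i\<in>Basis.
        (LINT x|lebesgue_on D. u x * frechet_derivative \<phi> (at x) i) =
        - (LINT x|lebesgue_on D. (g x \<bullet> i) * \<phi> x))"

text \<open>On an open set the weak gradient is determined up to a null set.\<close>

definition weak_gradient :: "(real^'n) set \<Rightarrow> (real^'n \<Rightarrow> real) \<Rightarrow> (real^'n \<Rightarrow> real^'n)" where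
  "weak_gradient D u = (SOME g. square_integrable (lebesgue_on D) g \<and> has_weak_gradient D u g)"

definition H1 :: "(real^'n) set \<Rightarrow> (real^'n \<Rightarrow> real) nspace" where
  "H1 D =
     \<lparr> carr = {u. square_integrable (lebesgue_on D) u \<and>
                  (\<exists>g. square_integrable (lebesgue_on D) g \<and> has_weak_gradient D u g)},
       nrm = (\<lambda>u. sqrt ((LINT x|lebesgue_on D. (u x)\<^sup>2) +
                        (LINT x|lebesgue_on D. (norm (weak_gradient D u x))\<^sup>2))) \<rparr>"

text \<open>
  Continuously differentiable functions on a set \<open>S\<close>, not necessarily open, with compact support
  in \<open>S\<close>. Values outside \<open>S\<close> are irrelevant.
\<close>

definition C1_compact :: "(real^'n) set \<Rightarrow> (real^'n \<Rightarrow> real) set" where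
  "C1_compact S =
     {u. (\<exists>g. continuous_on S g \<and>
              (\<forall>x\<in>S. (u has_derivative (\<lambda>h. g x \<bullet> h)) (at x within S))) \<and>
         compact (closure {x\<in>S. u x \<noteq> 0}) \<and> closure {x\<in>S. u x \<noteq> 0} \<subseteq> S}"

text \<open>The closure is taken in \<^term>\<open>H1 D\<close>; the norm is that of the gradient only.\<close>

definition H1_zero_on ::
  "(real^'n) set \<Rightarrow> (real^'n) set \<Rightarrow> (real^'n \<Rightarrow> real) nspace" where
  "H1_zero_on D \<Gamma>N =
     \<lparr> carr = {u \<in> carr (H1 D). \<forall>e>0. \<exists>\<phi> \<in> C1_compact (D \<union> \<Gamma>N) \<inter> carr (H1 D). nrm (H1 D) (u - \<phi>) < e},
       nrm = (\<lambda>u. sqrt (LINT x|lebesgue_on D. (norm (weak_gradient D u x))\<^sup>2)) \<rparr>"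

text \<open>The Sobolev capacity of order 2.\<close>

definition capacity :: "(real^'n) set \<Rightarrow> ennreal" where
  "capacity E =
     (INF v \<in> {v \<in> carr (H1 UNIV).
                 \<exists>U. open U \<and> E \<subseteq> U \<and> (AE x in lebesgue. x \<in> U \<longrightarrow> v x \<ge> 1)}.
        ennreal ((nrm (H1 UNIV) v)\<^sup>2))"

text \<open>
  Near each boundary point the domain is the region above the graph of a Lipschitz function,
  where \<open>e\<close> is the vertical direction and the hyperplane orthogonal to \<open>e\<close> is the base.
\<close>

definition lipschitz_domain :: "(real^'n) set \<Rightarrow> bool" where
  "lipschitz_domain D \<longleftrightarrow>
     open D \<and> connected D \<and> D \<noteq> {} \<and>
     (\<forall>p\<in>frontier D. \<exists>r>0. \<exists>e. \<exists>\<gamma>. \<exists>L. norm e = 1 \<and>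
        L-lipschitz_on {z. z \<bullet> e = 0} \<gamma> \<and>
        D \<inter> ball p r = {x \<in> ball p r. x \<bullet> e > \<gamma> (x - (x \<bullet> e) *\<^sub>R e)})"


section \<open>Sobolev functions of time\<close>

definition has_weak_time_derivative ::
  "real \<Rightarrow> ('v::real_vector) nspace \<Rightarrow> (real \<Rightarrow> 'v) \<Rightarrow> (real \<Rightarrow> 'v) \<Rightarrow> bool" where
  "has_weak_time_derivative T X u v \<longleftrightarrow>
     (\<forall>\<phi>\<in>test_functions {0<..<T}. \<exists>y.
        has_bochner_integral_in X (lebesgue_on {0..T}) (\<lambda>t. deriv \<phi> t *\<^sub>R u t) y \<and>
        has_bochner_integral_in X (lebesgue_on {0..T}) (\<lambda>t. \<phi> t *\<^sub>R v t) (- y))"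

text \<open>The continuous representatives of the elements of the Sobolev space on \<open>{0..T}\<close>.\<close>

definition time_H1 :: "real \<Rightarrow> ('v::real_vector) nspace \<Rightarrow> (real \<Rightarrow> 'v) set" where
  "time_H1 T X =
     {u. u \<in> carr (bochner_L2 X (lebesgue_on {0..T})) \<and>
         (\<forall>t\<in>{0..T}. ((\<lambda>s. nrm X (u s - u t)) \<longlongrightarrow> 0) (at t within {0..T})) \<and>
         (\<exists>v\<in>carr (bochner_L2 X (lebesgue_on {0..T})). has_weak_time_derivative T X u v)}"

definition time_derivative :: "real \<Rightarrow> ('v::real_vector) nspace \<Rightarrow> (real \<Rightarrow> 'v) \<Rightarrow> (real \<Rightarrow> 'v)" where
  "time_derivative T X u =
     (SOME v. v \<in> carr (bochner_L2 X (lebesgue_on {0..T})) \<and> has_weak_time_derivative T X u v)"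

text \<open>
  An element \<open>u\<close> of \<open>L\<^sup>2([0,T]; L\<^sup>2(\<Omega>; X))\<close> is, for every \<open>t\<close>, a class of functions of \<open>\<omega>\<close>.
  Statements about almost every pair \<open>(t, \<omega>)\<close> refer to a jointly measurable representative
  \<open>U\<close>, which is unique up to a null set of pairs.
\<close>

definition joint_representative ::
  "real \<Rightarrow> ('v::real_vector) nspace \<Rightarrow> 'w measure \<Rightarrow> (real \<Rightarrow> 'w \<Rightarrow> 'v) \<Rightarrow> (real \<times> 'w \<Rightarrow> 'v) \<Rightarrow> bool" where
  "joint_representative T X M u U \<longleftrightarrow>
     strongly_measurable X (lebesgue_on {0..T} \<Otimes>\<^sub>M M) U \<and>
     (AE t in lebesgue_on {0..T}. AE \<omega> in M. nrm X (U (t, \<omega>) - u t \<omega>) = 0)"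


section \<open>Dual space, subdifferential and Gateaux derivative\<close>

definition dual :: "('v::real_vector) nspace \<Rightarrow> ('v \<Rightarrow> real) set" where
  "dual X =
     {p. (\<forall>u\<in>carr X. \<forall>v\<in>carr X. p (u + v) = p u + p v) \<and>
         (\<forall>c. \<forall>u\<in>carr X. p (c *\<^sub>R u) = c * p u) \<and>
         (\<exists>K. \<forall>u\<in>carr X. \<bar>p u\<bar> \<le> K * nrm X u)}"

definition subdifferential :: "('v::real_vector) nspace \<Rightarrow> ('v \<Rightarrow> real) \<Rightarrow> 'v \<Rightarrow> ('v \<Rightarrow> real) set" where
  "subdifferential X F v = {p \<in> dual X. \<forall>w\<in>carr X. F w \<ge> F v + p (w - v)}"

definition has_gateaux_derivative ::
  "('v::real_vector) nspace \<Rightarrow> ('v \<Rightarrow> real) \<Rightarrow> ('v \<Rightarrow> real) \<Rightarrow> 'v \<Rightarrow> bool" where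
  "has_gateaux_derivative X F q u \<longleftrightarrow>
     q \<in> dual X \<and>
     (\<forall>w\<in>carr X. ((\<lambda>h. (F (u + h *\<^sub>R w) - F u) / h) \<longlongrightarrow> q w) (at 0))"


section \<open>Ergodic dynamical systems\<close>

definition separable_L2 :: "'w measure \<Rightarrow> bool" where
  "separable_L2 M \<longleftrightarrow>
     (\<exists>C. countable C \<and> (\<forall>g\<in>C. square_integrable M g) \<and>
          (\<forall>f :: 'w \<Rightarrow> real. square_integrable M f \<longrightarrow>
             (\<forall>e>0. \<exists>g\<in>C. sqrt (LINT \<omega>|M. (f \<omega> - g \<omega>)\<^sup>2) < e)))"

definition ergodic_dynamical_system :: "'w measure \<Rightarrow> (real^'n \<Rightarrow> 'w \<Rightarrow> 'w) \<Rightarrow> bool" where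
  "ergodic_dynamical_system M \<tau> \<longleftrightarrow>
     (\<forall>x. \<tau> x \<in> measurable M M \<and> bij_betw (\<tau> x) (space M) (space M)) \<and>
     (\<forall>\<omega>\<in>space M. \<tau> 0 \<omega> = \<omega>) \<and>
     (\<forall>x y. \<forall>\<omega>\<in>space M. \<tau> x (\<tau> y \<omega>) = \<tau> (x + y) \<omega>) \<and>
     (\<forall>x. \<forall>E\<in>sets M. emeasure M (\<tau> x -` E \<inter> space M) = emeasure M E) \<and>
     (\<forall>E\<in>sets M. {(\<omega>, x). \<omega> \<in> space M \<and> \<tau> x \<omega> \<in> E} \<in> sets (M \<Otimes>\<^sub>M lebesgue)) \<and>
     (\<forall>E\<in>sets M. (\<forall>x. emeasure M ((\<tau> x ` E - E) \<union> (E - \<tau> x ` E)) = 0) \<longrightarrow>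
                 emeasure M E = 0 \<or> emeasure M E = 1)"


section \<open>The functionals and the evolution inclusion\<close>

text \<open>Here \<open>y\<close> and \<open>y'\<close> are the boundary datum and its time derivative at a fixed time.\<close>

definition Phi ::
  "(real^'n) set \<Rightarrow> ('w \<Rightarrow> real^'n \<Rightarrow> real^'n^'n) \<Rightarrow> real \<Rightarrow> (real^'n \<Rightarrow> real) \<Rightarrow> 'w
     \<Rightarrow> (real^'n \<Rightarrow> real) \<Rightarrow> real" where
  "Phi D A \<epsilon> y \<omega> u =
     1 / 2 * (LINT x|lebesgue_on D.
       weak_gradient D (y + u) x \<bullet> (A \<omega> (x /\<^sub>R \<epsilon>) *v weak_gradient D (y + u) x))"

definition Psi ::
  "(real^'n) set \<Rightarrow> ('w \<Rightarrow> real^'n \<Rightarrow> real^'n \<Rightarrow> real) \<Rightarrow> real \<Rightarrow> (real^'n \<Rightarrow> real) \<Rightarrow> 'w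
     \<Rightarrow> (real^'n \<Rightarrow> real) \<Rightarrow> real" where
  "Psi D \<psi> \<epsilon> y' \<omega> v =
     (LINT x|lebesgue_on D. \<psi> \<omega> (x /\<^sub>R \<epsilon>) (weak_gradient D y' x + weak_gradient D v x))"

definition is_solution ::
  "real \<Rightarrow> (real^'n) set \<Rightarrow> (real^'n) set \<Rightarrow> 'w measure \<Rightarrow>
   ('w \<Rightarrow> real^'n \<Rightarrow> real^'n^'n) \<Rightarrow> ('w \<Rightarrow> real^'n \<Rightarrow> real^'n \<Rightarrow> real) \<Rightarrow> real \<Rightarrow>
   (real \<Rightarrow> real^'n \<Rightarrow> real) \<Rightarrow> (real \<Rightarrow> 'w \<Rightarrow> real^'n \<Rightarrow> real) \<Rightarrow> bool" where
  "is_solution T D \<Gamma>N M A \<psi> \<epsilon> y u \<longleftrightarrow>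
     (let X = H1_zero_on D \<Gamma>N; Y = bochner_L2 X M; y' = time_derivative T (H1 D) y in
      u \<in> time_H1 T Y \<and>
      nrm Y (u 0) = 0 \<and>
      (\<exists>U V. joint_representative T X M u U \<and>
             joint_representative T X M (time_derivative T Y u) V \<and>
             (AE (t, \<omega>) in lebesgue_on {0..T} \<Otimes>\<^sub>M M.
                \<exists>p \<in> subdifferential X (Psi D \<psi> \<epsilon> (y' t) \<omega>) (V (t, \<omega>)).
                \<exists>q. has_gateaux_derivative X (Phi D A \<epsilon> (y t) \<omega>) q (U (t, \<omega>)) \<and>
                    (\<forall>w\<in>carr X. p w + q w = 0))))"

end

(*
  For fixed (t, omega) the inclusion says that the gradient of the velocity v minimises
  g |-> Psi(grad y' + g) + <grad Phi(u), g> over the closed subspace G of L^2 formed by the gradients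
  of H^1_{Gamma_D}. By (psi3) the minimiser is unique and depends Lipschitz continuously on the
  gradient of u, uniformly in (t, omega), and its size at u = 0 is bounded by a square integrable
  function of t alone. So the inclusion is the ordinary differential equation V = R(t, omega, U),
  U(t) = int_0^t V, which Picard iteration solves for every omega at once; measurability of R
  makes U and V jointly measurable, and separability of L^2(Omega) turns them into Bochner measurable
  functions of t. Uniqueness follows from testing with functionals and Gronwall's inequality.

  G is closed because of the Poincare-Wirtinger inequality on bounded Lipschitz domains, which
  is obtained from balls by moving pieces of the boundary layer into the domain and chaining.
*)

theory Submission imports Defs begin

section \<open>Direct method for uniformly convex functionals; orthogonal projections\<close>

section \<open>Uniformly convex minimisation in Hilbert spaces\<close>

text \<open>Functions on \<open>D\<close> are replaced by their gradients, extended by zero, so that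
  one Hilbert space type \<open>l2\<close> serves every domain; the seminormed function space enters
  only through the isometry \<open>grad\<close>. Its range has to be closed, since otherwise a
  minimising sequence of gradients could converge to a field that is the gradient of no admissible
  function.

  The assumptions on the integrands hold only off a null set of pairs (\<omega>, x), while the
  iteration is to run for every \<omega>. At exceptional points the integrands are therefore
  exchanged for harmless ones; this alters the functionals for a null set of \<omega> only, and the
  inclusion is transferred back at the very end.

  A time derivative is a choice among functions that agree almost everywhere, and the values of a
  solution are themselves random functions known up to seminorm 0. Two candidates are hence compared
  through scalar functions of time, obtained from functionals that attain the norm.

  The quadratic growth of a uniformly convex functional away from its minimiser gives uniqueness,
  measurability and Lipschitz dependence of the velocity alike.\<close>

definition uniformly_midconvex_on :: "real => 'h::real_normed_vector set => ('h => real) => bool" where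
 "uniformly_midconvex_on k G F \<longleftrightarrow>
  (\<forall>u\<in>G. \<forall>v\<in>G. F ((1/2) *\<^sub>R (u + v)) <= (F u + F v) / 2 - k * (norm (u - v))\<^sup>2)"

definition minimiser_on :: "'h set => ('h => real) => 'h => bool" where
 "minimiser_on G F v \<longleftrightarrow> v \<in> G \<and> (\<forall>w\<in>G. F v <= F w)"

definition argmin :: "'h set => ('h => real) => 'h" where
 "argmin G F = (SOME v. minimiser_on G F v)"

text \<open>The midpoint of \<open>v\<close> and \<open>w\<close> cannot lie below the minimum, yet
  midconvexity puts it below the average by \<open>k\<close> times the squared distance; doubling
  gives the factor 2. Uniqueness, stability of minimisers and convergence of minimising sequences
  are all read off from this growth.\<close>

lemma minimiser_growth:
 assumes F: "uniformly_midconvex_on k G F" and G: "subspace G"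
  and v: "minimiser_on G F v" and w: "w \<in> G"
 shows "F w \<ge> F v + 2 * k * (norm (w - v))\<^sup>2"
proof -
 have v': "v \<in> G" using v by (simp add: minimiser_on_def)
 have "(1/2) *\<^sub>R (w + v) \<in> G" using G v' w by (intro subspace_scale subspace_add)
 then have "F v <= F ((1/2) *\<^sub>R (w + v))" using v by (simp add: minimiser_on_def)
 also have "... <= (F w + F v) / 2 - k * (norm (w - v))\<^sup>2"
  using F v' w unfolding uniformly_midconvex_on_def by blast
 finally show ?thesis by argo
qed

text \<open>The direct method without weak compactness: midconvexity makes a minimising sequence
  Cauchy, and continuity identifies the value at its limit.\<close>

lemma minimiser_exists:
 fixes F :: "'h::banach => real"
 assumes F: "uniformly_midconvex_on k G F" and k: "k > 0"
  and G: "subspace G" "closed G"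
  and cont: "continuous_on G F" and bdd: "!!u. u \<in> G ==> m <= F u"
 shows "\<exists>v. minimiser_on G F v"
proof -
 define m0 where "m0 = Inf (F ` G)"
 have ne: "F ` G \<noteq> {}" using subspace_0[OF G(1)] by auto
 have bb: "bdd_below (F ` G)" using bdd by (auto simp: bdd_below_def)
 have m0: "m0 <= F u" if "u \<in> G" for u
  unfolding m0_def using bb that by (simp add: cInf_lower)
 have "\<exists>u\<in>G. F u < m0 + 1 / real (Suc n)" for n
  using cInf_lessD[OF ne, of "m0 + 1 / real (Suc n)"] unfolding m0_def by auto
 then obtain x where x: "!!n. x n \<in> G" "!!n. F (x n) < m0 + 1 / real (Suc n)" by metis
 \<comment> \<open>The value at the midpoint is at least the infimum, while the values at both
   points exceed it by little; this slack bounds the squared distance.\<close>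
 have dist: "k * (norm (x i - x j))\<^sup>2 <= (1 / real (Suc i) + 1 / real (Suc j)) / 2" for i j
 proof -
  have "(1/2) *\<^sub>R (x i + x j) \<in> G" using G x by (intro subspace_scale subspace_add)
  then have "m0 <= F ((1/2) *\<^sub>R (x i + x j))" by (rule m0)
  also have "... <= (F (x i) + F (x j)) / 2 - k * (norm (x i - x j))\<^sup>2"
   using F x unfolding uniformly_midconvex_on_def by blast
  finally show ?thesis using x(2)[of i] x(2)[of j] by argo
 qed
 have "Cauchy x"
 proof (rule CauchyI)
  fix e :: real assume e: "e > 0"
  obtain N where N: "1 / real (Suc N) < k * e\<^sup>2"
   using nat_approx_posE[of "k * e\<^sup>2"] k e by auto
  show "\<exists>M. \<forall>i\<ge>M. \<forall>j\<ge>M. norm (x i - x j) < e"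
  proof (intro exI allI impI)
   fix i j assume ij: "i \<ge> N" "j \<ge> N"
   have "1 / real (Suc i) <= 1 / real (Suc N)" "1 / real (Suc j) <= 1 / real (Suc N)"
    using ij by (auto intro!: divide_left_mono)
   then have "k * (norm (x i - x j))\<^sup>2 < k * e\<^sup>2" using dist[of i j] N by argo
   then have "(norm (x i - x j))\<^sup>2 < e\<^sup>2" using k by simp
   then show "norm (x i - x j) < e" using e by (simp add: power_less_imp_less_base)
  qed
 qed
 then obtain v where v: "x \<longlonglongrightarrow> v" using Cauchy_convergent_iff convergent_def by blast
 have vG: "v \<in> G" using closed_sequentially[OF G(2) _ v] x by blast
 have "(\<lambda>n. F (x n)) \<longlonglongrightarrow> F v"
  by (rule continuous_on_tendsto_compose[OF cont v vG]) (simp add: x)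
 moreover have "(\<lambda>n. F (x n)) \<longlonglongrightarrow> m0"
 proof (rule tendsto_sandwich[of "\<lambda>_. m0" _ _ "\<lambda>n. m0 + 1 / real (Suc n)"])
  show "(\<lambda>n. m0 + 1 / real (Suc n)) \<longlonglongrightarrow> m0"
   using tendsto_add[OF tendsto_const[of m0] LIMSEQ_inverse_real_of_nat] by (simp add: inverse_eq_divide)
  show "\<forall>\<^sub>F n in sequentially. F (x n) <= m0 + 1 / real (Suc n)"
   using less_imp_le[OF x(2)] by (intro always_eventually allI)
 qed (use m0 x(1) in \<open>auto intro!: always_eventually\<close>)
 ultimately have "F v = m0" by (rule LIMSEQ_unique)
 then show ?thesis using vG m0 unfolding minimiser_on_def by auto
qed

lemma minimiser_unique:
 assumes "uniformly_midconvex_on k G F" "k > 0" "subspace G"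
  "minimiser_on G F v" "minimiser_on G F w"
 shows "v = w"
proof -
 have "F w \<ge> F v + 2 * k * (norm (w - v))\<^sup>2"
  using assms minimiser_growth[of k G F v w] by (auto simp: minimiser_on_def)
 moreover have "F w <= F v" using assms by (auto simp: minimiser_on_def)
 ultimately have "k * (norm (w - v))\<^sup>2 <= 0" by simp
 then show ?thesis using \<open>k > 0\<close> by (simp add: mult_le_0_iff)
qed

lemma argmin_minimiser:
 assumes "\<exists>v. minimiser_on G F v" shows "minimiser_on G F (argmin G F)"
 unfolding argmin_def using assms by (rule someI_ex)

lemma argmin_eq:
 assumes "uniformly_midconvex_on k G F" "k > 0" "subspace G" "minimiser_on G F v"
 shows "argmin G F = v"
 using minimiser_unique[OF assms(1-3) argmin_minimiser assms(4)] assms(4) by blast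

text \<open>A minimiser depends measurably on parameters because the best of the first \<open>n\<close> members
 of a dense sequence is a measurable minimising sequence.\<close>

lemma argmin_measurable:
 fixes F :: "'z => 'h::{banach, second_countable_topology} => real"
 assumes meas: "!!v. v \<in> G ==> (\<lambda>z. F z v) \<in> borel_measurable N"
  and F: "!!z. z \<in> space N ==> uniformly_midconvex_on k G (F z)" and k: "k > 0"
  and G: "subspace G" "closed G"
  and cont: "!!z. z \<in> space N ==> continuous_on G (F z)"
  and bdd: "!!z u. z \<in> space N ==> u \<in> G ==> m z <= F z u"
 shows "(\<lambda>z. argmin G (F z)) \<in> borel_measurable N"
proof -
 obtain E where E: "countable E" "E \<subseteq> G" "G \<subseteq> closure E"
  using separable[of G] by auto
 have "E \<noteq> {}" using E subspace_0[OF G(1)] by auto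
 then obtain e :: "nat => 'h" where e: "range e = E" using E(1) uncountable_def by metis
 have eG: "e n \<in> G" for n using e E by auto
 \<comment> \<open>\<open>s n z\<close> is the best of \<open>e 0\<close>, ..., \<open>e n\<close>
   at \<open>z\<close>. Finitely many constants are selected by measurable comparisons, so both
   \<open>s n\<close> and its value are measurable.\<close>
 define s where "s = rec_nat (\<lambda>z. e 0) (\<lambda>n r z. if F z (e (Suc n)) < F z (r z) then e (Suc n) else r z)"
 have s0: "s 0 z = e 0" and sS: "s (Suc n) z = (if F z (e (Suc n)) < F z (s n z) then e (Suc n) else s n z)" for n z
  by (auto simp: s_def)
 have meas_e [measurable]: "(\<lambda>z. F z (e n)) \<in> borel_measurable N" for n using meas eG by blast
 have sm: "s n \<in> borel_measurable N \<and> (\<lambda>z. F z (s n z)) \<in> borel_measurable N" for n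
 proof (induction n)
  case 0
  have "s 0 = (\<lambda>z. e 0)" using s0 by auto
  then show ?case by simp
 next
  case (Suc n)
  then have [measurable]: "s n \<in> borel_measurable N" "(\<lambda>z. F z (s n z)) \<in> borel_measurable N" by auto
  have 1: "s (Suc n) = (\<lambda>z. if F z (e (Suc n)) < F z (s n z) then e (Suc n) else s n z)"
   using sS by auto
  have 2: "(\<lambda>z. F z (s (Suc n) z)) = (\<lambda>z. min (F z (e (Suc n))) (F z (s n z)))"
   by (auto simp: sS min_def fun_eq_iff)
  show ?case unfolding 2 unfolding 1 by measurable
 qed
 have sG: "s n z \<in> G" for n z by (induction n) (auto simp: s0 sS eG)
 have sle: "F z (s n z) <= F z (e j)" if "j <= n" for j n z
  using that
 proof (induction n)
  case (Suc n)
  then show ?case by (cases "j = Suc n") (fastforce simp: sS)+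
 qed (simp add: s0)
 show ?thesis
 proof (rule borel_measurable_LIMSEQ_metric)
  show "s n \<in> borel_measurable N" for n using sm by blast
  fix z assume z: "z \<in> space N"
  let ?v = "argmin G (F z)"
  have v: "minimiser_on G (F z) ?v"
   by (rule argmin_minimiser, rule minimiser_exists[OF F[OF z] k G cont[OF z] bdd[OF z]])
  have lim: "(\<lambda>n. F z (s n z)) \<longlonglongrightarrow> F z ?v"
  proof (rule LIMSEQ_I)
   fix r :: real assume r: "r > 0"
   have vG: "?v \<in> G" using v by (simp add: minimiser_on_def)
   obtain d where d: "d > 0" "!!x. x \<in> G ==> dist x ?v < d ==> dist (F z x) (F z ?v) < r"
    using cont[OF z] vG r unfolding continuous_on_iff by blast
   obtain x where x: "x \<in> E" "dist x ?v < d" using E vG d(1) closure_approachable by blast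
   then obtain j where j: "x = e j" using e by blast
   have "F z (e j) < F z ?v + r" using d(2)[of x] x E j by (auto simp: dist_real_def)
   then have "norm (F z (s n z) - F z ?v) < r" if "n \<ge> j" for n
    using sle[OF that, of z] v sG[of n z] by (auto simp: minimiser_on_def)
   then show "\<exists>no. \<forall>n\<ge>no. norm (F z (s n z) - F z ?v) < r" by blast
  qed
  \<comment> \<open>Quadratic growth converts convergence of the values into convergence of the
    points.\<close>
  have "(\<lambda>n. (norm (s n z - ?v))\<^sup>2) \<longlonglongrightarrow> 0"
  proof (rule tendsto_sandwich[of "\<lambda>_. 0" _ _ "\<lambda>n. (F z (s n z) - F z ?v) / (2 * k)"])
   show "(\<lambda>n. (F z (s n z) - F z ?v) / (2 * k)) \<longlonglongrightarrow> 0"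
    using tendsto_divide[OF tendsto_diff[OF lim tendsto_const[of "F z ?v"]] tendsto_const[of "2 * k"]] k by simp
   show "\<forall>\<^sub>F n in sequentially. (norm (s n z - ?v))\<^sup>2 <= (F z (s n z) - F z ?v) / (2 * k)"
    using minimiser_growth[OF F[OF z] G(1) v sG] k
    by (auto intro!: always_eventually simp: field_simps)
  qed auto
  then have "(\<lambda>n. sqrt ((norm (s n z - ?v))\<^sup>2)) \<longlonglongrightarrow> sqrt 0" by (rule tendsto_real_sqrt)
  then show "(\<lambda>n. s n z) \<longlonglongrightarrow> ?v" by (simp add: LIM_zero_iff tendsto_norm_zero_iff)
 qed
qed

text \<open>A simple approximation of \<open>g\<close> freezes the second argument on each of
  finitely many measurable pieces; continuity in that argument carries measurability to the
  limit.\<close>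

lemma borel_measurable_Caratheodory:
 fixes f :: "'w => 'h::{metric_space, second_countable_topology} => 'b::metric_space"
 assumes meas: "!!g. (\<lambda>w. f w g) \<in> borel_measurable M"
  and cont: "!!w. w \<in> space M ==> continuous_on UNIV (f w)"
  and p: "p \<in> N \<rightarrow>\<^sub>M M" and g: "g \<in> borel_measurable N"
 shows "(\<lambda>z. f (p z) (g z)) \<in> borel_measurable N"
proof -
 obtain s where s: "!!i. simple_function N (s i)" "!!x. x \<in> space N ==> (\<lambda>i. s i x) \<longlonglongrightarrow> g x"
  using borel_measurable_implies_sequence_metric[OF g] by blast
 show ?thesis
 proof (rule borel_measurable_LIMSEQ_metric)
  fix i
  have fin: "finite (s i ` space N)" using s(1)[of i] by (simp add: simple_function_def)
  show "(\<lambda>z. f (p z) (s i z)) \<in> borel_measurable N"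
  proof (rule measurable_compose_countable'[where f = "\<lambda>g z. f (p z) g" and g = "s i" and I = "s i ` space N"])
   show "(\<lambda>z. f (p z) h) \<in> borel_measurable N" for h
    using measurable_compose[OF p meas[of h]] .
   show "s i \<in> N \<rightarrow>\<^sub>M count_space (s i ` space N)"
    using fin s(1)[of i] by (simp add: measurable_count_space_eq2 simple_function_def)
   show "countable (s i ` space N)" using fin by (rule countable_finite)
  qed
 next
  fix z assume z: "z \<in> space N"
  have "p z \<in> space M" using p z by (rule measurable_space)
  then show "(\<lambda>i. f (p z) (s i z)) \<longlonglongrightarrow> f (p z) (g z)"
   using continuous_on_tendsto_compose[OF cont s(2)[OF z]] by simp
 qed
qed

subsection \<open>Orthogonal projections\<close>

definition proj :: "'h::real_inner set => 'h => 'h" where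
 "proj G x = argmin G (\<lambda>g. (norm (x - g))\<^sup>2)"

text \<open>The parallelogram identity; it is an equality, hence the constant 1/4.\<close>

lemma dist_square_midconvex:
 fixes x :: "'h::real_inner"
 shows "uniformly_midconvex_on (1/4) G (\<lambda>g. (norm (x - g))\<^sup>2)"
 unfolding uniformly_midconvex_on_def
proof (intro ballI)
 fix u v
 have "x - (1/2) *\<^sub>R (u + v) = (1/2) *\<^sub>R ((x - u) + (x - v))"
  by (simp add: algebra_simps flip: scaleR_2)
 moreover have "u - v = (x - v) - (x - u)" by simp
 ultimately show "(norm (x - (1/2) *\<^sub>R (u + v)))\<^sup>2 <= ((norm (x - u))\<^sup>2 + (norm (x - v))\<^sup>2) / 2 - 1/4 * (norm (u - v))\<^sup>2"
  by (simp only: power2_norm_eq_inner) (simp add: inner_add_left inner_add_right inner_diff_left inner_diff_right inner_commute field_simps)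
qed

lemma proj_minimiser:
 fixes x :: "'h::{real_inner, banach}"
 assumes G: "subspace G" "closed G"
 shows "minimiser_on G (\<lambda>g. (norm (x - g))\<^sup>2) (proj G x)"
 unfolding proj_def
 by (rule argmin_minimiser, rule minimiser_exists[OF dist_square_midconvex _ G, where m = 0])
  (auto intro!: continuous_intros)

lemma proj_in:
 fixes x :: "'h::{real_inner, banach}"
 assumes G: "subspace G" "closed G"
 shows "proj G x \<in> G"
 using proj_minimiser[OF G] by (simp add: minimiser_on_def)

lemma proj_orthogonal:
 fixes x :: "'h::{real_inner, banach}"
 assumes G: "subspace G" "closed G" and w: "w \<in> G"
 shows "(x - proj G x) \<bullet> w = 0"
proof (rule ccontr)
 let ?p = "proj G x" and ?a = "(x - proj G x) \<bullet> w"
 assume a: "?a \<noteq> 0"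
 then have w0: "w \<noteq> 0" by auto
 \<comment> \<open>The step along \<open>w\<close> that minimises the squared distance, a quadratic
   polynomial in the step length; a nonzero inner product would make the distance strictly
   smaller.\<close>
 define t where "t = ?a / (w \<bullet> w)"
 have "?p + t *\<^sub>R w \<in> G" using proj_in[OF G] w G by (intro subspace_add subspace_scale)
 then have "(norm (x - ?p))\<^sup>2 <= (norm (x - (?p + t *\<^sub>R w)))\<^sup>2"
  using proj_minimiser[OF G, of x] by (simp add: minimiser_on_def)
 also have "... = (norm (x - ?p))\<^sup>2 - 2 * t * ?a + t * t * (w \<bullet> w)"
  unfolding power2_norm_eq_inner
  by (simp add: inner_diff_left inner_diff_right inner_add_left inner_add_right inner_commute algebra_simps)
 finally have "2 * t * ?a <= t * t * (w \<bullet> w)" by simp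
 also have "t * (w \<bullet> w) = ?a" using w0 by (simp add: t_def)
 then have "t * t * (w \<bullet> w) = t * ?a" by simp
 finally have "t * ?a <= 0" by simp
 moreover have "t * ?a = ?a\<^sup>2 / (w \<bullet> w)" by (simp add: t_def power2_eq_square)
 moreover have "?a\<^sup>2 / (w \<bullet> w) > 0" using a w0 by simp
 ultimately show False by simp
qed

lemma proj_unique:
 fixes x :: "'h::{real_inner, banach}"
 assumes G: "subspace G" "closed G" and p: "p \<in> G" "!!w. w \<in> G ==> (x - p) \<bullet> w = 0"
 shows "proj G x = p"
proof -
 have d: "p - proj G x \<in> G" using p proj_in[OF G] G by (intro subspace_diff)
 have "(p - proj G x) \<bullet> (p - proj G x) = (x - proj G x) \<bullet> (p - proj G x) - (x - p) \<bullet> (p - proj G x)"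
  by (simp add: inner_diff_left)
 also have "... = 0" using proj_orthogonal[OF G d] p(2)[OF d] by simp
 finally show ?thesis by simp
qed

lemma proj_id:
 fixes x :: "'h::{real_inner, banach}"
 assumes G: "subspace G" "closed G" and "x \<in> G" shows "proj G x = x"
 by (rule proj_unique[OF G]) (auto simp: assms)

lemma bounded_linear_proj:
 fixes G :: "'h::{real_inner, banach} set"
 assumes G: "subspace G" "closed G"
 shows "bounded_linear (proj G)"
proof (rule bounded_linear_intro[where K = 1])
 note in' = proj_in[OF G] and orth = proj_orthogonal[OF G]
 show "proj G (x + y) = proj G x + proj G y" for x y
  using orth[of _ x] orth[of _ y]
  by (intro proj_unique[OF G]) (auto simp: in' G subspace_add inner_diff_left inner_add_left)
 show "proj G (r *\<^sub>R x) = r *\<^sub>R proj G x" for r x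
  using orth[of _ x] by (intro proj_unique[OF G]) (auto simp: in' G subspace_scale inner_diff_left)
 show "norm (proj G x) <= norm x * 1" for x
 proof -
  have "(norm (proj G x))\<^sup>2 = proj G x \<bullet> x"
   using orth[OF in', of x x] unfolding power2_norm_eq_inner inner_diff_left by (simp add: inner_commute)
  also have "... <= norm (proj G x) * norm x" by (rule norm_cauchy_schwarz)
  finally show ?thesis by (cases "norm (proj G x) = 0") (auto simp: power2_eq_square)
 qed
qed

text \<open>A closed subspace is the fixed-point set of a bounded linear projection, and such a map
  commutes with the integral. If \<open>f\<close> is not integrable, its integral is 0 by convention
  and lies in the subspace as well.\<close>

lemma integral_in_closed_subspace:
 fixes f :: "'z => 'h::{real_inner, banach, second_countable_topology}"
 assumes G: "subspace G" "closed G" and f: "AE z in N. f z \<in> G"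
 shows "integral\<^sup>L N f \<in> G"
proof (cases "integrable N f")
 case True
 have "integral\<^sup>L N f = integral\<^sup>L N (\<lambda>z. proj G (f z))"
 proof (rule integral_cong_AE)
  show "(\<lambda>z. proj G (f z)) \<in> borel_measurable N"
   using integrable_bounded_linear[OF bounded_linear_proj[OF G] True] by (rule borel_measurable_integrable)
  show "AE z in N. f z = proj G (f z)" using f by eventually_elim (simp add: proj_id[OF G])
 qed (use True in simp)
 also have "... = proj G (integral\<^sup>L N f)"
  by (rule integral_bounded_linear[OF bounded_linear_proj[OF G] True])
 finally show ?thesis by (metis proj_in[OF G])
next
 case False
 then show ?thesis using subspace_0[OF G(1)] by (simp add: not_integrable_integral_eq)
qed

lemma subspace_closure:
 fixes S :: "'h::real_normed_vector set"
 assumes S: "subspace S" shows "subspace (closure S)"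
proof (rule subspaceI)
 show "0 \<in> closure S" using subspace_0[OF S] closure_subset by auto
 fix x y assume "x \<in> closure S" "y \<in> closure S"
 then obtain f g where "!!n. f n \<in> S" "f \<longlonglongrightarrow> x" "!!n. g n \<in> S" "g \<longlonglongrightarrow> y"
  unfolding closure_sequential by blast
 then show "x + y \<in> closure S" unfolding closure_sequential
  using subspace_add[OF S] by (intro exI[of _ "\<lambda>n. f n + g n"]) (simp add: tendsto_add)
next
 fix c x assume "x \<in> closure S"
 then obtain f where "!!n. f n \<in> S" "f \<longlonglongrightarrow> x" unfolding closure_sequential by blast
 then show "c *\<^sub>R x \<in> closure S" unfolding closure_sequential
  using subspace_scale[OF S] by (intro exI[of _ "\<lambda>n. c *\<^sub>R f n"]) (simp add: tendsto_scaleR)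
qed

text \<open>The residual of the projection, divided by its squared norm, replaces a Hahn-Banach
  functional.\<close>

lemma closed_subspace_separation:
 fixes G :: "'h::{real_inner, banach} set"
 assumes G: "subspace G" "closed G" and x: "x \<notin> G"
 obtains e where "!!w. w \<in> G ==> e \<bullet> w = 0" "e \<bullet> x = 1"
proof -
 let ?r = "x - proj G x"
 have "?r \<noteq> 0" using x proj_in[OF G, of x] by auto
 moreover have "?r \<bullet> x = ?r \<bullet> ?r" using proj_orthogonal[OF G proj_in[OF G], of x x] by (simp add: inner_diff_right)
 ultimately have "((1 / (?r \<bullet> ?r)) *\<^sub>R ?r) \<bullet> x = 1"
  by (simp only: inner_scaleR_left) (simp add: divide_inverse right_inverse_eq)
 then show thesis
  by (rule that[rotated]) (simp only: inner_scaleR_left proj_orthogonal[OF G] mult_zero_right)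
qed

lemma dense_if_orthogonal_trivial:
 fixes S :: "'h::{real_inner, banach} set"
 assumes S: "subspace S" and triv: "!!e. (!!w. w \<in> S ==> e \<bullet> w = 0) ==> e = 0"
 shows "closure S = UNIV"
proof (rule ccontr)
 assume "closure S \<noteq> UNIV"
 then obtain x where x: "x \<notin> closure S" by auto
 obtain e where e: "!!w. w \<in> closure S ==> e \<bullet> w = 0" "e \<bullet> x = 1"
  using closed_subspace_separation[OF subspace_closure[OF S] closed_closure x] by blast
 have "e = 0" using triv e(1) closure_subset by blast
 then show False using e(2) by simp
qed

section \<open>Square integrable functions: Cauchy-Schwarz inequality and completeness\<close>

section \<open>Square integrable functions\<close>

definition mem_L2 :: "'z measure => ('z => 'b::{banach, second_countable_topology}) => bool" where
 "mem_L2 N f \<longleftrightarrow> f \<in> borel_measurable N \<and> integrable N (\<lambda>x. (norm (f x))\<^sup>2)"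

definition L2norm :: "'z measure => ('z => 'b::{banach, second_countable_topology}) => real" where
 "L2norm N f = sqrt (LINT x|N. (norm (f x))\<^sup>2)"

lemma square_integrable_iff_mem_L2: "square_integrable N f \<longleftrightarrow> mem_L2 N f"
 by (simp add: square_integrable_def mem_L2_def)

lemma norm_add_square_le: "(norm (x + y))\<^sup>2 <= 2 * (norm x)\<^sup>2 + 2 * (norm y)\<^sup>2"
 for x y :: "'b::real_normed_vector"
proof -
 have "(norm (x + y))\<^sup>2 <= (norm x + norm y)\<^sup>2"
  by (intro power_mono norm_triangle_ineq norm_ge_zero)
 also have "... <= 2 * (norm x)\<^sup>2 + 2 * (norm y)\<^sup>2"
  using sum_squares_bound[of "norm x" "norm y"] by (simp add: power2_sum)
 finally show ?thesis .
qed

lemma mem_L2_measurable: "mem_L2 N f ==> f \<in> borel_measurable N"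
 by (simp add: mem_L2_def)

lemma mem_L2_integrable: "mem_L2 N f ==> integrable N (\<lambda>x. (norm (f x))\<^sup>2)"
 by (simp add: mem_L2_def)

lemma mem_L2_bound:
 assumes "g \<in> borel_measurable N" "integrable N h" "AE x in N. (norm (g x))\<^sup>2 <= h x"
 shows "mem_L2 N g"
 unfolding mem_L2_def using assms
 by (auto intro!: Bochner_Integration.integrable_bound[OF assms(2)])

lemma mem_L2_add:
 assumes "mem_L2 N f" "mem_L2 N g"
 shows "mem_L2 N (\<lambda>x. f x + g x)"
 by (rule mem_L2_bound[where h = "\<lambda>x. 2 * (norm (f x))\<^sup>2 + 2 * (norm (g x))\<^sup>2"])
  (use assms in \<open>auto simp: mem_L2_def norm_add_square_le\<close>)

lemma mem_L2_scaleR: "mem_L2 N f ==> mem_L2 N (\<lambda>x. c *\<^sub>R f x)"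
 by (auto simp: mem_L2_def power_mult_distrib)

lemma mem_L2_uminus: "mem_L2 N f ==> mem_L2 N (\<lambda>x. - f x)"
 by (auto simp: mem_L2_def)

lemma mem_L2_diff:
 assumes "mem_L2 N f" "mem_L2 N g"
 shows "mem_L2 N (\<lambda>x. f x - g x)"
 using mem_L2_add[OF assms(1) mem_L2_uminus[OF assms(2)]] by simp

lemma mem_L2_zero: "mem_L2 N (\<lambda>x. 0)"
 by (simp add: mem_L2_def)

lemma mem_L2_cong_AE:
 assumes "mem_L2 N f" "g \<in> borel_measurable N" "AE x in N. f x = g x"
 shows "mem_L2 N g"
 by (rule mem_L2_bound[where h = "\<lambda>x. (norm (f x))\<^sup>2"]) (use assms in \<open>auto simp: mem_L2_def\<close>)

lemma mem_L2_integrable_norm_mult: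
 assumes "mem_L2 N f" "mem_L2 N g"
 shows "integrable N (\<lambda>x. norm (f x) * norm (g x))"
proof (rule Bochner_Integration.integrable_bound[where f = "\<lambda>x. (norm (f x))\<^sup>2 + (norm (g x))\<^sup>2"])
 show "AE x in N. norm (norm (f x) * norm (g x)) <= norm ((norm (f x))\<^sup>2 + (norm (g x))\<^sup>2)"
 proof (rule AE_I2)
  fix x
  have "norm (f x) * norm (g x) <= (norm (f x))\<^sup>2 + (norm (g x))\<^sup>2"
   using sum_squares_bound[of "norm (f x)" "norm (g x)"] zero_le_power2[of "norm (f x)"] zero_le_power2[of "norm (g x)"]
    mult_nonneg_nonneg[of "norm (f x)" "norm (g x)"] by linarith
  then show "norm (norm (f x) * norm (g x)) <= norm ((norm (f x))\<^sup>2 + (norm (g x))\<^sup>2)" by simp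
 qed
qed (use assms in \<open>auto simp: mem_L2_def\<close>)

lemma mem_L2_integrable_inner:
 fixes f g :: "'z => 'b::{real_inner, banach, second_countable_topology}"
 assumes "mem_L2 N f" "mem_L2 N g"
 shows "integrable N (\<lambda>x. f x \<bullet> g x)"
 by (rule Bochner_Integration.integrable_bound[OF mem_L2_integrable_norm_mult[OF assms]])
  (use assms in \<open>auto simp: mem_L2_def Cauchy_Schwarz_ineq2\<close>)

lemma L2norm_nonneg: "0 <= L2norm N f"
 by (simp add: L2norm_def integral_nonneg_AE)

lemma L2norm_power2: "(L2norm N f)\<^sup>2 = (LINT x|N. (norm (f x))\<^sup>2)"
 by (simp add: L2norm_def integral_nonneg_AE)

text \<open>Weighted AM-GM, with the weights \<open>s\<close> and \<open>1/s\<close> afterwards chosen as norms (plus \<open>\<delta>\<close>).\<close>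

lemma L2_Cauchy_Schwarz:
 assumes f: "mem_L2 N f" and g: "mem_L2 N g"
 shows "(LINT x|N. norm (f x) * norm (g x)) <= L2norm N f * L2norm N g"
proof -
 define I where "I = (LINT x|N. norm (f x) * norm (g x))"
 have AG: "2 * I <= s * (L2norm N f)\<^sup>2 + (1/s) * (L2norm N g)\<^sup>2" if s: "s > 0" for s
 proof -
  have "2 * I = (LINT x|N. 2 * (norm (f x) * norm (g x)))" by (simp add: I_def)
  also have "... <= (LINT x|N. s * (norm (f x))\<^sup>2 + (1/s) * (norm (g x))\<^sup>2)"
  proof (rule integral_mono)
   show "2 * (norm (f x) * norm (g x)) <= s * (norm (f x))\<^sup>2 + (1/s) * (norm (g x))\<^sup>2" for x
   proof -
    have "0 <= (sqrt s * norm (f x) - (1 / sqrt s) * norm (g x))\<^sup>2" by simp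
    also have "... = s * (norm (f x))\<^sup>2 + (1/s) * (norm (g x))\<^sup>2 - 2 * (norm (f x) * norm (g x))"
     using s by (simp add: power2_diff power_mult_distrib power_divide)
    finally show ?thesis by simp
   qed
  qed (use mem_L2_integrable_norm_mult[OF f g] f g in \<open>auto simp: mem_L2_def\<close>)
  also have "... = s * (L2norm N f)\<^sup>2 + (1/s) * (L2norm N g)\<^sup>2"
   using f g by (simp add: L2norm_power2 mem_L2_def)
  finally show ?thesis .
 qed
 \<comment> \<open>The shift by \<open>d\<close> keeps both weights positive even if a norm
   vanishes; it tends to 0 at the end.\<close>
 have "I <= (L2norm N f + d) * (L2norm N g + d)" if d: "d > 0" for d
 proof -
  define a b where "a = L2norm N f + d" and "b = L2norm N g + d"
  have ab: "a > 0" "b > 0" "L2norm N f <= a" "L2norm N g <= b"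
   using d L2norm_nonneg[of N f] L2norm_nonneg[of N g] by (auto simp: a_def b_def)
  have "2 * I <= (b/a) * (L2norm N f)\<^sup>2 + (1/(b/a)) * (L2norm N g)\<^sup>2" using ab by (intro AG) simp
  also have "... <= (b/a) * a\<^sup>2 + (1/(b/a)) * b\<^sup>2"
   using ab L2norm_nonneg[of N f] L2norm_nonneg[of N g] by (intro add_mono mult_left_mono power_mono) auto
  also have "... = 2 * (a * b)" using ab by (simp add: power2_eq_square)
  finally show ?thesis by (simp add: a_def b_def)
 qed
 moreover have "((\<lambda>d. (L2norm N f + d) * (L2norm N g + d)) \<longlongrightarrow> (L2norm N f + 0) * (L2norm N g + 0)) (at_right 0)"
  by (intro tendsto_intros)
 ultimately have "I <= (L2norm N f + 0) * (L2norm N g + 0)"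
  by (intro tendsto_lowerbound[of "\<lambda>d. (L2norm N f + d) * (L2norm N g + d)" _ "at_right (0::real)"])
   (auto simp: eventually_at_right_less eventually_at_filter intro!: always_eventually)
 then show ?thesis by (simp add: I_def)
qed

lemma L2norm_triangle:
 assumes f: "mem_L2 N f" and g: "mem_L2 N g"
 shows "L2norm N (\<lambda>x. f x + g x) <= L2norm N f + L2norm N g"
proof (rule power2_le_imp_le)
 have "(L2norm N (\<lambda>x. f x + g x))\<^sup>2 <= (LINT x|N. (norm (f x))\<^sup>2 + (norm (g x))\<^sup>2 + 2 * (norm (f x) * norm (g x)))"
  unfolding L2norm_power2
 proof (rule integral_mono)
  show "(norm (f x + g x))\<^sup>2 <= (norm (f x))\<^sup>2 + (norm (g x))\<^sup>2 + 2 * (norm (f x) * norm (g x))" for x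
   using power_mono[OF norm_triangle_ineq[of "f x" "g x"], of 2] by (simp add: power2_sum)
 qed (use mem_L2_add[OF f g] mem_L2_integrable_norm_mult[OF f g] f g in \<open>auto simp: mem_L2_def\<close>)
 also have "... = (L2norm N f)\<^sup>2 + (L2norm N g)\<^sup>2 + 2 * (LINT x|N. norm (f x) * norm (g x))"
  using mem_L2_integrable_norm_mult[OF f g] f g by (simp add: mem_L2_def L2norm_power2)
 also have "... <= (L2norm N f + L2norm N g)\<^sup>2"
  using L2_Cauchy_Schwarz[OF f g] by (simp add: power2_sum)
 finally show "(L2norm N (\<lambda>x. f x + g x))\<^sup>2 <= (L2norm N f + L2norm N g)\<^sup>2" .
qed (simp add: L2norm_nonneg)

lemma L2norm_scaleR: "L2norm N (\<lambda>x. c *\<^sub>R f x) = \<bar>c\<bar> * L2norm N f"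
 by (simp add: L2norm_def power_mult_distrib real_sqrt_mult)

lemma L2norm_uminus: "L2norm N (\<lambda>x. - f x) = L2norm N f"
 by (simp add: L2norm_def)

lemma L2norm_eq_0_iff:
 assumes "mem_L2 N f"
 shows "L2norm N f = 0 \<longleftrightarrow> (AE x in N. f x = 0)"
 using assms by (simp add: L2norm_def mem_L2_def integral_nonneg_eq_0_iff_AE)

lemma nn_integral_L2norm:
 assumes "mem_L2 N f"
 shows "(\<integral>\<^sup>+x. ennreal ((norm (f x))\<^sup>2) \<partial>N) = ennreal ((L2norm N f)\<^sup>2)"
 unfolding L2norm_power2 using assms by (intro nn_integral_eq_integral) (auto simp: mem_L2_def)

text \<open>The Riesz-Fischer argument: a subsequence with geometrically small increments converges
  almost everywhere, and Fatou's lemma shows that the whole sequence converges to its limit in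
  norm.\<close>

lemma L2_complete:
 fixes f :: "nat => 'z => 'b::{banach, second_countable_topology}"
 assumes f: "!!n. mem_L2 N (f n)"
  and Cau: "!!e. e > 0 ==> \<exists>k. \<forall>i\<ge>k. \<forall>j\<ge>k. L2norm N (\<lambda>x. f i x - f j x) < e"
 shows "\<exists>g. mem_L2 N g \<and> (\<lambda>n. L2norm N (\<lambda>x. f n x - g x)) \<longlonglongrightarrow> 0"
proof -
 have [measurable]: "f n \<in> borel_measurable N" for n using f by (simp add: mem_L2_def)
 have fd: "mem_L2 N (\<lambda>x. f i x - f j x)" for i j by (rule mem_L2_diff[OF f f])
 have "\<exists>k. \<forall>i\<ge>k. \<forall>j\<ge>k. L2norm N (\<lambda>x. f i x - f j x) < (1/2)^n" for n using Cau[of "(1/2)^n"] by simp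
 then obtain K where K: "!!n i j. i \<ge> K n ==> j \<ge> K n ==> L2norm N (\<lambda>x. f i x - f j x) < (1/2)^n" by metis
 \<comment> \<open>Both \<open>f (r (Suc n))\<close> and \<open>f (r n)\<close> are compared at
   level \<open>n\<close>, so \<open>r\<close> has to dominate all earlier thresholds; adding
   \<open>n\<close> lets the indices tend to infinity.\<close>
 define r where "r n = Max (K ` {..n}) + n" for n
 have rK: "K n <= r n" for n unfolding r_def by (simp add: trans_le_add1)
 have rK': "K n <= r (Suc n)" for n unfolding r_def by (intro trans_le_add1 Max_ge finite_imageI imageI) simp_all
 have rn: "r n \<ge> n" for n by (simp add: r_def)
 define d where "d n x = norm (f (r (Suc n)) x - f (r n) x)" for n x
 have [measurable]: "d n \<in> borel_measurable N" for n unfolding d_def by measurable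
 \<comment> \<open>The squared distances are below 4^-n, so the weight 2^n still leaves a summable
   series; its finiteness at a point forces geometric decay of the increments there.\<close>
 have "(\<integral>\<^sup>+x. (\<Sum>n. ennreal (2^n * (d n x)\<^sup>2)) \<partial>N) = (\<Sum>n. \<integral>\<^sup>+x. ennreal (2^n * (d n x)\<^sup>2) \<partial>N)"
  by (rule nn_integral_suminf) measurable
 also have "... <= (\<Sum>n. ennreal ((1/2)^n))"
 proof (rule suminf_le)
  fix n
  have "(\<integral>\<^sup>+x. ennreal (2^n * (d n x)\<^sup>2) \<partial>N) = (\<integral>\<^sup>+x. ennreal (2^n) * ennreal ((d n x)\<^sup>2) \<partial>N)"
   by (simp add: ennreal_mult)
  also have "... = ennreal (2^n) * (\<integral>\<^sup>+x. ennreal ((d n x)\<^sup>2) \<partial>N)" by (rule nn_integral_cmult) measurable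
  also have "(\<integral>\<^sup>+x. ennreal ((d n x)\<^sup>2) \<partial>N) = ennreal ((L2norm N (\<lambda>x. f (r (Suc n)) x - f (r n) x))\<^sup>2)"
   unfolding d_def by (rule nn_integral_L2norm[OF fd])
  also have "ennreal (2^n) * ... <= ennreal (2^n) * ennreal (((1/2)^n)\<^sup>2)"
   using K[OF rK' rK, of n] L2norm_nonneg
   by (intro mult_left_mono ennreal_leI power_mono) auto
  also have "... = ennreal (2^n * ((1/2)^n)\<^sup>2)" by (simp add: ennreal_mult)
  also have "(2::real)^n * ((1/2)^n)\<^sup>2 = (1/2)^n" by (simp add: power2_eq_square power_divide)
  finally show "(\<integral>\<^sup>+x. ennreal (2^n * (d n x)\<^sup>2) \<partial>N) <= ennreal ((1/2)^n)" .
 qed auto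
 also have "... = ennreal (\<Sum>n. (1/2)^n)" by (rule suminf_ennreal2) (auto intro!: summable_geometric)
 also have "... < \<infinity>" by simp
 finally have "(\<integral>\<^sup>+x. (\<Sum>n. ennreal (2^n * (d n x)\<^sup>2)) \<partial>N) \<noteq> \<infinity>" by simp
 then have "AE x in N. (\<Sum>n. ennreal (2^n * (d n x)\<^sup>2)) \<noteq> \<infinity>" by (intro nn_integral_PInf_AE) auto
 then have conv: "AE x in N. convergent (\<lambda>n. f (r n) x)"
 proof eventually_elim
  case (elim x)
  have "summable (\<lambda>n. 2^n * (d n x)\<^sup>2)" using elim by (intro summable_suminf_not_top) auto
  then obtain B where B: "!!n. 2^n * (d n x)\<^sup>2 <= B"
   using summable_imp_bounded[of "\<lambda>n. 2^n * (d n x)\<^sup>2"] unfolding bounded_iff by fastforce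
  have "d n x <= sqrt B * (1 / sqrt 2)^n" for n
  proof -
   have "(d n x)\<^sup>2 <= B * (1/2)^n" using B[of n] by (simp add: field_simps power_divide)
   then have "sqrt ((d n x)\<^sup>2) <= sqrt (B * (1/2)^n)" by (rule real_sqrt_le_mono)
   then show ?thesis by (simp add: d_def real_sqrt_mult real_sqrt_power real_sqrt_divide)
  qed
  then have le: "norm (norm (f (r (Suc n)) x - f (r n) x)) <= sqrt B * (1 / sqrt 2)^n" for n
   by (simp add: d_def)
  have "summable (\<lambda>n. sqrt B * (1 / sqrt 2)^n)"
   by (intro summable_mult summable_geometric) simp
  then have "summable (\<lambda>n. norm (f (r (Suc n)) x - f (r n) x))"
   by (rule summable_comparison_test') (rule le)
  then have "summable (\<lambda>n. f (r (Suc n)) x - f (r n) x)" by (rule summable_norm_cancel)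
  then show "convergent (\<lambda>n. f (r n) x)" 
   using sum_lessThan_telescope[of "\<lambda>n. f (r n) x"]
   by (simp add: summable_iff_convergent convergent_diff_const_right_iff)
 qed
 define g where "g x = lim (\<lambda>n. f (r n) x)" for x
 have [measurable]: "g \<in> borel_measurable N" unfolding g_def by measurable
 \<comment> \<open>Fatou's lemma along the subsequence transfers the Cauchy estimate to the limit
   function, for every index beyond \<open>r n\<close>.\<close>
 have est: "(\<integral>\<^sup>+x. ennreal ((norm (f i x - g x))\<^sup>2) \<partial>N) <= ennreal (((1/2)^n)\<^sup>2)" if i: "i \<ge> r n" for i n
 proof -
  have "(\<integral>\<^sup>+x. ennreal ((norm (f i x - g x))\<^sup>2) \<partial>N) = (\<integral>\<^sup>+x. liminf (\<lambda>k. ennreal ((norm (f i x - f (r k) x))\<^sup>2)) \<partial>N)"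
  proof (rule nn_integral_cong_AE, use conv in eventually_elim)
   case (elim x)
   then have "(\<lambda>k. f (r k) x) \<longlonglongrightarrow> g x" by (simp add: g_def convergent_LIMSEQ_iff)
   then have "(\<lambda>k. ennreal ((norm (f i x - f (r k) x))\<^sup>2)) \<longlonglongrightarrow> ennreal ((norm (f i x - g x))\<^sup>2)"
    by (intro tendsto_ennrealI tendsto_intros)
   then show "ennreal ((norm (f i x - g x))\<^sup>2) = liminf (\<lambda>k. ennreal ((norm (f i x - f (r k) x))\<^sup>2))"
    by (intro lim_imp_Liminf[symmetric]) simp_all
  qed
  also have "... <= liminf (\<lambda>k. \<integral>\<^sup>+x. ennreal ((norm (f i x - f (r k) x))\<^sup>2) \<partial>N)"
   by (rule nn_integral_liminf) measurable
  also have "... <= ennreal (((1/2)^n)\<^sup>2)"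
  proof (rule Liminf_le[OF sequentially_bot])
   have "(\<integral>\<^sup>+x. ennreal ((norm (f i x - f (r k) x))\<^sup>2) \<partial>N) <= ennreal (((1/2)^n)\<^sup>2)" if "k \<ge> r n" for k
   proof -
    have "L2norm N (\<lambda>x. f i x - f (r k) x) < (1/2)^n"
     using i that rK[of n] rn[of k] by (intro K) auto
    then show ?thesis unfolding nn_integral_L2norm[OF fd]
     by (intro ennreal_leI power_mono) (auto simp: L2norm_nonneg)
   qed
   then show "\<forall>\<^sub>F k in sequentially. (\<integral>\<^sup>+x. ennreal ((norm (f i x - f (r k) x))\<^sup>2) \<partial>N) <= ennreal (((1/2)^n)\<^sup>2)"
    by (auto simp: eventually_sequentially)
  qed
  finally show ?thesis .
 qed
 have gd: "mem_L2 N (\<lambda>x. f (r 0) x - g x)" unfolding mem_L2_def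
 proof
  show "integrable N (\<lambda>x. (norm (f (r 0) x - g x))\<^sup>2)"
   using le_less_trans[OF est[of 0 "r 0"] ennreal_less_top] by (intro integrableI_bounded) simp_all
 qed measurable
 have g: "mem_L2 N g" using mem_L2_diff[OF f[of "r 0"] gd] by simp
 have le: "L2norm N (\<lambda>x. f i x - g x) <= (1/2)^n" if "i \<ge> r n" for i n
 proof -
  have "ennreal ((L2norm N (\<lambda>x. f i x - g x))\<^sup>2) <= ennreal (((1/2)^n)\<^sup>2)"
   using est[OF that] nn_integral_L2norm[OF mem_L2_diff[OF f g], of i] by simp
  then have "(L2norm N (\<lambda>x. f i x - g x))\<^sup>2 <= ((1/2)^n)\<^sup>2"
   by (subst (asm) ennreal_le_iff) auto
  then show ?thesis by (rule power2_le_imp_le) simp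
 qed
 have "(\<lambda>n. L2norm N (\<lambda>x. f n x - g x)) \<longlonglongrightarrow> 0"
 proof (rule LIMSEQ_I)
  fix e :: real assume "e > 0"
  then obtain n where n: "(1/2)^n < e" using real_arch_pow_inv[of e "1/2"] by auto
  show "\<exists>no. \<forall>i\<ge>no. norm (L2norm N (\<lambda>x. f i x - g x) - 0) < e"
  proof (intro exI allI impI)
   fix i assume "i \<ge> r n"
   from le[OF this] n show "norm (L2norm N (\<lambda>x. f i x - g x) - 0) < e"
    using L2norm_nonneg[of N "\<lambda>x. f i x - g x"] by simp
  qed
 qed
 then show ?thesis using g by blast
qed

section \<open>Functions determined by their integrals over a generator\<close>

section \<open>Functions with vanishing integrals\<close>

text \<open>The sets over which \<open>f\<close> integrates to 0 are closed under countable disjoint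
  unions, and under complements because the total integral vanishes; an intersection-stable
  generator therefore reaches all measurable sets.\<close>

lemma AE_zero_if_integrals_zero_on_generator:
 fixes f :: "'z => real"
 assumes N: "sigma_finite_measure N" and f: "integrable N f"
  and E: "Int_stable E" "E \<subseteq> Pow (space N)" "sets N = sigma_sets (space N) E"
  and zero: "!!X. X \<in> E ==> (LINT x:X|N. f x) = 0" and total: "(LINT x|N. f x) = 0"
 shows "AE x in N. f x = 0"
proof (rule sigma_finite_measure.density_zero[OF N f])
 fix A assume "A \<in> sets N"
 then have "A \<in> sigma_sets (space N) E" using E by simp
 then show "(LINT x:A|N. f x) = 0"
 proof (induct rule: sigma_sets_induct_disjoint[OF E(1,2), consumes 1, case_names basic empty compl union])
  case (basic A) then show ?case by (rule zero)
 next
  case empty then show ?case by (simp add: set_lebesgue_integral_def)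
 next
  case (compl A)
  then have A: "A \<in> sets N" using compl(1) unfolding E(3) by simp
  have "(LINT x:space N - A|N. f x) = (LINT x|N. f x - indicator A x *\<^sub>R f x)"
   unfolding set_lebesgue_integral_def by (rule Bochner_Integration.integral_cong) (auto simp: indicator_def)
  also have "... = (LINT x|N. f x) - (LINT x:A|N. f x)" unfolding set_lebesgue_integral_def
   using f A by (intro Bochner_Integration.integral_diff integrable_mult_indicator)
  finally show ?case using compl total by simp
 next
  case (union A)
  then have A: "A i \<in> sets N" for i unfolding E(3) using union(2) by blast
  have "(LINT x:(\<Union>i. A i)|N. f x) = (\<Sum>i. (LINT x:(A i)|N. f x))"
  proof (rule lebesgue_integral_countable_add)
   show "A i \<inter> A j = {}" if "i \<noteq> j" for i j using union(1) that by (simp add: disjoint_family_on_def)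
   show "set_integrable N (\<Union>i. A i) f"
    unfolding set_integrable_def using A f by (intro integrable_mult_indicator sets.countable_UN) auto
  qed (rule A)
  then show ?case using union(3) by simp
 qed
qed

text \<open>The generator produces only the Borel sets, so the argument is run for a Borel
  representative of \<open>f\<close> and transferred back through the completion.\<close>

lemma AE_zero_if_integrals_zero_lebesgue:
 fixes f :: "'a::euclidean_space => real"
 assumes f: "integrable lebesgue f"
  and E: "Int_stable E" "sets (borel :: 'a measure) = sigma_sets UNIV E"
  and zero: "!!X. X \<in> E ==> (LINT x|lebesgue. indicator X x * f x) = 0" and total: "(LINT x|lebesgue. f x) = 0"
 shows "AE x in lebesgue. f x = 0"
proof -
 obtain f' where f' [measurable]: "f' \<in> borel_measurable lborel" and ae: "AE x in lborel. f x = f' x"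
  using completion_ex_borel_measurable_real[of f lborel] f by blast
 have ae': "AE x in lebesgue. f x = f' x" using ae by (simp add: AE_completion_iff)
 have fm [measurable]: "f \<in> borel_measurable lebesgue" using f by simp
 have f'm [measurable]: "f' \<in> borel_measurable lebesgue" using f' by (rule measurable_completion)
 have int': "integrable lborel f'"
 proof -
  have "integrable lebesgue f'" using integrable_cong_AE[OF fm f'm ae'] f by simp
  then show ?thesis by (simp add: integrable_completion[OF f'])
 qed
 have eq: "(LINT x|lborel. indicator X x * f' x) = (LINT x|lebesgue. indicator X x * f x)" if [measurable]: "X \<in> sets borel" for X
 proof -
  have "(LINT x|lborel. indicator X x * f' x) = (LINT x|lebesgue. indicator X x * f' x)"
   by (rule integral_completion[symmetric]) measurable
  also have "... = (LINT x|lebesgue. indicator X x * f x)"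
  proof (rule integral_cong_AE)
   show "AE x in lebesgue. indicator X x * f' x = indicator X x * f x" using ae' by eventually_elim simp
   have X: "indicat_real X \<in> borel_measurable lebesgue" using that by (intro borel_measurable_indicator) simp
   show "(\<lambda>x. indicator X x * f' x) \<in> borel_measurable lebesgue" "(\<lambda>x. indicator X x * f x) \<in> borel_measurable lebesgue"
    by (rule borel_measurable_times[OF X f'm], rule borel_measurable_times[OF X fm])
  qed
  finally show ?thesis .
 qed
 have "AE x in lborel. f' x = 0"
 proof (rule AE_zero_if_integrals_zero_on_generator[OF _ int' E(1)])
  fix X assume X: "X \<in> E"
  then have "X \<in> sets borel" using E(2) by (simp add: sigma_sets.Basic)
  then show "(LINT x:X|lborel. f' x) = 0" using eq[of X] zero[OF X] by (simp add: set_lebesgue_integral_def)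
 next
  show "(LINT x|lborel. f' x) = 0" using eq[of UNIV] total by simp
 next
  show "sets lborel = sigma_sets (space (lborel :: 'a measure)) E" using E(2) by simp
 qed (simp_all add: lborel.sigma_finite_measure_axioms)
 then have "AE x in lebesgue. f' x = 0" by (simp add: AE_completion_iff)
 then show ?thesis using ae' by eventually_elim simp
qed

section \<open>A separable Hilbert space type of square integrable functions\<close>

section \<open>The Hilbert space of square integrable functions on Euclidean space\<close>

text \<open>Membership is built into the relation, so that the quotient is partial and its
  operations carry no integrability conditions.\<close>

definition l2_rel :: "('a::euclidean_space => 'b::euclidean_space) => ('a => 'b) => bool" where
 "l2_rel f g \<longleftrightarrow> mem_L2 lebesgue f \<and> mem_L2 lebesgue g \<and> (AE x in lebesgue. f x = g x)"

lemma part_equivp_l2_rel: "part_equivp (l2_rel :: ('a::euclidean_space => 'b::euclidean_space) => _)"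
proof (rule part_equivpI)
 show "\<exists>f :: 'a => 'b. l2_rel f f" by (rule exI[of _ "\<lambda>x. 0"]) (simp add: l2_rel_def mem_L2_zero)
 show "symp (l2_rel :: ('a => 'b) => _)" by (auto simp: symp_def l2_rel_def)
 show "transp (l2_rel :: ('a => 'b) => _)"
  by (rule transpI) (auto simp: l2_rel_def)
qed

quotient_type (overloaded) ('a, 'b) l2 = "'a::euclidean_space => 'b::euclidean_space" / partial: l2_rel
 by (rule part_equivp_l2_rel)

abbreviation l2_fun :: "('a::euclidean_space, 'b::euclidean_space) l2 => 'a => 'b" where "l2_fun \<equiv> rep_l2"
abbreviation l2_of :: "('a::euclidean_space => 'b::euclidean_space) => ('a, 'b) l2" where "l2_of \<equiv> abs_l2"

lemma l2_fun_mem: "mem_L2 lebesgue (l2_fun x)"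
 using Quotient3_rep_reflp[OF Quotient3_l2, of x] by (simp add: l2_rel_def)

lemma l2_of_fun [simp]: "l2_of (l2_fun x) = x"
 by (rule Quotient3_abs_rep[OF Quotient3_l2])

lemma l2_of_eq_iff:
 assumes "mem_L2 lebesgue f" "mem_L2 lebesgue g"
 shows "l2_of f = l2_of g \<longleftrightarrow> (AE x in lebesgue. f x = g x)"
 using Quotient3_rel[OF Quotient3_l2, of f g] assms by (simp add: l2_rel_def)

lemma l2_fun_of:
 assumes "mem_L2 lebesgue f" shows "AE x in lebesgue. l2_fun (l2_of f) x = f x"
 using l2_of_eq_iff[OF l2_fun_mem assms, of "l2_of f"] by simp

instantiation l2 :: (euclidean_space, euclidean_space) real_inner
begin

lift_definition zero_l2 :: "('a, 'b) l2" is "\<lambda>x. 0" by (simp add: l2_rel_def mem_L2_zero)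

lift_definition plus_l2 :: "('a, 'b) l2 => ('a, 'b) l2 => ('a, 'b) l2" is "\<lambda>f g x. f x + g x"
 by (auto simp: l2_rel_def mem_L2_add)

lift_definition minus_l2 :: "('a, 'b) l2 => ('a, 'b) l2 => ('a, 'b) l2" is "\<lambda>f g x. f x - g x"
 by (auto simp: l2_rel_def mem_L2_diff)

lift_definition uminus_l2 :: "('a, 'b) l2 => ('a, 'b) l2" is "\<lambda>f x. - f x"
 by (auto simp: l2_rel_def mem_L2_uminus)

lift_definition scaleR_l2 :: "real => ('a, 'b) l2 => ('a, 'b) l2" is "\<lambda>c f x. c *\<^sub>R f x"
 by (auto simp: l2_rel_def mem_L2_scaleR)

lift_definition inner_l2 :: "('a, 'b) l2 => ('a, 'b) l2 => real" is "\<lambda>f g. LINT x|lebesgue. f x \<bullet> g x"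
proof -
 fix f f' g g' :: "'a => 'b"
 assume "l2_rel f f'" "l2_rel g g'"
 then show "(LINT x|lebesgue. f x \<bullet> g x) = (LINT x|lebesgue. f' x \<bullet> g' x)"
  unfolding l2_rel_def
  by (intro integral_cong_AE)
   (auto intro: borel_measurable_integrable mem_L2_integrable_inner)
qed

definition norm_l2 :: "('a, 'b) l2 => real" where "norm_l2 x = sqrt (x \<bullet> x)"
definition dist_l2 :: "('a, 'b) l2 => ('a, 'b) l2 => real" where "dist_l2 x y = norm (x - y)"
definition sgn_l2 :: "('a, 'b) l2 => ('a, 'b) l2" where "sgn_l2 x = scaleR (inverse (norm x)) x"
definition uniformity_l2 :: "(('a, 'b) l2 \<times> ('a, 'b) l2) filter" where
 "uniformity_l2 = (INF e\<in>{0<..}. principal {(x, y). dist x y < e})"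
definition open_l2 :: "('a, 'b) l2 set => bool" where
 "open_l2 U \<longleftrightarrow> (\<forall>x\<in>U. eventually (\<lambda>(x', y). x' = x --> y \<in> U) uniformity)"

instance
proof
 fix x y z :: "('a, 'b) l2" and a b :: real and U :: "('a, 'b) l2 set"
 show "x + y + z = x + (y + z)"
  by transfer (auto simp: l2_rel_def mem_L2_add add.assoc)
 show "x + y = y + x" by transfer (auto simp: l2_rel_def mem_L2_add add.commute)
 show "0 + x = x" by transfer (auto simp: l2_rel_def)
 show "- x + x = 0" by transfer (auto simp: l2_rel_def mem_L2_zero)
 show "x - y = x + - y" by transfer (auto simp: l2_rel_def mem_L2_diff)
 show "a *\<^sub>R (x + y) = a *\<^sub>R x + a *\<^sub>R y"
  by transfer (auto simp: l2_rel_def mem_L2_add mem_L2_scaleR scaleR_add_right)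
 show "(a + b) *\<^sub>R x = a *\<^sub>R x + b *\<^sub>R x"
  by transfer (auto simp: l2_rel_def mem_L2_add mem_L2_scaleR scaleR_add_left)
 show "a *\<^sub>R b *\<^sub>R x = (a * b) *\<^sub>R x" by transfer (auto simp: l2_rel_def mem_L2_scaleR)
 show "1 *\<^sub>R x = x" by transfer (auto simp: l2_rel_def)
 show "x \<bullet> y = y \<bullet> x" by transfer (simp add: inner_commute)
 show "(x + y) \<bullet> z = x \<bullet> z + y \<bullet> z"
  by transfer (simp add: l2_rel_def inner_add_left mem_L2_integrable_inner)
 show "a *\<^sub>R x \<bullet> y = a * (x \<bullet> y)" by transfer simp
 show "0 <= x \<bullet> x" by transfer simp
 show "x \<bullet> x = 0 \<longleftrightarrow> x = 0"
 proof transfer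
  fix f :: "'a => 'b" assume "l2_rel f f"
  then have f: "mem_L2 lebesgue f" by (simp add: l2_rel_def)
  have "(LINT x|lebesgue. f x \<bullet> f x) = 0 \<longleftrightarrow> (AE x in lebesgue. f x \<bullet> f x = 0)"
   using mem_L2_integrable_inner[OF f f] by (intro integral_nonneg_eq_0_iff_AE) auto
  then show "(LINT x|lebesgue. f x \<bullet> f x) = 0 \<longleftrightarrow> l2_rel f (\<lambda>x. 0)"
   using f by (simp add: l2_rel_def mem_L2_zero)
 qed
qed (simp_all add: norm_l2_def dist_l2_def sgn_l2_def uniformity_l2_def open_l2_def)

end

lemma inner_l2: "x \<bullet> y = (LINT t|lebesgue. l2_fun x t \<bullet> l2_fun y t)"
 by (simp add: inner_l2_def)

lemma norm_l2: "norm x = L2norm lebesgue (l2_fun x)"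
 by (simp add: norm_eq_sqrt_inner inner_l2 L2norm_def power2_norm_eq_inner)

lemma l2_of_add:
 assumes "mem_L2 lebesgue f" "mem_L2 lebesgue g"
 shows "l2_of (\<lambda>x. f x + g x) = l2_of f + l2_of g"
 using assms plus_l2.abs_eq[of f g] by (simp add: l2_rel_def)

lemma l2_of_diff:
 assumes "mem_L2 lebesgue f" "mem_L2 lebesgue g"
 shows "l2_of (\<lambda>x. f x - g x) = l2_of f - l2_of g"
 using assms minus_l2.abs_eq[of f g] by (simp add: l2_rel_def)

lemma l2_of_scaleR:
 assumes "mem_L2 lebesgue f" shows "l2_of (\<lambda>x. c *\<^sub>R f x) = c *\<^sub>R l2_of f"
 using assms scaleR_l2.abs_eq[of f c] by (simp add: l2_rel_def)

lemma l2_of_zero: "l2_of (\<lambda>x. 0) = 0"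
 by (simp add: zero_l2_def)

lemma inner_l2_of:
 assumes "mem_L2 lebesgue f" "mem_L2 lebesgue g"
 shows "l2_of f \<bullet> l2_of g = (LINT t|lebesgue. f t \<bullet> g t)"
 using assms inner_l2.abs_eq[of f g] by (simp add: l2_rel_def)

lemma norm_l2_of: "mem_L2 lebesgue f ==> norm (l2_of f) = L2norm lebesgue f"
 by (simp add: norm_eq_sqrt_inner inner_l2_of L2norm_def power2_norm_eq_inner)

lemma l2_fun_add: "AE t in lebesgue. l2_fun (x + y) t = l2_fun x t + l2_fun y t"
 using l2_fun_of[OF mem_L2_add[OF l2_fun_mem l2_fun_mem], of x y] by (simp add: l2_of_add l2_fun_mem)

lemma l2_fun_diff: "AE t in lebesgue. l2_fun (x - y) t = l2_fun x t - l2_fun y t"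
 using l2_fun_of[OF mem_L2_diff[OF l2_fun_mem l2_fun_mem], of x y] by (simp add: l2_of_diff l2_fun_mem)

lemma l2_fun_scaleR: "AE t in lebesgue. l2_fun (c *\<^sub>R x) t = c *\<^sub>R l2_fun x t"
 using l2_fun_of[OF mem_L2_scaleR[OF l2_fun_mem], of c x] by (simp add: l2_of_scaleR l2_fun_mem)

lemma l2_fun_zero: "AE t in lebesgue. l2_fun 0 t = 0"
 using l2_fun_of[OF mem_L2_zero] by (simp add: l2_of_zero)

instance l2 :: (euclidean_space, euclidean_space) banach
proof
 fix X :: "nat => ('a, 'b) l2" assume X: "Cauchy X"
 have eq: "L2norm lebesgue (\<lambda>t. l2_fun (X i) t - l2_fun (X j) t) = norm (X i - X j)" for i j
  using norm_l2_of[OF mem_L2_diff[OF l2_fun_mem l2_fun_mem], of "X i" "X j"] by (simp add: l2_of_diff l2_fun_mem)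
 obtain g where g: "mem_L2 lebesgue g" "(\<lambda>n. L2norm lebesgue (\<lambda>t. l2_fun (X n) t - g t)) \<longlonglongrightarrow> 0"
  using L2_complete[of lebesgue "\<lambda>n. l2_fun (X n)"] X l2_fun_mem unfolding eq Cauchy_iff by blast
 have "L2norm lebesgue (\<lambda>t. l2_fun (X n) t - g t) = norm (X n - l2_of g)" for n
  using norm_l2_of[OF mem_L2_diff[OF l2_fun_mem g(1)], of "X n"] by (simp add: l2_of_diff l2_fun_mem g(1))
 then have "X \<longlonglongrightarrow> l2_of g" using g(2) by (simp add: LIM_zero_iff tendsto_norm_zero_iff)
 then show "convergent X" by (auto simp: convergent_def)
qed

subsection \<open>Separability\<close>

text \<open>Rational combinations of \<open>B\<close> are countable, and their closure is a real
  subspace because every real scalar is a limit of rationals; a total set leaves no direction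
  orthogonal to it.\<close>

lemma separable_if_total:
 fixes B :: "'h::{real_inner, banach} set"
 assumes B: "countable B" and total: "!!e. (!!b. b \<in> B ==> e \<bullet> b = 0) ==> e = 0"
 shows "\<exists>C::'h set. countable C \<and> closure C = UNIV"
proof -
 let ?ev = "\<lambda>xs. \<Sum>(q, v)\<leftarrow>xs. q *\<^sub>R v :: 'h"
 let ?L = "lists (\<rat> \<times> B)"
 define C where "C = ?ev ` ?L"
 have "countable C" unfolding C_def using B countable_rat by (intro countable_image countable_lists countable_SIGMA)
 have scale: "q *\<^sub>R ?ev xs = ?ev (map (\<lambda>(p, v). (q * p, v)) xs)" for q and xs :: "(real \<times> 'h) list"
  by (induction xs) (auto simp: scaleR_add_right)
 have Cadd: "x + y \<in> C" if xC: "x \<in> C" and yC: "y \<in> C" for x y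
 proof -
  obtain xs where "x = ?ev xs" "xs \<in> ?L" using xC unfolding C_def by (rule imageE)
  moreover obtain ys where "y = ?ev ys" "ys \<in> ?L" using yC unfolding C_def by (rule imageE)
  ultimately have "x + y = ?ev (xs @ ys)" "xs @ ys \<in> ?L" by auto
  then show ?thesis unfolding C_def by blast
 qed
 have Cscale: "q *\<^sub>R x \<in> C" if xC: "x \<in> C" and q: "q \<in> \<rat>" for x q
 proof -
  obtain xs where xs: "x = ?ev xs" "xs \<in> ?L" using xC unfolding C_def by (rule imageE)
  have "map (\<lambda>(p, v). (q * p, v)) xs \<in> ?L" using xs(2) q by (auto simp: in_lists_conv_set)
  then show ?thesis unfolding C_def xs(1) scale by blast
 qed
 have sub: "subspace (closure C)"
 proof (rule subspaceI)
  have "?ev [] \<in> C" unfolding C_def by (intro imageI) simp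
  then show "0 \<in> closure C" using closure_subset by auto
  fix x y assume "x \<in> closure C" "y \<in> closure C"
  then obtain f g where "!!n. f n \<in> C" "f \<longlonglongrightarrow> x" "!!n. g n \<in> C" "g \<longlonglongrightarrow> y"
   unfolding closure_sequential by blast
  then show "x + y \<in> closure C" unfolding closure_sequential
   using Cadd by (intro exI[of _ "\<lambda>n. f n + g n"]) (simp add: tendsto_add)
 next
  fix c :: real and x assume "x \<in> closure C"
  then obtain f where f: "!!n. f n \<in> C" "f \<longlonglongrightarrow> x" unfolding closure_sequential by blast
  have "c \<in> closure \<rat>" by (simp add: Rats_closure_real)
  then obtain q where q: "!!n. q n \<in> \<rat>" "q \<longlonglongrightarrow> c" unfolding closure_sequential by blast
  show "c *\<^sub>R x \<in> closure C" unfolding closure_sequential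
   using Cscale f q by (intro exI[of _ "\<lambda>n. q n *\<^sub>R f n"]) (simp add: tendsto_scaleR)
 qed
 have BC: "b \<in> C" if "b \<in> B" for b
  unfolding C_def using that by (intro image_eqI[of _ _ "[(1, b)]"]) auto
 have "closure (closure C) = UNIV"
  by (rule dense_if_orthogonal_trivial[OF sub]) (use total BC closure_subset in blast)
 with \<open>countable C\<close> show ?thesis by (intro exI[of _ C]) simp
qed

lemma second_countable_if_separable:
 fixes C :: "'h::metric_space set"
 assumes C: "countable C" "closure C = UNIV"
 shows "\<exists>B::'h set set. countable B \<and> open = generate_topology B"
proof (intro exI conjI)
 let ?B = "(\<lambda>(c, n). ball c (1 / real (Suc n))) ` (C \<times> (UNIV :: nat set))"
 show "countable ?B" using C by (intro countable_image countable_SIGMA) auto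
 have "topological_basis ?B"
 proof (rule topological_basisI)
  fix S and x :: 'h assume S: "open S" "x \<in> S"
  then obtain e where e: "e > 0" "ball x e \<subseteq> S" using open_contains_ball by blast
  obtain n where n: "1 / real (Suc n) < e / 2" using nat_approx_posE[of "e/2"] e by auto
  have "x \<in> closure C" using C by simp
  then obtain c where c: "c \<in> C" "dist c x < 1 / real (Suc n)" unfolding closure_approachable by (meson of_nat_0_less_iff zero_less_divide_1_iff zero_less_Suc)
  have "ball c (1 / real (Suc n)) \<subseteq> ball x e"
  proof
   fix y assume "y \<in> ball c (1 / real (Suc n))"
   then have "dist c y < e / 2" "dist c x < e / 2" using n c by auto
   then show "y \<in> ball x e" using dist_triangle[of x y c] by (simp add: dist_commute)
  qed
  then show "\<exists>B'\<in>?B. x \<in> B' \<and> B' \<subseteq> S" using c e by (intro bexI[of _ "ball c (1 / real (Suc n))"]) auto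
 qed auto
 then show "open = generate_topology ?B" by (rule topological_basis_imp_subbasis)
qed

text \<open>Finite intersections of a countable basis remain countable and open, and they make the
  generator stable under intersections.\<close>

lemma countable_Int_stable_borel_generator:
 "\<exists>E :: 'a::second_countable_topology set set. countable E \<and> Int_stable E \<and> sets borel = sigma_sets UNIV E \<and> E \<subseteq> sets borel"
proof -
 obtain B :: "'a set set" where B: "countable B" "topological_basis B" using ex_countable_basis by blast
 define E where "E = Inter ` {F. finite F \<and> F \<subseteq> B}"
 have ctbl: "countable E" unfolding E_def using B(1) by (intro countable_image countable_Collect_finite_subset)
 have int: "Int_stable E"
 proof (rule Int_stableI)
  fix a b assume "a \<in> E" "b \<in> E"
  then obtain F G where FG: "finite F" "F \<subseteq> B" "a = \<Inter>F" "finite G" "G \<subseteq> B" "b = \<Inter>G" unfolding E_def by blast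
  then have "a \<inter> b = \<Inter>(F \<union> G)" by blast
  moreover have "F \<union> G \<in> {F. finite F \<and> F \<subseteq> B}" using FG by simp
  ultimately show "a \<inter> b \<in> E" unfolding E_def by (rule image_eqI)
 qed
 have E: "E \<subseteq> sets borel"
 proof
  fix X assume "X \<in> E"
  then obtain F where F: "finite F" "F \<subseteq> B" "X = \<Inter>F" unfolding E_def by blast
  have "open X" unfolding F(3) using F(1,2) topological_basis_open[OF B(2)] by (intro open_Inter) auto
  then show "X \<in> sets borel" by (rule borel_open)
 qed
 have BE: "B \<subseteq> E" unfolding E_def 
 proof
  fix b assume "b \<in> B"
  then show "b \<in> Inter ` {F. finite F \<and> F \<subseteq> B}" by (intro image_eqI[of _ _ "{b}"]) auto
 qed
 have sB: "sets borel = sigma_sets UNIV B" unfolding borel_eq_countable_basis[OF B] by (rule sets_measure_of) simp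
 have "sigma_sets UNIV E = sets borel"
 proof
  show "sigma_sets UNIV E \<subseteq> sets borel" using E sets.sigma_sets_subset[of E borel] by simp
  show "sets borel \<subseteq> sigma_sets UNIV E" unfolding sB using BE by (rule sigma_sets_subseteq)
 qed
 then show ?thesis using ctbl int E by blast
qed

text \<open>The total family consists of indicators of generator sets, cut off at integer radii to
  be square integrable, times basis vectors. For a vector orthogonal to all of them, every truncated
  coordinate integrates to 0 over the generator and hence vanishes.\<close>

instance l2 :: (euclidean_space, euclidean_space) second_countable_topology
proof
 obtain E :: "'a set set" where E: "countable E" "Int_stable E" "sets borel = sigma_sets UNIV E" "E \<subseteq> sets borel"
  using countable_Int_stable_borel_generator by blast
 define v :: "'a set \<times> nat \<times> 'b => 'a => 'b" where
  "v = (\<lambda>(X, m, i) t. indicator (X \<inter> ball 0 (real m)) t *\<^sub>R i)"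
 \<comment> \<open>\<open>UNIV\<close> is added for the condition on the total integral, which the
   generator itself need not supply.\<close>
 let ?I = "insert UNIV E \<times> (UNIV :: nat set) \<times> (Basis :: 'b set)"
 have v: "mem_L2 lebesgue (v (X, m, i))" if "X \<in> insert UNIV E" for X m i
 proof -
  have X: "X \<inter> ball 0 (real m) \<in> sets lebesgue" using that E(4) by auto
  have "X \<inter> ball 0 (real m) \<in> lmeasurable" by (rule fmeasurableI2[OF lmeasurable_ball _ X]) auto
  then have int: "integrable lebesgue (\<lambda>t. indicat_real (X \<inter> ball 0 (real m)) t * (norm i)\<^sup>2)"
   by (intro integrable_mult_left) (auto simp: integrable_indicator_iff fmeasurable_def)
  have vm: "v (X, m, i) \<in> borel_measurable lebesgue"
   using borel_measurable_scaleR[OF borel_measurable_indicator[OF X] borel_measurable_const[of i]]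
   by (simp add: v_def)
  show ?thesis
   by (rule mem_L2_bound[OF vm int]) (auto simp: v_def split: split_indicator)
 qed
 have "\<exists>C :: ('a, 'b) l2 set. countable C \<and> closure C = UNIV"
 proof (rule separable_if_total)
  show "countable ((\<lambda>p. l2_of (v p)) ` ?I)"
   using E(1) by (intro countable_image countable_SIGMA) (auto simp: countable_finite)
  fix e :: "('a, 'b) l2" assume e: "!!b. b \<in> (\<lambda>p. l2_of (v p)) ` ?I ==> e \<bullet> b = 0"
  have "AE t in lebesgue. indicator (ball 0 (real m)) t * (l2_fun e t \<bullet> i) = 0" if i: "i \<in> Basis" for m i
  proof (rule AE_zero_if_integrals_zero_lebesgue[OF _ E(2,3)])
   have eq: "(LINT t|lebesgue. indicator X t * (indicator (ball 0 (real m)) t * (l2_fun e t \<bullet> i))) = 0"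
    if X: "X \<in> insert UNIV E" for X
   proof -
    have "(LINT t|lebesgue. l2_fun e t \<bullet> v (X, m, i) t) = l2_of (l2_fun e) \<bullet> l2_of (v (X, m, i))"
     by (rule inner_l2_of[OF l2_fun_mem v[OF X], symmetric])
    also have "... = e \<bullet> l2_of (v (X, m, i))" by (simp only: l2_of_fun)
    also have "... = 0" using X i by (intro e imageI) simp
    finally have "(LINT t|lebesgue. l2_fun e t \<bullet> v (X, m, i) t) = 0" .
    moreover have "(LINT t|lebesgue. l2_fun e t \<bullet> v (X, m, i) t)
      = (LINT t|lebesgue. indicator X t * (indicator (ball 0 (real m)) t * (l2_fun e t \<bullet> i)))"
     by (rule Bochner_Integration.integral_cong) (auto simp: v_def indicator_def)
    ultimately show ?thesis by simp
   qed
   show "(LINT t|lebesgue. indicator X t * (indicator (ball 0 (real m)) t * (l2_fun e t \<bullet> i))) = 0" if "X \<in> E" for X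
    using eq that by blast
   show "(LINT t|lebesgue. indicator (ball 0 (real m)) t * (l2_fun e t \<bullet> i)) = 0" using eq[of UNIV] by simp
   have "integrable lebesgue (\<lambda>t. l2_fun e t \<bullet> v (UNIV, m, i) t)"
    by (rule mem_L2_integrable_inner[OF l2_fun_mem v]) simp
   moreover have "(\<lambda>t. l2_fun e t \<bullet> v (UNIV, m, i) t) = (\<lambda>t. indicator (ball 0 (real m)) t * (l2_fun e t \<bullet> i))"
    by (auto simp: v_def)
   ultimately show "integrable lebesgue (\<lambda>t. indicator (ball 0 (real m)) t * (l2_fun e t \<bullet> i))" by simp
  qed
  then have "AE t in lebesgue. \<forall>m. \<forall>i\<in>Basis. indicator (ball 0 (real m)) t * (l2_fun e t \<bullet> i) = 0"
   by (intro AE_all_countable[THEN iffD2] allI AE_finite_allI finite_Basis)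
  then have "AE t in lebesgue. l2_fun e t = 0"
  proof eventually_elim
   case (elim t)
   obtain m where "norm t < real m" using reals_Archimedean2 by blast
   then have "\<forall>i\<in>Basis. l2_fun e t \<bullet> i = 0" using elim by (force simp: indicator_def)
   then show ?case by (simp add: euclidean_all_zero_iff)
  qed
  then have "l2_of (l2_fun e) = l2_of (\<lambda>x. 0)" by (subst l2_of_eq_iff) (auto simp: l2_fun_mem mem_L2_zero)
  then show "e = 0" by (simp add: l2_of_zero)
 qed
 then show "\<exists>B::('a, 'b) l2 set set. countable B \<and> open = generate_topology B"
  using second_countable_if_separable by blast
qed

section \<open>Smooth bump functions and the fundamental lemma of the calculus of variations\<close>

section \<open>Test functions\<close>

text \<open>All orders of smoothness come at once from a set of differentiable functions that
  contains the partial derivatives of its members.\<close>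

lemma C_k_coinduct:
 fixes \<phi> :: "'a::euclidean_space => real"
 assumes "\<phi> \<in> S"
  and diff: "!!f x. f \<in> S ==> f differentiable (at x)"
  and deriv: "!!f i. f \<in> S ==> i \<in> Basis ==> (\<lambda>x. frechet_derivative f (at x) i) \<in> S"
 shows "C_k k \<phi>"
 using assms(1)
proof (induction k arbitrary: \<phi>)
 case 0
 then show ?case using diff by (auto intro!: continuous_at_imp_continuous_on differentiable_imp_continuous_within)
next
 case (Suc k)
 then show ?case using diff deriv by auto
qed

lemma C_k_differentiable: "C_k (Suc k) \<phi> ==> \<phi> differentiable (at x)"
 by simp

lemma C_k_add: "C_k k \<phi> ==> C_k k \<psi> ==> C_k k (\<lambda>x. \<phi> x + \<psi> x)"
proof (induction k arbitrary: \<phi> \<psi>)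
 case 0 then show ?case by (auto intro: continuous_on_add)
next
 case (Suc k)
 have "frechet_derivative (\<lambda>x. \<phi> x + \<psi> x) (at x) = (\<lambda>h. frechet_derivative \<phi> (at x) h + frechet_derivative \<psi> (at x) h)" for x
  using Suc.prems by (intro frechet_derivative_at[symmetric] has_derivative_add) (auto simp: frechet_derivative_works[symmetric])
 then show ?case using Suc by (auto intro!: differentiable_add)
qed

lemma C_k_scale: "C_k k \<phi> ==> C_k k (\<lambda>x. c * \<phi> x)"
proof (induction k arbitrary: \<phi>)
 case 0 then show ?case by (auto intro: continuous_on_mult_left)
next
 case (Suc k)
 have "frechet_derivative (\<lambda>x. c * \<phi> x) (at x) = (\<lambda>h. c * frechet_derivative \<phi> (at x) h)" for x
  using Suc.prems by (intro frechet_derivative_at[symmetric] has_derivative_mult_right) (auto simp: frechet_derivative_works[symmetric])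
 then show ?case using Suc by (auto intro!: differentiable_mult)
qed

lemma frechet_derivative_translate:
 assumes "\<phi> differentiable (at (x - h))"
 shows "((\<lambda>x. \<phi> (x - h)) has_derivative frechet_derivative \<phi> (at (x - h))) (at x)"
proof -
 have "((\<lambda>x. x - h) has_derivative (\<lambda>k. k)) (at x)" by (auto intro!: derivative_eq_intros)
 moreover have "(\<phi> has_derivative frechet_derivative \<phi> (at (x - h))) (at (x - h))"
  using assms by (simp add: frechet_derivative_works[symmetric])
 ultimately show ?thesis by (rule has_derivative_compose)
qed

lemma C_k_translate: "C_k k \<phi> ==> C_k k (\<lambda>x. \<phi> (x - h))"
proof (induction k arbitrary: \<phi>)
 case 0 then show ?case by (auto intro!: continuous_on_compose2[of UNIV \<phi>] continuous_intros)
next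
 case (Suc k)
 have *: "((\<lambda>x. \<phi> (x - h)) has_derivative frechet_derivative \<phi> (at (x - h))) (at x)" for x
  using Suc.prems by (intro frechet_derivative_translate) auto
 then have "frechet_derivative (\<lambda>x. \<phi> (x - h)) (at x) = frechet_derivative \<phi> (at (x - h))" for x
  by (rule frechet_derivative_at[symmetric])
 moreover have "(\<lambda>x. \<phi> (x - h)) differentiable (at x)" for x using * by (auto simp: differentiable_def)
 moreover have "C_k k (\<lambda>x. frechet_derivative \<phi> (at (x - h)) i)" if "i \<in> Basis" for i
  using Suc.IH[of "\<lambda>x. frechet_derivative \<phi> (at x) i"] Suc.prems that by simp
 ultimately show ?case by simp
qed

subsection \<open>Bump functions\<close>

text \<open>The function exp(-1/t), flat at 0, multiplied by a power of 1/t. The power is carried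
  along because differentiation raises it, so that derivatives are combinations of members of the
  same family.\<close>

definition flat :: "nat => real => real" where
 "flat m t = (if t > 0 then exp (- (1 / t)) * (1 / t) ^ m else 0)"

lemma flat_tendsto_0: "((\<lambda>t. flat m t) \<longlongrightarrow> 0) (at_right 0)"
proof -
 have "((\<lambda>t::real. (inverse t) ^ m / exp (inverse t)) \<longlongrightarrow> 0) (at_right 0)"
  by (rule filterlim_compose[OF tendsto_power_div_exp_0 filterlim_inverse_at_top_right])
 moreover have "eventually (\<lambda>t::real. (inverse t) ^ m / exp (inverse t) = flat m t) (at_right 0)"
  unfolding eventually_at_right_field by (auto simp: flat_def exp_minus field_simps intro!: exI[of _ 1])
 ultimately show ?thesis by (rule Lim_transform_eventually)
qed

lemma flat_has_derivative: "(flat m has_real_derivative (flat (m + 2) t - real m * flat (m + 1) t)) (at t)"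
proof -
 consider "t > 0" | "t < 0" | "t = 0" by linarith
 then show ?thesis
 proof cases
  case 1
  have "((\<lambda>t. exp (- (1 / t)) * (1 / t) ^ m) has_real_derivative (flat (m + 2) t - real m * flat (m + 1) t)) (at t)"
   using 1
   by (auto intro!: derivative_eq_intros simp: flat_def)
    (cases m; simp add: field_simps power2_eq_square)
  then show ?thesis
   by (rule has_field_derivative_transform_within[where d = t]) (use 1 in \<open>auto simp: flat_def dist_real_def\<close>)
 next
  case 2
  have "((\<lambda>t. 0) has_real_derivative (flat (m + 2) t - real m * flat (m + 1) t)) (at t)"
   using 2 by (simp add: flat_def)
  then show ?thesis
   by (rule has_field_derivative_transform_within[where d = "- t"]) (use 2 in \<open>auto simp: flat_def dist_real_def\<close>)
 next
  \<comment> \<open>At 0 the difference quotient is \<open>flat (m + 1)\<close> from the right and 0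
    from the left.\<close>
  case 3
  have "((\<lambda>h. flat m h / h) \<longlongrightarrow> 0) (at_right 0)"
  proof (rule Lim_transform_eventually[OF flat_tendsto_0[of "m + 1"]])
   show "eventually (\<lambda>h. flat (m + 1) h = flat m h / h) (at_right 0)"
    unfolding eventually_at_right_field by (auto simp: flat_def intro!: exI[of _ 1])
  qed
  moreover have "((\<lambda>h. flat m h / h) \<longlongrightarrow> 0) (at_left 0)"
  proof (rule Lim_transform_eventually[OF tendsto_const])
   show "eventually (\<lambda>h. 0 = flat m h / h) (at_left 0)"
    unfolding eventually_at_left_field by (auto simp: flat_def intro!: exI[of _ "-1"])
  qed
  ultimately have "((\<lambda>h. flat m h / h) \<longlongrightarrow> 0) (at 0)" by (simp add: filterlim_at_split)
  moreover have z: "flat k 0 = 0" for k by (simp add: flat_def)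
  ultimately show ?thesis unfolding DERIV_def by (simp add: 3 z)
 qed
qed

text \<open>The algebra generated by flat functions of affine arguments is closed under partial
  derivatives, so smoothness follows by coinduction and no higher derivative has to be
  computed.\<close>

inductive_set bump_algebra :: "('a::euclidean_space => real) set" where
 const: "(\<lambda>x. c) \<in> bump_algebra"
| flat: "(\<lambda>x. flat m (v \<bullet> x + c)) \<in> bump_algebra"
| add: "f \<in> bump_algebra ==> g \<in> bump_algebra ==> (\<lambda>x. f x + g x) \<in> bump_algebra"
| mult: "f \<in> bump_algebra ==> g \<in> bump_algebra ==> (\<lambda>x. f x * g x) \<in> bump_algebra"

lemma bump_algebra_derivative:
 assumes "f \<in> bump_algebra"
 shows "\<exists>f'. (\<forall>x. (f has_derivative f' x) (at x)) \<and> (\<forall>i. (\<lambda>x. f' x i) \<in> bump_algebra)"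
 using assms
proof induction
 case (const c)
 show ?case by (rule exI[of _ "\<lambda>x h. 0"]) (auto intro: bump_algebra.const)
next
 case (flat m v c)
 let ?d = "\<lambda>x h. (flat (m + 2) (v \<bullet> x + c) + (- real m) * flat (m + 1) (v \<bullet> x + c)) * (v \<bullet> h)"
 have "((\<lambda>x. flat m (v \<bullet> x + c)) has_derivative ?d x) (at x)" for x
 proof -
  have "((\<lambda>x. v \<bullet> x + c) has_derivative (\<lambda>h. v \<bullet> h)) (at x)" by (auto intro!: derivative_eq_intros)
  from has_derivative_compose[OF this flat_has_derivative[of m "v \<bullet> x + c", unfolded has_field_derivative_def]]
  show ?thesis by simp
 qed
 moreover have "(\<lambda>x. ?d x i) \<in> bump_algebra" for i
  by (intro bump_algebra.intros)
 ultimately show ?case by (intro exI[of _ ?d] conjI allI)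
next
 case (add f g)
 then obtain f' g' where f': "!!x. (f has_derivative f' x) (at x)" "!!i. (\<lambda>x. f' x i) \<in> bump_algebra"
  and g': "!!x. (g has_derivative g' x) (at x)" "!!i. (\<lambda>x. g' x i) \<in> bump_algebra" by blast
 show ?case
  by (rule exI[of _ "\<lambda>x h. f' x h + g' x h"]) (auto intro!: has_derivative_add f' g' bump_algebra.add)
next
 case (mult f g)
 then obtain f' g' where f': "!!x. (f has_derivative f' x) (at x)" "!!i. (\<lambda>x. f' x i) \<in> bump_algebra"
  and g': "!!x. (g has_derivative g' x) (at x)" "!!i. (\<lambda>x. g' x i) \<in> bump_algebra" by blast
 show ?case
  by (rule exI[of _ "\<lambda>x h. f x * g' x h + f' x h * g x"])
   (auto intro!: has_derivative_mult f' g' bump_algebra.add bump_algebra.mult mult)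
qed

lemma C_k_bump_algebra:
 assumes "f \<in> bump_algebra" shows "C_k k f"
 using assms
proof (rule C_k_coinduct)
 fix f :: "'a => real" assume "f \<in> bump_algebra"
 then obtain f' where f': "!!x. (f has_derivative f' x) (at x)" "!!i. (\<lambda>x. f' x i) \<in> bump_algebra"
  using bump_algebra_derivative by blast
 then show "f differentiable (at x)" for x by (auto simp: differentiable_def)
 have "frechet_derivative f (at x) = f' x" for x using frechet_derivative_at[OF f'(1)] by simp
 then show "(\<lambda>x. frechet_derivative f (at x) i) \<in> bump_algebra" for i using f'(2)[of i] by simp
qed

text \<open>Each factor is positive exactly on the inner side of one face, so the product is nonzero
  exactly on the open box. As \<open>n\<close> grows, the arguments tend to infinity inside the box,
  where exp(-1/s) tends to 1, and the bumps tend to the indicator.\<close>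

definition bump :: "nat => 'a::euclidean_space => 'a => 'a => real" where
 "bump n a b x = (\<Prod>i\<in>Basis. flat 0 (real (Suc n) * ((x - a) \<bullet> i)) * flat 0 (real (Suc n) * ((b - x) \<bullet> i)))"

lemma bump_algebra_prod:
 assumes "finite I" "!!i. i \<in> I ==> f i \<in> bump_algebra"
 shows "(\<lambda>x. \<Prod>i\<in>I. f i x) \<in> bump_algebra"
 using assms by (induction I) (auto intro: bump_algebra.const bump_algebra.mult)

lemma bump_in_bump_algebra: "bump n a b \<in> bump_algebra"
proof -
 have "(\<lambda>x. flat 0 (real (Suc n) * ((x - a) \<bullet> i)) * flat 0 (real (Suc n) * ((b - x) \<bullet> i))) \<in> bump_algebra" for i
 proof -
  have "(\<lambda>x. flat 0 (((real (Suc n)) *\<^sub>R i) \<bullet> x + (- real (Suc n) * (a \<bullet> i))) * flat 0 (((- real (Suc n)) *\<^sub>R i) \<bullet> x + real (Suc n) * (b \<bullet> i))) \<in> bump_algebra"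
   by (intro bump_algebra.intros)
  then show ?thesis by (simp add: inner_diff_left algebra_simps inner_commute)
 qed
 then show ?thesis unfolding bump_def[abs_def] by (intro bump_algebra_prod) auto
qed

lemma flat_0_pos_iff: "flat 0 t > 0 \<longleftrightarrow> t > 0" and flat_0_nonneg: "flat 0 t \<ge> 0" and flat_0_le_1: "flat 0 t <= 1"
 by (auto simp: flat_def)

lemma flat_0_neq_0_iff: "flat 0 t \<noteq> 0 \<longleftrightarrow> t > 0"
 by (auto simp: flat_def)

lemma bump_neq_0_iff: "bump n a b x \<noteq> 0 \<longleftrightarrow> x \<in> box a b"
 by (auto simp: bump_def flat_0_neq_0_iff zero_less_mult_iff inner_diff_left mem_box)

lemma bump_bounds: "0 <= bump n a b x" "bump n a b x <= 1"
 unfolding bump_def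
 by (intro prod_nonneg ballI mult_nonneg_nonneg flat_0_nonneg)
  (intro prod_le_1 conjI mult_nonneg_nonneg mult_le_one flat_0_nonneg flat_0_le_1)

lemma bump_test_function:
 assumes "cbox a b \<subseteq> S" shows "bump n a b \<in> test_functions S"
proof -
 have eq: "{x. bump n a b x \<noteq> 0} = box a b" by (auto simp: bump_neq_0_iff)
 have sub: "closure (box a b) \<subseteq> cbox a b" by (rule closure_minimal) (auto simp: box_subset_cbox)
 then have "compact (closure (box a b))"
  by (meson bounded_cbox bounded_subset closed_closure compact_eq_bounded_closed)
 then have "compact (closure {x. bump n a b x \<noteq> 0})" "closure {x. bump n a b x \<noteq> 0} \<subseteq> S"
  unfolding eq using sub assms by blast+
 then show ?thesis unfolding test_functions_def
  using C_k_bump_algebra[OF bump_in_bump_algebra] by blast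
qed

lemma bump_tendsto_indicator: "(\<lambda>n. bump n a b x) \<longlonglongrightarrow> indicator (box a b) x"
proof (cases "x \<in> box a b")
 case True
 have flat1: "(\<lambda>n. flat 0 (real (Suc n) * t)) \<longlonglongrightarrow> 1" if "t > 0" for t
 proof -
  have "(\<lambda>n. (1 / t) * (1 / real (Suc n))) \<longlonglongrightarrow> (1 / t) * 0"
   by (intro tendsto_mult tendsto_const) (use LIMSEQ_inverse_real_of_nat in \<open>simp add: inverse_eq_divide\<close>)
  then have "(\<lambda>n. exp (- ((1 / t) * (1 / real (Suc n))))) \<longlonglongrightarrow> exp (- ((1 / t) * 0))"
   by (intro tendsto_exp tendsto_minus)
  moreover have "exp (- ((1 / t) * (1 / real (Suc n)))) = flat 0 (real (Suc n) * t)" for n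
  proof -
   have "real (Suc n) * t > 0" using that by (intro mult_pos_pos) simp_all
   then show ?thesis by (simp add: flat_def mult.commute del: of_nat_Suc)
  qed
  ultimately show ?thesis by simp
 qed
 have "(\<lambda>n. bump n a b x) \<longlonglongrightarrow> (\<Prod>i\<in>(Basis::'a set). 1 * 1)" unfolding bump_def
 proof (rule tendsto_prod)
  fix i :: 'a assume "i \<in> Basis"
  then have "(x - a) \<bullet> i > 0" "(b - x) \<bullet> i > 0" using True by (auto simp: mem_box inner_diff_left)
  then show "(\<lambda>n. flat 0 (real (Suc n) * ((x - a) \<bullet> i)) * flat 0 (real (Suc n) * ((b - x) \<bullet> i))) \<longlonglongrightarrow> 1 * 1"
   by (intro tendsto_mult flat1)
 qed
 then show ?thesis using True by simp
next
 case False
 then have "bump n a b x = 0" for n using bump_neq_0_iff by blast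
 then show ?thesis using False by simp
qed

lemma test_function_C_k: "\<phi> \<in> test_functions S ==> C_k k \<phi>"
 unfolding test_functions_def mem_Collect_eq by (elim conjE) (erule spec)

lemma test_function_bounded:
 assumes "\<phi> \<in> test_functions S"
 shows "\<exists>B. \<forall>x. \<bar>\<phi> x\<bar> <= B"
proof -
 let ?K = "closure {x. \<phi> x \<noteq> 0}"
 have K: "compact ?K" and "C_k 0 \<phi>" using assms unfolding test_functions_def by blast+
 then have "compact (\<phi> ` ?K)" by (intro compact_continuous_image) (auto intro: continuous_on_subset)
 then have "bounded (\<phi> ` ?K)" by (rule compact_imp_bounded)
 then obtain B where B: "!!x. x \<in> ?K ==> \<bar>\<phi> x\<bar> <= B" unfolding bounded_iff by auto
 have "\<bar>\<phi> x\<bar> <= max B 0" for x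
  using B[of x] closure_subset[of "{x. \<phi> x \<noteq> 0}"] by (cases "\<phi> x = 0") (auto simp: le_max_iff_disj)
 then show ?thesis by blast
qed

lemma test_function_continuous: "\<phi> \<in> test_functions S ==> continuous_on UNIV \<phi>"
 by (rule C_k.simps(1)[THEN iffD1]) (rule test_function_C_k)

lemma test_function_measurable : "\<phi> \<in> test_functions S ==> \<phi> \<in> borel_measurable borel"
 by (rule borel_measurable_continuous_onI[OF test_function_continuous])

lemma test_function_zero_outside: "\<phi> \<in> test_functions S ==> x \<notin> S ==> \<phi> x = 0"
 using closure_subset[of "{x. \<phi> x \<noteq> 0}"] unfolding test_functions_def by auto

lemma test_function_differentiable: "\<phi> \<in> test_functions S ==> \<phi> differentiable (at x)"
 by (rule C_k_differentiable[of 0]) (rule test_function_C_k)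

lemma compact_closure_if_subset: "compact K ==> closure S \<subseteq> K ==> compact (closure S)"
 using compact_Int_closed[OF _ closed_closure, of K S] by (simp only: Int_absorb1)

lemma test_functions_add:
 assumes "\<phi> \<in> test_functions S" "\<psi> \<in> test_functions S"
 shows "(\<lambda>x. \<phi> x + \<psi> x) \<in> test_functions S"
proof -
 let ?K = "closure {x. \<phi> x \<noteq> 0} \<union> closure {x. \<psi> x \<noteq> 0}"
 have K: "compact ?K" "?K \<subseteq> S" using assms unfolding test_functions_def by (simp_all only: mem_Collect_eq compact_Un Un_subset_iff)
 have sub: "closure {x. \<phi> x + \<psi> x \<noteq> 0} \<subseteq> ?K"
 proof (rule closure_minimal)
  have "{x. \<phi> x + \<psi> x \<noteq> 0} \<subseteq> {x. \<phi> x \<noteq> 0} \<union> {x. \<psi> x \<noteq> 0}" by auto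
  also have "... \<subseteq> ?K" by (intro Un_mono closure_subset)
  finally show "{x. \<phi> x + \<psi> x \<noteq> 0} \<subseteq> ?K" .
 qed (intro closed_Un closed_closure)
 have "compact (closure {x. \<phi> x + \<psi> x \<noteq> 0})"
  by (rule compact_closure_if_subset[OF K(1) sub])
 moreover have "C_k k (\<lambda>x. \<phi> x + \<psi> x)" for k
  by (intro C_k_add test_function_C_k[OF assms(1)] test_function_C_k[OF assms(2)])
 ultimately show ?thesis unfolding test_functions_def mem_Collect_eq using sub K(2) by (intro conjI allI order_trans[OF sub K(2)])
qed

lemma test_functions_scale:
 assumes "\<phi> \<in> test_functions S"
 shows "(\<lambda>x. c * \<phi> x) \<in> test_functions S"
proof -
 let ?K = "closure {x. \<phi> x \<noteq> 0}"
 have K: "compact ?K" "?K \<subseteq> S" using assms by (auto simp: test_functions_def)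
 have sub: "closure {x. c * \<phi> x \<noteq> 0} \<subseteq> ?K"
  by (rule closure_mono) auto
 have "compact (closure {x. c * \<phi> x \<noteq> 0})"
  by (rule compact_closure_if_subset[OF K(1) sub])
 moreover have "C_k k (\<lambda>x. c * \<phi> x)" for k
  by (intro C_k_scale test_function_C_k[OF assms])
 ultimately show ?thesis unfolding test_functions_def mem_Collect_eq using sub K(2) by (intro conjI allI order_trans[OF sub K(2)])
qed

lemma test_functions_zero: "(\<lambda>x. 0) \<in> test_functions S"
proof -
 have "C_k k (\<lambda>x::'a. 0)" for k by (rule C_k_bump_algebra[OF bump_algebra.const])
 then show ?thesis unfolding test_functions_def by simp
qed

lemma test_functions_translate:
 fixes \<phi> :: "'a::euclidean_space => real"
 assumes \<phi>: "\<phi> \<in> test_functions P" and sub: "!!x. x \<in> P ==> x + h \<in> S"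
 shows "(\<lambda>x. \<phi> (x - h)) \<in> test_functions S"
proof -
 have "{x. \<phi> (x - h) \<noteq> 0} = (+) h ` {x. \<phi> x \<noteq> 0}"
  by (auto simp: image_iff intro!: exI[of _ "_ - h"])
 then have eq: "closure {x. \<phi> (x - h) \<noteq> 0} = (+) h ` closure {x. \<phi> x \<noteq> 0}"
  by (simp add: closure_translation)
 have K: "compact (closure {x. \<phi> x \<noteq> 0})" "closure {x. \<phi> x \<noteq> 0} \<subseteq> P" "!!k. C_k k \<phi>"
  using \<phi> unfolding test_functions_def by blast+
 have "compact (closure {x. \<phi> (x - h) \<noteq> 0})" unfolding eq using K(1) by (rule compact_translation)
 moreover have "closure {x. \<phi> (x - h) \<noteq> 0} \<subseteq> S" unfolding eq using K(2) sub by (force simp: add.commute)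
 ultimately show ?thesis unfolding test_functions_def using C_k_translate[OF K(3)] by blast
qed

lemma test_function_derivative:
 assumes "\<phi> \<in> test_functions S" "i \<in> Basis"
 shows "(\<lambda>x. frechet_derivative \<phi> (at x) i) \<in> test_functions S"
proof -
 let ?K = "closure {x. \<phi> x \<noteq> 0}"
 have K: "compact ?K" "?K \<subseteq> S" using assms by (auto simp: test_functions_def)
 have "frechet_derivative \<phi> (at x) i = 0" if x: "x \<notin> ?K" for x
 proof -
  have "(\<phi> has_derivative (\<lambda>h. 0)) (at x)"
  proof (rule has_derivative_transform_within_open[of "\<lambda>x. 0" _ _ _ "- ?K"])
   show "0 = \<phi> y" if "y \<in> - ?K" for y using that closure_subset[of "{x. \<phi> x \<noteq> 0}"] by auto
  qed (use x in auto)
  from fun_cong[OF frechet_derivative_at[OF this], of i] show ?thesis by simp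
 qed
 then have sub: "closure {x. frechet_derivative \<phi> (at x) i \<noteq> 0} \<subseteq> ?K"
  by (intro closure_minimal) auto
 have "compact (closure {x. frechet_derivative \<phi> (at x) i \<noteq> 0})"
  by (rule compact_closure_if_subset[OF K(1) sub])
 moreover have "C_k k (\<lambda>x. frechet_derivative \<phi> (at x) i)" for k
 proof -
  have "C_k (Suc k) \<phi>" using assms(1) unfolding test_functions_def by blast
  then show ?thesis using assms(2) by simp
 qed
 ultimately show ?thesis using sub K by (auto simp: test_functions_def)
qed

lemma test_function_mem_L2:
 assumes "\<phi> \<in> test_functions S"
 shows "mem_L2 lebesgue \<phi>"
proof -
 let ?K = "closure {x. \<phi> x \<noteq> 0}"
 have K: "compact ?K" using assms by (simp add: test_functions_def)
 obtain B where B: "!!x. \<bar>\<phi> x\<bar> <= B" using test_function_bounded[OF assms] by blast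
 have m: "\<phi> \<in> borel_measurable lebesgue"
  using test_function_measurable[OF assms] by (intro measurable_completion) simp
 have "?K \<in> lmeasurable" using K by (rule lmeasurable_compact)
 then have int: "integrable lebesgue (\<lambda>x. indicat_real ?K x * B\<^sup>2)"
  by (intro integrable_mult_left) (auto simp: integrable_indicator_iff fmeasurable_def)
 show ?thesis
 proof (rule mem_L2_bound[OF m int], rule AE_I2)
  fix x
  show "(norm (\<phi> x))\<^sup>2 <= indicat_real ?K x * B\<^sup>2"
   using power_mono[OF B[of x], of 2] closure_subset[of "{x. \<phi> x \<noteq> 0}"]
   by (cases "\<phi> x = 0") (auto simp: indicator_def)
 qed
qed

subsection \<open>The fundamental lemma of the calculus of variations\<close>

lemma Int_stable_boxes: "Int_stable (range (\<lambda>(a, b). box a b :: 'a::euclidean_space set))"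
proof (rule Int_stableI)
 fix X Y :: "'a set" assume "X \<in> range (\<lambda>(a, b). box a b)" "Y \<in> range (\<lambda>(a, b). box a b)"
 then obtain a b c d where "X = box a b" "Y = box c d" by auto
 then have "X \<inter> Y = (\<lambda>(a, b). box a b) (\<Sum>i\<in>Basis. max (a \<bullet> i) (c \<bullet> i) *\<^sub>R i, \<Sum>i\<in>Basis. min (b \<bullet> i) (d \<bullet> i) *\<^sub>R i)"
  by (simp add: box_Int_box)
 then show "X \<inter> Y \<in> range (\<lambda>(a, b). box a b)" by (rule range_eqI)
qed

lemma integrable_lebesgue_on_iff:
 fixes f :: "'a::euclidean_space => 'b::{banach, second_countable_topology}"
 assumes "S \<in> sets lebesgue"
 shows "integrable (lebesgue_on S) f \<longleftrightarrow> integrable lebesgue (\<lambda>x. indicator S x *\<^sub>R f x)"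
 by (rule integrable_restrict_space) (use assms in auto)

lemma integral_lebesgue_on_eq:
 fixes f :: "'a::euclidean_space => 'b::{banach, second_countable_topology}"
 assumes "S \<in> sets lebesgue"
 shows "(LINT x|lebesgue_on S. f x) = (LINT x|lebesgue. indicator S x *\<^sub>R f x)"
 by (rule integral_restrict_space) (use assms in auto)

lemma AE_lebesgue_on_iff:
 assumes "S \<in> sets lebesgue"
 shows "(AE x in lebesgue_on S. P x) \<longleftrightarrow> (AE x in lebesgue. x \<in> S --> P x)"
 by (rule AE_restrict_space_iff) (use assms in auto)

text \<open>Bumps converge boundedly to indicators of boxes, so dominated convergence turns the
  hypothesis into vanishing integrals over boxes. These determine the function in each box whose
  closure lies in \<open>S\<close>, and countably many such boxes cover \<open>S\<close>.\<close>

lemma fundamental_lemma: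
 fixes f :: "'a::euclidean_space => real"
 assumes S: "open S" and f: "integrable (lebesgue_on S) f"
  and zero: "!!\<phi>. \<phi> \<in> test_functions S ==> (LINT x|lebesgue_on S. f x * \<phi> x) = 0"
 shows "AE x in lebesgue_on S. f x = 0"
proof -
 have Sl: "S \<in> sets lebesgue" using S by simp
 \<comment> \<open>Fixing an outer box with closure in \<open>S\<close> makes every generator box
   admissible after intersection with it.\<close>
 have box0: "AE x in lebesgue. indicator (box p q) x * f x = 0" if pq: "cbox p q \<subseteq> S" for p q
 proof (rule AE_zero_if_integrals_zero_lebesgue[OF _ Int_stable_boxes])
  have pqS: "box p q \<subseteq> S" using pq box_subset_cbox by blast
  have "integrable lebesgue (\<lambda>x. indicator S x *\<^sub>R f x)"
   using f unfolding integrable_lebesgue_on_iff[OF Sl] .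
  then have "integrable lebesgue (\<lambda>x. indicator (box p q) x *\<^sub>R (indicator S x *\<^sub>R f x))"
   by (rule integrable_mult_indicator[rotated]) simp
  moreover have "(\<lambda>x. indicator (box p q) x *\<^sub>R (indicator S x *\<^sub>R f x)) = (\<lambda>x. indicator (box p q) x * f x)"
   using pqS by (auto simp: fun_eq_iff split: split_indicator)
  ultimately show "integrable lebesgue (\<lambda>x. indicator (box p q) x * f x)" by simp
  show "sets (borel :: 'a measure) = sigma_sets UNIV (range (\<lambda>(a, b). box a b))"
   unfolding borel_eq_box by (rule sets_measure_of) simp
  have main: "(LINT x|lebesgue. indicator (box a b) x * f x) = 0" if ab: "cbox a b \<subseteq> S" for a b
  proof -
   have abS: "box a b \<subseteq> S" using ab box_subset_cbox by blast
   have "(\<lambda>n. LINT x|lebesgue_on S. f x * bump n a b x) \<longlonglongrightarrow> (LINT x|lebesgue_on S. f x * indicator (box a b) x)"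
   proof (rule integral_dominated_convergence[where w = "\<lambda>x. \<bar>f x\<bar>"])
    show "AE x in lebesgue_on S. (\<lambda>n. f x * bump n a b x) \<longlonglongrightarrow> f x * indicator (box a b) x"
     by (intro AE_I2 tendsto_mult tendsto_const bump_tendsto_indicator)
    show "AE x in lebesgue_on S. norm (f x * bump n a b x) <= \<bar>f x\<bar>" for n
     using bump_bounds[of n a b] by (intro AE_I2) (simp add: abs_mult mult_left_le)
    have "bump n a b \<in> borel_measurable lebesgue" for n
     using test_function_mem_L2[OF bump_test_function[OF ab]] by (rule mem_L2_measurable)
    then show "(\<lambda>x. f x * bump n a b x) \<in> borel_measurable (lebesgue_on S)" for n
     using f by (intro borel_measurable_times) (auto intro: measurable_restrict_space1)
    have "indicat_real (box a b) \<in> borel_measurable lebesgue" by (intro borel_measurable_indicator) simp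
    then show "(\<lambda>x. f x * indicator (box a b) x) \<in> borel_measurable (lebesgue_on S)"
     using f by (intro borel_measurable_times) (auto intro: measurable_restrict_space1)
   qed (use f in auto)
   moreover have "(LINT x|lebesgue_on S. f x * bump n a b x) = 0" for n
    by (rule zero[OF bump_test_function[OF ab]])
   ultimately have "(\<lambda>n::nat. 0) \<longlonglongrightarrow> (LINT x|lebesgue_on S. f x * indicator (box a b) x)" by simp
   then have "(LINT x|lebesgue_on S. f x * indicator (box a b) x) = 0"
    by (simp only: LIMSEQ_const_iff)
   also have "(LINT x|lebesgue_on S. f x * indicator (box a b) x) = (LINT x|lebesgue. indicator S x *\<^sub>R (f x * indicator (box a b) x))"
    by (rule integral_lebesgue_on_eq[OF Sl])
   also have "... = (LINT x|lebesgue. indicator (box a b) x * f x)"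
    using abS by (intro Bochner_Integration.integral_cong) (auto simp: indicator_def)
   finally show ?thesis .
  qed
  show "(LINT x|lebesgue. indicator (box p q) x * f x) = 0" by (rule main[OF pq])
  fix X :: "'a set" assume "X \<in> range (\<lambda>(a, b). box a b)"
  then obtain a b where X: "X = box a b" by auto
  define a' b' where "a' = (\<Sum>i\<in>Basis. max (a \<bullet> i) (p \<bullet> i) *\<^sub>R i)" and "b' = (\<Sum>i\<in>Basis. min (b \<bullet> i) (q \<bullet> i) *\<^sub>R i)"
  have 1: "X \<inter> box p q = box a' b'" unfolding X a'_def b'_def by (rule box_Int_box)
  have "cbox a' b' \<subseteq> cbox p q" unfolding a'_def b'_def by (auto simp: mem_box)
  then have "(LINT x|lebesgue. indicator (box a' b') x * f x) = 0" using pq by (intro main) auto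
  then show "(LINT x|lebesgue. indicator X x * (indicator (box p q) x * f x)) = 0"
   unfolding 1[symmetric] by (simp add: indicator_inter_arith mult.assoc)
 qed
 define F where "F = {box p q | p q. cbox p q \<subseteq> S}"
 have "!!U. U \<in> F ==> open U" unfolding F_def by auto
 then obtain F' where F': "F' \<subseteq> F" "countable F'" "\<Union>F' = \<Union>F" using Lindelof by metis
 have UF: "S \<subseteq> \<Union>F"
 proof
  fix x assume "x \<in> S"
  then obtain a b where "cbox a b \<subseteq> S" "x \<in> box a b" using open_contains_cbox[OF S] by metis
  then have "box a b \<in> F" "x \<in> box a b" unfolding F_def by auto
  then show "x \<in> \<Union>F" by (rule UnionI)
 qed
 have "AE x in lebesgue. \<forall>U\<in>F'. indicator U x * f x = 0"
 proof (intro AE_ball_countable[OF F'(2), THEN iffD2] ballI)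
  fix U assume "U \<in> F'"
  then obtain p q where "U = box p q" "cbox p q \<subseteq> S" using F'(1) unfolding F_def by auto
  then show "AE x in lebesgue. indicator U x * f x = 0" using box0 by simp
 qed
 then have "AE x in lebesgue. x \<in> S --> f x = 0"
 proof eventually_elim
  case (elim x)
  show ?case
  proof
   assume "x \<in> S"
   then obtain U where "U \<in> F'" "x \<in> U" using UF F'(3) by (metis UnionE subsetD)
   then show "f x = 0" using elim by (metis indicator_simps(1) mult_1)
  qed
 qed
 then show ?thesis by (rule AE_lebesgue_on_iff[OF Sl, THEN iffD2])
qed

lemma mem_L2_integrable_finite:
 assumes f: "mem_L2 N f" and fin: "finite_measure N"
 shows "integrable N f"
proof (rule Bochner_Integration.integrable_bound[where f = "\<lambda>x. 1 + (norm (f x))\<^sup>2"])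
 show "integrable N (\<lambda>x. 1 + (norm (f x))\<^sup>2)"
  using f finite_measure.integrable_const[OF fin] by (intro Bochner_Integration.integrable_add) (auto simp: mem_L2_def)
 show "AE x in N. norm (f x) <= norm (1 + (norm (f x))\<^sup>2)"
 proof (rule AE_I2)
  fix x
  have "2 * norm (f x) * 1 <= (norm (f x))\<^sup>2 + 1\<^sup>2" by (rule sum_squares_bound)
  then have "norm (f x) <= 1 + (norm (f x))\<^sup>2" using norm_ge_zero[of "f x"] unfolding one_power2 by linarith
  then show "norm (f x) <= norm (1 + (norm (f x))\<^sup>2)" by simp
 qed
qed (use f in \<open>simp add: mem_L2_def\<close>)

lemma mem_L2_restrict:
 assumes S: "S \<in> sets N" and f: "mem_L2 N f"
 shows "mem_L2 (restrict_space N S) f"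
 unfolding mem_L2_def
proof
 show "f \<in> borel_measurable (restrict_space N S)" using mem_L2_measurable[OF f] by (rule measurable_restrict_space1)
 have "S \<inter> space N \<in> sets N" using S by auto
 then show "integrable (restrict_space N S) (\<lambda>x. (norm (f x))\<^sup>2)"
  unfolding integrable_restrict_space[OF \<open>S \<inter> space N \<in> sets N\<close>]
  by (intro integrable_mult_indicator S mem_L2_integrable f)
qed

text \<open>A vector orthogonal to all test functions of \<open>S\<close> vanishes on
  \<open>S\<close> by the fundamental lemma, hence is orthogonal to every \<open>w\<close> supported
  in \<open>S\<close>; separation leaves no such \<open>w\<close> outside the closure.\<close>

lemma test_functions_dense:
 fixes w :: "('a::euclidean_space, real) l2"
 assumes S: "open S" "bounded S" and w: "AE x in lebesgue. x \<notin> S --> l2_fun w x = 0"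
 shows "w \<in> closure (l2_of ` test_functions S)"
proof (rule ccontr)
 let ?T = "l2_of ` test_functions S :: ('a, real) l2 set"
 assume nw: "w \<notin> closure ?T"
 have Sl: "S \<in> lmeasurable" using S by (simp add: lmeasurable_open)
 have "subspace ?T"
 proof (rule subspaceI)
  show "0 \<in> ?T" using test_functions_zero by (rule image_eqI[rotated]) (rule l2_of_zero[symmetric])
  show "x + y \<in> ?T" if xy: "x \<in> ?T" "y \<in> ?T" for x y
  proof -
   obtain \<phi> \<psi> where "\<phi> \<in> test_functions S" "x = l2_of \<phi>" "\<psi> \<in> test_functions S" "y = l2_of \<psi>" using xy by blast
   then have "x + y = l2_of (\<lambda>x. \<phi> x + \<psi> x)" "(\<lambda>x. \<phi> x + \<psi> x) \<in> test_functions S"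
    by (simp_all add: l2_of_add[OF test_function_mem_L2 test_function_mem_L2] test_functions_add)
   then show ?thesis by (rule image_eqI)
  qed
  show "c *\<^sub>R x \<in> ?T" if x: "x \<in> ?T" for c x
  proof -
   obtain \<phi> where "\<phi> \<in> test_functions S" "x = l2_of \<phi>" using x by blast
   then have "c *\<^sub>R x = l2_of (\<lambda>x. c * \<phi> x)" "(\<lambda>x. c * \<phi> x) \<in> test_functions S"
    using l2_of_scaleR[OF test_function_mem_L2, of \<phi> S c] by (simp_all add: test_functions_scale)
   then show ?thesis by (rule image_eqI)
  qed
 qed
 then obtain e where e: "!!v. v \<in> closure ?T ==> e \<bullet> v = 0" "e \<bullet> w = 1"
  using closed_subspace_separation[OF subspace_closure closed_closure nw] by blast
 have m: "mem_L2 (lebesgue_on S) (l2_fun e)"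
  using Sl by (intro mem_L2_restrict l2_fun_mem) (simp add: fmeasurableD)
 have "AE x in lebesgue_on S. l2_fun e x = 0"
 proof (rule fundamental_lemma[OF S(1) mem_L2_integrable_finite[OF m finite_measure_lebesgue_on[OF Sl]]])
  fix \<phi> :: "'a => real" assume \<phi>: "\<phi> \<in> test_functions S"
  have "(LINT x|lebesgue_on S. l2_fun e x * \<phi> x) = (LINT x|lebesgue. indicator S x *\<^sub>R (l2_fun e x * \<phi> x))"
   by (rule integral_lebesgue_on_eq[OF fmeasurableD[OF Sl]])
  also have "... = (LINT x|lebesgue. l2_fun e x \<bullet> \<phi> x)"
   using test_function_zero_outside[OF \<phi>] by (intro Bochner_Integration.integral_cong) (auto simp: indicator_def)
  also have "... = l2_of (l2_fun e) \<bullet> l2_of \<phi>"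
   by (rule inner_l2_of[OF l2_fun_mem test_function_mem_L2[OF \<phi>], symmetric])
  also have "... = e \<bullet> l2_of \<phi>" by (simp only: l2_of_fun)
  also have "... = 0" by (intro e(1) subsetD[OF closure_subset] imageI \<phi>)
  finally show "(LINT x|lebesgue_on S. l2_fun e x * \<phi> x) = 0" .
 qed
 then have "AE x in lebesgue. x \<in> S --> l2_fun e x = 0"
  by (rule AE_lebesgue_on_iff[OF fmeasurableD[OF Sl], THEN iffD1])
 then have "AE x in lebesgue. l2_fun e x \<bullet> l2_fun w x = 0" using w by eventually_elim auto
 then have "e \<bullet> w = 0" unfolding inner_l2 by (rule integral_eq_zero_AE)
 then show False using e(2) by simp
qed

section \<open>Translation estimates and the Poincare inequality by chaining\<close>

section \<open>The Poincare inequality on Lipschitz domains\<close>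

lemma test_functions_sum:
 assumes "finite I" "!!i. i \<in> I ==> \<phi> i \<in> test_functions S"
 shows "(\<lambda>x. \<Sum>i\<in>I. \<phi> i x) \<in> test_functions S"
 using assms by (induction I) (simp_all add: test_functions_zero test_functions_add)

lemma linear_frechet_derivative_test_function:
 assumes "\<phi> \<in> test_functions S" shows "linear (frechet_derivative \<phi> (at x))"
 using test_function_differentiable[OF assms] by (rule linear_frechet_derivative)

lemma test_function_derivative_expand:
 assumes "\<phi> \<in> test_functions S"
 shows "frechet_derivative \<phi> (at x) h = (\<Sum>i\<in>Basis. (h \<bullet> i) * frechet_derivative \<phi> (at x) i)"
proof -
 interpret linear "frechet_derivative \<phi> (at x)" by (rule linear_frechet_derivative_test_function[OF assms])
 have "frechet_derivative \<phi> (at x) h = frechet_derivative \<phi> (at x) (\<Sum>i\<in>Basis. (h \<bullet> i) *\<^sub>R i)"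
  by (simp add: euclidean_representation)
 also have "... = (\<Sum>i\<in>Basis. (h \<bullet> i) * frechet_derivative \<phi> (at x) i)" by (simp add: sum scaleR)
 finally show ?thesis .
qed

lemma test_function_directional_derivative:
 assumes "\<phi> \<in> test_functions S"
 shows "(\<lambda>x. frechet_derivative \<phi> (at x) h) \<in> test_functions S"
 unfolding test_function_derivative_expand[OF assms, of _ h]
 by (intro test_functions_sum test_functions_scale test_function_derivative[OF assms]) simp_all

lemma nn_integral_lborel_translate:
 assumes [measurable]: "f \<in> borel_measurable borel"
 shows "(\<integral>\<^sup>+x. f (x + h) \<partial>lborel) = (\<integral>\<^sup>+x. f x \<partial>(lborel :: 'a::euclidean_space measure))"
proof -
 have "(\<integral>\<^sup>+x. f x \<partial>lborel) = (\<integral>\<^sup>+x. f x \<partial>distr lborel borel ((+) h))" by (simp add: lborel_distr_plus)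
 also have "... = (\<integral>\<^sup>+x. f (h + x) \<partial>lborel)" by (rule nn_integral_distr) measurable
 finally show ?thesis by (simp add: add.commute)
qed

lemma integral_lborel_translate:
 fixes f :: "'a::euclidean_space => real"
 assumes [measurable]: "f \<in> borel_measurable borel"
 shows "(LINT x|lborel. f (x + h)) = (LINT x|lborel. f x)"
proof -
 have "(LINT x|lborel. f x) = (LINT x|distr lborel borel ((+) h). f x)" by (simp add: lborel_distr_plus)
 also have "... = (LINT x|lborel. f (h + x))" by (rule integral_distr) measurable
 finally show ?thesis by (simp add: add.commute)
qed

text \<open>The bound on \<open>u\<close> tested against derivatives is all that is used of a weak gradient
 with norm at most \<open>\<kappa>\<close>.\<close>

locale weakly_differentiable =
 fixes D :: "'a::euclidean_space set" and u :: "'a => real" and \<kappa> :: real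
 assumes open_D: "open D"
  and u_borel [measurable]: "u \<in> borel_measurable borel"
  and u_integrable: "integrable lborel u"
  and u_L2: "mem_L2 lborel u"
  and \<kappa>_pos: "\<kappa> > 0"
  and bound: "!!\<phi> h. \<phi> \<in> test_functions D ==>
   \<bar>LINT x|lborel. u x * frechet_derivative \<phi> (at x) h\<bar> <= norm h * \<kappa> * L2norm lborel \<phi>"
begin

lemma integrable_mult_test_function:
 assumes \<phi>: "\<phi> \<in> test_functions S"
 shows "integrable lborel (\<lambda>x. u x * \<phi> x)"
proof -
 obtain B where B: "!!x. \<bar>\<phi> x\<bar> <= B" using test_function_bounded[OF \<phi>] by blast
 have m: "(\<lambda>x. u x * \<phi> x) \<in> borel_measurable lborel"
  using test_function_measurable[OF \<phi>] by simp
 show ?thesis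
 proof (rule Bochner_Integration.integrable_bound[OF _ m])
  show "integrable lborel (\<lambda>x. \<bar>u x\<bar> * B)" using u_integrable by simp
  show "AE x in lborel. norm (u x * \<phi> x) <= norm (\<bar>u x\<bar> * B)"
  proof (rule AE_I2)
   fix x
   have "B \<ge> 0" using B[of x] by linarith
   then show "norm (u x * \<phi> x) <= norm (\<bar>u x\<bar> * B)"
    using B[of x] by (simp add: abs_mult mult_left_mono)
  qed
 qed
qed

text \<open>The increment of \<open>u\<close> is moved onto the test function, where the fundamental
  theorem of calculus along the segment from \<open>x\<close> to \<open>x - h\<close> applies. The
  condition \<open>sub\<close> keeps all intermediate translates of \<phi> supported in
  \<open>D\<close>, so the weak bound holds for each of them and is integrated over the
  segment.\<close>

lemma translation_test:
 assumes \<phi>: "\<phi> \<in> test_functions P"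
  and sub: "!!x s. x \<in> P ==> 0 <= s ==> s <= 1 ==> x + s *\<^sub>R h \<in> D"
 shows "\<bar>LINT x|lborel. (u (x + h) - u x) * \<phi> x\<bar> <= norm h * \<kappa> * L2norm lborel \<phi>"
proof -
 define d where "d x = frechet_derivative \<phi> (at x) h" for x
 have dt: "d \<in> test_functions P" unfolding d_def[abs_def] by (rule test_function_directional_derivative[OF \<phi>])
 have [measurable]: "d \<in> borel_measurable borel" "\<phi> \<in> borel_measurable borel"
  using test_function_measurable dt \<phi> by blast+
 obtain B where B: "!!x. \<bar>d x\<bar> <= B" using test_function_bounded[OF dt] by blast
 have B0: "B \<ge> 0" using B[of 0] by linarith
 define F where "F x s = u x * (- d (x - s *\<^sub>R h)) * indicator {0..1::real} s" for x s
 have Fm [measurable]: "case_prod F \<in> borel_measurable (lborel \<Otimes>\<^sub>M lborel)"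
  unfolding F_def[abs_def] by measurable
 have ftc: "(LINT s|lborel. F x s) = u x * (\<phi> (x - h) - \<phi> x)" for x
 proof -
  have "(LINT s|lborel. (- d (x - s *\<^sub>R h)) * indicator {0..1} s) = \<phi> (x - 1 *\<^sub>R h) - \<phi> (x - 0 *\<^sub>R h)"
  proof (rule integral_FTC_Icc_real)
   fix s :: real
   have 1: "((\<lambda>s. x - s *\<^sub>R h) has_derivative (\<lambda>t. - (t *\<^sub>R h))) (at s)" by (auto intro!: derivative_eq_intros)
   have 2: "(\<phi> has_derivative frechet_derivative \<phi> (at (x - s *\<^sub>R h))) (at (x - s *\<^sub>R h))"
    using test_function_differentiable[OF \<phi>] by (simp add: frechet_derivative_works[symmetric])
   interpret linear "frechet_derivative \<phi> (at (x - s *\<^sub>R h))" by (rule linear_frechet_derivative_test_function[OF \<phi>])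
   have eq: "frechet_derivative \<phi> (at (x - s *\<^sub>R h)) (- (t *\<^sub>R h)) = (- d (x - s *\<^sub>R h)) * t" for t
    by (simp add: neg scaleR d_def)
   show "((\<lambda>s. \<phi> (x - s *\<^sub>R h)) has_real_derivative (- d (x - s *\<^sub>R h))) (at s)"
    using has_derivative_compose[OF 1 2] unfolding has_field_derivative_def eq .
   have "continuous_on UNIV (\<lambda>s. d (x - s *\<^sub>R h))"
    by (rule continuous_on_compose2[OF test_function_continuous[OF dt]]) (intro continuous_intros, simp)
   then have "isCont (\<lambda>s. d (x - s *\<^sub>R h)) s" by (simp add: continuous_on_eq_continuous_at)
   then show "isCont (\<lambda>s. - d (x - s *\<^sub>R h)) s" by (rule isCont_minus)
  qed simp
  moreover have "(LINT s|lborel. F x s) = u x * (LINT s|lborel. (- d (x - s *\<^sub>R h)) * indicator {0..1} s)"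
   by (simp only: F_def mult.assoc integral_mult_right_zero)
  ultimately show ?thesis by simp
 qed
 have Fint: "integrable (lborel \<Otimes>\<^sub>M lborel) (case_prod F)"
 proof (rule lborel_pair.Fubini_integrable)
  have le: "norm (F x s) <= (\<bar>u x\<bar> * B) * indicator {0..1} s" for x s
   unfolding F_def using B[of "x - s *\<^sub>R h"] by (auto simp: abs_mult mult_left_mono split: split_indicator)
  have i1: "integrable lborel (\<lambda>s. (\<bar>u x\<bar> * B) * indicator {0..1::real} s)" for x
   by (intro integrable_mult_right) simp
  show "AE x in lborel. integrable lborel (\<lambda>s. case (x, s) of (x, s) => F x s)"
  proof (rule AE_I2)
   fix x
   show "integrable lborel (\<lambda>s. case (x, s) of (x, s) => F x s)"
    by (rule Bochner_Integration.integrable_bound[OF i1[of x]])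
     (use le[of x] in \<open>auto intro: order_trans[OF _ abs_ge_self] simp: F_def\<close>)
  qed
  show "integrable lborel (\<lambda>x. LINT s|lborel. norm (case (x, s) of (x, s) => F x s))"
  proof (rule Bochner_Integration.integrable_bound[where f = "\<lambda>x. \<bar>u x\<bar> * B"])
   show "integrable lborel (\<lambda>x. \<bar>u x\<bar> * B)" using u_integrable by simp
   show "(\<lambda>x. LINT s|lborel. norm (case (x, s) of (x, s) => F x s)) \<in> borel_measurable lborel" by measurable
   show "AE x in lborel. norm (LINT s|lborel. norm (case (x, s) of (x, s) => F x s)) <= norm (\<bar>u x\<bar> * B)"
   proof (rule AE_I2)
    fix x
    have "(LINT s|lborel. norm (F x s)) <= (LINT s|lborel. (\<bar>u x\<bar> * B) * indicator {0..1::real} s)"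
     by (rule integral_mono_AE') (use i1 le B0 in auto)
    also have "... = \<bar>u x\<bar> * B" by simp
    finally show "norm (LINT s|lborel. norm (case (x, s) of (x, s) => F x s)) <= norm (\<bar>u x\<bar> * B)"
     using B0 by simp
   qed
  qed
 qed measurable
 have tr: "(\<lambda>x. \<phi> (x - s *\<^sub>R h)) \<in> test_functions D" if "0 <= s" "s <= 1" for s
  using test_functions_translate[OF \<phi>, of "s *\<^sub>R h" D] sub that by blast
 have fd: "frechet_derivative (\<lambda>x. \<phi> (x - k)) (at x) = frechet_derivative \<phi> (at (x - k))" for x k
  using frechet_derivative_translate[OF test_function_differentiable[OF \<phi>]] by (rule frechet_derivative_at[symmetric])
 have norm_tr: "L2norm lborel (\<lambda>x. \<phi> (x - k)) = L2norm lborel \<phi>" for k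
  using integral_lborel_translate[of "\<lambda>x. (norm (\<phi> x))\<^sup>2" "- k"] by (simp add: L2norm_def)
 have inner: "\<bar>LINT x|lborel. F x s\<bar> <= (norm h * \<kappa> * L2norm lborel \<phi>) * indicator {0..1} s" for s
 proof (cases "s \<in> {0..1}")
  case True
  have "(LINT x|lborel. F x s) = - (LINT x|lborel. u x * frechet_derivative (\<lambda>x. \<phi> (x - s *\<^sub>R h)) (at x) h)"
   using True unfolding F_def fd d_def by simp
  then show ?thesis using bound[OF tr, of s h] True norm_tr by simp
 next
  case False
  then show ?thesis by (simp add: F_def)
 qed
 have "(LINT x|lborel. (u (x + h) - u x) * \<phi> x) = (LINT x|lborel. u (x + h) * \<phi> x) - (LINT x|lborel. u x * \<phi> x)"
 proof -
  have "(\<lambda>x. u x * \<phi> (x - h)) \<in> borel_measurable borel" by measurable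
  moreover have "integrable lborel (\<lambda>x. u x * \<phi> (x - h))"
   by (rule integrable_mult_test_function[where S = UNIV]) (rule test_functions_translate[OF \<phi>], simp)
  ultimately have "integrable lborel (\<lambda>x. u (x + h) * \<phi> x)"
   using integrable_distr_eq[of "(+) h" lborel borel "\<lambda>x. u x * \<phi> (x - h)"]
   by (simp add: lborel_distr_plus add.commute)
  then show ?thesis using integrable_mult_test_function[OF \<phi>] by (simp add: left_diff_distrib)
 qed
 also have "(LINT x|lborel. u (x + h) * \<phi> x) = (LINT x|lborel. u x * \<phi> (x - h))"
  using integral_lborel_translate[of "\<lambda>x. u x * \<phi> (x - h)" h] by simp
 also have "(LINT x|lborel. u x * \<phi> (x - h)) - (LINT x|lborel. u x * \<phi> x) = (LINT x|lborel. u x * (\<phi> (x - h) - \<phi> x))"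
 proof -
  have "integrable lborel (\<lambda>x. u x * \<phi> (x - h))"
   by (rule integrable_mult_test_function[where S = UNIV]) (rule test_functions_translate[OF \<phi>], simp)
  then show ?thesis using integrable_mult_test_function[OF \<phi>] by (simp add: right_diff_distrib)
 qed
 also have "... = (LINT x|lborel. LINT s|lborel. F x s)" by (simp add: ftc)
 also have "... = (LINT s|lborel. LINT x|lborel. F x s)" by (rule lborel_pair.Fubini_integral[OF Fint, symmetric])
 finally have eq: "(LINT x|lborel. (u (x + h) - u x) * \<phi> x) = (LINT s|lborel. LINT x|lborel. F x s)" .
 have "\<bar>LINT s|lborel. LINT x|lborel. F x s\<bar> <= (LINT s|lborel. \<bar>LINT x|lborel. F x s\<bar>)"
  by (rule integral_abs_bound)
 also have "... <= (LINT s|lborel. (norm h * \<kappa> * L2norm lborel \<phi>) * indicator {0..1::real} s)"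
  using \<kappa>_pos L2norm_nonneg[of lborel \<phi>]
  by (intro integral_mono_AE' AE_I2 inner integrable_mult_right) auto
 also have "... = norm h * \<kappa> * L2norm lborel \<phi>" by simp
 finally show ?thesis unfolding eq .
qed

text \<open>The norm over \<open>P\<close> is recovered by duality: test functions of
  \<open>P\<close> are dense among the functions that vanish outside \<open>P\<close>, so the
  increment may be tested against approximations of itself.\<close>

lemma translation_estimate:
 assumes P: "open P" "bounded P"
  and sub: "!!x s. x \<in> P ==> 0 <= s ==> s <= 1 ==> x + s *\<^sub>R h \<in> D"
 shows "(\<integral>\<^sup>+x. ennreal ((u (x + h) - u x)\<^sup>2) * indicator P x \<partial>lborel) <= ennreal ((norm h * \<kappa>)\<^sup>2)"
proof -
 have [measurable]: "P \<in> sets borel" using P by simp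
 define w where "w x = indicator P x * (u (x + h) - u x)" for x
 have [measurable]: "w \<in> borel_measurable borel" unfolding w_def by measurable
 have uh: "mem_L2 lborel (\<lambda>x. u (x + h))"
 proof -
  have "integrable lborel (\<lambda>x. (norm (u (x + h)))\<^sup>2)"
   using integrable_distr_eq[of "(+) h" lborel borel "\<lambda>x. (norm (u x))\<^sup>2"] u_L2
   by (simp add: lborel_distr_plus add.commute mem_L2_def)
  then show ?thesis by (simp add: mem_L2_def)
 qed
 have wb: "mem_L2 lborel w"
  by (rule mem_L2_bound[OF _ mem_L2_integrable[OF mem_L2_diff[OF uh u_L2]]]) (auto simp: w_def split: split_indicator)
 have wl: "mem_L2 lebesgue w" and wn: "L2norm lebesgue w = L2norm lborel w"
  using wb by (simp_all add: mem_L2_def L2norm_def integrable_completion integral_completion measurable_completion)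
 define W where "W = l2_of w"
 have Wf: "AE x in lebesgue. l2_fun W x = w x" unfolding W_def by (rule l2_fun_of[OF wl])
 have "W \<in> closure (l2_of ` test_functions P)"
  by (rule test_functions_dense[OF P]) (use Wf in eventually_elim, simp add: w_def)
 then obtain v where v: "!!n. v n \<in> l2_of ` test_functions P" "v \<longlonglongrightarrow> W" unfolding closure_sequential by blast
 have le: "W \<bullet> v n <= norm h * \<kappa> * norm (v n)" for n
 proof -
  obtain \<phi> where \<phi>: "\<phi> \<in> test_functions P" "v n = l2_of \<phi>" using v(1) by blast
  note \<phi>m = test_function_mem_L2[OF \<phi>(1)]
  have [measurable]: "\<phi> \<in> borel_measurable borel" using test_function_measurable[OF \<phi>(1)] .
  have "W \<bullet> v n = (LINT x|lebesgue. w x * \<phi> x)" unfolding W_def \<phi>(2) using inner_l2_of[OF wl \<phi>m] by simp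
  also have "... = (LINT x|lborel. w x * \<phi> x)" by (rule integral_completion) measurable
  also have "... = (LINT x|lborel. (u (x + h) - u x) * \<phi> x)"
   using test_function_zero_outside[OF \<phi>(1)]
   by (intro Bochner_Integration.integral_cong) (auto simp: w_def split: split_indicator)
  also have "... <= norm h * \<kappa> * L2norm lborel \<phi>" using translation_test[OF \<phi>(1) sub] by linarith
  also have "L2norm lborel \<phi> = norm (v n)" unfolding \<phi>(2) norm_l2_of[OF \<phi>m]
   by (simp add: L2norm_def integral_completion)
  finally show ?thesis .
 qed
 have "W \<bullet> W <= norm h * \<kappa> * norm W"
  by (rule tendsto_le[OF sequentially_bot tendsto_mult[OF tendsto_const tendsto_norm[OF v(2)]] tendsto_inner[OF tendsto_const v(2)]])
   (simp add: le)
 then have "norm W * norm W <= (norm h * \<kappa>) * norm W" by (simp add: power2_norm_eq_inner[symmetric] power2_eq_square)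
 then have "norm W <= norm h * \<kappa>" using \<kappa>_pos by (cases "norm W = 0") auto
 then have "(L2norm lborel w)\<^sup>2 <= (norm h * \<kappa>)\<^sup>2"
  unfolding W_def norm_l2_of[OF wl] wn by (intro power_mono L2norm_nonneg)
 moreover have "(\<integral>\<^sup>+x. ennreal ((u (x + h) - u x)\<^sup>2) * indicator P x \<partial>lborel) = ennreal ((L2norm lborel w)\<^sup>2)"
  unfolding nn_integral_L2norm[OF wb, symmetric]
  by (intro nn_integral_cong) (auto simp: w_def split: split_indicator)
 ultimately show ?thesis by (simp add: ennreal_leI)
qed

end

text \<open>\<open>K\<close> is uniform in \<open>u\<close> and \<kappa>, while \<open>a\<close> may
  be any real number that depends on them. Nonnegative integrals spare integrability questions when
  such sets are shifted and joined.\<close>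

definition poincare_set :: "'a::euclidean_space set => 'a set => bool" where
 "poincare_set D P \<longleftrightarrow> (\<exists>K\<ge>0. \<forall>u \<kappa>. weakly_differentiable D u \<kappa> -->
  (\<exists>a. (\<integral>\<^sup>+x. ennreal ((u x - a)\<^sup>2) * indicator P x \<partial>lborel) <= ennreal (K * \<kappa>\<^sup>2)))"

text \<open>Integrate (u x - u y)^2 over all pairs of points of the ball and substitute y = x + h.
  By convexity the segments stay in the ball, so the translation estimate controls each shift;
  averaging then finds one point \<open>y\<close> for which \<open>u y\<close> serves as the
  constant.\<close>

lemma poincare_set_ball:
 fixes p :: "'a::euclidean_space"
 assumes \<delta>: "\<delta> > 0" and sub: "ball p \<delta> \<subseteq> D"
 shows "poincare_set D (ball p \<delta>)"
proof -
 let ?B = "ball p \<delta>"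
 define b where "b = measure lborel ?B"
 define b2 where "b2 = measure lborel (ball (0::'a) (2 * \<delta>))"
 have eb: "emeasure lborel ?B = ennreal b" and eb2: "emeasure lborel (ball (0::'a) (2 * \<delta>)) = ennreal b2"
  unfolding b_def b2_def using emeasure_lborel_ball_finite[of p \<delta>] emeasure_lborel_ball_finite[of "0::'a" "2 * \<delta>"]
  by (simp_all add: emeasure_eq_ennreal_measure)
 have bpos: "b > 0" "b2 > 0" unfolding b_def b2_def using \<delta> by (simp_all add: content_ball_pos)
 have [measurable]: "?B \<in> sets borel" "ball (0::'a) (2 * \<delta>) \<in> sets borel" by simp_all
 \<comment> \<open>Each shift contributes at most (2 \<delta> \<kappa>)^2, the shifts fill a volume
   \<open>b2\<close>, and the average is taken over the volume \<open>b\<close>. The factor 2 makes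
   the contradiction below strict.\<close>
 define K where "K = 2 * (2 * \<delta>)\<^sup>2 * b2 / b"
 show ?thesis unfolding poincare_set_def
 proof (rule exI[of _ K], intro conjI allI impI)
  show "0 <= K" using bpos by (simp add: K_def)
  fix u \<kappa> assume "weakly_differentiable D u \<kappa>"
  then interpret weakly_differentiable D u \<kappa> .
  define f where "f y = (\<integral>\<^sup>+x. ennreal ((u x - u y)\<^sup>2) * indicator ?B x \<partial>lborel)" for y
  have "(\<integral>\<^sup>+y. f y * indicator ?B y \<partial>lborel)
    = (\<integral>\<^sup>+y. (\<integral>\<^sup>+x. ennreal ((u x - u y)\<^sup>2) * indicator ?B x * indicator ?B y \<partial>lborel) \<partial>lborel)"
   unfolding f_def by (intro nn_integral_cong nn_integral_multc[symmetric]) measurable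
  also have "... = (\<integral>\<^sup>+x. (\<integral>\<^sup>+y. ennreal ((u x - u y)\<^sup>2) * indicator ?B x * indicator ?B y \<partial>lborel) \<partial>lborel)"
   by (rule lborel_pair.Fubini') measurable
  also have "... = (\<integral>\<^sup>+x. (\<integral>\<^sup>+h. ennreal ((u x - u (h + x))\<^sup>2) * indicator ?B x * indicator ?B (h + x) \<partial>lborel) \<partial>lborel)"
   by (intro nn_integral_cong nn_integral_lborel_translate[symmetric, where f = "\<lambda>y. ennreal ((u _ - u y)\<^sup>2) * indicator ?B _ * indicator ?B y"]) measurable
  also have "... = (\<integral>\<^sup>+h. (\<integral>\<^sup>+x. ennreal ((u x - u (h + x))\<^sup>2) * indicator ?B x * indicator ?B (h + x) \<partial>lborel) \<partial>lborel)"
   by (rule lborel_pair.Fubini'[symmetric]) measurable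
  also have "... <= (\<integral>\<^sup>+h. ennreal ((2 * \<delta> * \<kappa>)\<^sup>2) * indicator (ball (0::'a) (2 * \<delta>)) h \<partial>lborel)"
  proof (rule nn_integral_mono)
   fix h :: 'a
   show "(\<integral>\<^sup>+x. ennreal ((u x - u (h + x))\<^sup>2) * indicator ?B x * indicator ?B (h + x) \<partial>lborel) <= ennreal ((2 * \<delta> * \<kappa>)\<^sup>2) * indicator (ball (0::'a) (2 * \<delta>)) h"
   proof (cases "norm h < 2 * \<delta>")
    case True
    let ?P = "?B \<inter> (\<lambda>x. x + h) -` ?B"
    have "(\<integral>\<^sup>+x. ennreal ((u x - u (h + x))\<^sup>2) * indicator ?B x * indicator ?B (h + x) \<partial>lborel)
      = (\<integral>\<^sup>+x. ennreal ((u (x + h) - u x)\<^sup>2) * indicator ?P x \<partial>lborel)"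
     by (intro nn_integral_cong) (auto simp: add.commute power2_commute split: split_indicator)
    also have "... <= ennreal ((norm h * \<kappa>)\<^sup>2)"
    proof (rule translation_estimate)
     show "open ?P" by (intro open_Int open_vimage continuous_intros open_ball)
     show "bounded ?P" by (rule bounded_subset[OF bounded_ball]) blast
     fix x and s :: real assume x: "x \<in> ?P" and s: "0 <= s" "s <= 1"
     have "(1 - s) *\<^sub>R x + s *\<^sub>R (x + h) \<in> ?B"
      using x s convex_ball[of p \<delta>] by (intro convexD) auto
     moreover have "(1 - s) *\<^sub>R x + s *\<^sub>R (x + h) = x + s *\<^sub>R h" by (simp add: algebra_simps)
     ultimately show "x + s *\<^sub>R h \<in> D" using sub by auto
    qed
    also have "... <= ennreal ((2 * \<delta> * \<kappa>)\<^sup>2)"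
     using True \<kappa>_pos by (intro ennreal_leI power_mono mult_right_mono) auto
    finally show ?thesis using True by simp
   next
    case False
    have "indicator ?B x * (indicator ?B (h + x) :: ennreal) = 0" for x
    proof (rule ccontr)
     assume "indicator ?B x * (indicator ?B (h + x) :: ennreal) \<noteq> 0"
     then have "dist p x < \<delta>" "dist p (h + x) < \<delta>" by (auto split: split_indicator_asm)
     then have "dist x (h + x) < 2 * \<delta>" using dist_triangle[of x "h + x" p] by (simp add: dist_commute)
     then show False using False by (simp add: dist_norm)
    qed
    then have "(\<integral>\<^sup>+x. ennreal ((u x - u (h + x))\<^sup>2) * indicator ?B x * indicator ?B (h + x) \<partial>lborel) = (\<integral>\<^sup>+x. 0 \<partial>(lborel :: 'a measure))"
     by (intro nn_integral_cong) (simp only: mult.assoc mult_zero_right)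
    then show ?thesis by simp
   qed
  qed
  also have "... = ennreal ((2 * \<delta> * \<kappa>)\<^sup>2) * ennreal b2"
   by (simp add: nn_integral_cmult_indicator eb2)
  also have "... = ennreal ((2 * \<delta> * \<kappa>)\<^sup>2 * b2)" using bpos by (simp add: ennreal_mult)
  finally have le: "(\<integral>\<^sup>+y. f y * indicator ?B y \<partial>lborel) <= ennreal ((2 * \<delta> * \<kappa>)\<^sup>2 * b2)" .
  have "\<exists>y\<in>?B. f y <= ennreal (K * \<kappa>\<^sup>2)"
  proof (rule ccontr)
   assume "\<not> ?thesis"
   then have "ennreal (K * \<kappa>\<^sup>2) * indicator ?B y <= f y * indicator ?B y" for y
    by (auto simp: not_le less_imp_le split: split_indicator)
   then have "(\<integral>\<^sup>+y. ennreal (K * \<kappa>\<^sup>2) * indicator ?B y \<partial>lborel) <= (\<integral>\<^sup>+y. f y * indicator ?B y \<partial>lborel)"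
    by (intro nn_integral_mono)
   also have "(\<integral>\<^sup>+y. ennreal (K * \<kappa>\<^sup>2) * indicator ?B y \<partial>lborel) = ennreal (K * \<kappa>\<^sup>2 * b)"
   proof -
    have "0 <= K * \<kappa>\<^sup>2" "0 <= b" using bpos by (simp_all add: K_def)
    then have "ennreal (K * \<kappa>\<^sup>2 * b) = ennreal (K * \<kappa>\<^sup>2) * ennreal b" by (rule ennreal_mult)
    then show ?thesis by (simp only: nn_integral_cmult_indicator[OF _] eb nn_integral_cmult_indicator sets_lborel \<open>?B \<in> sets borel\<close>)
   qed
   finally have "ennreal (K * \<kappa>\<^sup>2 * b) <= ennreal ((2 * \<delta> * \<kappa>)\<^sup>2 * b2)" using le by (rule order_trans)
   moreover have "K * \<kappa>\<^sup>2 * b = 2 * ((2 * \<delta> * \<kappa>)\<^sup>2 * b2)" using bpos by (simp add: K_def power_mult_distrib)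
   moreover have "(2 * \<delta> * \<kappa>)\<^sup>2 * b2 > 0" using bpos \<delta> \<kappa>_pos by simp
   ultimately show False by (simp add: ennreal_le_iff mult.commute)
  qed
  then show "\<exists>a. (\<integral>\<^sup>+x. ennreal ((u x - a)\<^sup>2) * indicator ?B x \<partial>lborel) <= ennreal (K * \<kappa>\<^sup>2)"
   unfolding f_def by blast
 qed
qed

lemma ennreal_square_diff_le:
 "ennreal ((a - c)\<^sup>2) <= 2 * ennreal ((a - b)\<^sup>2) + 2 * ennreal ((b - c)\<^sup>2)" for a b c :: real
proof -
 have "(a - c)\<^sup>2 <= 2 * (a - b)\<^sup>2 + 2 * (b - c)\<^sup>2" using norm_add_square_le[of "a - b" "b - c"] by simp
 then have "ennreal ((a - c)\<^sup>2) <= ennreal (2 * (a - b)\<^sup>2 + 2 * (b - c)\<^sup>2)" by (rule ennreal_leI)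
 also have "... = 2 * ennreal ((a - b)\<^sup>2) + 2 * ennreal ((b - c)\<^sup>2)"
  by (simp add: ennreal_plus ennreal_mult flip: ennreal_numeral)
 finally show ?thesis .
qed

text \<open>Near a boundary point the domain can be shifted in the vertical direction into an interior ball.\<close>

lemma poincare_set_shift:
 assumes P: "open P" "bounded P" and Q: "poincare_set D Q" "open Q"
  and sub: "!!x s. x \<in> P ==> 0 <= s ==> s <= 1 ==> x + s *\<^sub>R h \<in> D"
  and PQ: "!!x. x \<in> P ==> x + h \<in> Q"
 shows "poincare_set D P"
proof -
 obtain K where K: "K \<ge> 0" "!!u \<kappa>. weakly_differentiable D u \<kappa> ==>
  \<exists>a. (\<integral>\<^sup>+x. ennreal ((u x - a)\<^sup>2) * indicator Q x \<partial>lborel) <= ennreal (K * \<kappa>\<^sup>2)"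
  using Q(1) unfolding poincare_set_def by blast
 have [measurable]: "P \<in> sets borel" "Q \<in> sets borel" using P Q by simp_all
 show ?thesis unfolding poincare_set_def
 proof (rule exI[of _ "2 * (norm h)\<^sup>2 + 2 * K"], intro conjI allI impI)
  show "0 <= 2 * (norm h)\<^sup>2 + 2 * K" using K by simp
  fix u \<kappa> assume u: "weakly_differentiable D u \<kappa>"
  then interpret weakly_differentiable D u \<kappa> .
  obtain a where a: "(\<integral>\<^sup>+x. ennreal ((u x - a)\<^sup>2) * indicator Q x \<partial>lborel) <= ennreal (K * \<kappa>\<^sup>2)"
   using K(2)[OF u] by blast
  have "(\<integral>\<^sup>+x. ennreal ((u x - a)\<^sup>2) * indicator P x \<partial>lborel)
   <= (\<integral>\<^sup>+x. 2 * (ennreal ((u (x + h) - u x)\<^sup>2) * indicator P x) + 2 * (ennreal ((u (x + h) - a)\<^sup>2) * indicator Q (x + h)) \<partial>lborel)"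
  proof (rule nn_integral_mono)
   fix x
   show "ennreal ((u x - a)\<^sup>2) * indicator P x <= 2 * (ennreal ((u (x + h) - u x)\<^sup>2) * indicator P x) + 2 * (ennreal ((u (x + h) - a)\<^sup>2) * indicator Q (x + h))"
    using ennreal_square_diff_le[of "u x" a "u (x + h)"] PQ[of x]
    by (auto simp: power2_commute[of "u x"] split: split_indicator)
  qed
  also have "... = 2 * (\<integral>\<^sup>+x. ennreal ((u (x + h) - u x)\<^sup>2) * indicator P x \<partial>lborel)
    + 2 * (\<integral>\<^sup>+x. ennreal ((u (x + h) - a)\<^sup>2) * indicator Q (x + h) \<partial>lborel)"
   by (subst nn_integral_add) (auto simp: nn_integral_cmult)
  also have "(\<integral>\<^sup>+x. ennreal ((u (x + h) - a)\<^sup>2) * indicator Q (x + h) \<partial>lborel) = (\<integral>\<^sup>+x. ennreal ((u x - a)\<^sup>2) * indicator Q x \<partial>lborel)"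
   by (rule nn_integral_lborel_translate[where f = "\<lambda>x. ennreal ((u x - a)\<^sup>2) * indicator Q x"]) measurable
  also have "2 * (\<integral>\<^sup>+x. ennreal ((u (x + h) - u x)\<^sup>2) * indicator P x \<partial>lborel) + 2 * (\<integral>\<^sup>+x. ennreal ((u x - a)\<^sup>2) * indicator Q x \<partial>lborel)
   <= 2 * ennreal ((norm h * \<kappa>)\<^sup>2) + 2 * ennreal (K * \<kappa>\<^sup>2)"
   using translation_estimate[OF P sub] a by (intro add_mono mult_left_mono) auto
  also have "... = ennreal ((2 * (norm h)\<^sup>2 + 2 * K) * \<kappa>\<^sup>2)"
  proof -
   have "2 * ennreal ((norm h * \<kappa>)\<^sup>2) + 2 * ennreal (K * \<kappa>\<^sup>2) = ennreal (2 * (norm h * \<kappa>)\<^sup>2 + 2 * (K * \<kappa>\<^sup>2))"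
    using K by (simp add: ennreal_plus ennreal_mult flip: ennreal_numeral)
   then show ?thesis by (simp add: power_mult_distrib algebra_simps)
  qed
  finally show "\<exists>a. (\<integral>\<^sup>+x. ennreal ((u x - a)\<^sup>2) * indicator P x \<partial>lborel) <= ennreal ((2 * (norm h)\<^sup>2 + 2 * K) * \<kappa>\<^sup>2)"
   by blast
 qed
qed

text \<open>The overlap is open and nonempty, so it has positive measure; comparing the two
  approximations there controls the difference of their constants.\<close>

lemma poincare_set_Un:
 assumes P: "open P" "bounded P" "poincare_set D P" and Q: "open Q" "bounded Q" "poincare_set D Q"
  and ne: "P \<inter> Q \<noteq> {}"
 shows "poincare_set D (P \<union> Q)"
proof -
 obtain K1 where K1: "K1 \<ge> 0" "!!u \<kappa>. weakly_differentiable D u \<kappa> ==>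
  \<exists>a. (\<integral>\<^sup>+x. ennreal ((u x - a)\<^sup>2) * indicator P x \<partial>lborel) <= ennreal (K1 * \<kappa>\<^sup>2)"
  using P(3) unfolding poincare_set_def by blast
 obtain K2 where K2: "K2 \<ge> 0" "!!u \<kappa>. weakly_differentiable D u \<kappa> ==>
  \<exists>a. (\<integral>\<^sup>+x. ennreal ((u x - a)\<^sup>2) * indicator Q x \<partial>lborel) <= ennreal (K2 * \<kappa>\<^sup>2)"
  using Q(3) unfolding poincare_set_def by blast
 have [measurable]: "P \<in> sets borel" "Q \<in> sets borel" using P Q by simp_all
 have fin: "emeasure lborel (P \<inter> Q) < \<infinity>" "emeasure lborel Q < \<infinity>"
  using P(2) Q(2) by (intro emeasure_bounded_finite; simp add: bounded_Int)+
 define m where "m = measure lborel (P \<inter> Q)"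
 define q where "q = measure lborel Q"
 have em: "emeasure lborel (P \<inter> Q) = ennreal m" and eq: "emeasure lborel Q = ennreal q"
  unfolding m_def q_def using fin by (auto intro!: emeasure_eq_ennreal_measure)
 have "emeasure lborel (P \<inter> Q) \<noteq> 0"
 proof
  assume "emeasure lborel (P \<inter> Q) = 0"
  then have "negligible (P \<inter> Q)" by (simp add: negligible_iff_emeasure0)
  then show False using open_not_negligible[of "P \<inter> Q"] P Q ne by blast
 qed
 then have m: "m > 0" using em m_def by (metis ennreal_0 measure_nonneg order_less_le)
 \<comment> \<open>Obtained by integrating (a - b)^2 <= 2 (u - a)^2 + 2 (u - b)^2 over the overlap,
   whose measure is \<open>m\<close>.\<close>
 define K3 where "K3 = 2 * (K1 + K2) / m"
 have K3: "K3 \<ge> 0" unfolding K3_def using K1 K2 m by simp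
 have q0: "q \<ge> 0" unfolding q_def by simp
 show ?thesis unfolding poincare_set_def
 proof (rule exI[of _ "K1 + (2 * K2 + 2 * (K3 * q))"], intro conjI allI impI)
  show "0 <= K1 + (2 * K2 + 2 * (K3 * q))" using K1 K2 K3 q0 by simp
  fix u \<kappa> assume u: "weakly_differentiable D u \<kappa>"
  then interpret weakly_differentiable D u \<kappa> .
  obtain a where a: "(\<integral>\<^sup>+x. ennreal ((u x - a)\<^sup>2) * indicator P x \<partial>lborel) <= ennreal (K1 * \<kappa>\<^sup>2)"
   using K1(2)[OF u] by blast
  obtain b where b: "(\<integral>\<^sup>+x. ennreal ((u x - b)\<^sup>2) * indicator Q x \<partial>lborel) <= ennreal (K2 * \<kappa>\<^sup>2)"
   using K2(2)[OF u] by blast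
  have "ennreal ((a - b)\<^sup>2) * ennreal m = (\<integral>\<^sup>+x. ennreal ((a - b)\<^sup>2) * indicator (P \<inter> Q) x \<partial>lborel)"
   by (simp add: nn_integral_cmult_indicator em)
  also have "... <= (\<integral>\<^sup>+x. 2 * (ennreal ((u x - a)\<^sup>2) * indicator P x) + 2 * (ennreal ((u x - b)\<^sup>2) * indicator Q x) \<partial>lborel)"
  proof (rule nn_integral_mono)
   fix x
   show "ennreal ((a - b)\<^sup>2) * indicator (P \<inter> Q) x <= 2 * (ennreal ((u x - a)\<^sup>2) * indicator P x) + 2 * (ennreal ((u x - b)\<^sup>2) * indicator Q x)"
    using ennreal_square_diff_le[of a b "u x"] by (auto simp: power2_commute[of a "u x"] split: split_indicator)
  qed
  also have "... = 2 * (\<integral>\<^sup>+x. ennreal ((u x - a)\<^sup>2) * indicator P x \<partial>lborel) + 2 * (\<integral>\<^sup>+x. ennreal ((u x - b)\<^sup>2) * indicator Q x \<partial>lborel)"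
   by (subst nn_integral_add) (auto simp: nn_integral_cmult)
  also have "... <= 2 * ennreal (K1 * \<kappa>\<^sup>2) + 2 * ennreal (K2 * \<kappa>\<^sup>2)" using a b by (intro add_mono mult_left_mono) auto
  also have "... = ennreal (2 * (K1 + K2) * \<kappa>\<^sup>2)"
   using K1 K2 by (simp add: ennreal_plus ennreal_mult algebra_simps flip: ennreal_numeral)
  finally have "ennreal ((a - b)\<^sup>2 * m) <= ennreal (2 * (K1 + K2) * \<kappa>\<^sup>2)" using m by (simp add: ennreal_mult)
  then have "(a - b)\<^sup>2 * m <= 2 * (K1 + K2) * \<kappa>\<^sup>2" using K1 K2 by (subst (asm) ennreal_le_iff) auto
  then have ab: "(a - b)\<^sup>2 <= K3 * \<kappa>\<^sup>2" using m by (simp add: K3_def field_simps)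
  have "(\<integral>\<^sup>+x. ennreal ((u x - a)\<^sup>2) * indicator (P \<union> Q) x \<partial>lborel)
    <= (\<integral>\<^sup>+x. ennreal ((u x - a)\<^sup>2) * indicator P x + (2 * (ennreal ((u x - b)\<^sup>2) * indicator Q x) + 2 * (ennreal ((a - b)\<^sup>2) * indicator Q x)) \<partial>lborel)"
  proof (rule nn_integral_mono)
   fix x
   show "ennreal ((u x - a)\<^sup>2) * indicator (P \<union> Q) x <= ennreal ((u x - a)\<^sup>2) * indicator P x + (2 * (ennreal ((u x - b)\<^sup>2) * indicator Q x) + 2 * (ennreal ((a - b)\<^sup>2) * indicator Q x))"
    using ennreal_square_diff_le[of "u x" a b] by (auto simp: power2_commute[of a b] split: split_indicator)
  qed
  also have "... = (\<integral>\<^sup>+x. ennreal ((u x - a)\<^sup>2) * indicator P x \<partial>lborel) +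
   (2 * (\<integral>\<^sup>+x. ennreal ((u x - b)\<^sup>2) * indicator Q x \<partial>lborel) + 2 * (ennreal ((a - b)\<^sup>2) * emeasure lborel Q))"
   by (subst nn_integral_add, measurable, subst nn_integral_add, measurable) (simp add: nn_integral_cmult nn_integral_cmult_indicator)
  also have "... <= ennreal (K1 * \<kappa>\<^sup>2) + (2 * ennreal (K2 * \<kappa>\<^sup>2) + 2 * (ennreal (K3 * \<kappa>\<^sup>2) * ennreal q))"
   unfolding eq using a b ab by (intro add_mono mult_left_mono mult_right_mono ennreal_leI) auto
  also have "... = ennreal ((K1 + (2 * K2 + 2 * (K3 * q))) * \<kappa>\<^sup>2)"
   using K1 K2 K3 q0 by (simp add: ennreal_plus ennreal_mult algebra_simps flip: ennreal_numeral)
  finally show "\<exists>a. (\<integral>\<^sup>+x. ennreal ((u x - a)\<^sup>2) * indicator (P \<union> Q) x \<partial>lborel) <= ennreal ((K1 + (2 * K2 + 2 * (K3 * q))) * \<kappa>\<^sup>2)"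
   by blast
 qed
qed

text \<open>Take a subfamily of maximal size whose union is a Poincare set. A further piece that
  meets the union could be joined to it, so the union and the remaining pieces separate
  \<open>D\<close>, and connectedness leaves only the union.\<close>

lemma poincare_set_connected:
 assumes D: "connected D" "D \<noteq> {}" and F: "finite F" "\<Union>F = D"
  and P: "!!P. P \<in> F ==> open P \<and> bounded P \<and> P \<noteq> {} \<and> poincare_set D P"
 shows "poincare_set D D"
proof -
 define G where "G = {I. I \<subseteq> F \<and> I \<noteq> {} \<and> poincare_set D (\<Union>I)}"
 have "finite G" unfolding G_def using F(1) by (auto intro: finite_subset[of _ "Pow F"])
 obtain P0 where P0: "P0 \<in> F" using D(2) F(2) by auto
 have "{P0} \<in> G" unfolding G_def using P0 P by auto
 then obtain I where I: "I \<in> G" "!!J. J \<in> G ==> card J <= card I"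
 proof -
  have "Max (card ` G) \<in> card ` G" using \<open>finite G\<close> \<open>{P0} \<in> G\<close> by (intro Max_in) auto
  then obtain I where "I \<in> G" "card I = Max (card ` G)" by force
  then show thesis using that[of I] \<open>finite G\<close> by simp
 qed
 have IF: "I \<subseteq> F" "I \<noteq> {}" "poincare_set D (\<Union>I)" using I(1) unfolding G_def by auto
 have finI: "finite I" using IF(1) F(1) by (rule finite_subset)
 have opI: "open (\<Union>I)" using IF(1) P by (intro open_Union) blast
 have bdI: "bounded (\<Union>I)" using IF(1) P finI by (intro bounded_Union) blast+
 have disj: "\<Union>I \<inter> Q = {}" if Q: "Q \<in> F" "Q \<notin> I" for Q
 proof (rule ccontr)
  assume "\<Union>I \<inter> Q \<noteq> {}"
  then have "poincare_set D (\<Union>I \<union> Q)" using P[OF Q(1)] opI bdI IF(3) by (intro poincare_set_Un) auto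
  moreover have "\<Union>I \<union> Q = \<Union>(insert Q I)" by auto
  ultimately have "insert Q I \<in> G" unfolding G_def using IF Q by auto
  then have "card (insert Q I) <= card I" by (rule I(2))
  then show False using Q(2) finI by simp
 qed
 have op2: "open (\<Union>(F - I))" using P by (intro open_Union) blast
 have int: "\<Union>I \<inter> \<Union>(F - I) = {}" using disj by blast
 have un: "D \<subseteq> \<Union>I \<union> \<Union>(F - I)" using F(2) IF(1) by blast
 have "\<Union>I \<inter> D \<noteq> {}" using IF(1,2) P F(2) by fastforce
 then have "\<Union>(F - I) \<inter> D = {}" using connectedD[OF D(1) opI op2] int un by blast
 then have "\<Union>I = D" using un IF(1) F(2) by blast
 then show ?thesis using IF(3) by simp
qed

lemma poincare_set_lipschitz_domain:
 fixes D :: "(real^'n) set"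
 assumes D: "bounded D" "lipschitz_domain D"
 shows "poincare_set D D"
proof -
 have D': "open D" "connected D" "D \<noteq> {}" using D(2) unfolding lipschitz_domain_def by blast+
 have loc: "\<exists>\<delta>>0. poincare_set D (D \<inter> ball p \<delta>)" if p: "p \<in> closure D" for p
 proof (cases "p \<in> D")
  case True
  then obtain \<delta> where \<delta>: "\<delta> > 0" "ball p \<delta> \<subseteq> D" using D'(1) open_contains_ball by blast
  then have "D \<inter> ball p \<delta> = ball p \<delta>" by blast
  then show ?thesis using poincare_set_ball[OF \<delta>] \<delta>(1) by metis
 next
  case False
  then have "p \<in> frontier D" using p D'(1) by (simp add: frontier_def interior_open)
  then obtain r e \<gamma> L where r: "r > 0" and e: "norm e = 1"
   and \<gamma>: "L-lipschitz_on {z. z \<bullet> e = 0} \<gamma>"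
   and chart: "D \<inter> ball p r = {x \<in> ball p r. x \<bullet> e > \<gamma> (x - (x \<bullet> e) *\<^sub>R e)}"
   using D(2) unfolding lipschitz_domain_def by blast
  have L0: "L \<ge> 0" using \<gamma> by (rule lipschitz_on_nonneg)
  have ee: "e \<bullet> e = 1" using e by (simp add: norm_eq_1)
  define pr where "pr x = x - (x \<bullet> e) *\<^sub>R e" for x
  have pr_perp: "pr x \<in> {z. z \<bullet> e = 0}" for x by (simp add: pr_def inner_diff_left ee)
  have pr_diff: "pr x - pr z = pr (x - z)" for x z by (simp add: pr_def inner_diff_left scaleR_left_diff_distrib)
  have pr_norm: "norm (pr x) <= norm x" for x
  proof -
   have "(norm (pr x))\<^sup>2 = (norm x)\<^sup>2 - (x \<bullet> e)\<^sup>2"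
    unfolding power2_norm_eq_inner pr_def
    by (simp add: inner_diff_left inner_diff_right ee inner_commute power2_eq_square algebra_simps)
   then have "(norm (pr x))\<^sup>2 <= (norm x)\<^sup>2" by simp
   then show ?thesis by (rule power2_le_imp_le) simp
  qed
  have pr_e: "pr (x + t *\<^sub>R e) = pr x" for x t by (simp add: pr_def inner_add_left ee algebra_simps)
  have \<gamma>_lip: "\<bar>\<gamma> (pr x) - \<gamma> (pr z)\<bar> <= L * norm (x - z)" for x z
  proof -
   have "\<bar>\<gamma> (pr x) - \<gamma> (pr z)\<bar> <= L * dist (pr x) (pr z)"
    using lipschitz_onD[OF \<gamma> pr_perp[of x] pr_perp[of z]] by (simp add: dist_real_def)
   also have "... <= L * norm (x - z)"
    using L0 pr_norm[of "x - z"] by (intro mult_left_mono) (simp_all add: dist_norm pr_diff)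
   finally show ?thesis .
  qed
  have inD: "x \<in> D \<longleftrightarrow> x \<bullet> e > \<gamma> (pr x)" if "x \<in> ball p r" for x
   using chart that unfolding pr_def by blast
  \<comment> \<open>A boundary point is a limit of points of \<open>D\<close>, which lie above the
    graph. A gap \<open>g\<close> below the graph would persist within distance g / (1 + L), where 1
    accounts for the change of height and \<open>L\<close> for that of the graph.\<close>
  have pge: "p \<bullet> e \<ge> \<gamma> (pr p)"
  proof (rule ccontr)
   assume "\<not> p \<bullet> e \<ge> \<gamma> (pr p)"
   define g where "g = \<gamma> (pr p) - p \<bullet> e"
   have g: "g > 0" using \<open>\<not> p \<bullet> e \<ge> \<gamma> (pr p)\<close> by (simp add: g_def)
   define \<rho> where "\<rho> = min r (g / (1 + L))"
   have \<rho>: "\<rho> > 0" using r g L0 by (simp add: \<rho>_def)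
   obtain x where x: "x \<in> D" "dist x p < \<rho>" using p \<rho> unfolding closure_approachable by blast
   then have "x \<in> ball p r" by (simp add: \<rho>_def dist_commute)
   then have "x \<bullet> e > \<gamma> (pr x)" using inD x(1) by blast
   moreover have "\<gamma> (pr x) \<ge> \<gamma> (pr p) - L * norm (x - p)" using \<gamma>_lip[of x p] by linarith
   moreover have "x \<bullet> e - p \<bullet> e <= norm (x - p)"
    using norm_cauchy_schwarz[of "x - p" e] e by (simp add: inner_diff_left)
   ultimately have "g < (1 + L) * norm (x - p)" by (simp add: g_def algebra_simps)
   also have "... <= (1 + L) * (g / (1 + L))" using x(2) L0 by (intro mult_left_mono) (simp_all add: \<rho>_def dist_norm)
   also have "... = g" using L0 by simp
   finally show False by simp
  qed
  \<comment> \<open>Within distance \<delta> the height relative to the graph changes by at most (1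
    + L) \<delta> = r/4, less than the upward shift h = r/2; and \<delta> + h < r keeps everything
    inside the chart.\<close>
  define \<delta> where "\<delta> = r / (4 * (1 + L))"
  define h where "h = r / 2"
  have \<delta>0: "\<delta> > 0" using r L0 by (simp add: \<delta>_def)
  have \<delta>L: "\<delta> * (1 + L) = r / 4" using L0 by (simp add: \<delta>_def field_simps)
  have \<delta>r: "\<delta> <= r / 4" using \<delta>L mult_nonneg_nonneg[OF less_imp_le[OF \<delta>0] L0] by (simp add: algebra_simps)
  have Qsub: "ball (p + h *\<^sub>R e) \<delta> \<subseteq> D"
  proof
   fix x assume "x \<in> ball (p + h *\<^sub>R e) \<delta>"
   then have x: "norm (x - (p + h *\<^sub>R e)) < \<delta>" by (simp add: dist_norm norm_minus_commute)
   have "norm (x - p) <= norm (x - (p + h *\<^sub>R e)) + norm (h *\<^sub>R e)"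
    using norm_triangle_ineq[of "x - (p + h *\<^sub>R e)" "h *\<^sub>R e"] by simp
   also have "... < r" using x \<delta>r e r by (simp add: h_def)
   finally have xr: "x \<in> ball p r" by (simp add: dist_norm norm_minus_commute)
   have "\<gamma> (pr x) <= \<gamma> (pr p) + L * norm (x - (p + h *\<^sub>R e))"
    using \<gamma>_lip[of x "p + h *\<^sub>R e"] unfolding pr_e by linarith
   moreover have "(p + h *\<^sub>R e) \<bullet> e - x \<bullet> e <= norm (x - (p + h *\<^sub>R e))"
    using norm_cauchy_schwarz[of "(p + h *\<^sub>R e) - x" e] e by (simp add: inner_diff_left norm_minus_commute)
   moreover have "(p + h *\<^sub>R e) \<bullet> e = p \<bullet> e + h" by (simp add: inner_add_left ee)
   moreover have "(1 + L) * norm (x - (p + h *\<^sub>R e)) <= (1 + L) * \<delta>" using x L0 by (intro mult_left_mono) auto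
   moreover have "(1 + L) * norm (x - (p + h *\<^sub>R e)) = norm (x - (p + h *\<^sub>R e)) + L * norm (x - (p + h *\<^sub>R e))"
    by (simp add: distrib_right)
   ultimately have "\<gamma> (pr x) + h <= x \<bullet> e + (1 + L) * \<delta>" using pge by linarith
   then have "\<gamma> (pr x) + h <= x \<bullet> e + \<delta> * (1 + L)" by (simp add: mult.commute)
   then show "x \<in> D" using inD[OF xr] \<delta>L r by (simp add: h_def)
  qed
  have "poincare_set D (D \<inter> ball p \<delta>)"
  proof (rule poincare_set_shift[where h = "h *\<^sub>R e"])
   show "open (D \<inter> ball p \<delta>)" using D'(1) by auto
   show "bounded (D \<inter> ball p \<delta>)" by (rule bounded_subset[OF bounded_ball]) blast
   show "poincare_set D (ball (p + h *\<^sub>R e) \<delta>)" by (rule poincare_set_ball[OF \<delta>0 Qsub])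
   show "open (ball (p + h *\<^sub>R e) \<delta>)" by simp
   fix x assume x: "x \<in> D \<inter> ball p \<delta>"
   show "x + h *\<^sub>R e \<in> ball (p + h *\<^sub>R e) \<delta>" using x by (simp add: dist_norm)
   \<comment> \<open>Moving upwards leaves the base point unchanged and only raises the height, so
     the whole segment stays above the graph.\<close>
   fix s :: real assume s: "0 <= s" "s <= 1"
   have xr: "x \<in> ball p r" using x \<delta>r r by simp
   have "norm ((x + s *\<^sub>R h *\<^sub>R e) - p) <= norm (x - p) + norm (s *\<^sub>R h *\<^sub>R e)"
    using norm_triangle_ineq[of "x - p" "s *\<^sub>R h *\<^sub>R e"] by (simp add: algebra_simps)
   also have "norm (s *\<^sub>R h *\<^sub>R e) <= h" using s e r by (simp add: h_def mult_left_le_one_le)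
   finally have "norm ((x + s *\<^sub>R h *\<^sub>R e) - p) < r"
    using x \<delta>r r by (simp add: h_def dist_norm norm_minus_commute)
   then have "x + s *\<^sub>R h *\<^sub>R e \<in> ball p r" by (simp add: dist_norm norm_minus_commute)
   moreover have "pr (x + s *\<^sub>R h *\<^sub>R e) = pr x" using pr_e[of x "s * h"] by simp
   moreover have "(x + s *\<^sub>R h *\<^sub>R e) \<bullet> e \<ge> x \<bullet> e" using s r by (simp add: inner_add_left ee h_def)
   moreover have "x \<bullet> e > \<gamma> (pr x)" using inD[OF xr] x by blast
   ultimately show "x + s *\<^sub>R h *\<^sub>R e \<in> D" using inD by force
  qed
  then show ?thesis using \<delta>0 by blast
 qed
 then obtain \<delta> where \<delta>: "!!p. p \<in> closure D ==> \<delta> p > 0" "!!p. p \<in> closure D ==> poincare_set D (D \<inter> ball p (\<delta> p))"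
  by metis
 have "compact (closure D)" using D(1) by simp
 moreover have "closure D \<subseteq> (\<Union>p\<in>closure D. ball p (\<delta> p))" using \<delta>(1) by force
 ultimately obtain S where S: "S \<subseteq> closure D" "finite S" "closure D \<subseteq> (\<Union>p\<in>S. ball p (\<delta> p))"
  using compactE_image[of "closure D" "closure D" "\<lambda>p. ball p (\<delta> p)"] open_ball by metis
 show ?thesis
 proof (rule poincare_set_connected[OF D'(2,3), of "(\<lambda>p. D \<inter> ball p (\<delta> p)) ` S - {{}}"])
  show "finite ((\<lambda>p. D \<inter> ball p (\<delta> p)) ` S - {{}})" using S(2) by simp
  show "\<Union>((\<lambda>p. D \<inter> ball p (\<delta> p)) ` S - {{}}) = D"
  proof
   show "D \<subseteq> \<Union>((\<lambda>p. D \<inter> ball p (\<delta> p)) ` S - {{}})"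
   proof
    fix x assume x: "x \<in> D"
    then have "x \<in> (\<Union>p\<in>S. ball p (\<delta> p))" using closure_subset[of D] S(3) by (meson subsetD)
    then obtain p where p: "p \<in> S" "x \<in> ball p (\<delta> p)" by (rule UN_E)
    have xp: "x \<in> D \<inter> ball p (\<delta> p)" using x p(2) by (rule IntI)
    have "D \<inter> ball p (\<delta> p) \<in> (\<lambda>p. D \<inter> ball p (\<delta> p)) ` S - {{}}"
     using xp imageI[OF p(1), of "\<lambda>p. D \<inter> ball p (\<delta> p)"] by (metis DiffI empty_iff singletonD)
    then show "x \<in> \<Union>((\<lambda>p. D \<inter> ball p (\<delta> p)) ` S - {{}})" using xp by (rule UnionI)
   qed
  qed blast
  fix P assume "P \<in> (\<lambda>p. D \<inter> ball p (\<delta> p)) ` S - {{}}"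
  then obtain p where p: "p \<in> S" "P = D \<inter> ball p (\<delta> p)" "P \<noteq> {}" by auto
  have "open P" unfolding p(2) using D'(1) by auto
  moreover have "bounded P" unfolding p(2) using D(1) by (simp add: bounded_Int)
  ultimately show "open P \<and> bounded P \<and> P \<noteq> {} \<and> poincare_set D P" using \<delta>(2) p S(1) by auto
 qed
qed

section \<open>Sobolev spaces as closed subspaces of a product Hilbert space\<close>

section \<open>Sobolev spaces inside the Hilbert space of square integrable functions\<close>

definition l2_on :: "'a::euclidean_space set => ('a => 'b::euclidean_space) => ('a, 'b) l2" where
 "l2_on D f = l2_of (\<lambda>x. indicator D x *\<^sub>R f x)"

lemma mem_L2_extend:
 fixes f :: "'a::euclidean_space => 'b::{banach, second_countable_topology}"
 assumes D: "D \<in> sets lebesgue" and f: "mem_L2 (lebesgue_on D) f"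
 shows "mem_L2 lebesgue (\<lambda>x. indicator D x *\<^sub>R f x)"
 unfolding mem_L2_def
proof
 show "(\<lambda>x. indicator D x *\<^sub>R f x) \<in> borel_measurable lebesgue"
  using mem_L2_measurable[OF f] D by (subst (asm) borel_measurable_restrict_space_iff) auto
 have "integrable lebesgue (\<lambda>x. indicator D x *\<^sub>R (norm (f x))\<^sup>2)"
  using mem_L2_integrable[OF f] unfolding integrable_lebesgue_on_iff[OF D] .
 moreover have "(\<lambda>x. indicator D x *\<^sub>R (norm (f x))\<^sup>2) = (\<lambda>x. (norm (indicator D x *\<^sub>R f x))\<^sup>2)"
  by (auto simp: fun_eq_iff split: split_indicator)
 ultimately show "integrable lebesgue (\<lambda>x. (norm (indicator D x *\<^sub>R f x))\<^sup>2)" by simp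
qed

lemma l2_on_add:
 assumes D: "D \<in> sets lebesgue" and "mem_L2 (lebesgue_on D) f" "mem_L2 (lebesgue_on D) g"
 shows "l2_on D (\<lambda>x. f x + g x) = l2_on D f + l2_on D g"
 unfolding l2_on_def scaleR_add_right by (intro l2_of_add mem_L2_extend assms)

lemma l2_on_scaleR:
 assumes D: "D \<in> sets lebesgue" and "mem_L2 (lebesgue_on D) f"
 shows "l2_on D (\<lambda>x. c *\<^sub>R f x) = c *\<^sub>R l2_on D f"
proof -
 have "l2_on D (\<lambda>x. c *\<^sub>R f x) = l2_of (\<lambda>x. c *\<^sub>R (indicator D x *\<^sub>R f x))"
  unfolding l2_on_def by (simp add: mult.commute)
 then show ?thesis unfolding l2_on_def using l2_of_scaleR[OF mem_L2_extend[OF assms]] by simp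
qed

lemma inner_l2_on:
 assumes D: "D \<in> sets lebesgue" and f: "mem_L2 (lebesgue_on D) f" and g: "mem_L2 lebesgue g"
 shows "l2_on D f \<bullet> l2_of g = (LINT x|lebesgue_on D. f x \<bullet> g x)"
 unfolding l2_on_def inner_l2_of[OF mem_L2_extend[OF D f] g] integral_lebesgue_on_eq[OF D]
 by simp

lemma norm_l2_on:
 assumes D: "D \<in> sets lebesgue" and f: "mem_L2 (lebesgue_on D) f"
 shows "norm (l2_on D f) = L2norm (lebesgue_on D) f"
proof -
 have "(LINT x|lebesgue. (norm (indicator D x *\<^sub>R f x))\<^sup>2) = (LINT x|lebesgue. indicator D x *\<^sub>R (norm (f x))\<^sup>2)"
  by (intro Bochner_Integration.integral_cong) (auto split: split_indicator)
 then show ?thesis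
  unfolding l2_on_def norm_l2_of[OF mem_L2_extend[OF D f]] L2norm_def integral_lebesgue_on_eq[OF D] by simp
qed

lemma l2_on_eq_iff:
 assumes D: "D \<in> sets lebesgue" and f: "mem_L2 (lebesgue_on D) f" and g: "mem_L2 (lebesgue_on D) g"
 shows "l2_on D f = l2_on D g \<longleftrightarrow> (AE x in lebesgue_on D. f x = g x)"
proof -
 have "l2_on D f = l2_on D g \<longleftrightarrow> (AE x in lebesgue. indicator D x *\<^sub>R f x = indicator D x *\<^sub>R g x)"
  unfolding l2_on_def by (rule l2_of_eq_iff[OF mem_L2_extend[OF D f] mem_L2_extend[OF D g]])
 also have "... \<longleftrightarrow> (AE x in lebesgue. x \<in> D --> f x = g x)"
  by (intro arg_cong[where f = "almost_everywhere lebesgue"]) (auto simp: fun_eq_iff split: split_indicator)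
 finally show ?thesis unfolding AE_lebesgue_on_iff[OF D] .
qed

lemma l2_fun_on:
 assumes D: "D \<in> sets lebesgue" and f: "mem_L2 (lebesgue_on D) f"
 shows "AE x in lebesgue_on D. l2_fun (l2_on D f) x = f x"
 unfolding AE_lebesgue_on_iff[OF D] l2_on_def
 using l2_fun_of[OF mem_L2_extend[OF D f]] by eventually_elim auto

lemma norm_l2_on_fun_le:
 assumes D: "D \<in> sets lebesgue" shows "norm (l2_on D (l2_fun x)) <= norm x"
proof -
 have "(LINT t|lebesgue_on D. (norm (l2_fun x t))\<^sup>2) <= (LINT t|lebesgue. (norm (l2_fun x t))\<^sup>2)"
  unfolding integral_lebesgue_on_eq[OF D]
  by (intro integral_mono integrable_mult_indicator D mem_L2_integrable l2_fun_mem) (auto split: split_indicator)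
 then show ?thesis unfolding norm_l2_on[OF D mem_L2_restrict[OF D l2_fun_mem]] norm_l2[of x] L2norm_def by simp
qed

lemma l2_on_fun_on:
 assumes D: "D \<in> sets lebesgue" and f: "mem_L2 (lebesgue_on D) f"
 shows "l2_on D (l2_fun (l2_on D f)) = l2_on D f"
 unfolding l2_on_eq_iff[OF D mem_L2_restrict[OF D l2_fun_mem] f] by (rule l2_fun_on[OF D f])

text \<open>These are the fixed points of restriction to \<open>D\<close>, a bounded linear
  map.\<close>

lemma closed_supported:
 assumes D: "D \<in> sets lebesgue"
 shows "closed {x :: ('a::euclidean_space, 'b::euclidean_space) l2. l2_on D (l2_fun x) = x}"
proof -
 have "bounded_linear (\<lambda>x :: ('a, 'b) l2. l2_on D (l2_fun x))"
 proof (rule bounded_linear_intro[where K = 1])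
  fix x y :: "('a, 'b) l2" and r :: real
  note m = mem_L2_restrict[OF D l2_fun_mem]
  have "l2_on D (l2_fun (x + y)) = l2_on D (\<lambda>t. l2_fun x t + l2_fun y t)"
   unfolding l2_on_eq_iff[OF D m mem_L2_add[OF m m]] AE_lebesgue_on_iff[OF D]
   using l2_fun_add[of x y] by eventually_elim simp
  then show "l2_on D (l2_fun (x + y)) = l2_on D (l2_fun x) + l2_on D (l2_fun y)"
   unfolding l2_on_add[OF D m m] .
  have "l2_on D (l2_fun (r *\<^sub>R x)) = l2_on D (\<lambda>t. r *\<^sub>R l2_fun x t)"
   unfolding l2_on_eq_iff[OF D m mem_L2_scaleR[OF m]] AE_lebesgue_on_iff[OF D]
   using l2_fun_scaleR[of r x] by eventually_elim simp
  then show "l2_on D (l2_fun (r *\<^sub>R x)) = r *\<^sub>R l2_on D (l2_fun x)"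
   unfolding l2_on_scaleR[OF D m] .
  show "norm (l2_on D (l2_fun x)) <= norm x * 1" using norm_l2_on_fun_le[OF D, of x] by simp
 qed
 then have "continuous_on UNIV (\<lambda>x :: ('a, 'b) l2. l2_on D (l2_fun x))"
  by (rule linear_continuous_on)
 then show ?thesis by (intro closed_Collect_eq continuous_on_id)
qed

subsection \<open>Weak gradients\<close>

text \<open>Integration by parts becomes a family of inner product identities, linear and continuous
  in the pair of function and gradient; hence weak gradients add up and pass to limits.\<close>

lemma has_weak_gradient_iff_inner:
 fixes u :: "real^'n => real" and g :: "real^'n => real^'n"
 assumes D: "D \<in> sets lebesgue" and u: "mem_L2 (lebesgue_on D) u" and g: "mem_L2 (lebesgue_on D) g"
 shows "has_weak_gradient D u g \<longleftrightarrow> (\<forall>\<phi>\<in>test_functions D. \<forall>i\<in>Basis.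
  l2_on D u \<bullet> l2_of (\<lambda>x. frechet_derivative \<phi> (at x) i) = - (l2_on D g \<bullet> l2_of (\<lambda>x. \<phi> x *\<^sub>R i)))"
proof -
 have "l2_on D u \<bullet> l2_of (\<lambda>x. frechet_derivative \<phi> (at x) i) = (LINT x|lebesgue_on D. u x * frechet_derivative \<phi> (at x) i)"
  "l2_on D g \<bullet> l2_of (\<lambda>x. \<phi> x *\<^sub>R i) = (LINT x|lebesgue_on D. (g x \<bullet> i) * \<phi> x)"
  if \<phi>: "\<phi> \<in> test_functions D" and i: "i \<in> Basis" for \<phi> and i :: "real^'n"
 proof -
  show "l2_on D u \<bullet> l2_of (\<lambda>x. frechet_derivative \<phi> (at x) i) = (LINT x|lebesgue_on D. u x * frechet_derivative \<phi> (at x) i)"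
   using inner_l2_on[OF D u test_function_mem_L2[OF test_function_derivative[OF \<phi> i]]] by simp
  have "mem_L2 lebesgue (\<lambda>x. \<phi> x *\<^sub>R i)"
   using test_function_mem_L2[OF \<phi>] by (auto simp: mem_L2_def power_mult_distrib)
  then show "l2_on D g \<bullet> l2_of (\<lambda>x. \<phi> x *\<^sub>R i) = (LINT x|lebesgue_on D. (g x \<bullet> i) * \<phi> x)"
   using inner_l2_on[OF D g] by (simp add: mult.commute)
 qed
 then show ?thesis unfolding has_weak_gradient_def by auto
qed

lemma has_weak_gradient_unique:
 fixes u :: "real^'n => real"
 assumes D: "open D" "bounded D" and g: "mem_L2 (lebesgue_on D) g" "has_weak_gradient D u g"
  and g': "mem_L2 (lebesgue_on D) g'" "has_weak_gradient D u g'"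
 shows "AE x in lebesgue_on D. g x = g' x"
proof -
 have Dl: "D \<in> lmeasurable" using D by (simp add: lmeasurable_open)
 note fin = finite_measure_lebesgue_on[OF Dl]
 note i1 = mem_L2_integrable_finite[OF _ fin]
 have "AE x in lebesgue_on D. (g x - g' x) \<bullet> i = 0" if i: "i \<in> Basis" for i
 proof (rule fundamental_lemma[OF D(1)])
  have gi: "mem_L2 (lebesgue_on D) (\<lambda>x. g x \<bullet> i)" if "mem_L2 (lebesgue_on D) g" for g :: "real^'n => real^'n"
  proof (rule mem_L2_bound[OF _ mem_L2_integrable[OF that]])
   show "(\<lambda>x. g x \<bullet> i) \<in> borel_measurable (lebesgue_on D)" using mem_L2_measurable[OF that] by (rule borel_measurable_inner) simp
   show "AE x in lebesgue_on D. (norm (g x \<bullet> i))\<^sup>2 <= (norm (g x))\<^sup>2"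
    using Basis_le_norm[OF i] by (intro AE_I2 power_mono) auto
  qed
  show "integrable (lebesgue_on D) (\<lambda>x. (g x - g' x) \<bullet> i)"
   unfolding inner_diff_left by (intro Bochner_Integration.integrable_diff i1 gi g g')
  fix \<phi> :: "real^'n => real" assume \<phi>: "\<phi> \<in> test_functions D"
  have \<phi>m: "mem_L2 (lebesgue_on D) \<phi>" using Dl by (intro mem_L2_restrict test_function_mem_L2[OF \<phi>]) (simp add: fmeasurableD)
  have int: "integrable (lebesgue_on D) (\<lambda>x. (g x \<bullet> i) * \<phi> x)" "integrable (lebesgue_on D) (\<lambda>x. (g' x \<bullet> i) * \<phi> x)"
   using mem_L2_integrable_inner[OF gi[OF g(1)] \<phi>m] mem_L2_integrable_inner[OF gi[OF g'(1)] \<phi>m] by simp_all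
  have "(LINT x|lebesgue_on D. (g x \<bullet> i) * \<phi> x) = (LINT x|lebesgue_on D. (g' x \<bullet> i) * \<phi> x)"
   using g(2)[unfolded has_weak_gradient_def, rule_format, OF \<phi> i]
    g'(2)[unfolded has_weak_gradient_def, rule_format, OF \<phi> i] by simp
  then show "(LINT x|lebesgue_on D. ((g x - g' x) \<bullet> i) * \<phi> x) = 0"
   using int by (simp add: inner_diff_left left_diff_distrib)
 qed
 then have "AE x in lebesgue_on D. \<forall>i\<in>Basis. (g x - g' x) \<bullet> i = 0" by (intro AE_finite_allI finite_Basis)
 then show ?thesis by eventually_elim (simp add: euclidean_all_zero_iff)
qed

locale bounded_open =
 fixes D :: "(real^'n) set"
 assumes bounded_D: "bounded D" and open_D: "open D"
begin

lemma D_sets: "D \<in> sets lebesgue" using open_D by simp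

lemma D_lmeasurable: "D \<in> lmeasurable" using open_D bounded_D by (simp add: lmeasurable_open)

lemma finite_measure_D: "finite_measure (lebesgue_on D)" by (rule finite_measure_lebesgue_on[OF D_lmeasurable])

lemma carr_H1_iff: "u \<in> carr (H1 D) \<longleftrightarrow> mem_L2 (lebesgue_on D) u \<and> (\<exists>g. mem_L2 (lebesgue_on D) g \<and> has_weak_gradient D u g)"
 by (simp add: H1_def square_integrable_iff_mem_L2)

lemma H1_mem_L2: "u \<in> carr (H1 D) ==> mem_L2 (lebesgue_on D) u"
 by (simp add: carr_H1_iff)

lemma weak_gradient:
 assumes "u \<in> carr (H1 D)"
 shows "mem_L2 (lebesgue_on D) (weak_gradient D u)" "has_weak_gradient D u (weak_gradient D u)"
proof -
 have "\<exists>g. square_integrable (lebesgue_on D) g \<and> has_weak_gradient D u g" using assms by (simp add: H1_def)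
 from someI_ex[OF this] show "mem_L2 (lebesgue_on D) (weak_gradient D u)" "has_weak_gradient D u (weak_gradient D u)"
  unfolding weak_gradient_def square_integrable_iff_mem_L2 by auto
qed

definition grad :: "(real^'n => real) => (real^'n, real^'n) l2" where
 "grad u = l2_on D (weak_gradient D u)"

lemma H1_grad_eq:
 assumes u: "mem_L2 (lebesgue_on D) u" and g: "mem_L2 (lebesgue_on D) g" and ug: "has_weak_gradient D u g"
 shows "u \<in> carr (H1 D)" "grad u = l2_on D g"
proof -
 show uH: "u \<in> carr (H1 D)" using assms unfolding carr_H1_iff by blast
 show "grad u = l2_on D g" unfolding grad_def l2_on_eq_iff[OF D_sets weak_gradient(1)[OF uH] g]
  by (rule has_weak_gradient_unique[OF open_D bounded_D weak_gradient[OF uH] g ug])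
qed

lemma grad_supported: "u \<in> carr (H1 D) ==> l2_on D (l2_fun (grad u)) = grad u"
 unfolding grad_def by (rule l2_on_fun_on[OF D_sets weak_gradient(1)])

lemma H1_add:
 assumes u: "u \<in> carr (H1 D)" and v: "v \<in> carr (H1 D)"
 shows "u + v \<in> carr (H1 D)" "l2_on D (u + v) = l2_on D u + l2_on D v" "grad (u + v) = grad u + grad v"
proof -
 let ?g = "\<lambda>x. weak_gradient D u x + weak_gradient D v x"
 note m = H1_mem_L2[OF u] H1_mem_L2[OF v] and g = weak_gradient(1)[OF u] weak_gradient(1)[OF v]
 have uv: "u + v = (\<lambda>x. u x + v x)" by (simp add: fun_eq_iff)
 have m': "mem_L2 (lebesgue_on D) (\<lambda>x. u x + v x)" and g': "mem_L2 (lebesgue_on D) ?g"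
  by (intro mem_L2_add m g)+
 show L: "l2_on D (u + v) = l2_on D u + l2_on D v" unfolding uv by (rule l2_on_add[OF D_sets m])
 have "has_weak_gradient D (\<lambda>x. u x + v x) ?g"
  using weak_gradient(2)[OF u] weak_gradient(2)[OF v] L
  unfolding has_weak_gradient_iff_inner[OF D_sets m(1) g(1)] has_weak_gradient_iff_inner[OF D_sets m(2) g(2)]
   has_weak_gradient_iff_inner[OF D_sets m' g'] l2_on_add[OF D_sets g] uv
  by (simp add: inner_add_left)
 from H1_grad_eq[OF m' g' this] show "u + v \<in> carr (H1 D)" "grad (u + v) = grad u + grad v"
  unfolding uv grad_def l2_on_add[OF D_sets g] by auto
qed

lemma H1_scaleR:
 assumes u: "u \<in> carr (H1 D)"
 shows "c *\<^sub>R u \<in> carr (H1 D)" "l2_on D (c *\<^sub>R u) = c *\<^sub>R l2_on D u" "grad (c *\<^sub>R u) = c *\<^sub>R grad u"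
proof -
 let ?g = "\<lambda>x. c *\<^sub>R weak_gradient D u x"
 note m = H1_mem_L2[OF u] and g = weak_gradient(1)[OF u]
 have cu: "c *\<^sub>R u = (\<lambda>x. c *\<^sub>R u x)" by (simp add: scaleR_fun_def)
 have m': "mem_L2 (lebesgue_on D) (\<lambda>x. c *\<^sub>R u x)" and g': "mem_L2 (lebesgue_on D) ?g"
  by (intro mem_L2_scaleR m g)+
 show L: "l2_on D (c *\<^sub>R u) = c *\<^sub>R l2_on D u" unfolding cu by (rule l2_on_scaleR[OF D_sets m])
 have "has_weak_gradient D (\<lambda>x. c *\<^sub>R u x) ?g"
  using weak_gradient(2)[OF u] L
  unfolding has_weak_gradient_iff_inner[OF D_sets m g]
   has_weak_gradient_iff_inner[OF D_sets m' g'] l2_on_scaleR[OF D_sets g] cu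
  by simp
 from H1_grad_eq[OF m' g' this] show "c *\<^sub>R u \<in> carr (H1 D)" "grad (c *\<^sub>R u) = c *\<^sub>R grad u"
  unfolding cu grad_def l2_on_scaleR[OF D_sets g] by auto
qed

lemma H1_zero: "0 \<in> carr (H1 D)" "l2_on D (0 :: real^'n => real) = 0" "grad 0 = 0"
proof -
 have z: "(0 :: real^'n => real) = (\<lambda>x. 0)" by (simp add: fun_eq_iff)
 have "has_weak_gradient D (\<lambda>x. 0) (\<lambda>x. 0)" by (simp add: has_weak_gradient_def)
 from H1_grad_eq[OF mem_L2_zero mem_L2_zero this]
 show "0 \<in> carr (H1 D)" "l2_on D (0 :: real^'n => real) = 0" "grad 0 = 0" unfolding z by (simp_all add: l2_on_def l2_of_zero)
qed

lemma fun_diff_eq: "u - v = u + (-1) *\<^sub>R v" for u v :: "'x => real"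
 by (simp add: fun_eq_iff scaleR_fun_def)

lemma H1_diff:
 assumes u: "u \<in> carr (H1 D)" and v: "v \<in> carr (H1 D)"
 shows "u - v \<in> carr (H1 D)" "l2_on D (u - v) = l2_on D u - l2_on D v" "grad (u - v) = grad u - grad v"
 unfolding fun_diff_eq using H1_add[OF u H1_scaleR(1)[OF v, of "-1"]] H1_scaleR[OF v, of "-1"] by simp_all

text \<open>The graph of the weak gradient. The product norm is the H^1 norm, so approximation in
  H^1 becomes closure in a Hilbert space.\<close>

definition H1_pair :: "(real^'n => real) => (real^'n, real) l2 \<times> (real^'n, real^'n) l2" where
 "H1_pair u = (l2_on D u, grad u)"

lemma norm_grad: "u \<in> carr (H1 D) ==> norm (grad u) = sqrt (LINT x|lebesgue_on D. (norm (weak_gradient D u x))\<^sup>2)"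
 unfolding grad_def norm_l2_on[OF D_sets weak_gradient(1)] L2norm_def ..

lemma nrm_H1: "u \<in> carr (H1 D) ==> nrm (H1 D) u = norm (H1_pair u)"
proof -
 assume u: "u \<in> carr (H1 D)"
 have "nrm (H1 D) u = sqrt ((L2norm (lebesgue_on D) u)\<^sup>2 + (L2norm (lebesgue_on D) (weak_gradient D u))\<^sup>2)"
  unfolding L2norm_power2 by (simp add: H1_def)
 then show ?thesis
  unfolding H1_pair_def norm_Pair grad_def norm_l2_on[OF D_sets weak_gradient(1)[OF u]] norm_l2_on[OF D_sets H1_mem_L2[OF u]] .
qed

text \<open>A pair that satisfies these closed conditions comes from any representative of its first
  component; this is completeness of H^1 in disguise.\<close>

lemma H1_pair_range:
 "H1_pair ` carr (H1 D) = {(U, G). l2_on D (l2_fun U) = U \<and> l2_on D (l2_fun G) = G \<and>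
  (\<forall>\<phi>\<in>test_functions D. \<forall>i\<in>Basis. U \<bullet> l2_of (\<lambda>x. frechet_derivative \<phi> (at x) i) = - (G \<bullet> l2_of (\<lambda>x. \<phi> x *\<^sub>R i)))}"
  (is "_ = ?R")
proof
 show "H1_pair ` carr (H1 D) \<subseteq> ?R"
 proof (rule image_subsetI)
  fix u assume u: "u \<in> carr (H1 D)"
  have 1: "l2_on D (l2_fun (l2_on D u)) = l2_on D u" by (rule l2_on_fun_on[OF D_sets H1_mem_L2[OF u]])
  have 2: "\<forall>\<phi>\<in>test_functions D. \<forall>i\<in>Basis. l2_on D u \<bullet> l2_of (\<lambda>x. frechet_derivative \<phi> (at x) i) = - (grad u \<bullet> l2_of (\<lambda>x. \<phi> x *\<^sub>R i))"
   using weak_gradient(2)[OF u] unfolding has_weak_gradient_iff_inner[OF D_sets H1_mem_L2[OF u] weak_gradient(1)[OF u]] grad_def .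
  show "H1_pair u \<in> ?R" unfolding H1_pair_def mem_Collect_eq case_prod_conv using 1 grad_supported[OF u] 2 by (intro conjI)
 qed
 show "?R \<subseteq> H1_pair ` carr (H1 D)"
 proof clarify
  fix U :: "(real^'n, real) l2" and G :: "(real^'n, real^'n) l2"
  assume UG: "l2_on D (l2_fun U) = U" "l2_on D (l2_fun G) = G"
   and w: "\<forall>\<phi>\<in>test_functions D. \<forall>i\<in>Basis. U \<bullet> l2_of (\<lambda>x. frechet_derivative \<phi> (at x) i) = - (G \<bullet> l2_of (\<lambda>x. \<phi> x *\<^sub>R i))"
  note m = mem_L2_restrict[OF D_sets l2_fun_mem]
  have "has_weak_gradient D (l2_fun U) (l2_fun G)"
   unfolding has_weak_gradient_iff_inner[OF D_sets m m] UG by (rule w)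
  from H1_grad_eq[OF m m this] show "(U, G) \<in> H1_pair ` carr (H1 D)"
   unfolding UG by (intro image_eqI[of _ _ "l2_fun U"]) (simp_all add: H1_pair_def UG)
 qed
qed

lemma closed_H1_pair_range: "closed (H1_pair ` carr (H1 D))"
proof -
 have "closed {p :: (real^'n, real) l2 \<times> (real^'n, real^'n) l2. l2_on D (l2_fun (fst p)) = fst p}"
  using closed_vimage_fst[OF closed_supported[OF D_sets]] by (simp add: vimage_def)
 moreover have "closed {p :: (real^'n, real) l2 \<times> (real^'n, real^'n) l2. l2_on D (l2_fun (snd p)) = snd p}"
  using closed_vimage_snd[OF closed_supported[OF D_sets]] by (simp add: vimage_def)
 moreover have "closed {p. \<forall>\<phi>\<in>test_functions D. \<forall>i\<in>Basis.
   fst p \<bullet> l2_of (\<lambda>x. frechet_derivative \<phi> (at x) i) = - (snd p \<bullet> l2_of (\<lambda>x. \<phi> x *\<^sub>R i))}"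
  unfolding Ball_def
  by (intro closed_Collect_all closed_Collect_imp open_Collect_const closed_Collect_eq continuous_intros)
 ultimately have "closed ({p. l2_on D (l2_fun (fst p)) = fst p} \<inter> {p. l2_on D (l2_fun (snd p)) = snd p}
  \<inter> {p. \<forall>\<phi>\<in>test_functions D. \<forall>i\<in>Basis. fst p \<bullet> l2_of (\<lambda>x. frechet_derivative \<phi> (at x) i) = - (snd p \<bullet> l2_of (\<lambda>x. \<phi> x *\<^sub>R i))})"
  by (intro closed_Int)
 moreover have "H1_pair ` carr (H1 D) = {p. l2_on D (l2_fun (fst p)) = fst p} \<inter> {p. l2_on D (l2_fun (snd p)) = snd p}
  \<inter> {p. \<forall>\<phi>\<in>test_functions D. \<forall>i\<in>Basis. fst p \<bullet> l2_of (\<lambda>x. frechet_derivative \<phi> (at x) i) = - (snd p \<bullet> l2_of (\<lambda>x. \<phi> x *\<^sub>R i))}"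
  unfolding H1_pair_range by auto
 ultimately show ?thesis by simp
qed

subsection \<open>The space with zero boundary values on a part of the boundary\<close>

lemma C1_compact_zero: "0 \<in> C1_compact S" for S :: "(real^'m) set"
proof -
 have "\<exists>g. continuous_on S g \<and> (\<forall>x\<in>S. ((0 :: real^'m => real) has_derivative (\<lambda>h. g x \<bullet> h)) (at x within S))"
  by (rule exI[of _ "\<lambda>x. 0"]) (simp add: zero_fun_def)
 then show ?thesis by (simp add: C1_compact_def)
qed

lemma C1_compactD:
 assumes "u \<in> C1_compact S"
 shows "\<exists>g. continuous_on S g \<and> (\<forall>x\<in>S. (u has_derivative (\<lambda>h. g x \<bullet> h)) (at x within S))"
  and "compact (closure {x\<in>S. u x \<noteq> 0})" and "closure {x\<in>S. u x \<noteq> 0} \<subseteq> S"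
proof -
 note a = assms[unfolded C1_compact_def mem_Collect_eq]
 show "\<exists>g. continuous_on S g \<and> (\<forall>x\<in>S. (u has_derivative (\<lambda>h. g x \<bullet> h)) (at x within S))" by (rule a[THEN conjunct1])
 show "compact (closure {x\<in>S. u x \<noteq> 0})" by (rule a[THEN conjunct2, THEN conjunct1])
 show "closure {x\<in>S. u x \<noteq> 0} \<subseteq> S" by (rule a[THEN conjunct2, THEN conjunct2])
qed

lemma C1_compact_scaleR:
 assumes u: "u \<in> C1_compact S"
 shows "c *\<^sub>R u \<in> C1_compact S"
proof -
 from C1_compactD(1)[OF u] obtain g where g: "continuous_on S g"
  "!!x. x \<in> S ==> (u has_derivative (\<lambda>h. g x \<bullet> h)) (at x within S)"
  by metis
 have ku: "compact (closure {x\<in>S. u x \<noteq> 0})" "closure {x\<in>S. u x \<noteq> 0} \<subseteq> S"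
  using C1_compactD(2,3)[OF u] .
 have "\<exists>g. continuous_on S g \<and> (\<forall>x\<in>S. (c *\<^sub>R u has_derivative (\<lambda>h. g x \<bullet> h)) (at x within S))"
 proof (intro exI conjI ballI)
  show "continuous_on S (\<lambda>x. c *\<^sub>R g x)" using g(1) by (intro continuous_intros)
  fix x assume "x \<in> S"
  from has_derivative_scaleR_right[OF g(2)[OF this], of c]
  show "(c *\<^sub>R u has_derivative (\<lambda>h. (c *\<^sub>R g x) \<bullet> h)) (at x within S)" by (simp add: scaleR_fun_def)
 qed
 moreover have sub: "closure {x\<in>S. (c *\<^sub>R u) x \<noteq> 0} \<subseteq> closure {x\<in>S. u x \<noteq> 0}"
  by (rule closure_mono) (auto simp: scaleR_fun_def)
 moreover have "compact (closure {x\<in>S. (c *\<^sub>R u) x \<noteq> 0})" by (rule compact_closure_if_subset[OF ku(1) sub])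
 ultimately show ?thesis unfolding C1_compact_def mem_Collect_eq using subset_trans[OF sub ku(2)] by (intro conjI)
qed

lemma C1_compact_add:
 assumes u: "u \<in> C1_compact S" and v: "v \<in> C1_compact S"
 shows "u + v \<in> C1_compact S"
proof -
 from C1_compactD(1)[OF u] obtain g where g: "continuous_on S g"
  "!!x. x \<in> S ==> (u has_derivative (\<lambda>h. g x \<bullet> h)) (at x within S)"
  by metis
 have ku: "compact (closure {x\<in>S. u x \<noteq> 0})" "closure {x\<in>S. u x \<noteq> 0} \<subseteq> S"
  using C1_compactD(2,3)[OF u] .
 from C1_compactD(1)[OF v] obtain g' where g': "continuous_on S g'"
  "!!x. x \<in> S ==> (v has_derivative (\<lambda>h. g' x \<bullet> h)) (at x within S)"
  by metis
 have kv: "compact (closure {x\<in>S. v x \<noteq> 0})" "closure {x\<in>S. v x \<noteq> 0} \<subseteq> S"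
  using C1_compactD(2,3)[OF v] .
 have "\<exists>g. continuous_on S g \<and> (\<forall>x\<in>S. (u + v has_derivative (\<lambda>h. g x \<bullet> h)) (at x within S))"
 proof (intro exI conjI ballI)
  show "continuous_on S (\<lambda>x. g x + g' x)" using g(1) g'(1) by (intro continuous_intros)
  fix x assume "x \<in> S"
  from has_derivative_add[OF g(2)[OF this] g'(2)[OF this]]
  show "(u + v has_derivative (\<lambda>h. (g x + g' x) \<bullet> h)) (at x within S)"
   by (simp add: inner_add_left plus_fun_def)
 qed
 moreover have sub: "closure {x\<in>S. (u + v) x \<noteq> 0} \<subseteq> closure {x\<in>S. u x \<noteq> 0} \<union> closure {x\<in>S. v x \<noteq> 0}"
 proof (rule closure_minimal)
  have "{x\<in>S. (u + v) x \<noteq> 0} \<subseteq> {x\<in>S. u x \<noteq> 0} \<union> {x\<in>S. v x \<noteq> 0}" by auto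
  also have "... \<subseteq> closure {x\<in>S. u x \<noteq> 0} \<union> closure {x\<in>S. v x \<noteq> 0}" by (intro Un_mono closure_subset)
  finally show "{x\<in>S. (u + v) x \<noteq> 0} \<subseteq> closure {x\<in>S. u x \<noteq> 0} \<union> closure {x\<in>S. v x \<noteq> 0}" .
 qed (intro closed_Un closed_closure)
 moreover have "compact (closure {x\<in>S. (u + v) x \<noteq> 0})"
  by (rule compact_closure_if_subset[OF compact_Un[OF ku(1) kv(1)] sub])
 ultimately show ?thesis unfolding C1_compact_def mem_Collect_eq
  using subset_trans[OF sub Un_least[OF ku(2) kv(2)]] by (intro conjI)
qed

definition smooth_pairs :: "(real^'n) set => ((real^'n, real) l2 \<times> (real^'n, real^'n) l2) set" where
 "smooth_pairs \<Gamma> = H1_pair ` (C1_compact (D \<union> \<Gamma>) \<inter> carr (H1 D))"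

lemma subspace_smooth_pairs: "subspace (smooth_pairs \<Gamma>)"
proof (rule subspaceI)
 have "H1_pair 0 = 0" by (simp add: H1_pair_def H1_zero zero_prod_def)
 from this[symmetric] show "0 \<in> smooth_pairs \<Gamma>" unfolding smooth_pairs_def
  by (rule image_eqI[where f = H1_pair and x = 0]) (intro IntI C1_compact_zero H1_zero(1))
next
 fix x y assume "x \<in> smooth_pairs \<Gamma>" "y \<in> smooth_pairs \<Gamma>"
 then obtain u v where uv: "x = H1_pair u" "u \<in> C1_compact (D \<union> \<Gamma>)" "u \<in> carr (H1 D)"
  "y = H1_pair v" "v \<in> C1_compact (D \<union> \<Gamma>)" "v \<in> carr (H1 D)"
  unfolding smooth_pairs_def by (elim imageE IntE)
 have "x + y = H1_pair (u + v)" using uv H1_add[OF uv(3,6)] by (simp add: H1_pair_def)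
 then show "x + y \<in> smooth_pairs \<Gamma>" unfolding smooth_pairs_def
  by (rule image_eqI[where f = H1_pair and x = "u + v"]) (intro IntI C1_compact_add[OF uv(2,5)] H1_add(1)[OF uv(3,6)])
next
 fix c x assume "x \<in> smooth_pairs \<Gamma>"
 then obtain u where u: "x = H1_pair u" "u \<in> C1_compact (D \<union> \<Gamma>)" "u \<in> carr (H1 D)"
  unfolding smooth_pairs_def by (elim imageE IntE)
 have "c *\<^sub>R x = H1_pair (c *\<^sub>R u)" using u H1_scaleR[OF u(3)] by (simp add: H1_pair_def)
 then show "c *\<^sub>R x \<in> smooth_pairs \<Gamma>" unfolding smooth_pairs_def
  by (rule image_eqI[where f = H1_pair and x = "c *\<^sub>R u"]) (intro IntI C1_compact_scaleR[OF u(2)] H1_scaleR(1)[OF u(3)])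
qed

lemma carr_H1_zero_on: "u \<in> carr (H1_zero_on D \<Gamma>) \<longleftrightarrow> u \<in> carr (H1 D) \<and> H1_pair u \<in> closure (smooth_pairs \<Gamma>)"
proof -
 have "(\<forall>e>0. \<exists>\<phi>\<in>C1_compact (D \<union> \<Gamma>) \<inter> carr (H1 D). nrm (H1 D) (u - \<phi>) < e) \<longleftrightarrow> H1_pair u \<in> closure (smooth_pairs \<Gamma>)"
  if u: "u \<in> carr (H1 D)"
 proof -
  have "nrm (H1 D) (u - \<phi>) = dist (H1_pair \<phi>) (H1_pair u)" if "\<phi> \<in> carr (H1 D)" for \<phi>
  proof -
   have "H1_pair (u - \<phi>) = H1_pair u - H1_pair \<phi>" using H1_diff[OF u that] by (simp add: H1_pair_def)
   then show ?thesis using nrm_H1[OF H1_diff(1)[OF u that]] by (simp only: dist_norm norm_minus_commute)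
  qed
  then show ?thesis unfolding closure_approachable smooth_pairs_def by auto
 qed
 then show ?thesis by (auto simp: H1_zero_on_def)
qed

lemma H1_zero_on_sub: "u \<in> carr (H1_zero_on D \<Gamma>) ==> u \<in> carr (H1 D)"
 by (simp add: carr_H1_zero_on)

lemma nrm_H1_zero_on: "u \<in> carr (H1 D) ==> nrm (H1_zero_on D \<Gamma>) u = norm (grad u)"
 by (simp add: norm_grad H1_zero_on_def)

lemma H1_zero_on_zero: "0 \<in> carr (H1_zero_on D \<Gamma>)"
 using subspace_0[OF subspace_closure[OF subspace_smooth_pairs]] H1_zero
 by (simp add: carr_H1_zero_on H1_pair_def zero_prod_def)

lemma H1_zero_on_add:
 assumes "u \<in> carr (H1_zero_on D \<Gamma>)" "v \<in> carr (H1_zero_on D \<Gamma>)"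
 shows "u + v \<in> carr (H1_zero_on D \<Gamma>)"
 using assms subspace_add[OF subspace_closure[OF subspace_smooth_pairs], of "H1_pair u" \<Gamma> "H1_pair v"] H1_add[of u v]
 by (simp add: carr_H1_zero_on H1_pair_def)

lemma H1_zero_on_scaleR:
 assumes "u \<in> carr (H1_zero_on D \<Gamma>)"
 shows "c *\<^sub>R u \<in> carr (H1_zero_on D \<Gamma>)"
 using assms subspace_scale[OF subspace_closure[OF subspace_smooth_pairs], of "H1_pair u" \<Gamma> c] H1_scaleR[of u c]
 by (simp add: carr_H1_zero_on H1_pair_def)

lemma H1_pair_H1_zero_on: "H1_pair ` carr (H1_zero_on D \<Gamma>) = closure (smooth_pairs \<Gamma>)"
proof -
 have "smooth_pairs \<Gamma> \<subseteq> H1_pair ` carr (H1 D)" unfolding smooth_pairs_def by blast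
 then have "closure (smooth_pairs \<Gamma>) \<subseteq> H1_pair ` carr (H1 D)" by (rule closure_minimal[OF _ closed_H1_pair_range])
 then show ?thesis by (auto simp: carr_H1_zero_on)
qed

subsection \<open>Closedness of the space of gradients\<close>

text \<open>The strict inequality supplies a positive bound even when the gradient vanishes. The
  directional bound follows by expanding the derivative of \<phi> in coordinates and applying
  Cauchy-Schwarz to the gradient and the field \<phi> h.\<close>

lemma weakly_differentiable_H1:
 assumes u: "u \<in> carr (H1 D)" and \<kappa>: "\<kappa> > norm (grad u)"
 shows "\<exists>u'. weakly_differentiable D u' \<kappa> \<and> (AE x in lebesgue. u' x = indicator D x *\<^sub>R u x)"
proof -
 note ul = mem_L2_extend[OF D_sets H1_mem_L2[OF u]]
 obtain u' where u'm: "u' \<in> borel_measurable lborel" and ae: "AE x in lborel. indicator D x *\<^sub>R u x = u' x"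
  using completion_ex_borel_measurable_real[OF mem_L2_measurable[OF ul]] by blast
 have ae': "AE x in lebesgue. indicator D x *\<^sub>R u x = u' x" using ae by (simp add: AE_completion_iff)
 have u'l: "mem_L2 lebesgue u'" by (rule mem_L2_cong_AE[OF ul measurable_completion[OF u'm] ae'])
 have "integrable lebesgue (\<lambda>x. indicator D x *\<^sub>R u x)"
  using mem_L2_integrable_finite[OF H1_mem_L2[OF u] finite_measure_D] unfolding integrable_lebesgue_on_iff[OF D_sets] .
 then have "integrable lebesgue u'" using integrable_cong_AE[OF mem_L2_measurable[OF ul] measurable_completion[OF u'm] ae'] by simp
 then have u'i: "integrable lborel u'" by (simp add: integrable_completion[OF u'm])
 have eqU: "l2_on D u = l2_of u'" unfolding l2_on_def using ae' unfolding l2_of_eq_iff[OF ul u'l] .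
 have "weakly_differentiable D u' \<kappa>"
 proof
  show "open D" by (rule open_D)
  show "u' \<in> borel_measurable borel" using u'm by simp
  show "integrable lborel u'" by (rule u'i)
  show "mem_L2 lborel u'" using u'l u'm unfolding mem_L2_def by (simp add: integrable_completion)
  show "\<kappa> > 0" using \<kappa> norm_ge_zero[of "grad u"] by linarith
  fix \<phi> :: "real^'n => real" and h :: "real^'n" assume \<phi>: "\<phi> \<in> test_functions D"
  have \<phi>d: "mem_L2 lebesgue (\<lambda>x. frechet_derivative \<phi> (at x) h)" for h
   by (rule test_function_mem_L2[OF test_function_directional_derivative[OF \<phi>]])
  have \<phi>h: "mem_L2 lebesgue (\<lambda>x. \<phi> x *\<^sub>R h)" for h :: "real^'n"
   using test_function_mem_L2[OF \<phi>] by (auto simp: mem_L2_def power_mult_distrib)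
  have w: "l2_on D u \<bullet> l2_of (\<lambda>x. frechet_derivative \<phi> (at x) i) = - (grad u \<bullet> l2_of (\<lambda>x. \<phi> x *\<^sub>R i))" if "i \<in> Basis" for i
   using weak_gradient(2)[OF u] that \<phi>
   unfolding has_weak_gradient_iff_inner[OF D_sets H1_mem_L2[OF u] weak_gradient(1)[OF u]] grad_def by blast
  have lin: "l2_of (\<lambda>x. \<Sum>i\<in>I. c i *\<^sub>R f i x) = (\<Sum>i\<in>I. c i *\<^sub>R l2_of (f i)) \<and> mem_L2 lebesgue (\<lambda>x. \<Sum>i\<in>I. c i *\<^sub>R f i x)"
   if "finite I" "!!i. mem_L2 lebesgue (f i)" for I c and f :: "real^'n => real^'n => 'c::euclidean_space"
   using that(1)
  proof induction
   case empty then show ?case by (simp add: l2_of_zero mem_L2_zero)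
  next
   case (insert a I)
   then show ?case using that(2) by (simp add: l2_of_add l2_of_scaleR mem_L2_scaleR mem_L2_add)
  qed
  have "(LINT x|lborel. u' x * frechet_derivative \<phi> (at x) h) = (LINT x|lebesgue. u' x \<bullet> frechet_derivative \<phi> (at x) h)"
   using u'm test_function_measurable[OF test_function_directional_derivative[OF \<phi>, of h]]
   by (subst integral_completion) auto
  also have "... = l2_on D u \<bullet> l2_of (\<lambda>x. frechet_derivative \<phi> (at x) h)"
   unfolding eqU by (rule inner_l2_of[OF u'l \<phi>d, symmetric])
  also have "... = l2_on D u \<bullet> l2_of (\<lambda>x. \<Sum>i\<in>Basis. (h \<bullet> i) *\<^sub>R frechet_derivative \<phi> (at x) i)"
   unfolding test_function_derivative_expand[OF \<phi>, of _ h] by simp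
  also have "... = (\<Sum>i\<in>Basis. (h \<bullet> i) * (l2_on D u \<bullet> l2_of (\<lambda>x. frechet_derivative \<phi> (at x) i)))"
   using lin[of Basis "\<lambda>i x. frechet_derivative \<phi> (at x) i" "\<lambda>i. h \<bullet> i"] \<phi>d by (simp add: inner_sum_right)
  also have "... = - (grad u \<bullet> (\<Sum>i\<in>Basis. (h \<bullet> i) *\<^sub>R l2_of (\<lambda>x. \<phi> x *\<^sub>R i)))"
   using w by (simp add: inner_sum_right sum_negf)
  also have "(\<Sum>i\<in>Basis. (h \<bullet> i) *\<^sub>R l2_of (\<lambda>x. \<phi> x *\<^sub>R i)) = l2_of (\<lambda>x. \<Sum>i\<in>Basis. (h \<bullet> i) *\<^sub>R \<phi> x *\<^sub>R i)"
   using lin[of Basis "\<lambda>i x. \<phi> x *\<^sub>R i" "\<lambda>i. h \<bullet> i"] \<phi>h by simp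
  also have "(\<lambda>x. \<Sum>i\<in>Basis. (h \<bullet> i) *\<^sub>R \<phi> x *\<^sub>R i) = (\<lambda>x. \<phi> x *\<^sub>R h)"
  proof
   fix x
   have "(\<Sum>i\<in>Basis. (h \<bullet> i) *\<^sub>R \<phi> x *\<^sub>R i) = \<phi> x *\<^sub>R (\<Sum>i\<in>Basis. (h \<bullet> i) *\<^sub>R i)"
    by (simp add: scaleR_sum_right mult.commute)
   then show "(\<Sum>i\<in>Basis. (h \<bullet> i) *\<^sub>R \<phi> x *\<^sub>R i) = \<phi> x *\<^sub>R h" by (simp add: euclidean_representation)
  qed
  finally have "\<bar>LINT x|lborel. u' x * frechet_derivative \<phi> (at x) h\<bar> = \<bar>grad u \<bullet> l2_of (\<lambda>x. \<phi> x *\<^sub>R h)\<bar>" by simp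
  also have "... <= norm (grad u) * norm (l2_of (\<lambda>x. \<phi> x *\<^sub>R h))" by (rule Cauchy_Schwarz_ineq2)
  also have "norm (l2_of (\<lambda>x. \<phi> x *\<^sub>R h)) = norm h * L2norm lborel \<phi>"
  proof -
   have "norm (l2_of (\<lambda>x. \<phi> x *\<^sub>R h)) = sqrt (LINT x|lebesgue. (\<phi> x)\<^sup>2 * (norm h)\<^sup>2)"
    unfolding norm_l2_of[OF \<phi>h] L2norm_def by (simp add: power_mult_distrib)
   also have "(LINT x|lebesgue. (\<phi> x)\<^sup>2 * (norm h)\<^sup>2) = (LINT x|lborel. (\<phi> x)\<^sup>2) * (norm h)\<^sup>2"
    using test_function_measurable[OF \<phi>] by (simp add: integral_completion)
   finally show ?thesis by (simp add: real_sqrt_mult L2norm_def)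
  qed
  also have "norm (grad u) * (norm h * L2norm lborel \<phi>) <= \<kappa> * (norm h * L2norm lborel \<phi>)"
   using \<kappa> L2norm_nonneg by (intro mult_right_mono mult_nonneg_nonneg) auto
  finally show "\<bar>LINT x|lborel. u' x * frechet_derivative \<phi> (at x) h\<bar> <= norm h * \<kappa> * L2norm lborel \<phi>"
   by (simp add: mult.commute mult.left_commute)
 qed
 then show ?thesis using ae' by (intro exI[of _ u']) (auto simp: eq_commute)
qed

definition one_on :: "(real^'n, real) l2" where
 "one_on = l2_on D (\<lambda>x. 1)"

definition mean :: "(real^'n, real) l2 => real" where
 "mean U = (U \<bullet> one_on) / (one_on \<bullet> one_on)"

lemma mem_L2_const: "mem_L2 (lebesgue_on D) (\<lambda>x. c)"
 using finite_measure.integrable_const[OF finite_measure_D] by (simp add: mem_L2_def)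

text \<open>The mean is the coefficient of the projection onto the constants, hence the best
  constant; unlike the number that a Poincare set provides, it is linear in the function. If
  \<open>one_on\<close> is 0, both sides agree.\<close>

lemma norm_minus_mean_le:
 "norm (U - mean U *\<^sub>R one_on) <= norm (U - a *\<^sub>R one_on)"
proof (cases "one_on = 0")
 case False
 then have "(U - mean U *\<^sub>R one_on) \<bullet> one_on = 0" by (simp add: mean_def inner_diff_left)
 then have orth: "(U - mean U *\<^sub>R one_on) \<bullet> ((mean U - a) *\<^sub>R one_on) = 0" by simp
 have "U - a *\<^sub>R one_on = (U - mean U *\<^sub>R one_on) + (mean U - a) *\<^sub>R one_on" by (simp add: algebra_simps)
 then have "(norm (U - a *\<^sub>R one_on))\<^sup>2 = (norm (U - mean U *\<^sub>R one_on))\<^sup>2 + (norm ((mean U - a) *\<^sub>R one_on))\<^sup>2"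
  using orth by (simp only: power2_norm_eq_inner inner_add_left inner_add_right) (simp add: inner_commute)
 then have "(norm (U - mean U *\<^sub>R one_on))\<^sup>2 <= (norm (U - a *\<^sub>R one_on))\<^sup>2" by simp
 then show ?thesis by (rule power2_le_imp_le) simp
qed simp

lemma poincare_wirtinger:
 assumes "poincare_set D D"
 shows "\<exists>K\<ge>0. \<forall>u\<in>carr (H1 D). norm (l2_on D u - mean (l2_on D u) *\<^sub>R one_on) <= K * norm (grad u)"
proof -
 obtain K where K: "K \<ge> 0" "!!u \<kappa>. weakly_differentiable D u \<kappa> ==>
  \<exists>a. (\<integral>\<^sup>+x. ennreal ((u x - a)\<^sup>2) * indicator D x \<partial>lborel) <= ennreal (K * \<kappa>\<^sup>2)"
  using assms unfolding poincare_set_def by blast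
 have "norm (l2_on D u - mean (l2_on D u) *\<^sub>R one_on) <= sqrt K * norm (grad u)" if u: "u \<in> carr (H1 D)" for u
 proof -
  let ?V = "l2_on D u - mean (l2_on D u) *\<^sub>R one_on"
  have le: "norm ?V <= sqrt K * \<kappa>" if \<kappa>: "\<kappa> > norm (grad u)" for \<kappa>
  proof -
   have \<kappa>0: "\<kappa> > 0" using \<kappa> norm_ge_zero[of "grad u"] by linarith
   obtain u' where u': "weakly_differentiable D u' \<kappa>" "AE x in lebesgue. u' x = indicator D x *\<^sub>R u x"
    using weakly_differentiable_H1[OF u \<kappa>] by blast
   obtain a where a: "(\<integral>\<^sup>+x. ennreal ((u' x - a)\<^sup>2) * indicator D x \<partial>lborel) <= ennreal (K * \<kappa>\<^sup>2)"
    using K(2)[OF u'(1)] by blast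
   note m = mem_L2_diff[OF H1_mem_L2[OF u] mem_L2_const[of a]]
   have V: "l2_on D u - a *\<^sub>R one_on = l2_on D (\<lambda>x. u x - a)"
   proof -
    have "l2_on D (\<lambda>x. u x - a) = l2_on D (\<lambda>x. u x + (- a) *\<^sub>R 1)" by simp
    also have "... = l2_on D u + (- a) *\<^sub>R l2_on D (\<lambda>x. 1)"
     unfolding l2_on_add[OF D_sets H1_mem_L2[OF u] mem_L2_scaleR[OF mem_L2_const]] l2_on_scaleR[OF D_sets mem_L2_const] ..
    finally show ?thesis by (simp add: one_on_def)
   qed
   have "ennreal ((norm (l2_on D u - a *\<^sub>R one_on))\<^sup>2) = (\<integral>\<^sup>+x. ennreal ((norm (u x - a))\<^sup>2) \<partial>lebesgue_on D)"
    unfolding V norm_l2_on[OF D_sets m] by (rule nn_integral_L2norm[OF m, symmetric])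
   also have "... = (\<integral>\<^sup>+x. ennreal ((norm (u x - a))\<^sup>2) * indicator D x \<partial>lebesgue)"
    using D_sets by (subst nn_integral_restrict_space) auto
   also have "... = (\<integral>\<^sup>+x. ennreal ((u' x - a)\<^sup>2) * indicator D x \<partial>lebesgue)"
    by (rule nn_integral_cong_AE) (use u'(2) in eventually_elim, auto split: split_indicator)
   also have "... <= ennreal (K * \<kappa>\<^sup>2)" using a by (simp add: nn_integral_completion)
   finally have "(norm (l2_on D u - a *\<^sub>R one_on))\<^sup>2 <= K * \<kappa>\<^sup>2" using K by (subst (asm) ennreal_le_iff) auto
   also have "... = (sqrt K * \<kappa>)\<^sup>2" using K by (simp add: power_mult_distrib)
   finally have "norm (l2_on D u - a *\<^sub>R one_on) <= sqrt K * \<kappa>" by (rule power2_le_imp_le) (use K \<kappa>0 in simp)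
   then show ?thesis using norm_minus_mean_le[of "l2_on D u" a] by linarith
  qed
  \<comment> \<open>The estimate is known only for \<kappa> above the norm of the gradient; \<kappa>
    decreases to it.\<close>
  have "((\<lambda>\<kappa>. sqrt K * \<kappa>) \<longlongrightarrow> sqrt K * norm (grad u)) (at_right (norm (grad u)))" by (intro tendsto_intros)
  then show ?thesis
   by (rule tendsto_lowerbound[OF _ _ trivial_limit_at_right_real])
    (use le in \<open>auto simp: eventually_at_right_field intro!: exI[of _ "norm (grad u) + 1"]\<close>)
 qed
 then show ?thesis using K(1) by (intro exI[of _ "sqrt K"]) auto
qed

text \<open>Subtracting means makes a sequence with converging gradients converge. If the constants do not
 belong to the space, a vector orthogonal to the space but not to the constants shows
 that the means converge too.\<close>

lemma closed_grad_H1_zero_on: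
 assumes P: "poincare_set D D"
 shows "closed (grad ` carr (H1_zero_on D \<Gamma>))"
 unfolding closed_sequential_limits
proof (intro allI impI, elim conjE)
 fix g G assume g: "\<forall>n. g n \<in> grad ` carr (H1_zero_on D \<Gamma>)" and gG: "g \<longlonglongrightarrow> G"
 let ?S = "closure (smooth_pairs \<Gamma>)"
 note S = subspace_closure[OF subspace_smooth_pairs, of \<Gamma>]
 have "\<forall>n. \<exists>u. u \<in> carr (H1_zero_on D \<Gamma>) \<and> g n = grad u"
 proof
  fix n
  obtain v where v: "g n = grad v" "v \<in> carr (H1_zero_on D \<Gamma>)" using g[rule_format, of n] by (rule imageE)
  show "\<exists>u. u \<in> carr (H1_zero_on D \<Gamma>) \<and> g n = grad u" using v(2,1) by (intro exI[of _ v] conjI)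
 qed
 from choice[OF this] obtain u where u0: "\<forall>n. u n \<in> carr (H1_zero_on D \<Gamma>) \<and> g n = grad (u n)" by (rule exE)
 note u = u0[rule_format, THEN conjunct1] u0[rule_format, THEN conjunct2]
 note uH = H1_zero_on_sub[OF u(1)]
 from poincare_wirtinger[OF P] obtain K where K0: "K \<ge> 0"
  and "\<forall>u\<in>carr (H1 D). norm (l2_on D u - mean (l2_on D u) *\<^sub>R one_on) <= K * norm (grad u)"
  by (elim exE conjE)
 note K = K0 \<open>\<forall>u\<in>carr (H1 D). norm (l2_on D u - mean (l2_on D u) *\<^sub>R one_on) <= K * norm (grad u)\<close>[rule_format]
 define m where "m n = mean (l2_on D (u n))" for n
 define W where "W n = l2_on D (u n) - m n *\<^sub>R one_on" for n
 have Wd: "norm (W i - W j) <= K * norm (g i - g j)" for i j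
 proof -
  have mean_diff: "mean (U - V) = mean U - mean V" for U V by (simp add: mean_def inner_diff_left diff_divide_distrib)
  have "W i - W j = l2_on D (u i - u j) - mean (l2_on D (u i - u j)) *\<^sub>R one_on"
   unfolding W_def m_def H1_diff(2)[OF uH uH] mean_diff by (simp add: algebra_simps)
  then show ?thesis using K(2)[OF H1_diff(1)[OF uH uH, of i j]] unfolding H1_diff(3)[OF uH uH] u(2) by simp
 qed
 have "Cauchy W"
 proof (rule CauchyI)
  fix e :: real assume e: "e > 0"
  have "Cauchy g" using gG by (simp add: LIMSEQ_imp_Cauchy)
  \<comment> \<open>\<open>K + 1\<close> in place of \<open>K\<close> avoids division by
    zero.\<close>
  then obtain M where M: "!!i j. i \<ge> M ==> j \<ge> M ==> norm (g i - g j) < e / (K + 1)"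
   using CauchyD[of g "e / (K + 1)"] e K(1) by (metis add_nonneg_pos divide_pos_pos zero_less_one)
  show "\<exists>M. \<forall>i\<ge>M. \<forall>j\<ge>M. norm (W i - W j) < e"
  proof (intro exI allI impI)
   fix i j assume "i \<ge> M" "j \<ge> M"
   then have "(K + 1) * norm (g i - g j) < (K + 1) * (e / (K + 1))" using M K(1) by (intro mult_strict_left_mono) auto
   then have "(K + 1) * norm (g i - g j) < e" using K(1) by simp
   moreover have "K * norm (g i - g j) <= (K + 1) * norm (g i - g j)" by (intro mult_right_mono) auto
   ultimately show "norm (W i - W j) < e" using Wd[of i j] by linarith
  qed
 qed
 then obtain W0 where W0: "W \<longlonglongrightarrow> W0" using Cauchy_convergent_iff convergent_def by blast
 have pS: "(l2_on D (u n), g n) \<in> ?S" for n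
  using u(1)[of n] unfolding carr_H1_zero_on H1_pair_def u(2) by simp
 have "\<exists>U. (U, G) \<in> ?S"
 proof (cases "(one_on, 0) \<in> ?S")
  case True
  \<comment> \<open>The constants belong to the space, so the centred functions do too, and their
    limit can be used directly.\<close>
  have WS: "(W n, g n) \<in> ?S" for n
  proof -
   have "(W n, g n) = (l2_on D (u n), g n) - m n *\<^sub>R (one_on, 0)" by (simp add: W_def)
   then show ?thesis by (simp only: subspace_diff[OF S pS subspace_scale[OF S True]])
  qed
  have "(\<lambda>n. (W n, g n)) \<longlonglongrightarrow> (W0, G)" by (intro tendsto_Pair W0 gG)
  then have "(W0, G) \<in> ?S" by (rule closed_sequentially[OF closed_closure WS])
  then show ?thesis by (rule exI)
 next
  case False
  then obtain e where e: "!!w. w \<in> ?S ==> e \<bullet> w = 0" "e \<bullet> (one_on, 0) = 1"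
   using closed_subspace_separation[OF S closed_closure] by blast
  \<comment> \<open>\<open>e\<close> vanishes on the pair of \<open>u n\<close> and equals 1 on the
    constants, so it expresses the mean through the convergent centred part.\<close>
  have "m n = - (e \<bullet> (W n, g n))" for n
  proof -
   have "(l2_on D (u n), g n) = (W n, g n) + m n *\<^sub>R (one_on, 0)" by (simp add: W_def)
   then have "0 = e \<bullet> (W n, g n) + m n * (e \<bullet> (one_on, 0))" using e(1)[OF pS[of n]] by (simp only: inner_add_right inner_scaleR_right)
   then show ?thesis using e(2) by simp
  qed
  then have "m = (\<lambda>n. - (e \<bullet> (W n, g n)))" by auto
  moreover have "(\<lambda>n. - (e \<bullet> (W n, g n))) \<longlonglongrightarrow> - (e \<bullet> (W0, G))" by (intro tendsto_intros W0 gG)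
  ultimately have m: "m \<longlonglongrightarrow> - (e \<bullet> (W0, G))" by simp
  have "(\<lambda>n. W n + m n *\<^sub>R one_on) \<longlonglongrightarrow> W0 + (- (e \<bullet> (W0, G))) *\<^sub>R one_on" by (intro tendsto_intros W0 m)
  moreover have "(\<lambda>n. W n + m n *\<^sub>R one_on) = (\<lambda>n. l2_on D (u n))" by (simp add: W_def)
  ultimately have "(\<lambda>n. (l2_on D (u n), g n)) \<longlonglongrightarrow> (W0 + (- (e \<bullet> (W0, G))) *\<^sub>R one_on, G)" by (intro tendsto_Pair gG) simp
  then have "(W0 + (- (e \<bullet> (W0, G))) *\<^sub>R one_on, G) \<in> ?S" by (rule closed_sequentially[OF closed_closure pS])
  then show ?thesis by (rule exI)
 qed
 then obtain U where "(U, G) \<in> H1_pair ` carr (H1_zero_on D \<Gamma>)" unfolding H1_pair_H1_zero_on by (rule exE)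
 then obtain v where "(U, G) = H1_pair v" "v \<in> carr (H1_zero_on D \<Gamma>)" by (rule imageE)
 then show "G \<in> grad ` carr (H1_zero_on D \<Gamma>)" by (simp add: H1_pair_def)
qed

end

section \<open>Seminormed spaces, bounded functionals and Bochner integrals\<close>

section \<open>Seminormed spaces represented in a Hilbert space\<close>

lemma LIMSEQ_null_comparison:
 fixes f :: "nat => 'b::real_normed_vector"
 assumes "!!n. norm (f n) <= g n" "g \<longlonglongrightarrow> 0"
 shows "f \<longlonglongrightarrow> 0"
 by (rule Lim_null_comparison[OF always_eventually assms(2)]) (simp add: assms(1))

locale linear_nspace =
 fixes X :: "'v::real_vector nspace"
 assumes carr_zero: "0 \<in> carr X"
  and carr_add: "!!u v. u \<in> carr X ==> v \<in> carr X ==> u + v \<in> carr X"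
  and carr_scaleR: "!!c u. u \<in> carr X ==> c *\<^sub>R u \<in> carr X"
  and nrm_triangle: "!!u v. u \<in> carr X ==> v \<in> carr X ==> nrm X (u + v) <= nrm X u + nrm X v"
  and nrm_scaleR: "!!c u. u \<in> carr X ==> nrm X (c *\<^sub>R u) = \<bar>c\<bar> * nrm X u"
begin

lemma nrm_uminus: "u \<in> carr X ==> nrm X (- u) = nrm X u"
 using nrm_scaleR[of u "-1"] by simp

lemma nrm_nonneg: assumes u: "u \<in> carr X" shows "0 <= nrm X u"
proof -
 have "nrm X (0 *\<^sub>R u) = 0" using nrm_scaleR[OF u, of 0] by simp
 moreover have "nrm X (u + (-1) *\<^sub>R u) <= nrm X u + nrm X ((-1) *\<^sub>R u)" using u by (intro nrm_triangle carr_scaleR)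
 ultimately show ?thesis using nrm_scaleR[OF u, of "-1"] by simp
qed

lemma carr_diff: "u \<in> carr X ==> v \<in> carr X ==> u - v \<in> carr X"
 using carr_add[of u "(-1) *\<^sub>R v"] carr_scaleR[of v "-1"] by simp

lemma carr_uminus: "u \<in> carr X ==> - u \<in> carr X"
 using carr_scaleR[of u "-1"] by simp

lemma nrm_triangle_diff:
 assumes "u \<in> carr X" "v \<in> carr X" "w \<in> carr X"
 shows "nrm X (u - w) <= nrm X (u - v) + nrm X (v - w)"
 using nrm_triangle[OF carr_diff[OF assms(1,2)] carr_diff[OF assms(2,3)]] by simp

lemma nrm_minus_commute: "u \<in> carr X ==> v \<in> carr X ==> nrm X (u - v) = nrm X (v - u)"
 using nrm_uminus[OF carr_diff, of u v] by simp

lemma nrm_diff_measurable: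
 assumes f: "strongly_measurable X L f" and s: "simple_function L s" "s ` space L \<subseteq> carr X"
 shows "(\<lambda>t. nrm X (f t - s t)) \<in> borel_measurable L"
proof -
 obtain r where r: "\<forall>n. simple_function L (r n) \<and> r n ` space L \<subseteq> carr X"
  "\<forall>x\<in>space L. (\<lambda>n. nrm X (f x - r n x)) \<longlonglongrightarrow> 0"
  using f[unfolded strongly_measurable_def] by (elim conjE exE)
 show ?thesis
 proof (rule borel_measurable_LIMSEQ_metric)
  show "(\<lambda>t. nrm X (r n t - s t)) \<in> borel_measurable L" for n
   by (rule borel_measurable_simple_function)
    (rule simple_function_compose2[where h = "\<lambda>a b. nrm X (a - b)", OF r(1)[rule_format, THEN conjunct1] s(1)])
  fix t assume t: "t \<in> space L"
  have c: "f t \<in> carr X" "s t \<in> carr X" "r n t \<in> carr X" for n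
  proof -
   show "f t \<in> carr X" using f t by (simp add: strongly_measurable_def)
   show "s t \<in> carr X" by (rule subsetD[OF s(2) imageI[OF t]])
   show "r n t \<in> carr X" by (rule subsetD[OF r(1)[rule_format, THEN conjunct2] imageI[OF t]])
  qed
  have "norm (nrm X (r n t - s t) - nrm X (f t - s t)) <= nrm X (f t - r n t)" for n
   using nrm_triangle_diff[OF c(1) c(3)[of n] c(2)] nrm_triangle_diff[OF c(3)[of n] c(1) c(2)]
    nrm_minus_commute[OF c(1) c(3)[of n]] by (simp add: abs_le_iff)
  then have "(\<lambda>n. nrm X (r n t - s t) - nrm X (f t - s t)) \<longlonglongrightarrow> 0"
   by (rule LIMSEQ_null_comparison) (rule r(2)[rule_format, OF t])
  then show "(\<lambda>n. nrm X (r n t - s t)) \<longlonglongrightarrow> nrm X (f t - s t)" by (simp only: LIM_zero_iff)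
 qed
qed

lemma nrm_measurable:
 assumes f: "strongly_measurable X L f"
 shows "(\<lambda>t. nrm X (f t)) \<in> borel_measurable L"
proof -
 have "(\<lambda>t. nrm X (f t - 0)) \<in> borel_measurable L" by (rule nrm_diff_measurable[OF f]) (auto intro: carr_zero)
 then show ?thesis by simp
qed

lemma carr_sum: "(!!i. i \<in> I ==> f i \<in> carr X) ==> sum f I \<in> carr X"
 by (induction I rule: infinite_finite_induct) (simp_all add: carr_zero carr_add)

lemma simple_bochner_integral_in_carr:
 assumes "s ` space L \<subseteq> carr X"
 shows "Bochner_Integration.simple_bochner_integral L s \<in> carr X"
 unfolding Bochner_Integration.simple_bochner_integral_def
 using assms by (intro carr_sum carr_scaleR) auto

end

text \<open>\<open>g\<close> is arbitrary and the values of \<open>s\<close> carry no norm: finitely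
  many level sets suffice to write the composition as a sum of indicators.\<close>

lemma integral_simple_function_compose:
 fixes g :: "'v => 'b::{banach, second_countable_topology}"
 assumes L: "finite_measure L" and s: "simple_function L s"
 shows "integrable L (\<lambda>t. g (s t))"
  and "(LINT t|L. g (s t)) = (\<Sum>y\<in>s ` space L. measure L {t\<in>space L. s t = y} *\<^sub>R g y)"
proof -
 interpret L: finite_measure L by (rule L)
 have fin: "finite (s ` space L)" and meas: "!!y. {t\<in>space L. s t = y} \<in> sets L"
 proof -
  show "finite (s ` space L)" using s by (simp add: simple_function_def)
  fix y
  have "{t\<in>space L. s t = y} = s -` {y} \<inter> space L" by auto
  then show "{t\<in>space L. s t = y} \<in> sets L" using simple_functionD(2)[OF s, of "{y}"] by simp
 qed
 let ?h = "\<lambda>t. \<Sum>y\<in>s ` space L. indicator {t\<in>space L. s t = y} t *\<^sub>R g y"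
 have eq: "g (s t) = ?h t" if t: "t \<in> space L" for t
 proof -
  have "?h t = (\<Sum>y\<in>s ` space L. if y = s t then g y else 0)"
   using t by (intro sum.cong) (auto split: split_indicator)
  also have "... = g (s t)" using fin t by (simp add: sum.delta)
  finally show ?thesis by simp
 qed
 have int: "integrable L (\<lambda>t. indicator {t\<in>space L. s t = y} t *\<^sub>R g y)" for y
 proof -
  have "emeasure L {t\<in>space L. s t = y} < \<infinity>" using L.emeasure_finite by (simp add: less_top[symmetric])
  then show ?thesis using meas[of y] by (intro integrable_scaleR_left impI) (simp add: integrable_indicator_iff)
 qed
 have "integrable L ?h" by (intro Bochner_Integration.integrable_sum int)
 then show "integrable L (\<lambda>t. g (s t))" using eq by (subst Bochner_Integration.integrable_cong[OF refl, of L _ ?h]) auto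
 have "(LINT t|L. g (s t)) = (LINT t|L. ?h t)" using eq by (intro Bochner_Integration.integral_cong) auto
 also have "... = (\<Sum>y\<in>s ` space L. LINT t|L. indicator {t\<in>space L. s t = y} t *\<^sub>R g y)"
  by (rule Bochner_Integration.integral_sum) (rule int)
 also have "... = (\<Sum>y\<in>s ` space L. measure L {t\<in>space L. s t = y} *\<^sub>R g y)"
 proof (rule sum.cong[OF refl])
  fix y
  show "(LINT t|L. indicator {t\<in>space L. s t = y} t *\<^sub>R g y) = measure L {t\<in>space L. s t = y} *\<^sub>R g y"
   using meas[of y] L.emeasure_finite
   by (intro has_bochner_integral_integral_eq has_bochner_integral_indicator) (simp_all add: less_top[symmetric])
 qed
 finally show "(LINT t|L. g (s t)) = (\<Sum>y\<in>s ` space L. measure L {t\<in>space L. s t = y} *\<^sub>R g y)" .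
qed

context linear_nspace
begin

definition bounded_functional :: "('v => real) => real => bool" where
 "bounded_functional p B \<longleftrightarrow> (\<forall>u\<in>carr X. \<forall>v\<in>carr X. p (u + v) = p u + p v) \<and>
  (\<forall>c. \<forall>u\<in>carr X. p (c *\<^sub>R u) = c * p u) \<and> (\<forall>u\<in>carr X. \<bar>p u\<bar> <= B * nrm X u) \<and> B \<ge> 0"

lemma functional_add: "bounded_functional p B ==> u \<in> carr X ==> v \<in> carr X ==> p (u + v) = p u + p v"
 and functional_scaleR: "bounded_functional p B ==> u \<in> carr X ==> p (c *\<^sub>R u) = c * p u"
 and functional_le: "bounded_functional p B ==> u \<in> carr X ==> \<bar>p u\<bar> <= B * nrm X u"
 and functional_nonneg: "bounded_functional p B ==> B \<ge> 0"
 by (simp_all add: bounded_functional_def)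

lemma functional_diff: "bounded_functional p B ==> u \<in> carr X ==> v \<in> carr X ==> p (u - v) = p u - p v"
 using functional_add[of p B u "(-1) *\<^sub>R v"] functional_scaleR[of p B v "-1"] carr_scaleR[of v "-1"] by simp

lemma functional_uminus: "bounded_functional p B ==> u \<in> carr X ==> p (- u) = - p u"
 using functional_scaleR[of p B u "-1"] by simp

lemma functional_sum:
 assumes p: "bounded_functional p B" and f: "!!i. i \<in> I ==> f i \<in> carr X" and I: "finite I"
 shows "p (sum f I) = (\<Sum>i\<in>I. p (f i))"
 using I f
proof (induction I)
 case empty
 then show ?case using functional_scaleR[OF p carr_zero, of 0] by simp
next
 case (insert i I)
 then show ?case using functional_add[OF p, of "f i" "sum f I"] carr_sum[of I f] by simp
qed

lemma functional_measurable:
 assumes p: "bounded_functional p B" and f: "strongly_measurable X L f"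
 shows "(\<lambda>t. p (f t)) \<in> borel_measurable L"
proof -
 obtain s where s: "\<forall>n. simple_function L (s n) \<and> s n ` space L \<subseteq> carr X"
  "\<forall>x\<in>space L. (\<lambda>n. nrm X (f x - s n x)) \<longlonglongrightarrow> 0"
  using f[unfolded strongly_measurable_def] by (elim conjE exE)
 have fc: "f t \<in> carr X" if "t \<in> space L" for t using f that by (simp add: strongly_measurable_def)
 have sc: "s n t \<in> carr X" if "t \<in> space L" for n t using subsetD[OF s(1)[rule_format, THEN conjunct2] imageI[OF that]] .
 show ?thesis
 proof (rule borel_measurable_LIMSEQ_metric)
  show "(\<lambda>t. p (s n t)) \<in> borel_measurable L" for n
   using simple_function_compose[OF s(1)[rule_format, THEN conjunct1], of p n]
   by (intro borel_measurable_simple_function) (simp add: comp_def)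
  fix t assume t: "t \<in> space L"
  have "(\<lambda>n. B * nrm X (f t - s n t)) \<longlonglongrightarrow> B * 0" by (intro tendsto_mult_left s(2)[rule_format] t)
  then have "(\<lambda>n. B * nrm X (f t - s n t)) \<longlonglongrightarrow> 0" by simp
  then have "(\<lambda>n. p (f t - s n t)) \<longlonglongrightarrow> 0"
   by (rule LIMSEQ_null_comparison[rotated]) (simp add: functional_le[OF p carr_diff[OF fc[OF t] sc[OF t]]])
  then have "(\<lambda>n. p (f t) - p (s n t)) \<longlonglongrightarrow> 0" unfolding functional_diff[OF p fc[OF t] sc[OF t]] .
  from tendsto_diff[OF tendsto_const[of "p (f t)"] this] show "(\<lambda>n. p (s n t)) \<longlonglongrightarrow> p (f t)" by simp
 qed
qed

text \<open>Both sides are limits of the same numbers: on simple functions the functional commutes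
  with the integral by linearity, and its bound \<open>B\<close> controls the errors in the
  integrand and in the value \<open>y\<close>.\<close>

lemma functional_bochner_integral:
 assumes L: "finite_measure L" and p: "bounded_functional p B"
  and f: "has_bochner_integral_in X L f y"
  and int: "integrable L (\<lambda>t. p (f t))"
 shows "(LINT t|L. p (f t)) = p y"
proof -
 note f' = f[unfolded has_bochner_integral_in_def]
 note sm = f'[THEN conjunct1] and y = f'[THEN conjunct2, THEN conjunct1]
 obtain s where s: "\<forall>n. Bochner_Integration.simple_bochner_integrable L (s n) \<and> s n ` space L \<subseteq> carr X"
  "(\<lambda>n. \<integral>\<^sup>+x. ennreal (nrm X (f x - s n x)) \<partial>L) \<longlonglongrightarrow> 0"
  "(\<lambda>n. nrm X (Bochner_Integration.simple_bochner_integral L (s n) - y)) \<longlonglongrightarrow> 0"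
  using f[unfolded has_bochner_integral_in_def] by (elim conjE exE)
 have fc: "f t \<in> carr X" if "t \<in> space L" for t using sm that by (simp add: strongly_measurable_def)
 note sub = s(1)[rule_format, THEN conjunct2]
 have sf: "simple_function L (s n)" for n
  using s(1)[rule_format, THEN conjunct1, of n] by (simp add: Bochner_Integration.simple_bochner_integrable.simps)
 have sc: "s n t \<in> carr X" if "t \<in> space L" for n t using subsetD[OF sub imageI[OF that]] .
 let ?I = "\<lambda>n. Bochner_Integration.simple_bochner_integral L (s n)"
 have pI: "p (?I n) = (LINT t|L. p (s n t))" for n
 proof -
  have fin: "finite (s n ` space L)" using sf[of n] by (simp add: simple_function_def)
  have "p (?I n) = (\<Sum>y\<in>s n ` space L. p (measure L {t\<in>space L. s n t = y} *\<^sub>R y))"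
   unfolding Bochner_Integration.simple_bochner_integral_def
   by (rule functional_sum[OF p carr_scaleR fin]) (rule subsetD[OF sub])
  also have "... = (\<Sum>y\<in>s n ` space L. measure L {t\<in>space L. s n t = y} *\<^sub>R p y)"
   by (rule sum.cong[OF refl]) (simp add: functional_scaleR[OF p subsetD[OF sub]])
  finally show ?thesis unfolding integral_simple_function_compose(2)[OF L sf] .
 qed
 have B: "B \<ge> 0" by (rule functional_nonneg[OF p])
 have t1: "(\<lambda>n. ennreal B * (\<integral>\<^sup>+x. ennreal (nrm X (f x - s n x)) \<partial>L)) \<longlonglongrightarrow> ennreal B * 0"
  by (intro ennreal_tendsto_cmult s(2)) simp
 have t2: "ennreal (norm ((LINT t|L. p (f t)) - p (?I n))) <= ennreal B * (\<integral>\<^sup>+x. ennreal (nrm X (f x - s n x)) \<partial>L)" for n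
 proof -
  have "(LINT t|L. p (f t)) - p (?I n) = (LINT t|L. p (f t) - p (s n t))"
   unfolding pI using int integral_simple_function_compose(1)[OF L sf, where g = p] by simp
  also have "ennreal (norm ...) <= (\<integral>\<^sup>+t. ennreal (norm (p (f t) - p (s n t))) \<partial>L)"
   using int integral_simple_function_compose(1)[OF L sf, where g = p] by (intro integral_norm_bound_ennreal) auto
  also have "... <= (\<integral>\<^sup>+t. ennreal B * ennreal (nrm X (f t - s n t)) \<partial>L)"
  proof (rule nn_integral_mono)
   fix t assume t: "t \<in> space L"
   have "\<bar>p (f t) - p (s n t)\<bar> <= B * nrm X (f t - s n t)"
    using functional_le[OF p carr_diff[OF fc[OF t] sc[OF t]]] functional_diff[OF p fc[OF t] sc[OF t]] by simp
   then show "ennreal (norm (p (f t) - p (s n t))) <= ennreal B * ennreal (nrm X (f t - s n t))"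
    using B by (simp add: ennreal_mult'[symmetric] ennreal_leI)
  qed
  also have "... = ennreal B * (\<integral>\<^sup>+t. ennreal (nrm X (f t - s n t)) \<partial>L)"
   using nrm_diff_measurable[OF sm sf sub] by (intro nn_integral_cmult) simp
  finally show ?thesis .
 qed
 have "(\<lambda>n. ennreal (norm ((LINT t|L. p (f t)) - p (?I n)))) \<longlonglongrightarrow> ennreal 0"
 proof (rule tendsto_sandwich[where f = "\<lambda>_. 0" and h = "\<lambda>n. ennreal B * (\<integral>\<^sup>+x. ennreal (nrm X (f x - s n x)) \<partial>L)"])
  show "\<forall>\<^sub>F n in sequentially. ennreal (norm ((LINT t|L. p (f t)) - p (?I n))) <= ennreal B * (\<integral>\<^sup>+x. ennreal (nrm X (f x - s n x)) \<partial>L)"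
   by (intro always_eventually allI t2)
 qed (use t1 in simp_all)
 then have 1: "(\<lambda>n. norm ((LINT t|L. p (f t)) - p (?I n))) \<longlonglongrightarrow> 0"
  by (subst (asm) tendsto_ennreal_iff) auto
 have Ic: "?I n \<in> carr X" for n by (rule simple_bochner_integral_in_carr[OF sub])
 have "(\<lambda>n. B * nrm X (?I n - y)) \<longlonglongrightarrow> B * 0" by (intro tendsto_mult_left s(3))
 then have "(\<lambda>n. B * nrm X (?I n - y)) \<longlonglongrightarrow> 0" by simp
 then have "(\<lambda>n. p (?I n - y)) \<longlonglongrightarrow> 0"
  by (rule LIMSEQ_null_comparison[rotated]) (simp add: functional_le[OF p carr_diff[OF Ic y]])
 then have 2: "(\<lambda>n. p (?I n) - p y) \<longlonglongrightarrow> 0" unfolding functional_diff[OF p Ic y] .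
 have "(\<lambda>n. ((LINT t|L. p (f t)) - p (?I n)) + (p (?I n) - p y)) \<longlonglongrightarrow> 0 + 0"
  by (intro tendsto_add 2) (rule tendsto_norm_zero_cancel[OF 1])
 then show ?thesis by (simp add: LIMSEQ_const_iff)
qed

end

text \<open>Approximation by the best of the first \<open>n\<close> members of a sequence.\<close>

lemma strongly_measurable_if_dense_sequence:
 fixes c :: "nat => 'v::real_vector"
 assumes f: "!!t. t \<in> space L ==> f t \<in> carr X" and c: "!!n. c n \<in> carr X"
  and meas: "!!n. (\<lambda>t. nrm X (f t - c n)) \<in> borel_measurable L"
  and nonneg: "!!t n. t \<in> space L ==> 0 <= nrm X (f t - c n)"
  and dense: "!!t e. t \<in> space L ==> e > 0 ==> \<exists>n. nrm X (f t - c n) < e"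
 shows "strongly_measurable X L f"
proof -
 define s where "s = rec_nat (\<lambda>t. c 0) (\<lambda>n r t. if nrm X (f t - c (Suc n)) < nrm X (f t - r t) then c (Suc n) else r t)"
 have s0: "s 0 = (\<lambda>t. c 0)" and sS: "s (Suc n) = (\<lambda>t. if nrm X (f t - c (Suc n)) < nrm X (f t - s n t) then c (Suc n) else s n t)" for n
  by (auto simp: s_def)
 have sm: "simple_function L (s n) \<and> (\<lambda>t. nrm X (f t - s n t)) \<in> borel_measurable L" for n
 proof (induction n)
  case 0 then show ?case unfolding s0 using meas by simp
 next
  case (Suc n)
  have "(\<lambda>t. nrm X (f t - s (Suc n) t)) = (\<lambda>t. min (nrm X (f t - c (Suc n))) (nrm X (f t - s n t)))"
   by (auto simp: sS min_def fun_eq_iff)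
  moreover have "(\<lambda>t. min (nrm X (f t - c (Suc n))) (nrm X (f t - s n t))) \<in> borel_measurable L"
   by (intro borel_measurable_min meas Suc[THEN conjunct2])
  moreover have A: "{t \<in> space L. nrm X (f t - c (Suc n)) < nrm X (f t - s n t)} \<in> sets L"
   using meas[of "Suc n"] Suc[THEN conjunct2] by (rule borel_measurable_less)
  have "simple_function L (s (Suc n))"
   unfolding sS by (rule simple_function_If[OF simple_function_const Suc[THEN conjunct1] A])
  ultimately show ?case by simp
 qed
 have sc: "s n t \<in> carr X" for n t by (induction n) (auto simp: s0 sS c)
 have rng: "\<exists>k. s n t = c k" for n t by (induction n) (auto simp: s0 sS)
 have sle: "nrm X (f t - s n t) <= nrm X (f t - c j)" if "j <= n" for j n t
  using that
 proof (induction n)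
  case (Suc n)
  then show ?case by (cases "j = Suc n") (fastforce simp: sS)+
 qed (simp add: s0)
 have "(\<lambda>n. nrm X (f t - s n t)) \<longlonglongrightarrow> 0" if t: "t \<in> space L" for t
 proof (rule LIMSEQ_I)
  fix e :: real assume "e > 0"
  then obtain j where j: "nrm X (f t - c j) < e" using dense[OF t] by blast
  show "\<exists>k. \<forall>n\<ge>k. norm (nrm X (f t - s n t) - 0) < e"
  proof (intro exI allI impI)
   fix n assume "n \<ge> j"
   obtain k where "s n t = c k" using rng by blast
   then have "0 <= nrm X (f t - s n t)" using nonneg[OF t] by simp
   then show "norm (nrm X (f t - s n t) - 0) < e" using sle[OF \<open>n \<ge> j\<close>, of t] j by simp
  qed
 qed
 then show ?thesis unfolding strongly_measurable_def using f sm sc by (intro conjI exI[of _ s]) auto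
qed

text \<open>\<open>J\<close> identifies the space, up to elements of seminorm 0, with a closed
  subspace of a Hilbert space type; for the Sobolev space it is \<open>grad\<close>. Strong
  measurability and square integrability then reduce to the usual notions for functions with values
  in a separable Hilbert space.\<close>

locale hilbert_nspace = linear_nspace X
 for X :: "'v::real_vector nspace" +
 fixes J :: "'v => 'h::{real_inner, banach, second_countable_topology}"
 assumes J_add: "!!u v. u \<in> carr X ==> v \<in> carr X ==> J (u + v) = J u + J v"
  and J_scaleR: "!!c u. u \<in> carr X ==> J (c *\<^sub>R u) = c *\<^sub>R J u"
  and nrm_J: "!!u. u \<in> carr X ==> nrm X u = norm (J u)"
  and closed_range: "closed (J ` carr X)"
begin

abbreviation "G \<equiv> J ` carr X"

text \<open>A choice of preimages, which need not be linear; linear statements about it are verified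
  after applying \<open>J\<close>.\<close>

definition K :: "'h => 'v" where "K = inv_into (carr X) J"

lemma K_carr: "g \<in> G ==> K g \<in> carr X" unfolding K_def by (rule inv_into_into)
lemma J_K: "g \<in> G ==> J (K g) = g" unfolding K_def by (rule f_inv_into_f)

lemma J_diff: "u \<in> carr X ==> v \<in> carr X ==> J (u - v) = J u - J v"
 using J_add[of u "(-1) *\<^sub>R v"] J_scaleR[of v "-1"] carr_scaleR[of v "-1"] by simp

lemma J_uminus: "u \<in> carr X ==> J (- u) = - J u"
 using J_scaleR[of u "-1"] by simp

lemma J_zero: "J 0 = 0" using J_scaleR[OF carr_zero, of 0] by simp

lemma J_sum:
 assumes "finite I" "!!i. i \<in> I ==> f i \<in> carr X"
 shows "J (sum f I) = (\<Sum>i\<in>I. J (f i))"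
 using assms
proof (induction I)
 case empty then show ?case by (simp add: J_zero)
next
 case (insert i I) then show ?case using carr_sum[of I f] by (simp add: J_add)
qed

lemma subspace_range: "subspace G"
proof (rule subspaceI)
 show "0 \<in> G" using J_zero[symmetric] carr_zero by (rule image_eqI)
 show "x + y \<in> G" if x: "x \<in> G" and y: "y \<in> G" for x y
 proof -
  obtain u where u: "x = J u" "u \<in> carr X" using x by (rule imageE)
  obtain v where v: "y = J v" "v \<in> carr X" using y by (rule imageE)
  have "x + y = J (u + v)" using u v by (simp add: J_add)
  then show ?thesis using carr_add[OF u(2) v(2)] by (rule image_eqI)
 qed
 show "c *\<^sub>R x \<in> G" if x: "x \<in> G" for c x
 proof -
  obtain u where u: "x = J u" "u \<in> carr X" using x by (rule imageE)
  have "c *\<^sub>R x = J (c *\<^sub>R u)" using u by (simp add: J_scaleR)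
  then show ?thesis using carr_scaleR[OF u(2)] by (rule image_eqI)
 qed
qed

text \<open>In the converse direction the simple functions that approximate \<open>J\<close> of
  \<open>f\<close> may leave the range. Projecting them back and lifting them by \<open>K\<close>
  keeps them simple and convergent.\<close>

lemma strongly_measurable_iff:
 "strongly_measurable X N f \<longleftrightarrow> (\<forall>x\<in>space N. f x \<in> carr X) \<and> (\<lambda>x. J (f x)) \<in> borel_measurable N"
proof
 assume f: "strongly_measurable X N f"
 obtain s where s: "\<forall>n. simple_function N (s n) \<and> s n ` space N \<subseteq> carr X"
  "\<forall>x\<in>space N. (\<lambda>n. nrm X (f x - s n x)) \<longlonglongrightarrow> 0"
  using f[unfolded strongly_measurable_def] by (elim conjE exE)
 have fc: "f t \<in> carr X" if "t \<in> space N" for t using f that by (simp add: strongly_measurable_def)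
 have sc: "s n t \<in> carr X" if "t \<in> space N" for n t using subsetD[OF s(1)[rule_format, THEN conjunct2] imageI[OF that]] .
 have "(\<lambda>x. J (f x)) \<in> borel_measurable N"
 proof (rule borel_measurable_LIMSEQ_metric)
  show "(\<lambda>t. J (s n t)) \<in> borel_measurable N" for n
   using simple_function_compose[OF s(1)[rule_format, THEN conjunct1], of J n]
   by (intro borel_measurable_simple_function) (simp add: comp_def)
  fix t assume t: "t \<in> space N"
  have eq: "nrm X (f t - s n t) = norm (J (f t) - J (s n t))" for n
   using nrm_J[OF carr_diff[OF fc[OF t] sc[OF t]]] J_diff[OF fc[OF t] sc[OF t]] by simp
  have "(\<lambda>n. norm (J (f t) - J (s n t))) \<longlonglongrightarrow> 0"
   using s(2)[rule_format, OF t] by (simp only: eq)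
  then have "(\<lambda>n. J (f t) - J (s n t)) \<longlonglongrightarrow> 0" by (rule tendsto_norm_zero_cancel)
  from tendsto_diff[OF tendsto_const[of "J (f t)"] this] show "(\<lambda>n. J (s n t)) \<longlonglongrightarrow> J (f t)" by simp
 qed
 then show "(\<forall>x\<in>space N. f x \<in> carr X) \<and> (\<lambda>x. J (f x)) \<in> borel_measurable N" by (intro conjI ballI fc)
next
 assume f: "(\<forall>x\<in>space N. f x \<in> carr X) \<and> (\<lambda>x. J (f x)) \<in> borel_measurable N"
 note fm = f[THEN conjunct2]
 note fc = f[THEN conjunct1, rule_format]
 obtain s where s0: "(\<forall>i. simple_function N (s i)) \<and> (\<forall>x\<in>space N. (\<lambda>i. s i x) \<longlonglongrightarrow> J (f x)) \<and>
  (\<forall>i. \<forall>x\<in>space N. dist (s i x) 0 <= 2 * dist (J (f x)) 0)"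
  using borel_measurable_implies_sequence_metric[OF fm, of 0] by (rule exE)
 note s = s0[THEN conjunct1, rule_format] s0[THEN conjunct2, THEN conjunct1, rule_format]
 let ?s = "\<lambda>n x. K (proj G (s n x))"
 note PG = proj_in[OF subspace_range closed_range]
 have lim: "(\<lambda>n. nrm X (f x - ?s n x)) \<longlonglongrightarrow> 0" if x: "x \<in> space N" for x
 proof -
  have eq: "nrm X (f x - ?s n x) = norm (J (f x) - proj G (s n x))" for n
   using fc[OF x] K_carr[OF PG] by (simp add: nrm_J carr_diff J_diff J_K[OF PG])
  have "(\<lambda>n. proj G (s n x)) \<longlonglongrightarrow> proj G (J (f x))"
   by (rule bounded_linear.tendsto[OF bounded_linear_proj[OF subspace_range closed_range] s(2)[OF x]])
  also have "proj G (J (f x)) = J (f x)" using fc[OF x] by (intro proj_id[OF subspace_range closed_range] imageI)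
  finally have "(\<lambda>n. J (f x) - proj G (s n x)) \<longlonglongrightarrow> J (f x) - J (f x)" by (intro tendsto_diff tendsto_const)
  then have "(\<lambda>n. norm (J (f x) - proj G (s n x))) \<longlonglongrightarrow> 0" using tendsto_norm_zero by simp
  then show ?thesis by (simp only: eq)
 qed
 have simp: "simple_function N (?s n)" for n
  using simple_function_compose[OF s(1), of "\<lambda>h. K (proj G h)" n] by (simp add: comp_def)
 have car: "?s n ` space N \<subseteq> carr X" for n by (rule image_subsetI) (rule K_carr[OF PG])
 show "strongly_measurable X N f" unfolding strongly_measurable_def
  using fc lim simp car by (intro conjI exI[of _ ?s] allI ballI)
qed

subsection \<open>Square integrable functions with values in the space\<close>

lemma carr_bochner_L2: "f \<in> carr (bochner_L2 X N) \<longleftrightarrow> (\<forall>x\<in>space N. f x \<in> carr X) \<and> mem_L2 N (\<lambda>x. J (f x))"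
proof -
 have eq: "integrable N (\<lambda>x. (nrm X (f x))\<^sup>2) \<longleftrightarrow> integrable N (\<lambda>x. (norm (J (f x)))\<^sup>2)" if "\<forall>x\<in>space N. f x \<in> carr X"
  by (rule Bochner_Integration.integrable_cong[OF refl]) (simp add: nrm_J that)
 have 1: "f \<in> carr (bochner_L2 X N) \<longleftrightarrow> strongly_measurable X N f \<and> integrable N (\<lambda>x. (nrm X (f x))\<^sup>2)"
  by (simp add: bochner_L2_def)
 show ?thesis unfolding 1 strongly_measurable_iff mem_L2_def using eq by (intro iffI conjI; elim conjE; simp)
qed

lemma nrm_bochner_L2:
 assumes "!!x. x \<in> space N ==> f x \<in> carr X"
 shows "nrm (bochner_L2 X N) f = L2norm N (\<lambda>x. J (f x))"
proof -
 have "(LINT x|N. (nrm X (f x))\<^sup>2) = (LINT x|N. (norm (J (f x)))\<^sup>2)"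
  by (rule Bochner_Integration.integral_cong[OF refl]) (simp only: nrm_J[OF assms])
 then show ?thesis by (simp add: bochner_L2_def L2norm_def)
qed

lemma mem_L2_cong:
 assumes eq: "!!x. x \<in> space N ==> f x = g x"
 shows "mem_L2 N f \<longleftrightarrow> mem_L2 N g"
proof -
 have 1: "f \<in> borel_measurable N \<longleftrightarrow> g \<in> borel_measurable N" by (rule measurable_cong) (rule eq)
 have 2: "integrable N (\<lambda>x. (norm (f x))\<^sup>2) \<longleftrightarrow> integrable N (\<lambda>x. (norm (g x))\<^sup>2)"
  by (rule Bochner_Integration.integrable_cong[OF refl]) (simp only: eq)
 show ?thesis by (simp only: mem_L2_def 1 2)
qed

lemma L2norm_cong:
 assumes eq: "!!x. x \<in> space N ==> f x = g x"
 shows "L2norm N f = L2norm N g"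
proof -
 have "(LINT x|N. (norm (f x))\<^sup>2) = (LINT x|N. (norm (g x))\<^sup>2)"
  by (rule Bochner_Integration.integral_cong[OF refl]) (simp only: eq)
 then show ?thesis by (simp only: L2norm_def)
qed

lemma carr_bochner_L2D:
 assumes "f \<in> carr (bochner_L2 X N)"
 shows "!!x. x \<in> space N ==> f x \<in> carr X" and "mem_L2 N (\<lambda>x. J (f x))"
 using assms by (simp_all add: carr_bochner_L2)

lemma nrm_bochner_L2_carr: "u \<in> carr (bochner_L2 X N) ==> nrm (bochner_L2 X N) u = L2norm N (\<lambda>x. J (u x))"
 by (rule nrm_bochner_L2) (rule carr_bochner_L2D(1))

lemma bochner_L2_add:
 assumes u: "u \<in> carr (bochner_L2 X N)" and v: "v \<in> carr (bochner_L2 X N)"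
 shows "u + v \<in> carr (bochner_L2 X N)"
  and "nrm (bochner_L2 X N) (u + v) = L2norm N (\<lambda>x. J (u x) + J (v x))"
proof -
 have c: "(u + v) x \<in> carr X" and J: "J ((u + v) x) = J (u x) + J (v x)" if "x \<in> space N" for x
  using carr_bochner_L2D(1)[OF u that] carr_bochner_L2D(1)[OF v that] by (simp_all add: carr_add J_add)
 have "mem_L2 N (\<lambda>x. J ((u + v) x)) \<longleftrightarrow> mem_L2 N (\<lambda>x. J (u x) + J (v x))" by (rule mem_L2_cong) (rule J)
 then show uv: "u + v \<in> carr (bochner_L2 X N)"
  unfolding carr_bochner_L2 using c mem_L2_add[OF carr_bochner_L2D(2)[OF u] carr_bochner_L2D(2)[OF v]] by simp
 show "nrm (bochner_L2 X N) (u + v) = L2norm N (\<lambda>x. J (u x) + J (v x))"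
  unfolding nrm_bochner_L2_carr[OF uv] by (rule L2norm_cong) (rule J)
qed

lemma bochner_L2_scaleR:
 assumes u: "u \<in> carr (bochner_L2 X N)"
 shows "c *\<^sub>R u \<in> carr (bochner_L2 X N)"
  and "nrm (bochner_L2 X N) (c *\<^sub>R u) = L2norm N (\<lambda>x. c *\<^sub>R J (u x))"
proof -
 have c: "(c *\<^sub>R u) x \<in> carr X" and J: "J ((c *\<^sub>R u) x) = c *\<^sub>R J (u x)" if "x \<in> space N" for x
  using carr_bochner_L2D(1)[OF u that] by (simp_all add: scaleR_fun_def carr_scaleR J_scaleR)
 have "mem_L2 N (\<lambda>x. J ((c *\<^sub>R u) x)) \<longleftrightarrow> mem_L2 N (\<lambda>x. c *\<^sub>R J (u x))" by (rule mem_L2_cong) (rule J)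
 then show cu: "c *\<^sub>R u \<in> carr (bochner_L2 X N)"
  unfolding carr_bochner_L2 using c mem_L2_scaleR[OF carr_bochner_L2D(2)[OF u]] by simp
 show "nrm (bochner_L2 X N) (c *\<^sub>R u) = L2norm N (\<lambda>x. c *\<^sub>R J (u x))"
  unfolding nrm_bochner_L2_carr[OF cu] by (rule L2norm_cong) (rule J)
qed

lemma linear_nspace_bochner_L2: "linear_nspace (bochner_L2 X N)"
proof
 show "0 \<in> carr (bochner_L2 X N)" unfolding carr_bochner_L2 by (simp add: carr_zero J_zero mem_L2_zero)
 fix u assume u: "u \<in> carr (bochner_L2 X N)"
 show "c *\<^sub>R u \<in> carr (bochner_L2 X N)" for c by (rule bochner_L2_scaleR(1)[OF u])
 show "nrm (bochner_L2 X N) (c *\<^sub>R u) = \<bar>c\<bar> * nrm (bochner_L2 X N) u" for c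
  unfolding bochner_L2_scaleR(2)[OF u] nrm_bochner_L2_carr[OF u] by (rule L2norm_scaleR)
 fix v assume v: "v \<in> carr (bochner_L2 X N)"
 show "u + v \<in> carr (bochner_L2 X N)" by (rule bochner_L2_add(1)[OF u v])
 show "nrm (bochner_L2 X N) (u + v) <= nrm (bochner_L2 X N) u + nrm (bochner_L2 X N) v"
  unfolding bochner_L2_add(2)[OF u v] nrm_bochner_L2_carr[OF u] nrm_bochner_L2_carr[OF v]
  by (rule L2norm_triangle[OF carr_bochner_L2D(2)[OF u] carr_bochner_L2D(2)[OF v]])
qed

end

section \<open>Density in spaces of random variables with values in a separable space\<close>

subsection \<open>Separability of spaces of square integrable random variables\<close>

lemma L2norm_zero: "L2norm N (\<lambda>x. 0) = 0"
 by (simp add: L2norm_def)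

lemma L2norm_mono:
 assumes "mem_L2 N g" "f \<in> borel_measurable N" "AE x in N. norm (f x) <= norm (g x)"
 shows "L2norm N f <= L2norm N g"
proof -
 have sq: "AE x in N. (norm (f x))\<^sup>2 <= (norm (g x))\<^sup>2"
  using assms(3) by eventually_elim (simp add: power_mono)
 have "mem_L2 N f" by (rule mem_L2_bound[OF assms(2) mem_L2_integrable[OF assms(1)] sq])
 then have "(LINT x|N. (norm (f x))\<^sup>2) <= (LINT x|N. (norm (g x))\<^sup>2)"
  by (intro integral_mono_AE mem_L2_integrable assms sq)
 then show ?thesis by (simp add: L2norm_def)
qed

lemma L2norm_cong_AE:
 assumes "f \<in> borel_measurable N" "g \<in> borel_measurable N" "AE x in N. f x = g x"
 shows "L2norm N f = L2norm N g"
proof -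
 have "(LINT x|N. (norm (f x))\<^sup>2) = (LINT x|N. (norm (g x))\<^sup>2)"
  by (rule integral_cong_AE) (use assms in \<open>auto elim: eventually_mono\<close>)
 then show ?thesis by (simp add: L2norm_def)
qed

lemma L2norm_const_prob:
 assumes "prob_space M" shows "mem_L2 M (\<lambda>\<omega>. c)" "L2norm M (\<lambda>\<omega>. c) = norm c"
proof -
 interpret prob_space M by (rule assms)
 show "mem_L2 M (\<lambda>\<omega>. c)" by (simp add: mem_L2_def)
 show "L2norm M (\<lambda>\<omega>. c) = norm c" by (simp add: L2norm_def prob_space)
qed

text \<open>Finite sums of scalar random variables times fixed vectors. With both taken from
  countable dense sets they form a countable family.\<close>

definition elementary :: "(('w => real) \<times> 'h::real_normed_vector) list => 'w => 'h" where
 "elementary xs \<omega> = (\<Sum>(g, h)\<leftarrow>xs. g \<omega> *\<^sub>R h)"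

text \<open>Separability passes from scalar to vector values: the approximable functions are stable
  under sums and contain indicators times vectors, hence all simple functions, hence everything by
  dominated convergence.\<close>

lemma L2_dense_sequence:
 fixes M :: "'w measure"
 assumes M: "prob_space M" and sep: "separable_L2 M"
 obtains e :: "nat => 'w => 'h::{banach, second_countable_topology}"
 where "!!n. mem_L2 M (e n)" "!!w \<epsilon>. mem_L2 M w ==> \<epsilon> > 0 ==> \<exists>n. L2norm M (\<lambda>\<omega>. w \<omega> - e n \<omega>) < \<epsilon>"
proof -
 interpret prob_space M by (rule M)
 obtain C where C: "countable C" "\<forall>g\<in>C. square_integrable M g"
  "\<forall>f :: 'w => real. square_integrable M f --> (\<forall>e>0. \<exists>g\<in>C. sqrt (LINT \<omega>|M. (f \<omega> - g \<omega>)\<^sup>2) < e)"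
  using sep[unfolded separable_L2_def] by (elim conjE exE)
 have Cm: "mem_L2 M g" if "g \<in> C" for g using C(2)[rule_format, OF that] by (simp add: square_integrable_iff_mem_L2)
 obtain H0 :: "'h set" where H0: "countable H0" "UNIV \<subseteq> closure H0" using separable[of UNIV] by metis
 let ?L = "lists (C \<times> H0)"
 have evm: "mem_L2 M (elementary xs)" if "xs \<in> ?L" for xs :: "(('w => real) \<times> 'h) list"
  using that
 proof (induction xs)
  case Nil
  have "(elementary [] :: 'w => 'h) = (\<lambda>\<omega>. 0)" by (simp add: elementary_def fun_eq_iff)
  then show ?case by (simp add: mem_L2_zero)
 next
  case (Cons a xs)
  obtain g h where a: "a = (g, h)" by (cases a)
  have g: "mem_L2 M g" using Cons(1) a by (intro Cm) simp
  have "mem_L2 M (\<lambda>\<omega>. g \<omega> *\<^sub>R h)" using g by (auto simp: mem_L2_def power_mult_distrib)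
  moreover have "elementary (a # xs) = (\<lambda>\<omega>. g \<omega> *\<^sub>R h + elementary xs \<omega>)" by (simp add: elementary_def a fun_eq_iff)
  ultimately show ?case using mem_L2_add Cons.IH by simp
 qed
 define A where "A w \<longleftrightarrow> mem_L2 M w \<and> (\<forall>\<epsilon>>0. \<exists>xs\<in>?L. L2norm M (\<lambda>\<omega>. w \<omega> - elementary xs \<omega>) < \<epsilon>)" for w :: "'w => 'h"
 have A0: "A (\<lambda>\<omega>. 0)"
 proof -
  have "L2norm M (\<lambda>\<omega>. 0 - (elementary [] \<omega> :: 'h)) = 0" by (simp add: elementary_def L2norm_zero)
  then show ?thesis unfolding A_def using mem_L2_zero by (metis lists.Nil)
 qed
 have Aadd: "A (\<lambda>\<omega>. v \<omega> + w \<omega>)" if v: "A v" and w: "A w" for v w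
  unfolding A_def
 proof (intro conjI allI impI)
  have vm: "mem_L2 M v" and wm: "mem_L2 M w" using v w by (simp_all add: A_def)
  show "mem_L2 M (\<lambda>\<omega>. v \<omega> + w \<omega>)" by (rule mem_L2_add[OF vm wm])
  fix \<epsilon> :: real assume "\<epsilon> > 0"
  then have "\<epsilon> / 2 > 0" by simp
  then obtain xs ys where xs: "xs \<in> ?L" "L2norm M (\<lambda>\<omega>. v \<omega> - elementary xs \<omega>) < \<epsilon> / 2"
   and ys: "ys \<in> ?L" "L2norm M (\<lambda>\<omega>. w \<omega> - elementary ys \<omega>) < \<epsilon> / 2"
   using v w unfolding A_def by meson
  have "(\<lambda>\<omega>. (v \<omega> + w \<omega>) - elementary (xs @ ys) \<omega>) = (\<lambda>\<omega>. (v \<omega> - elementary xs \<omega>) + (w \<omega> - elementary ys \<omega>))"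
   by (simp add: elementary_def fun_eq_iff)
  then have "L2norm M (\<lambda>\<omega>. (v \<omega> + w \<omega>) - elementary (xs @ ys) \<omega>) <= L2norm M (\<lambda>\<omega>. v \<omega> - elementary xs \<omega>) + L2norm M (\<lambda>\<omega>. w \<omega> - elementary ys \<omega>)"
   using L2norm_triangle[OF mem_L2_diff[OF vm evm[OF xs(1)]] mem_L2_diff[OF wm evm[OF ys(1)]]] by simp
  then show "\<exists>xs\<in>?L. L2norm M (\<lambda>\<omega>. v \<omega> + w \<omega> - elementary xs \<omega>) < \<epsilon>"
   using xs ys by (intro bexI[of _ "xs @ ys"]) auto
 qed
 have Aind: "A (\<lambda>\<omega>. indicator E \<omega> *\<^sub>R h)" if E [measurable]: "E \<in> sets M" for E h
  unfolding A_def
 proof (intro conjI allI impI)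
  have im: "mem_L2 M (indicat_real E)"
   by (rule mem_L2_bound[where h = "\<lambda>_. 1"]) (auto split: split_indicator)
  show "mem_L2 M (\<lambda>\<omega>. indicator E \<omega> *\<^sub>R h)"
   by (rule mem_L2_bound[where h = "\<lambda>_. (norm h)\<^sup>2"]) (auto split: split_indicator)
  fix \<epsilon> :: real assume \<epsilon>: "\<epsilon> > 0"
  have "h \<in> closure H0" using H0(2) by blast
  then obtain h' where h': "h' \<in> H0" "dist h' h < \<epsilon> / 2" using \<epsilon> half_gt_zero unfolding closure_approachable by metis
  \<comment> \<open>Half of the error is spent on replacing the vector, half on replacing the
    indicator, where the error is multiplied by the norm of \<open>h'\<close>; adding 1 avoids
    division by zero.\<close>
  define \<delta> where "\<delta> = \<epsilon> / 2 / (norm h' + 1)"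
  have n1: "norm h' + 1 > 0" using norm_ge_zero[of h'] by linarith
  have \<delta>: "\<delta> > 0" using \<epsilon> n1 by (simp add: \<delta>_def)
  obtain g where g: "g \<in> C" "sqrt (LINT \<omega>|M. (indicat_real E \<omega> - g \<omega>)\<^sup>2) < \<delta>"
   using C(3)[rule_format, of "indicat_real E" \<delta>] im \<delta> by (auto simp: square_integrable_iff_mem_L2)
  note gm = Cm[OF g(1)]
  have [measurable]: "g \<in> borel_measurable M" using gm by (simp add: mem_L2_def)
  have m1: "mem_L2 M (\<lambda>\<omega>. indicat_real E \<omega> *\<^sub>R (h - h'))"
   by (rule mem_L2_bound[where h = "\<lambda>_. (norm (h - h'))\<^sup>2"]) (auto split: split_indicator)
  have m2: "mem_L2 M (\<lambda>\<omega>. (indicat_real E \<omega> - g \<omega>) *\<^sub>R h')"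
   using mem_L2_diff[OF im gm] by (auto simp: mem_L2_def power_mult_distrib)
  have "L2norm M (\<lambda>\<omega>. indicat_real E \<omega> *\<^sub>R (h - h')) <= L2norm M (\<lambda>\<omega>. h - h')"
   by (rule L2norm_mono[OF L2norm_const_prob(1)[OF M]]) (auto split: split_indicator)
  also have "... < \<epsilon> / 2" using h'(2) by (simp add: L2norm_const_prob(2)[OF M] dist_norm norm_minus_commute)
  finally have l1: "L2norm M (\<lambda>\<omega>. indicat_real E \<omega> *\<^sub>R (h - h')) < \<epsilon> / 2" .
  have "L2norm M (\<lambda>\<omega>. (indicat_real E \<omega> - g \<omega>) *\<^sub>R h') = norm h' * sqrt (LINT \<omega>|M. (indicat_real E \<omega> - g \<omega>)\<^sup>2)"
   unfolding L2norm_def by (simp add: power_mult_distrib real_sqrt_mult)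
  also have "... <= norm h' * \<delta>" using g(2) by (intro mult_left_mono) auto
  also have "... <= (norm h' + 1) * \<delta>" using \<delta> by (intro mult_right_mono) auto
  also have "... = \<epsilon> / 2" using n1 by (auto simp: \<delta>_def field_simps) 
  finally have l2: "L2norm M (\<lambda>\<omega>. (indicat_real E \<omega> - g \<omega>) *\<^sub>R h') <= \<epsilon> / 2" .
  have "(\<lambda>\<omega>. indicat_real E \<omega> *\<^sub>R h - elementary [(g, h')] \<omega>) = (\<lambda>\<omega>. indicat_real E \<omega> *\<^sub>R (h - h') + (indicat_real E \<omega> - g \<omega>) *\<^sub>R h')"
   by (simp add: elementary_def fun_eq_iff algebra_simps)
  then have "L2norm M (\<lambda>\<omega>. indicat_real E \<omega> *\<^sub>R h - elementary [(g, h')] \<omega>) < \<epsilon>"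
   using L2norm_triangle[OF m1 m2] l1 l2 by simp
  then show "\<exists>xs\<in>?L. L2norm M (\<lambda>\<omega>. indicat_real E \<omega> *\<^sub>R h - elementary xs \<omega>) < \<epsilon>"
   using g(1) h'(1) by (intro bexI[of _ "[(g, h')]"]) auto
 qed
 have Acong: "A w" if "A v" "!!\<omega>. \<omega> \<in> space M ==> v \<omega> = w \<omega>" for v w
 proof -
  have 1: "mem_L2 M w"
   by (rule mem_L2_cong_AE[of M v]) (use that in \<open>auto simp: A_def mem_L2_def cong: measurable_cong\<close>)
  have 2: "L2norm M (\<lambda>\<omega>. v \<omega> - elementary xs \<omega>) = L2norm M (\<lambda>\<omega>. w \<omega> - elementary xs \<omega>)" for xs
   unfolding L2norm_def using that(2) by (intro arg_cong[where f = sqrt] Bochner_Integration.integral_cong) auto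
  show ?thesis using that(1) 1 unfolding A_def 2 by simp
 qed
 have Asimple: "A s" if s: "simple_function M s" for s
 proof (rule Acong)
  have fin: "finite (s ` space M)" using s by (simp add: simple_function_def)
  have meas: "s -` {y} \<inter> space M \<in> sets M" for y using simple_functionD(2)[OF s, of "{y}"] .
  have "A (\<lambda>\<omega>. \<Sum>y\<in>F. indicator (s -` {y} \<inter> space M) \<omega> *\<^sub>R y)" if "finite F" for F
   using that
  proof induction
   case empty then show ?case using A0 by simp
  next
   case (insert y F) then show ?case using Aadd[OF Aind[OF meas[of y], of y] insert.IH] by (simp only: sum.insert[OF insert(1,2)])
  qed
  then show "A (\<lambda>\<omega>. \<Sum>y\<in>s ` space M. indicator (s -` {y} \<inter> space M) \<omega> *\<^sub>R y)" using fin .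
  fix \<omega> assume \<omega>: "\<omega> \<in> space M"
  have "(\<Sum>y\<in>s ` space M. indicator (s -` {y} \<inter> space M) \<omega> *\<^sub>R y) = (\<Sum>y\<in>s ` space M. if y = s \<omega> then y else 0)"
   using \<omega> by (intro sum.cong) (auto split: split_indicator)
  also have "... = s \<omega>" using fin \<omega> by (simp add: sum.delta)
  finally show "(\<Sum>y\<in>s ` space M. indicator (s -` {y} \<inter> space M) \<omega> *\<^sub>R y) = s \<omega>" .
 qed
 have Aall: "A w" if w: "mem_L2 M w" for w
  unfolding A_def
 proof (intro conjI allI impI)
  show "mem_L2 M w" by (rule w)
  fix \<epsilon> :: real assume \<epsilon>: "\<epsilon> > 0"
  obtain s where s0: "(\<forall>i. simple_function M (s i)) \<and> (\<forall>x\<in>space M. (\<lambda>i. s i x) \<longlonglongrightarrow> w x) \<and>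
   (\<forall>i. \<forall>x\<in>space M. dist (s i x) 0 <= 2 * dist (w x) 0)"
   using borel_measurable_implies_sequence_metric[OF mem_L2_measurable[OF w], of 0] by (rule exE)
  note s = s0[THEN conjunct1, rule_format] s0[THEN conjunct2, THEN conjunct1, rule_format] s0[THEN conjunct2, THEN conjunct2, rule_format]
  have [measurable]: "w \<in> borel_measurable M" "s i \<in> borel_measurable M" for i
   using mem_L2_measurable[OF w] borel_measurable_simple_function[OF s(1)] by auto
  have "(\<lambda>i. LINT \<omega>|M. (norm (w \<omega> - s i \<omega>))\<^sup>2) \<longlonglongrightarrow> (LINT \<omega>|M. 0)"
  \<comment> \<open>The simple functions satisfy |s i| <= 2 |w|, so the squared error is at most (3
    |w|)^2.\<close>
  proof (rule integral_dominated_convergence[where w = "\<lambda>\<omega>. 9 * (norm (w \<omega>))\<^sup>2"])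
   show "integrable M (\<lambda>\<omega>. 9 * (norm (w \<omega>))\<^sup>2)" using mem_L2_integrable[OF w] by simp
   show "AE \<omega> in M. (\<lambda>i. (norm (w \<omega> - s i \<omega>))\<^sup>2) \<longlonglongrightarrow> 0"
   proof (rule AE_I2)
    fix \<omega> assume "\<omega> \<in> space M"
    then have "(\<lambda>i. (norm (w \<omega> - s i \<omega>))\<^sup>2) \<longlonglongrightarrow> (norm (w \<omega> - w \<omega>))\<^sup>2" by (intro tendsto_intros s(2))
    then show "(\<lambda>i. (norm (w \<omega> - s i \<omega>))\<^sup>2) \<longlonglongrightarrow> 0" by simp
   qed
   show "AE \<omega> in M. norm ((norm (w \<omega> - s i \<omega>))\<^sup>2) <= 9 * (norm (w \<omega>))\<^sup>2" for i
   proof (rule AE_I2)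
    fix \<omega> assume "\<omega> \<in> space M"
    then have "norm (w \<omega> - s i \<omega>) <= 3 * norm (w \<omega>)" using s(3)[of \<omega> i] norm_triangle_ineq4[of "w \<omega>" "s i \<omega>"] by simp
    then have "(norm (w \<omega> - s i \<omega>))\<^sup>2 <= (3 * norm (w \<omega>))\<^sup>2" by (intro power_mono) auto
    then show "norm ((norm (w \<omega> - s i \<omega>))\<^sup>2) <= 9 * (norm (w \<omega>))\<^sup>2" by (simp add: power_mult_distrib)
   qed
  qed measurable
  then have "(\<lambda>i. sqrt (LINT \<omega>|M. (norm (w \<omega> - s i \<omega>))\<^sup>2)) \<longlonglongrightarrow> sqrt (LINT \<omega>|M. 0)" by (rule tendsto_real_sqrt)
  then have "(\<lambda>i. L2norm M (\<lambda>\<omega>. w \<omega> - s i \<omega>)) \<longlonglongrightarrow> 0" by (simp add: L2norm_def)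
  then have "\<forall>\<^sub>F i in sequentially. L2norm M (\<lambda>\<omega>. w \<omega> - s i \<omega>) < \<epsilon> / 2"
   by (rule order_tendstoD(2)) (use \<epsilon> in simp)
  then have "\<exists>i. L2norm M (\<lambda>\<omega>. w \<omega> - s i \<omega>) < \<epsilon> / 2" by (rule eventually_happens'[OF sequentially_bot])
  then obtain i where i: "L2norm M (\<lambda>\<omega>. w \<omega> - s i \<omega>) < \<epsilon> / 2" by (rule exE)
  have As: "A (s i)" by (rule Asimple[OF s(1)])
  have "\<exists>xs\<in>?L. L2norm M (\<lambda>\<omega>. s i \<omega> - elementary xs \<omega>) < \<epsilon> / 2"
   by (rule As[unfolded A_def, THEN conjunct2, THEN spec, THEN mp, OF half_gt_zero[OF \<epsilon>]])
  then obtain xs where xs: "xs \<in> ?L" "L2norm M (\<lambda>\<omega>. s i \<omega> - elementary xs \<omega>) < \<epsilon> / 2" by (rule bexE)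
  have sm: "mem_L2 M (s i)" using As by (simp add: A_def)
  have "L2norm M (\<lambda>\<omega>. (w \<omega> - s i \<omega>) + (s i \<omega> - elementary xs \<omega>)) <= L2norm M (\<lambda>\<omega>. w \<omega> - s i \<omega>) + L2norm M (\<lambda>\<omega>. s i \<omega> - elementary xs \<omega>)"
   by (rule L2norm_triangle[OF mem_L2_diff[OF w sm] mem_L2_diff[OF sm evm[OF xs(1)]]])
  then have "L2norm M (\<lambda>\<omega>. w \<omega> - elementary xs \<omega>) < \<epsilon>" using i xs(2) by simp
  then show "\<exists>xs\<in>?L. L2norm M (\<lambda>\<omega>. w \<omega> - elementary xs \<omega>) < \<epsilon>" using xs(1) by (rule bexI)
 qed
 have "countable ?L" using C(1) H0(1) by (intro countable_lists countable_SIGMA)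
 moreover have "?L \<noteq> {}" using lists.Nil[of "C \<times> H0"] by (auto simp only: empty_iff)
 ultimately have r: "range (from_nat_into ?L) = ?L" by (intro range_from_nat_into)
 define r where "r = from_nat_into ?L"
 note r = r[folded r_def]
 show thesis
 proof (rule that[of "\<lambda>n. elementary (r n)"])
  show "mem_L2 M (elementary (r n))" for n by (rule evm) (simp only: r[symmetric] rangeI)
  fix w :: "'w => 'h" and \<epsilon> :: real assume w: "mem_L2 M w" and \<epsilon>: "\<epsilon> > 0"
  obtain xs where xs: "xs \<in> ?L" "L2norm M (\<lambda>\<omega>. w \<omega> - elementary xs \<omega>) < \<epsilon>" using Aall[OF w, unfolded A_def, THEN conjunct2, THEN spec, THEN mp, OF \<epsilon>] by (rule bexE)
  have "xs \<in> range r" using xs(1) unfolding r .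
  then obtain n where "xs = r n" by (rule rangeE)
  then show "\<exists>n. L2norm M (\<lambda>\<omega>. w \<omega> - elementary (r n) \<omega>) < \<epsilon>" using xs(2) by (intro exI[of _ n]) simp
 qed
qed

section \<open>Measurability and Bochner integrals of sections\<close>

subsection \<open>Jointly measurable functions as Bochner functions of time\<close>

lemma norm_integral_square_le:
 assumes L: "finite_measure L" and f: "mem_L2 L f"
 shows "(norm (LINT t|L. f t))\<^sup>2 <= measure L (space L) * (LINT t|L. (norm (f t))\<^sup>2)"
proof -
 interpret finite_measure L by (rule L)
 have one: "mem_L2 L (\<lambda>t. 1 :: real)" by (simp add: mem_L2_def)
 have i: "integrable L f" by (rule mem_L2_integrable_finite[OF f L])
 have "norm (LINT t|L. f t) <= (LINT t|L. norm (f t) * norm (1::real))" using integral_norm_bound[of L f] by simp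
 also have "... <= L2norm L f * L2norm L (\<lambda>t. 1 :: real)" by (rule L2_Cauchy_Schwarz[OF f one])
 finally have "(norm (LINT t|L. f t))\<^sup>2 <= (L2norm L f * L2norm L (\<lambda>t. 1 :: real))\<^sup>2" by (intro power_mono) auto
 also have "... = (LINT t|L. (norm (f t))\<^sup>2) * measure L (space L)" unfolding power_mult_distrib L2norm_power2 by simp
 finally show ?thesis by (simp add: mult.commute)
qed

text \<open>Fubini for the squared norms makes almost every path square integrable; Cauchy-Schwarz
  in time gives the bound on each path, which is then integrated over \<omega>.\<close>

lemma joint_L2:
 fixes A :: "'t \<times> 'w => 'h::{banach, second_countable_topology}"
 assumes L: "finite_measure L" and M: "prob_space M"
  and A: "A \<in> borel_measurable (L \<Otimes>\<^sub>M M)"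
  and sec: "!!t. t \<in> space L ==> mem_L2 M (\<lambda>\<omega>. A (t, \<omega>))"
  and int: "integrable L (\<lambda>t. (L2norm M (\<lambda>\<omega>. A (t, \<omega>)))\<^sup>2)"
 shows "AE \<omega> in M. mem_L2 L (\<lambda>t. A (t, \<omega>))"
  and "mem_L2 M (\<lambda>\<omega>. LINT t|L. A (t, \<omega>))"
  and "(L2norm M (\<lambda>\<omega>. LINT t|L. A (t, \<omega>)))\<^sup>2 <= measure L (space L) * (LINT t|L. (L2norm M (\<lambda>\<omega>. A (t, \<omega>)))\<^sup>2)"
proof -
 interpret L: finite_measure L by (rule L)
 interpret M: prob_space M by (rule M)
 interpret P: pair_sigma_finite L M ..
 note [measurable] = A
 have pint: "integrable (L \<Otimes>\<^sub>M M) (\<lambda>(t, \<omega>). (norm (A (t, \<omega>)))\<^sup>2)"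
 proof (rule P.Fubini_integrable)
  show "(\<lambda>(t, \<omega>). (norm (A (t, \<omega>)))\<^sup>2) \<in> borel_measurable (L \<Otimes>\<^sub>M M)" by measurable
  have "(\<lambda>t. LINT \<omega>|M. norm (case (t, \<omega>) of (t, \<omega>) => (norm (A (t, \<omega>)))\<^sup>2)) = (\<lambda>t. (L2norm M (\<lambda>\<omega>. A (t, \<omega>)))\<^sup>2)"
   by (simp add: L2norm_power2)
  then show "integrable L (\<lambda>t. LINT \<omega>|M. norm (case (t, \<omega>) of (t, \<omega>) => (norm (A (t, \<omega>)))\<^sup>2))" using int by simp
  show "AE t in L. integrable M (\<lambda>\<omega>. case (t, \<omega>) of (t, \<omega>) => (norm (A (t, \<omega>)))\<^sup>2)"
   using mem_L2_integrable[OF sec] by (intro AE_I2) simp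
 qed
 have am: "(\<lambda>t. A (t, \<omega>)) \<in> borel_measurable L" if "\<omega> \<in> space M" for \<omega>
  by (rule measurable_Pair1[OF A that])
 show ae: "AE \<omega> in M. mem_L2 L (\<lambda>t. A (t, \<omega>))"
  using P.AE_integrable_snd[OF pint] AE_space
  by eventually_elim (simp add: mem_L2_def am)
 have im: "(\<lambda>\<omega>. LINT t|L. A (t, \<omega>)) \<in> borel_measurable M" by measurable
 have int2: "integrable M (\<lambda>\<omega>. measure L (space L) * (LINT t|L. (norm (A (t, \<omega>)))\<^sup>2))"
  using P.integrable_snd[OF pint] by simp
 have le: "AE \<omega> in M. (norm (LINT t|L. A (t, \<omega>)))\<^sup>2 <= measure L (space L) * (LINT t|L. (norm (A (t, \<omega>)))\<^sup>2)"
  using ae by eventually_elim (rule norm_integral_square_le[OF L])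
 show m: "mem_L2 M (\<lambda>\<omega>. LINT t|L. A (t, \<omega>))" by (rule mem_L2_bound[OF im int2 le])
 have "(L2norm M (\<lambda>\<omega>. LINT t|L. A (t, \<omega>)))\<^sup>2 <= (LINT \<omega>|M. measure L (space L) * (LINT t|L. (norm (A (t, \<omega>)))\<^sup>2))"
  unfolding L2norm_power2 by (rule integral_mono_AE[OF mem_L2_integrable[OF m] int2 le])
 also have "... = measure L (space L) * (LINT \<omega>|M. LINT t|L. (norm (A (t, \<omega>)))\<^sup>2)" by simp
 also have "(LINT \<omega>|M. LINT t|L. (norm (A (t, \<omega>)))\<^sup>2) = (LINT t|L. LINT \<omega>|M. (norm (A (t, \<omega>)))\<^sup>2)"
  by (rule P.Fubini_integral[OF pint])
 finally show "(L2norm M (\<lambda>\<omega>. LINT t|L. A (t, \<omega>)))\<^sup>2 <= measure L (space L) * (LINT t|L. (L2norm M (\<lambda>\<omega>. A (t, \<omega>)))\<^sup>2)"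
  by (simp add: L2norm_power2)
qed

context hilbert_nspace
begin

text \<open>A dense sequence of random variables is projected into the range and lifted, so that its
  members belong to the space; projecting brings them no farther from a function with values in the
  range. Distances to fixed members are parameter integrals of jointly measurable functions and
  hence measurable in time.\<close>

lemma strongly_measurable_section:
 assumes M: "prob_space M" and sep: "separable_L2 M"
  and W: "W \<in> borel_measurable (L \<Otimes>\<^sub>M M)"
  and f: "!!t. t \<in> space L ==> f t \<in> carr (bochner_L2 X M)"
  and fW: "!!t \<omega>. t \<in> space L ==> \<omega> \<in> space M ==> J (f t \<omega>) = W (t, \<omega>)"
 shows "strongly_measurable (bochner_L2 X M) L f"
proof -
 interpret M: prob_space M by (rule M)
 interpret Y: linear_nspace "bochner_L2 X M" by (rule linear_nspace_bochner_L2)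
 obtain e :: "nat => _ => 'h" where e: "!!n. mem_L2 M (e n)"
  "!!w \<epsilon>. mem_L2 M w ==> \<epsilon> > 0 ==> \<exists>n. L2norm M (\<lambda>\<omega>. w \<omega> - e n \<omega>) < \<epsilon>"
  using L2_dense_sequence[OF M sep] by metis
 note PG = proj_in[OF subspace_range closed_range]
 interpret P: bounded_linear "proj G" by (rule bounded_linear_proj[OF subspace_range closed_range])
 have Pm: "proj G \<in> borel_measurable borel"
  by (rule borel_measurable_continuous_onI) (rule linear_continuous_on[OF bounded_linear_proj[OF subspace_range closed_range]])
 have Ple: "norm (proj G x) <= norm x" for x
 proof -
  have "(norm (proj G x))\<^sup>2 = x \<bullet> proj G x"
   using proj_orthogonal[OF subspace_range closed_range PG, of x x] by (simp add: power2_norm_eq_inner inner_diff_left)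
  also have "... <= norm x * norm (proj G x)" by (rule norm_cauchy_schwarz)
  finally show ?thesis by (cases "norm (proj G x) = 0") (auto simp: power2_eq_square)
 qed
 let ?c = "\<lambda>n \<omega>. K (proj G (e n \<omega>))"
 have em: "e n \<in> borel_measurable M" for n using e(1) by (rule mem_L2_measurable)
 have pem: "(\<lambda>\<omega>. proj G (e n \<omega>)) \<in> borel_measurable M" for n by (rule measurable_compose[OF em Pm])
 have cm: "mem_L2 M (\<lambda>\<omega>. proj G (e n \<omega>))" for n
  by (rule mem_L2_bound[OF pem mem_L2_integrable[OF e(1)[of n]]]) (simp add: power_mono Ple)
 have c: "?c n \<in> carr (bochner_L2 X M)" for n
  unfolding carr_bochner_L2 using cm by (simp add: J_K[OF PG] K_carr[OF PG])
 have diff: "nrm (bochner_L2 X M) (f t - ?c n) = L2norm M (\<lambda>\<omega>. W (t, \<omega>) - proj G (e n \<omega>))" if t: "t \<in> space L" for t n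
  unfolding nrm_bochner_L2_carr[OF Y.carr_diff[OF f[OF t] c]]
 proof (rule L2norm_cong)
  fix \<omega> assume \<omega>: "\<omega> \<in> space M"
  show "J ((f t - ?c n) \<omega>) = W (t, \<omega>) - proj G (e n \<omega>)"
   using carr_bochner_L2D(1)[OF f[OF t] \<omega>] fW[OF t \<omega>] by (simp add: J_diff K_carr[OF PG] J_K[OF PG])
 qed
 have Wt: "mem_L2 M (\<lambda>\<omega>. W (t, \<omega>))" if t: "t \<in> space L" for t
  using carr_bochner_L2D(2)[OF f[OF t]] mem_L2_cong[of M "\<lambda>\<omega>. J (f t \<omega>)" "\<lambda>\<omega>. W (t, \<omega>)"] fW[OF t] by simp
 show ?thesis
 proof (rule strongly_measurable_if_dense_sequence[where c = ?c])
  show "f t \<in> carr (bochner_L2 X M)" if "t \<in> space L" for t by (rule f[OF that])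
  show "?c n \<in> carr (bochner_L2 X M)" for n by (rule c)
  show "0 <= nrm (bochner_L2 X M) (f t - ?c n)" if "t \<in> space L" for t n
   by (rule Y.nrm_nonneg[OF Y.carr_diff[OF f[OF that] c]])
  show "(\<lambda>t. nrm (bochner_L2 X M) (f t - ?c n)) \<in> borel_measurable L" for n
  proof -
   note [measurable] = W pem[of n]
   have "(\<lambda>t. LINT \<omega>|M. (norm (W (t, \<omega>) - proj G (e n \<omega>)))\<^sup>2) \<in> borel_measurable L" by measurable
   then have "(\<lambda>t. L2norm M (\<lambda>\<omega>. W (t, \<omega>) - proj G (e n \<omega>))) \<in> borel_measurable L" unfolding L2norm_def by simp
   then show ?thesis by (subst measurable_cong[OF diff])
  qed
  fix t and \<epsilon> :: real assume t: "t \<in> space L" and \<epsilon>: "\<epsilon> > 0"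
  obtain n where n: "L2norm M (\<lambda>\<omega>. W (t, \<omega>) - e n \<omega>) < \<epsilon>" using e(2)[OF Wt[OF t] \<epsilon>] by (rule exE)
  have "L2norm M (\<lambda>\<omega>. W (t, \<omega>) - proj G (e n \<omega>)) <= L2norm M (\<lambda>\<omega>. W (t, \<omega>) - e n \<omega>)"
  proof (rule L2norm_mono[OF mem_L2_diff[OF Wt[OF t] e(1)] mem_L2_measurable[OF mem_L2_diff[OF Wt[OF t] cm]]], rule AE_I2)
   fix \<omega> assume \<omega>: "\<omega> \<in> space M"
   have "W (t, \<omega>) \<in> G" using carr_bochner_L2D(1)[OF f[OF t] \<omega>] fW[OF t \<omega>] by (metis imageI)
   then have "W (t, \<omega>) - proj G (e n \<omega>) = proj G (W (t, \<omega>) - e n \<omega>)"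
    by (simp add: P.diff proj_id[OF subspace_range closed_range])
   then show "norm (W (t, \<omega>) - proj G (e n \<omega>)) <= norm (W (t, \<omega>) - e n \<omega>)" using Ple by simp
  qed
  then show "\<exists>n. nrm (bochner_L2 X M) (f t - ?c n) < \<epsilon>" using n diff[OF t, of n] by (intro exI[of _ n]) simp
 qed
qed

text \<open>The Bochner integral is the pathwise integral. Simple approximations are integrated path
  by path, and \<open>joint_L2\<close> bounds the error of the integral by the squared errors in
  time.\<close>

lemma has_bochner_integral_section:
 assumes L: "finite_measure L" and M: "prob_space M" and sep: "separable_L2 M"
  and W: "W \<in> borel_measurable (L \<Otimes>\<^sub>M M)"
  and f: "!!t. t \<in> space L ==> f t \<in> carr (bochner_L2 X M)"
  and fW: "!!t \<omega>. t \<in> space L ==> \<omega> \<in> space M ==> J (f t \<omega>) = W (t, \<omega>)"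
  and int: "integrable L (\<lambda>t. (nrm (bochner_L2 X M) (f t))\<^sup>2)"
  and y: "!!\<omega>. \<omega> \<in> space M ==> y \<omega> \<in> carr X" "!!\<omega>. \<omega> \<in> space M ==> J (y \<omega>) = (LINT t|L. W (t, \<omega>))"
 shows "has_bochner_integral_in (bochner_L2 X M) L f y"
proof -
 let ?Y = "bochner_L2 X M"
 interpret L: finite_measure L by (rule L)
 interpret M: prob_space M by (rule M)
 interpret Y: linear_nspace ?Y by (rule linear_nspace_bochner_L2)
 have sm: "strongly_measurable ?Y L f" by (rule strongly_measurable_section[OF M sep W f fW])
 have nf: "nrm ?Y (f t) = L2norm M (\<lambda>\<omega>. W (t, \<omega>))" if t: "t \<in> space L" for t
  unfolding nrm_bochner_L2_carr[OF f[OF t]] by (rule L2norm_cong) (rule fW[OF t])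
 have Wt: "mem_L2 M (\<lambda>\<omega>. W (t, \<omega>))" if t: "t \<in> space L" for t
  using carr_bochner_L2D(2)[OF f[OF t]] mem_L2_cong[of M "\<lambda>\<omega>. J (f t \<omega>)" "\<lambda>\<omega>. W (t, \<omega>)"] fW[OF t] by simp
 have intW: "integrable L (\<lambda>t. (L2norm M (\<lambda>\<omega>. W (t, \<omega>)))\<^sup>2)"
  using int by (subst (asm) Bochner_Integration.integrable_cong[OF refl, of L _ "\<lambda>t. (L2norm M (\<lambda>\<omega>. W (t, \<omega>)))\<^sup>2"]) (simp_all add: nf)
 have jW: "AE \<omega> in M. mem_L2 L (\<lambda>t. W (t, \<omega>))" "mem_L2 M (\<lambda>\<omega>. LINT t|L. W (t, \<omega>))"
  by (rule joint_L2(1)[OF L M W _ intW], erule Wt, rule joint_L2(2)[OF L M W _ intW], erule Wt)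
 have yc: "y \<in> carr ?Y" unfolding carr_bochner_L2
  using jW(2) mem_L2_cong[of M "\<lambda>\<omega>. J (y \<omega>)" "\<lambda>\<omega>. LINT t|L. W (t, \<omega>)"] y by simp
 obtain s where s0: "\<forall>n. simple_function L (s n) \<and> s n ` space L \<subseteq> carr ?Y"
  "\<forall>t\<in>space L. (\<lambda>n. nrm ?Y (f t - s n t)) \<longlonglongrightarrow> 0"
  using sm[unfolded strongly_measurable_def] by (elim conjE exE)
 note s = s0(1)[rule_format, THEN conjunct1] s0(1)[rule_format, THEN conjunct2] s0(2)[rule_format]
 have sc: "s n t \<in> carr ?Y" if "t \<in> space L" for n t by (rule subsetD[OF s(2) imageI[OF that]])
 \<comment> \<open>Discarding values above twice the norm of \<open>f t\<close> bounds the error by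
   three times that norm. The truncation is eventually inactive unless \<open>f t\<close> has norm
   0, and there the error is 0 by the same bound.\<close>
 define s' where "s' n t = (if nrm ?Y (s n t) <= 2 * nrm ?Y (f t) then s n t else 0)" for n t
 have s'c: "s' n t \<in> carr ?Y" if "t \<in> space L" for n t using sc[OF that] Y.carr_zero by (simp add: s'_def)
 have nfm: "(\<lambda>t. nrm ?Y (f t)) \<in> borel_measurable L" by (rule Y.nrm_measurable[OF sm])
 have s's: "simple_function L (s' n)" for n
 proof -
  have "(\<lambda>t. nrm ?Y (s n t)) \<in> borel_measurable L"
   using simple_function_compose[OF s(1), of "nrm ?Y" n] by (intro borel_measurable_simple_function) (simp add: comp_def)
  then have "{t\<in>space L. nrm ?Y (s n t) <= 2 * nrm ?Y (f t)} \<in> sets L" using nfm by measurable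
  then show ?thesis unfolding s'_def by (intro simple_function_If s(1) simple_function_const)
 qed
 define D where "D n t = nrm ?Y (f t - s' n t)" for n t
 have Dm: "D n \<in> borel_measurable L" for n
 proof -
  have "s' n ` space L \<subseteq> carr ?Y" using s'c by (intro image_subsetI)
  then show ?thesis unfolding D_def[abs_def] by (rule Y.nrm_diff_measurable[OF sm s's])
 qed
 have D0: "0 <= D n t" if "t \<in> space L" for n t unfolding D_def by (rule Y.nrm_nonneg[OF Y.carr_diff[OF f[OF that] s'c[OF that]]])
 have s'n: "nrm ?Y (s' n t) <= 2 * nrm ?Y (f t)" if t: "t \<in> space L" for n t
  using Y.nrm_nonneg[OF f[OF t]] Y.nrm_scaleR[OF Y.carr_zero, of 0] by (simp add: s'_def)
 have tri: "nrm ?Y (u - v) <= nrm ?Y u + nrm ?Y v" if "u \<in> carr ?Y" "v \<in> carr ?Y" for u v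
  using Y.nrm_triangle[OF that(1) Y.carr_uminus[OF that(2)]] Y.nrm_uminus[OF that(2)] by simp
 have D3: "D n t <= 3 * nrm ?Y (f t)" if t: "t \<in> space L" for n t
  using tri[OF f[OF t] s'c[OF t, of n]] s'n[OF t, of n] unfolding D_def by linarith
 have Dlim: "(\<lambda>n. D n t) \<longlonglongrightarrow> 0" if t: "t \<in> space L" for t
 proof (cases "nrm ?Y (f t) = 0")
  case True
  then have "D n t = 0" for n using D3[OF t, of n] D0[OF t, of n] by simp
  then show ?thesis by simp
 next
  case False
  then have pos: "nrm ?Y (f t) > 0" using Y.nrm_nonneg[OF f[OF t]] by simp
  have "\<forall>\<^sub>F n in sequentially. nrm ?Y (f t - s n t) < nrm ?Y (f t)" by (rule order_tendstoD(2)[OF s(3)[OF t] pos])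
  then have "\<forall>\<^sub>F n in sequentially. nrm ?Y (f t - s n t) = D n t"
  proof eventually_elim
   case (elim n)
   have "nrm ?Y (s n t) = nrm ?Y (f t - (f t - s n t))" by simp
   also have "... <= nrm ?Y (f t) + nrm ?Y (f t - s n t)" by (rule tri[OF f[OF t] Y.carr_diff[OF f[OF t] sc[OF t]]])
   finally have "nrm ?Y (s n t) <= 2 * nrm ?Y (f t)" using elim by simp
   then show ?case by (simp add: D_def s'_def)
  qed
  then show ?thesis using s(3)[OF t] by (rule Lim_transform_eventually[rotated])
 qed
 have int1: "integrable L (\<lambda>t. nrm ?Y (f t))"
 proof -
  have "mem_L2 L (\<lambda>t. nrm ?Y (f t))" unfolding mem_L2_def using int nfm by simp
  then show ?thesis by (rule mem_L2_integrable_finite[OF _ L])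
 qed
 have lim1: "(\<lambda>n. LINT t|L. D n t) \<longlonglongrightarrow> (LINT t|L. 0)"
  by (rule integral_dominated_convergence[where w = "\<lambda>t. 3 * nrm ?Y (f t)"])
   (use int1 Dm Dlim D3 D0 in \<open>auto intro!: AE_I2\<close>)
 have D9: "(D n t)\<^sup>2 <= 9 * (nrm ?Y (f t))\<^sup>2" if t: "t \<in> space L" for n t
  using power_mono[OF D3[OF t] D0[OF t], of n 2] by (simp add: power_mult_distrib)
 have lim2: "(\<lambda>n. LINT t|L. (D n t)\<^sup>2) \<longlonglongrightarrow> (LINT t|L. 0)"
 proof (rule integral_dominated_convergence[where w = "\<lambda>t. 9 * (nrm ?Y (f t))\<^sup>2"])
  show "AE t in L. (\<lambda>n. (D n t)\<^sup>2) \<longlonglongrightarrow> 0" using tendsto_power[OF Dlim, of _ 2] by (intro AE_I2) simp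
 qed (use int Dm D9 in \<open>auto intro!: AE_I2\<close>)
 have Dint: "integrable L (D n)" for n
  by (rule Bochner_Integration.integrable_bound[where f = "\<lambda>t. 3 * nrm ?Y (f t)"]) (use int1 Dm D3 D0 in \<open>auto intro!: AE_I2 intro: order_trans[OF _ abs_ge_self]\<close>)
 have Dint2: "integrable L (\<lambda>t. (D n t)\<^sup>2)" for n
  by (rule Bochner_Integration.integrable_bound[where f = "\<lambda>t. 9 * (nrm ?Y (f t))\<^sup>2"]) (use int Dm D9 in \<open>auto intro!: AE_I2\<close>)
 let ?I = "\<lambda>n. Bochner_Integration.simple_bochner_integral L (s' n)"
 have Ic: "?I n \<in> carr ?Y" for n
  by (rule Y.simple_bochner_integral_in_carr) (use s'c in \<open>intro image_subsetI\<close>)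
 have JI: "J (?I n \<omega>) = (LINT t|L. J (s' n t \<omega>))" if \<omega>: "\<omega> \<in> space M" for n \<omega>
 proof -
  let ?S = "s' n ` space L"
  have fin: "finite ?S" using s's[of n] by (simp add: simple_function_def)
  have Sc: "v \<omega> \<in> carr X" if "v \<in> ?S" for v
  proof -
   obtain t where "v = s' n t" "t \<in> space L" using \<open>v \<in> ?S\<close> by (rule imageE)
   then show ?thesis using carr_bochner_L2D(1)[OF s'c \<omega>] by simp
  qed
  have app: "(\<Sum>v\<in>F. measure L {t\<in>space L. s' n t = v} *\<^sub>R v) \<omega> = (\<Sum>v\<in>F. measure L {t\<in>space L. s' n t = v} *\<^sub>R v \<omega>)"
   if "finite F" for F
   using that by (induction F) (simp_all add: scaleR_fun_def)
  have "?I n \<omega> = (\<Sum>v\<in>?S. measure L {t\<in>space L. s' n t = v} *\<^sub>R v \<omega>)"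
   unfolding Bochner_Integration.simple_bochner_integral_def by (rule app[OF fin])
  also have "J ... = (\<Sum>v\<in>?S. J (measure L {t\<in>space L. s' n t = v} *\<^sub>R v \<omega>))"
   by (rule J_sum[OF fin]) (rule carr_scaleR[OF Sc])
  also have "... = (\<Sum>v\<in>?S. measure L {t\<in>space L. s' n t = v} *\<^sub>R J (v \<omega>))"
   by (rule sum.cong[OF refl]) (simp add: J_scaleR Sc)
  also have "... = (LINT t|L. J (s' n t \<omega>))"
   by (rule integral_simple_function_compose(2)[OF L s's, symmetric])
  finally show ?thesis .
 qed
 define A where "A n z = J (s' n (fst z) (snd z)) - W z" for n z
 have Am: "A n \<in> borel_measurable (L \<Otimes>\<^sub>M M)" for n
 proof -
  let ?S = "s' n ` space L"
  have fin: "finite ?S" using s's[of n] by (simp add: simple_function_def)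
  have "(\<lambda>z. J (s' n (fst z) (snd z))) \<in> borel_measurable (L \<Otimes>\<^sub>M M)"
  \<comment> \<open>\<open>s' n\<close> takes finitely many values, each a fixed random variable, so
    joint measurability holds piece by piece.\<close>
  proof (rule measurable_compose_countable'[where f = "\<lambda>v z. J (v (snd z))" and g = "\<lambda>z. s' n (fst z)" and I = ?S])
   show "countable ?S" using fin by (rule countable_finite)
   have "s' n \<in> L \<rightarrow>\<^sub>M count_space ?S" using fin s's[of n] by (simp add: measurable_count_space_eq2 simple_function_def)
   then show "(\<lambda>z. s' n (fst z)) \<in> L \<Otimes>\<^sub>M M \<rightarrow>\<^sub>M count_space ?S" by (rule measurable_compose[OF measurable_fst])
   fix v assume "v \<in> ?S"
   then obtain t where "v = s' n t" "t \<in> space L" by (rule imageE)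
   then have "(\<lambda>\<omega>. J (v \<omega>)) \<in> borel_measurable M" using mem_L2_measurable[OF carr_bochner_L2D(2)[OF s'c]] by simp
   then show "(\<lambda>z. J (v (snd z))) \<in> borel_measurable (L \<Otimes>\<^sub>M M)" by (rule measurable_compose[OF measurable_snd])
  qed
  then show ?thesis unfolding A_def[abs_def] using W by (rule borel_measurable_diff)
 qed
 have At: "mem_L2 M (\<lambda>\<omega>. A n (t, \<omega>))" if t: "t \<in> space L" for n t
  unfolding A_def fst_conv snd_conv by (rule mem_L2_diff[OF carr_bochner_L2D(2)[OF s'c[OF t]] Wt[OF t]])
 have AD: "L2norm M (\<lambda>\<omega>. A n (t, \<omega>)) = D n t" if t: "t \<in> space L" for n t
 proof -
  have "D n t = L2norm M (\<lambda>\<omega>. - A n (t, \<omega>))"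
   unfolding D_def nrm_bochner_L2_carr[OF Y.carr_diff[OF f[OF t] s'c[OF t]]]
  proof (rule L2norm_cong)
   fix \<omega> assume \<omega>: "\<omega> \<in> space M"
   show "J ((f t - s' n t) \<omega>) = - A n (t, \<omega>)"
    using carr_bochner_L2D(1)[OF f[OF t] \<omega>] carr_bochner_L2D(1)[OF s'c[OF t] \<omega>, of n] fW[OF t \<omega>] by (simp add: A_def J_diff)
  qed
  then show ?thesis by (simp add: L2norm_uminus)
 qed
 have intA: "integrable L (\<lambda>t. (L2norm M (\<lambda>\<omega>. A n (t, \<omega>)))\<^sup>2)" for n
  using Dint2[of n] by (subst Bochner_Integration.integrable_cong[OF refl, of L _ "\<lambda>t. (D n t)\<^sup>2"]) (simp_all add: AD)
 have jA: "mem_L2 M (\<lambda>\<omega>. LINT t|L. A n (t, \<omega>))"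
  "(L2norm M (\<lambda>\<omega>. LINT t|L. A n (t, \<omega>)))\<^sup>2 <= measure L (space L) * (LINT t|L. (L2norm M (\<lambda>\<omega>. A n (t, \<omega>)))\<^sup>2)" for n
  by (rule joint_L2(2)[OF L M Am _ intA], erule At, rule joint_L2(3)[OF L M Am _ intA], erule At)
 have nI: "nrm ?Y (?I n - y) <= sqrt (measure L (space L) * (LINT t|L. (D n t)\<^sup>2))" for n
 proof -
  have "nrm ?Y (?I n - y) = L2norm M (\<lambda>\<omega>. LINT t|L. A n (t, \<omega>))"
   unfolding nrm_bochner_L2_carr[OF Y.carr_diff[OF Ic yc]]
  proof (rule L2norm_cong_AE)
   show "(\<lambda>\<omega>. J ((?I n - y) \<omega>)) \<in> borel_measurable M"
    by (rule mem_L2_measurable[OF carr_bochner_L2D(2)[OF Y.carr_diff[OF Ic yc]]])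
   show "(\<lambda>\<omega>. LINT t|L. A n (t, \<omega>)) \<in> borel_measurable M" by (rule mem_L2_measurable[OF jA(1)])
   show "AE \<omega> in M. J ((?I n - y) \<omega>) = (LINT t|L. A n (t, \<omega>))"
    using jW(1) AE_space
   proof eventually_elim
    case (elim \<omega>)
    have "integrable L (\<lambda>t. W (t, \<omega>))" by (rule mem_L2_integrable_finite[OF elim(1) L])
    moreover have "integrable L (\<lambda>t. J (s' n t \<omega>))" by (rule integral_simple_function_compose(1)[OF L s's])
    ultimately have "(LINT t|L. A n (t, \<omega>)) = (LINT t|L. J (s' n t \<omega>)) - (LINT t|L. W (t, \<omega>))"
     unfolding A_def by simp
    moreover have "J ((?I n - y) \<omega>) = J (?I n \<omega>) - J (y \<omega>)"
     using carr_bochner_L2D(1)[OF Ic elim(2)] y(1)[OF elim(2)] by (simp add: J_diff)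
    ultimately show ?case by (simp add: JI[OF elim(2)] y(2)[OF elim(2)])
   qed
  qed
  also have "... = sqrt ((L2norm M (\<lambda>\<omega>. LINT t|L. A n (t, \<omega>)))\<^sup>2)" by (simp only: real_sqrt_abs abs_of_nonneg[OF L2norm_nonneg])
  also have "... <= sqrt (measure L (space L) * (LINT t|L. (L2norm M (\<lambda>\<omega>. A n (t, \<omega>)))\<^sup>2))"
   by (rule real_sqrt_le_mono[OF jA(2)])
  also have "(LINT t|L. (L2norm M (\<lambda>\<omega>. A n (t, \<omega>)))\<^sup>2) = (LINT t|L. (D n t)\<^sup>2)"
   by (rule Bochner_Integration.integral_cong[OF refl]) (simp add: AD)
  finally show ?thesis .
 qed
 have conv1: "(\<lambda>n. \<integral>\<^sup>+t. ennreal (nrm ?Y (f t - s' n t)) \<partial>L) \<longlonglongrightarrow> 0"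
 proof -
  have "(\<integral>\<^sup>+t. ennreal (nrm ?Y (f t - s' n t)) \<partial>L) = ennreal (LINT t|L. D n t)" for n
   using nn_integral_eq_integral[OF Dint AE_I2[OF D0], of n] by (simp only: D_def)
  moreover have "(\<lambda>n. ennreal (LINT t|L. D n t)) \<longlonglongrightarrow> ennreal 0" using lim1 by (intro tendsto_ennrealI) simp
  ultimately show ?thesis by simp
 qed
 have conv2: "(\<lambda>n. nrm ?Y (?I n - y)) \<longlonglongrightarrow> 0"
 proof (rule LIMSEQ_null_comparison)
  show "norm (nrm ?Y (?I n - y)) <= sqrt (measure L (space L) * (LINT t|L. (D n t)\<^sup>2))" for n
   using nI[of n] Y.nrm_nonneg[OF Y.carr_diff[OF Ic yc], of n] by simp
  have "(\<lambda>n. sqrt (measure L (space L) * (LINT t|L. (D n t)\<^sup>2))) \<longlonglongrightarrow> sqrt (measure L (space L) * (LINT t|L. 0))"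
   by (intro tendsto_real_sqrt tendsto_mult_left lim2)
  then show "(\<lambda>n. sqrt (measure L (space L) * (LINT t|L. (D n t)\<^sup>2))) \<longlonglongrightarrow> 0" by simp
 qed
 have sbi: "Bochner_Integration.simple_bochner_integrable L (s' n)" for n
  using s's by (intro Bochner_Integration.simple_bochner_integrable.intros) (simp_all add: L.emeasure_finite)
 have sub: "s' n ` space L \<subseteq> carr ?Y" for n using s'c by (intro image_subsetI)
 show ?thesis unfolding has_bochner_integral_in_def
  by (intro conjI sm yc exI[of _ s'] allI sbi sub conv1 conv2)
qed

end

section \<open>Primitives, Gronwall's inequality and weak derivatives in time\<close>

section \<open>Weak derivatives in time\<close>

lemma AE_zero_continuous:
 fixes g :: "'a::euclidean_space => real"
 assumes P: "open P" and g: "continuous_on P g" and ae: "AE x in lebesgue_on P. g x = 0" and x: "x \<in> P"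
 shows "g x = 0"
proof (rule ccontr)
 assume gx: "g x \<noteq> 0"
 let ?Q = "P \<inter> g -` (- {0})"
 have "open ?Q" by (rule continuous_open_preimage[OF g P open_Compl[OF closed_singleton]])
 moreover have "?Q \<in> null_sets lebesgue"
 proof -
  have "AE x in lebesgue. x \<in> P --> g x = 0" using ae P by (subst (asm) AE_lebesgue_on_iff) auto
  then have "AE x in lebesgue. x \<notin> ?Q" by eventually_elim simp
  then show ?thesis using \<open>open ?Q\<close> by (subst AE_iff_null_sets) auto
 qed
 ultimately show False using open_not_negligible[of ?Q] gx x by (auto simp: negligible_iff_null_sets)
qed

lemma deriv_test_function:
 fixes \<phi> :: "real => real"
 assumes \<phi>: "\<phi> \<in> test_functions S"
 shows "(\<phi> has_real_derivative deriv \<phi> t) (at t)"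
  and "frechet_derivative \<phi> (at t) h = h * deriv \<phi> t"
  and "deriv \<phi> \<in> test_functions S"
proof -
 show 1: "(\<phi> has_real_derivative deriv \<phi> t) (at t)" for t
  using test_function_differentiable[OF \<phi>, of t] by (simp add: DERIV_deriv_iff_real_differentiable)
 show 2: "frechet_derivative \<phi> (at t) h = h * deriv \<phi> t" for t h
  using frechet_derivative_at[OF 1[of t, unfolded has_field_derivative_def]] by (metis mult.commute)
 have "(\<lambda>x. frechet_derivative \<phi> (at x) 1) \<in> test_functions S" by (rule test_function_derivative[OF \<phi>]) simp
 then show "deriv \<phi> \<in> test_functions S" by (simp add: 2)
qed

locale time_interval =
 fixes T :: real
 assumes T_pos: "T > 0"
begin

abbreviation "L \<equiv> lebesgue_on {0..T}"

lemma finite_measure_L: "finite_measure L" by (rule finite_measure_lebesgue_on) simp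

sublocale L: finite_measure L by (rule finite_measure_L)

lemma id_measurable_L [measurable]: "(\<lambda>t. t) \<in> borel_measurable L"
 by (intro measurable_restrict_space1 measurable_completion) simp

lemma borel_measurable_L: "f \<in> borel_measurable borel ==> f \<in> borel_measurable L"
 by (rule measurable_compose[OF id_measurable_L])

lemma test_function_measurable_L: "\<phi> \<in> test_functions S ==> \<phi> \<in> borel_measurable L"
 by (intro borel_measurable_L test_function_measurable)

text \<open>A cut-off factor under an integral over the whole interval, so that the measure does not
  depend on \<open>t\<close> and the integrand is jointly measurable in both times.\<close>

definition primitive :: "(real => 'b) => real => 'b::{banach, second_countable_topology}" where
 "primitive z t = (LINT s|L. (if s <= t then 1 else 0) *\<^sub>R z s)"

lemma primitive_integrable:
 fixes z :: "real => 'b::{banach, second_countable_topology}"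
 assumes z: "integrable L z"
 shows "integrable L (\<lambda>s. (if s <= t then 1 else 0 :: real) *\<^sub>R z s)"
proof (rule Bochner_Integration.integrable_bound[OF z])
 note [measurable] = borel_measurable_integrable[OF z]
 show "(\<lambda>s. (if s <= t then 1 else 0 :: real) *\<^sub>R z s) \<in> borel_measurable L" by measurable
qed (auto intro!: AE_I2)

lemma integral_L_interval:
 fixes f :: "real => real"
 assumes f: "f \<in> borel_measurable borel" and s: "0 <= s" and t: "t <= T"
 shows "(LINT x|L. (if s <= x \<and> x <= t then 1 else 0) * f x) = (LINT x|lborel. f x * indicator {s..t} x)"
proof -
 have "(LINT x|L. (if s <= x \<and> x <= t then 1 else 0) * f x) = (LINT x|lebesgue. f x * indicator {s..t} x)"
  unfolding integral_lebesgue_on_eq[of "{0..T}", simplified]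
  using s t by (intro Bochner_Integration.integral_cong) (auto split: split_indicator)
 also have "... = (LINT x|lborel. f x * indicator {s..t} x)" using f by (intro integral_completion) simp
 finally show ?thesis .
qed

text \<open>Fubini on the triangle s <= t: the inner integral of the derivative of \<phi> is
  \<phi>(T) - \<phi>(s), and \<phi>(T) = 0.\<close>

lemma integral_by_parts:
 fixes z :: "real => 'b::{banach, second_countable_topology}"
 assumes z: "integrable L z" and \<phi>: "\<phi> \<in> test_functions {0<..<T}"
 shows "(LINT t|L. deriv \<phi> t *\<^sub>R primitive z t) = - (LINT t|L. \<phi> t *\<^sub>R z t)"
proof -
 interpret P: pair_sigma_finite L L ..
 note [measurable] = borel_measurable_integrable[OF z] test_function_measurable_L[OF deriv_test_function(3)[OF \<phi>]]
 obtain B where B: "!!t. \<bar>deriv \<phi> t\<bar> <= B" using test_function_bounded[OF deriv_test_function(3)[OF \<phi>]] by blast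
 define F where "F t s = (deriv \<phi> t * (if s <= t then 1 else 0)) *\<^sub>R z s" for t s
 have "integrable (L \<Otimes>\<^sub>M L) (\<lambda>(t, s). B * norm (z s))"
 proof (rule P.Fubini_integrable)
  show "AE t in L. integrable L (\<lambda>s. case (t, s) of (t, s) => B * norm (z s))" using z by (intro AE_I2) simp
  show "(\<lambda>(t, s). B * norm (z s)) \<in> borel_measurable (L \<Otimes>\<^sub>M L)" by measurable
 qed simp
 then have F: "integrable (L \<Otimes>\<^sub>M L) (case_prod F)"
 proof (rule Bochner_Integration.integrable_bound)
  show "case_prod F \<in> borel_measurable (L \<Otimes>\<^sub>M L)" unfolding F_def[abs_def] by measurable
  show "AE x in L \<Otimes>\<^sub>M L. norm (case_prod F x) <= norm (case x of (t, s) => B * norm (z s))"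
  proof (rule AE_I2, clarify)
   fix t s
   have "B \<ge> 0" using B[of 0] by linarith
   then show "norm (F t s) <= norm (B * norm (z s))"
    using mult_right_mono[OF B[of t] norm_ge_zero[of "z s"]] by (simp add: F_def)
  qed
 qed
 have 1: "(LINT s|L. F t s) = deriv \<phi> t *\<^sub>R primitive z t" for t
  unfolding F_def scaleR_scaleR[symmetric] primitive_def by (rule integral_scaleR_right)
 have 2: "(LINT t|L. F t s) = - (\<phi> s *\<^sub>R z s)" if s: "s \<in> space L" for s
 proof -
  have s': "0 <= s" "s <= T" using s by (simp_all add: space_restrict_space)
  have "(LINT t|L. F t s) = (LINT t|L. deriv \<phi> t * (if s <= t then 1 else 0)) *\<^sub>R z s"
   unfolding F_def
  proof (rule integral_scaleR_left)
   show "integrable L (\<lambda>t. deriv \<phi> t * (if s <= t then 1 else 0))"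
    by (rule L.integrable_const_bound[where B = B]) (use B order_trans[OF abs_ge_zero B] in auto)
  qed
  also have "(LINT t|L. deriv \<phi> t * (if s <= t then 1 else 0)) = (LINT t|L. (if s <= t \<and> t <= T then 1 else 0) * deriv \<phi> t)"
   by (rule Bochner_Integration.integral_cong) (auto simp: space_restrict_space)
  also have "... = (LINT x|lborel. deriv \<phi> x * indicator {s..T} x)"
   by (rule integral_L_interval[OF test_function_measurable[OF deriv_test_function(3)[OF \<phi>]] s'(1) order_refl])
  also have "... = \<phi> T - \<phi> s"
  proof (rule integral_FTC_Icc_real[OF s'(2)])
   show "(\<phi> has_real_derivative deriv \<phi> x) (at x)" for x by (rule deriv_test_function(1)[OF \<phi>])
   show "isCont (deriv \<phi>) x" for x
    using test_function_continuous[OF deriv_test_function(3)[OF \<phi>]] by (simp add: continuous_on_eq_continuous_at)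
  qed
  also have "\<phi> T = 0" by (rule test_function_zero_outside[OF \<phi>]) simp
  finally show ?thesis by simp
 qed
 have "(LINT t|L. deriv \<phi> t *\<^sub>R primitive z t) = (LINT t|L. LINT s|L. F t s)" by (simp add: 1)
 also have "... = (LINT s|L. LINT t|L. F t s)" by (rule P.Fubini_integral[OF F, symmetric])
 also have "... = (LINT s|L. - (\<phi> s *\<^sub>R z s))" by (rule Bochner_Integration.integral_cong[OF refl 2])
 finally show ?thesis by simp
qed

lemma primitive_eq_integral:
 fixes z :: "real => real"
 assumes z: "integrable L z" and t: "t \<in> {0..T}"
 shows "primitive z t = integral {0..t} z"
proof -
 have zl: "set_integrable lebesgue {0..T} z"
  using z unfolding integrable_lebesgue_on_iff[of "{0..T}", simplified] set_integrable_def by simp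
 have zt: "set_integrable lebesgue {0..t} z" by (rule set_integrable_subset[OF zl]) (use t in auto)
 have "primitive z t = (LINT x:{0..t}|lebesgue. z x)"
  unfolding primitive_def integral_lebesgue_on_eq[of "{0..T}", simplified] set_lebesgue_integral_def
  using t by (intro Bochner_Integration.integral_cong) (auto split: split_indicator)
 also have "... = integral {0..t} z" by (rule set_lebesgue_integral_eq_integral(2)[OF zt])
 finally show ?thesis .
qed

lemma continuous_on_primitive:
 fixes z :: "real => real"
 assumes z: "integrable L z"
 shows "continuous_on {0..T} (primitive z)" "primitive z 0 = 0"
proof -
 have zl: "set_integrable lebesgue {0..T} z"
  using z unfolding integrable_lebesgue_on_iff[of "{0..T}", simplified] set_integrable_def by simp
 have "continuous_on {0..T} (\<lambda>t. integral {0..t} z)"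
  by (rule indefinite_integral_continuous_1) (rule set_lebesgue_integral_eq_integral(1)[OF zl])
 then show "continuous_on {0..T} (primitive z)"
  by (rule continuous_on_eq) (simp add: primitive_eq_integral[OF z])
 show "primitive z 0 = 0" using primitive_eq_integral[OF z, of 0] T_pos by simp
qed

lemma primitive_mono:
 fixes f g :: "real => real"
 assumes "integrable L f" "integrable L g" "AE s in L. s <= t --> f s <= g s"
 shows "primitive f t <= primitive g t"
 unfolding primitive_def
proof (rule integral_mono_AE[OF primitive_integrable[OF assms(1)] primitive_integrable[OF assms(2)]])
 show "AE s in L. (if s <= t then 1 else 0) *\<^sub>R f s <= (if s <= t then 1 else 0) *\<^sub>R g s"
  using assms(3) by eventually_elim simp
qed

lemma primitive_power:
 assumes "t \<in> {0..T}"
 shows "primitive (\<lambda>s. s ^ n) t = t ^ Suc n / Suc n"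
proof -
 have "primitive (\<lambda>s. s ^ n) t = (LINT s|L. (if 0 <= s \<and> s <= t then 1 else 0) * s ^ n)"
  unfolding primitive_def by (rule Bochner_Integration.integral_cong) (auto simp: space_restrict_space)
 also have "... = (LINT s|lborel. s ^ n * indicator {0..t} s)" by (rule integral_L_interval) (use assms in auto)
 also have "... = (t ^ Suc n - 0 ^ Suc n) / Suc n" by (rule integral_power) (use assms in auto)
 finally show ?thesis by simp
qed

lemma integrable_power_L: "integrable L (\<lambda>s. s ^ n)"
proof (rule L.integrable_const_bound[where B = "T ^ n"])
 show "AE s in L. norm (s ^ n) <= T ^ n" by (rule AE_I2) (simp add: space_restrict_space power_mono)
qed (rule borel_measurable_L, simp)

text \<open>The induction step common to Gronwall's inequality and the Picard estimate: integrating
  s^n supplies the next factor of the factorial.\<close>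

lemma primitive_iterate:
 fixes f :: "real => real" and B \<Lambda> t :: real
 assumes f: "integrable L f" "!!s. s \<in> {0..T} ==> f s <= B * (\<Lambda> * s) ^ n / fact n"
  and \<Lambda>: "\<Lambda> \<ge> 0" and t: "t \<in> {0..T}"
 shows "\<Lambda> * primitive f t <= B * (\<Lambda> * t) ^ Suc n / fact (Suc n)"
proof -
 have "primitive f t <= primitive (\<lambda>s. (B * \<Lambda> ^ n / fact n) * s ^ n) t"
  using f(2) by (intro primitive_mono f integrable_mult_right integrable_power_L AE_I2)
   (simp add: space_restrict_space power_mult_distrib mult_ac)
 also have "... = (B * \<Lambda> ^ n / fact n) * primitive (\<lambda>s. s ^ n) t"
  unfolding primitive_def using integral_mult_right_zero[of L "B * \<Lambda> ^ n / fact n"] by (simp add: mult.left_commute)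
 also have "... = (B * \<Lambda> ^ n / fact n) * (t ^ Suc n / Suc n)" by (simp only: primitive_power[OF t])
 finally have "\<Lambda> * primitive f t <= \<Lambda> * ((B * \<Lambda> ^ n / fact n) * (t ^ Suc n / Suc n))"
  by (rule mult_left_mono[OF _ \<Lambda>])
 also have "... = B * (\<Lambda> * t) ^ Suc n / fact (Suc n)" by (simp add: power_mult_distrib mult_ac)
 finally show ?thesis .
qed

text \<open>Inserting the inequality into itself repeatedly bounds \<open>m\<close> by a multiple of
  a term of the exponential series, which tends to 0; the bound \<open>B\<close> starts the
  induction.\<close>

lemma gronwall_zero:
 fixes m :: "real => real" and B \<Lambda> t :: real
 assumes m: "integrable L m" "!!t. t \<in> {0..T} ==> 0 <= m t" "!!t. t \<in> {0..T} ==> m t <= B"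
  and le: "!!t. t \<in> {0..T} ==> m t <= \<Lambda> * primitive m t" and \<Lambda>: "\<Lambda> \<ge> 0" and t: "t \<in> {0..T}"
 shows "m t = 0"
proof -
 have b: "m t <= B * (\<Lambda> * t) ^ n / fact n" if "t \<in> {0..T}" for n t
  using that
 proof (induction n arbitrary: t)
  case 0 then show ?case using m(3) by simp
 next
  case (Suc n)
  show ?case using le[OF Suc.prems] primitive_iterate[OF m(1) Suc.IH \<Lambda> Suc.prems] by (rule order_trans)
 qed
 have "(\<lambda>n. B * (inverse (fact n) * (\<Lambda> * t) ^ n)) \<longlonglongrightarrow> B * 0"
  by (intro tendsto_mult_left summable_LIMSEQ_zero[OF summable_exp])
 then have "(\<lambda>n. B * (\<Lambda> * t) ^ n / fact n) \<longlonglongrightarrow> 0" by (simp add: field_simps)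
 then have "m t <= 0" by (rule LIMSEQ_le_const) (use b[OF t] in auto)
 then show ?thesis using m(2)[OF t] by simp
qed

text \<open>A vanishing weak derivative makes the function weakly differentiable with every bound
  \<kappa> > 0, so by \<open>translation_test\<close> its increments vanish when tested. Continuity
  removes the null sets and reaches the end points.\<close>

lemma constant_if_weak_derivative_zero:
 fixes f :: "real => real"
 assumes f: "continuous_on {0..T} f"
  and zero: "!!\<phi>. \<phi> \<in> test_functions {0<..<T} ==> (LINT t|L. deriv \<phi> t * f t) = 0"
  and t: "t \<in> {0..T}"
 shows "f t = f 0"
proof -
 define u where "u x = indicator {0<..<T} x *\<^sub>R f x" for x
 have fo: "continuous_on {0<..<T} f" by (rule continuous_on_subset[OF f]) auto
 have ub: "u \<in> borel_measurable borel"
  unfolding u_def[abs_def] by (rule borel_measurable_continuous_on_indicator[OF _ fo]) simp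
 obtain B where B: "!!x. x \<in> {0..T} ==> norm (f x) <= B"
  using compact_imp_bounded[OF compact_continuous_image[OF f compact_Icc]] unfolding bounded_iff by blast
 have int1: "integrable lborel (\<lambda>x. indicat_real {0<..<T} x * b)" for b
  using T_pos by (intro integrable_mult_left) (simp add: integrable_indicator_iff)
 have ui: "integrable lborel u"
 proof (rule Bochner_Integration.integrable_bound[OF int1[of B]])
  show "AE x in lborel. norm (u x) <= norm (indicat_real {0<..<T} x * B)"
   using B by (intro AE_I2) (auto simp: u_def intro: order_trans[OF _ abs_ge_self] split: split_indicator)
 qed (use ub in simp)
 have u2: "mem_L2 lborel u"
 proof (rule mem_L2_bound[OF _ int1[of "B\<^sup>2"]])
  show "AE x in lborel. (norm (u x))\<^sup>2 <= indicat_real {0<..<T} x * B\<^sup>2"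
   using power_mono[OF B norm_ge_zero, of _ 2] by (intro AE_I2) (auto simp: u_def split: split_indicator)
 qed (use ub in simp)
 have wd: "weakly_differentiable {0<..<T} u \<kappa>" if "\<kappa> > 0" for \<kappa>
 proof
  fix \<phi> h assume \<phi>: "\<phi> \<in> test_functions {0<..<T}"
  have "(LINT x|lborel. u x * frechet_derivative \<phi> (at x) h) = (LINT x|lborel. h * (deriv \<phi> x * u x))"
   by (simp add: deriv_test_function(2)[OF \<phi>] mult_ac)
  also have "... = h * (LINT x|lborel. deriv \<phi> x * u x)" by simp
  also have "(LINT x|lborel. deriv \<phi> x * u x) = (LINT x|lebesgue. deriv \<phi> x * u x)"
   using ub test_function_measurable[OF deriv_test_function(3)[OF \<phi>]] by (intro integral_completion[symmetric]) simp
  also have "... = (LINT x|L. deriv \<phi> x * f x)"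
   unfolding integral_lebesgue_on_eq[of "{0..T}", simplified]
  proof (rule Bochner_Integration.integral_cong[OF refl])
   fix x show "deriv \<phi> x * u x = indicator {0..T} x *\<^sub>R (deriv \<phi> x * f x)"
    using test_function_zero_outside[OF deriv_test_function(3)[OF \<phi>], of x] by (auto simp: u_def split: split_indicator)
  qed
  finally show "\<bar>LINT x|lborel. u x * frechet_derivative \<phi> (at x) h\<bar> <= norm h * \<kappa> * L2norm lborel \<phi>"
   using zero[OF \<phi>] that L2norm_nonneg[of lborel \<phi>] by simp
 qed (use ub ui u2 that in auto)
 have eq: "f x = f y" if x: "0 < x" and xy: "x < y" and y: "y < T" for x y
 proof -
  let ?h = "y - x" and ?P = "{0<..<T - (y - x)}"
  define g where "g x = u (x + (y - x)) - u x" for x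
  define d where "d s = u (s + ?h) - u s" for s
  have uh: "integrable lborel (\<lambda>s. u (s + ?h))"
   using lborel_integrable_real_affine[OF ui, of 1 ?h] by (simp add: add.commute)
  have di: "integrable lborel d" unfolding d_def[abs_def] using uh ui by simp
  have "AE s in lebesgue_on ?P. d s = 0"
  proof (rule fundamental_lemma)
   have "integrable lebesgue d" using di by (intro integrable_completion[THEN iffD2]) auto
   then have "integrable lebesgue (\<lambda>s. indicator ?P s *\<^sub>R d s)" by (rule integrable_mult_indicator[rotated]) simp
   then show "integrable (lebesgue_on ?P) d" by (simp add: integrable_lebesgue_on_iff)
   fix \<phi> assume \<phi>: "\<phi> \<in> test_functions ?P"
   have z: "\<bar>LINT s|lborel. d s * \<phi> s\<bar> <= \<bar>?h\<bar> * \<kappa> * L2norm lborel \<phi>" if "\<kappa> > 0" for \<kappa>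
    using weakly_differentiable.translation_test[OF wd[OF that] \<phi>, of ?h] xy
    unfolding d_def
   proof (simp, elim meta_mp)
    fix p s :: real assume a: "0 < p \<and> p < T - ?h" "0 <= s" "s <= 1"
    have "0 <= s * ?h" "s * ?h <= ?h" using a xy by (auto intro: mult_left_le_one_le)
    then show "0 < p + s * ?h \<and> p + s * ?h < T" using a by auto
   qed
   have "\<bar>LINT s|lborel. d s * \<phi> s\<bar> <= 0"
   proof (rule field_le_epsilon)
    fix e :: real assume e: "e > 0"
    \<comment> \<open>With \<kappa> equal to \<open>e\<close> divided by this number the bound is at
      most \<open>e\<close>; the added 1 excludes division by zero.\<close>
    let ?N = "\<bar>?h\<bar> * L2norm lborel \<phi> + 1"
    have N: "?N > 0" using L2norm_nonneg[of lborel \<phi>] by (intro add_nonneg_pos mult_nonneg_nonneg) auto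
    have "\<bar>LINT s|lborel. d s * \<phi> s\<bar> <= (e / ?N) * (\<bar>?h\<bar> * L2norm lborel \<phi>)"
     using z[of "e / ?N"] e N by (simp add: mult_ac)
    also have "... <= (e / ?N) * ?N" using e N by (intro mult_left_mono) auto
    finally show "\<bar>LINT s|lborel. d s * \<phi> s\<bar> <= 0 + e" using N by simp
   qed
   moreover have "(LINT s|lebesgue_on ?P. d s * \<phi> s) = (LINT s|lebesgue. d s * \<phi> s)"
    unfolding integral_lebesgue_on_eq[of ?P, simplified]
   proof (rule Bochner_Integration.integral_cong[OF refl])
    fix s show "indicator ?P s *\<^sub>R (d s * \<phi> s) = d s * \<phi> s"
     using test_function_zero_outside[OF \<phi>, of s] by (auto split: split_indicator)
   qed
   moreover have "(LINT s|lebesgue. d s * \<phi> s) = (LINT s|lborel. d s * \<phi> s)"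
    using borel_measurable_integrable[OF di] test_function_measurable[OF \<phi>] by (intro integral_completion) simp
   ultimately show "(LINT s|lebesgue_on ?P. d s * \<phi> s) = 0" by simp
  qed simp
  then have "AE s in lebesgue_on ?P. f (s + ?h) - f s = 0"
   using AE_space
  proof eventually_elim
   case (elim s)
   then show ?case using xy by (auto simp: d_def u_def space_restrict_space split: split_indicator_asm)
  qed
  note ae = this
  have cont: "continuous_on ?P (\<lambda>s. f (s + ?h) - f s)"
  proof (intro continuous_on_diff)
   show "continuous_on ?P (\<lambda>s. f (s + ?h))"
    by (rule continuous_on_compose2[OF fo]) (use xy in \<open>auto intro!: continuous_intros\<close>)
   show "continuous_on ?P f" by (rule continuous_on_subset[OF fo]) (use xy in auto)
  qed
  have "f (x + ?h) - f x = 0" by (rule AE_zero_continuous[OF open_greaterThanLessThan cont ae]) (use x xy y in simp)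
  then show ?thesis by simp
 qed
 have cl: "closure {0<..<T} = {0..T}" using T_pos by (rule closure_greaterThanLessThan)
 have mid: "f s = f (T / 2)" if s: "s \<in> {0<..<T}" for s
 proof -
  have s': "0 < s" "s < T" and T2: "0 < T / 2" "T / 2 < T" using s T_pos by auto
  consider "s < T / 2" | "s = T / 2" | "T / 2 < s" by linarith
  then show ?thesis
  proof cases
   case 1 show ?thesis by (rule eq[OF s'(1) 1 T2(2)])
  next
   case 2 show ?thesis by (rule arg_cong[OF 2])
  next
   case 3 show ?thesis by (rule eq[OF T2(1) 3 s'(2), symmetric])
  qed
 qed
 have c: "f s = f (T / 2)" if "s \<in> {0..T}" for s
  by (rule continuous_constant_on_closure[OF f[folded cl] mid that[folded cl]])
 show ?thesis by (rule trans[OF c[OF t] c[symmetric]]) (use T_pos in simp)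
qed

text \<open>Integration by parts shows that \<open>w\<close> minus the primitive is continuous with
  vanishing weak derivative.\<close>

lemma weak_derivative_primitive:
 fixes w z :: "real => real"
 assumes w: "continuous_on {0..T} w" and z: "integrable L z"
  and zero: "!!\<phi>. \<phi> \<in> test_functions {0<..<T} ==> (LINT t|L. deriv \<phi> t * w t) = - (LINT t|L. \<phi> t * z t)"
  and t: "t \<in> {0..T}"
 shows "w t = w 0 + primitive z t"
proof -
 have "w t - primitive z t = w 0 - primitive z 0"
 proof (rule constant_if_weak_derivative_zero[OF continuous_on_diff[OF w continuous_on_primitive(1)[OF z]] _ t])
  fix \<phi> assume \<phi>: "\<phi> \<in> test_functions {0<..<T}"
  note c\<phi> = continuous_on_subset[OF test_function_continuous[OF deriv_test_function(3)[OF \<phi>]] subset_UNIV]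
  have "integrable L (\<lambda>t. deriv \<phi> t * g t)" if g: "continuous_on {0..T} g" for g
   using continuous_imp_integrable_real[OF continuous_on_mult[OF c\<phi> g]] .
  then show "(LINT t|L. deriv \<phi> t * (w t - primitive z t)) = 0"
   using w continuous_on_primitive(1)[OF z] zero[OF \<phi>] integral_by_parts[OF z \<phi>]
   by (simp add: right_diff_distrib)
 qed
 then show ?thesis using continuous_on_primitive(2)[OF z] by simp
qed

end

subsection \<open>Weak derivatives with values in a seminormed space\<close>

lemma (in time_interval) primitive_mult_left:
 fixes f :: "real => real"
 shows "primitive (\<lambda>s. c * f s) t = c * primitive f t"
 unfolding primitive_def by (simp only: real_scaleR_def mult.left_commute[of _ c] integral_mult_right_zero)

context linear_nspace
begin

lemma carr_bochner_L2_iff: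
 "u \<in> carr (bochner_L2 X N) \<longleftrightarrow> strongly_measurable X N u \<and> integrable N (\<lambda>x. (nrm X (u x))\<^sup>2)"
 by (simp add: bochner_L2_def)

lemma carr_bochner_L2_in: "u \<in> carr (bochner_L2 X N) ==> t \<in> space N ==> u t \<in> carr X"
 by (simp add: carr_bochner_L2_iff strongly_measurable_def)

lemma mem_L2_nrm: "u \<in> carr (bochner_L2 X N) ==> mem_L2 N (\<lambda>t. nrm X (u t))"
 by (simp add: carr_bochner_L2_iff mem_L2_def nrm_measurable)

lemma nrm_pair_measurable:
 assumes f: "strongly_measurable X L f" and g: "strongly_measurable X L g"
 shows "(\<lambda>t. nrm X (f t - g t)) \<in> borel_measurable L"
proof -
 obtain r where r: "\<forall>n. simple_function L (r n) \<and> r n ` space L \<subseteq> carr X"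
  "\<forall>x\<in>space L. (\<lambda>n. nrm X (g x - r n x)) \<longlonglongrightarrow> 0"
  using g[unfolded strongly_measurable_def] by (elim conjE exE)
 show ?thesis
 proof (rule borel_measurable_LIMSEQ_metric)
  show "(\<lambda>t. nrm X (f t - r n t)) \<in> borel_measurable L" for n
   by (rule nrm_diff_measurable[OF f r(1)[rule_format, THEN conjunct1] r(1)[rule_format, THEN conjunct2]])
  fix t assume t: "t \<in> space L"
  have c: "f t \<in> carr X" "g t \<in> carr X" using f g t by (simp_all add: strongly_measurable_def)
  have rc: "r n t \<in> carr X" for n by (rule subsetD[OF r(1)[rule_format, THEN conjunct2] imageI[OF t]])
  have "norm (nrm X (f t - r n t) - nrm X (f t - g t)) <= nrm X (g t - r n t)" for n
   using nrm_triangle_diff[OF c(1) c(2) rc[of n]] nrm_triangle_diff[OF c(1) rc[of n] c(2)]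
    nrm_minus_commute[OF c(2) rc[of n]] by (simp add: abs_le_iff)
  then have "(\<lambda>n. nrm X (f t - r n t) - nrm X (f t - g t)) \<longlonglongrightarrow> 0"
   by (rule LIMSEQ_null_comparison) (rule r(2)[rule_format, OF t])
  then show "(\<lambda>n. nrm X (f t - r n t)) \<longlonglongrightarrow> nrm X (f t - g t)" by (simp only: LIM_zero_iff)
 qed
qed

lemma mem_L2_nrm_diff:
 assumes u: "u \<in> carr (bochner_L2 X N)" and v: "v \<in> carr (bochner_L2 X N)"
 shows "mem_L2 N (\<lambda>t. nrm X (u t - v t))"
proof (rule mem_L2_bound)
 show "(\<lambda>t. nrm X (u t - v t)) \<in> borel_measurable N"
  using u v by (intro nrm_pair_measurable) (simp_all add: carr_bochner_L2_iff)
 show "integrable N (\<lambda>t. (norm (nrm X (u t) + nrm X (v t)))\<^sup>2)"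
  by (rule mem_L2_integrable[OF mem_L2_add[OF mem_L2_nrm[OF u] mem_L2_nrm[OF v]]])
 show "AE t in N. (norm (nrm X (u t - v t)))\<^sup>2 <= (norm (nrm X (u t) + nrm X (v t)))\<^sup>2"
 proof (rule AE_I2)
  fix t assume t: "t \<in> space N"
  note c = carr_bochner_L2_in[OF u t] carr_bochner_L2_in[OF v t]
  have "nrm X (u t - v t) <= nrm X (u t) + nrm X (v t)"
   using nrm_triangle[OF c(1) carr_uminus[OF c(2)]] nrm_uminus[OF c(2)] by simp
  then show "(norm (nrm X (u t - v t)))\<^sup>2 <= (norm (nrm X (u t) + nrm X (v t)))\<^sup>2"
   using nrm_nonneg[OF carr_diff[OF c]] by (intro power_mono) auto
 qed
qed

lemma mem_L2_functional:
 assumes p: "bounded_functional p B" and u: "u \<in> carr (bochner_L2 X N)"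
 shows "mem_L2 N (\<lambda>t. p (u t))"
proof (rule mem_L2_bound)
 show "(\<lambda>t. p (u t)) \<in> borel_measurable N"
  using u by (intro functional_measurable[OF p]) (simp add: carr_bochner_L2_iff)
 show "integrable N (\<lambda>t. (norm (B *\<^sub>R nrm X (u t)))\<^sup>2)" by (rule mem_L2_integrable[OF mem_L2_scaleR[OF mem_L2_nrm[OF u]]])
 show "AE t in N. (norm (p (u t)))\<^sup>2 <= (norm (B *\<^sub>R nrm X (u t)))\<^sup>2"
 proof (rule AE_I2)
  fix t assume t: "t \<in> space N"
  have "norm (p (u t)) <= norm (B *\<^sub>R nrm X (u t))"
   using functional_le[OF p carr_bochner_L2_in[OF u t]] by (simp add: order_trans[OF _ abs_ge_self])
  then show "(norm (p (u t)))\<^sup>2 <= (norm (B *\<^sub>R nrm X (u t)))\<^sup>2" by (rule power_mono) simp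
 qed
qed

end

locale time_nspace = time_interval T + linear_nspace X
 for T :: real and X :: "'v::real_vector nspace"
begin

abbreviation "Z \<equiv> bochner_L2 X L"

lemma space_L: "space L = {0..T}" by (simp add: space_restrict_space)

lemma functional_weak_derivative:
 assumes p: "bounded_functional p B" and u: "u \<in> carr Z" and v: "v \<in> carr Z"
  and der: "has_weak_time_derivative T X u v" and \<phi>: "\<phi> \<in> test_functions {0<..<T}"
 shows "(LINT t|L. deriv \<phi> t * p (u t)) = - (LINT t|L. \<phi> t * p (v t))"
proof -
 have int: "integrable L (\<lambda>t. p (\<theta> t *\<^sub>R w t)) \<and> (LINT t|L. p (\<theta> t *\<^sub>R w t)) = (LINT t|L. \<theta> t * p (w t))"
  if w: "w \<in> carr Z" and \<theta>: "\<theta> \<in> test_functions {0<..<T}" for w \<theta>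
 proof -
  have eq: "p (\<theta> t *\<^sub>R w t) = \<theta> t * p (w t)" if "t \<in> space L" for t
   using functional_scaleR[OF p carr_bochner_L2_in[OF w that]] .
  obtain B' where B': "!!t. \<bar>\<theta> t\<bar> <= B'" using test_function_bounded[OF \<theta>] by blast
  have pw: "integrable L (\<lambda>t. p (w t))" by (rule mem_L2_integrable_finite[OF mem_L2_functional[OF p w] finite_measure_L])
  note [measurable] = borel_measurable_integrable[OF pw] test_function_measurable_L[OF \<theta>]
  have "integrable L (\<lambda>t. \<theta> t * p (w t))"
  proof (rule Bochner_Integration.integrable_bound)
   show "integrable L (\<lambda>t. B' * p (w t))" using pw by simp
   show "AE t in L. norm (\<theta> t * p (w t)) <= norm (B' * p (w t))"
    using B' by (intro AE_I2) (auto simp: abs_mult intro!: mult_right_mono intro: order_trans[OF _ abs_ge_self])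
  qed measurable
  moreover have "integrable L (\<lambda>t. p (\<theta> t *\<^sub>R w t)) \<longleftrightarrow> integrable L (\<lambda>t. \<theta> t * p (w t))"
   by (rule Bochner_Integration.integrable_cong[OF refl]) (rule eq)
  moreover have "(LINT t|L. p (\<theta> t *\<^sub>R w t)) = (LINT t|L. \<theta> t * p (w t))"
   by (rule Bochner_Integration.integral_cong[OF refl]) (rule eq)
  ultimately show ?thesis by (simp only: simp_thms)
 qed
 obtain y where y: "has_bochner_integral_in X L (\<lambda>t. deriv \<phi> t *\<^sub>R u t) y"
  "has_bochner_integral_in X L (\<lambda>t. \<phi> t *\<^sub>R v t) (- y)"
  using der \<phi> unfolding has_weak_time_derivative_def by (elim ballE exE conjE) auto
 note 1 = int[OF u deriv_test_function(3)[OF \<phi>]] and 2 = int[OF v \<phi>]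
 have yc: "y \<in> carr X" using y(1) by (simp add: has_bochner_integral_in_def)
 have "(LINT t|L. deriv \<phi> t * p (u t)) = p y"
  using functional_bochner_integral[OF finite_measure_L p y(1)] 1 by simp
 moreover have "(LINT t|L. \<phi> t * p (v t)) = p (- y)"
  using functional_bochner_integral[OF finite_measure_L p y(2)] 2 by simp
 ultimately show ?thesis using functional_uminus[OF p yc] by simp
qed

end

text \<open>A substitute for Hahn-Banach in the shape of Riesz functionals: the normalisation avoids
  dividing by a norm that may be 0.\<close>

locale normed_time_nspace = time_nspace +
 assumes norming: "!!c. c \<in> carr X ==> \<exists>p. bounded_functional p (nrm X c) \<and> p c = (nrm X c)\<^sup>2"
begin

text \<open>For a single functional the fundamental lemma gives equality outside a null set, so only
  countably many functionals are affordable. The simple approximations of \<open>v\<close> and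
  \<open>w\<close> have countably many values altogether, and functionals norming the differences of
  these values already control the norm of the difference.\<close>

lemma weak_time_derivative_unique:
 assumes u: "u \<in> carr Z" and v: "v \<in> carr Z" "has_weak_time_derivative T X u v"
  and w: "w \<in> carr Z" "has_weak_time_derivative T X u w"
 shows "AE t in L. nrm X (v t - w t) = 0"
proof -
 have sv: "strongly_measurable X L v" and sw: "strongly_measurable X L w" using v(1) w(1) by (simp_all add: carr_bochner_L2_iff)
 obtain s where s: "\<forall>n. simple_function L (s n) \<and> s n ` space L \<subseteq> carr X"
  "\<forall>x\<in>space L. (\<lambda>n. nrm X (v x - s n x)) \<longlonglongrightarrow> 0"
  using sv[unfolded strongly_measurable_def] by (elim conjE exE)
 obtain r where r: "\<forall>n. simple_function L (r n) \<and> r n ` space L \<subseteq> carr X"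
  "\<forall>x\<in>space L. (\<lambda>n. nrm X (w x - r n x)) \<longlonglongrightarrow> 0"
  using sw[unfolded strongly_measurable_def] by (elim conjE exE)
 let ?C = "\<Union>n. (\<lambda>(a, b). a - b) ` (s n ` space L \<times> r n ` space L)"
 have sc: "s n t \<in> carr X" and rc: "r n t \<in> carr X" if "t \<in> space L" for n t
  by (rule subsetD[OF s(1)[rule_format, THEN conjunct2] imageI[OF that]],
    rule subsetD[OF r(1)[rule_format, THEN conjunct2] imageI[OF that]])
 have fin: "finite (s n ` space L)" "finite (r n ` space L)" for n
  using s(1)[rule_format, THEN conjunct1, of n] r(1)[rule_format, THEN conjunct1, of n] by (simp_all add: simple_function_def)
 have count: "countable ?C"
  by (rule countable_UN, simp, rule countable_finite, rule finite_imageI, rule finite_cartesian_product, rule fin(1), rule fin(2))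
 define P where "P c = (SOME p. bounded_functional p (nrm X c) \<and> p c = (nrm X c)\<^sup>2)" for c
 have P: "bounded_functional (P c) (nrm X c)" "P c c = (nrm X c)\<^sup>2" if "c \<in> carr X" for c
  using someI_ex[OF norming[OF that]] unfolding P_def by simp_all
 have "AE t in L. \<forall>c\<in>?C. P c (v t - w t) = 0"
 proof (rule AE_ball_countable[OF count, THEN iffD2], rule ballI)
  fix c assume "c \<in> ?C"
  then obtain n a b where "c = a - b" "a \<in> s n ` space L" "b \<in> r n ` space L" by auto
  then have c: "c \<in> carr X"
   using s(1)[rule_format, THEN conjunct2, of n] r(1)[rule_format, THEN conjunct2, of n] by (auto intro: carr_diff)
  note p = P(1)[OF c]
  let ?g = "\<lambda>t. P c (v t) - P c (w t)"
  have vi: "integrable L (\<lambda>t. P c (v t))" and wi: "integrable L (\<lambda>t. P c (w t))"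
   using mem_L2_functional[OF p v(1)] mem_L2_functional[OF p w(1)] mem_L2_integrable_finite[OF _ finite_measure_L] by auto
  have gi: "integrable L ?g" using vi wi by simp
  have "AE t in lebesgue_on {0<..<T}. ?g t = 0"
  proof (rule fundamental_lemma)
   have "integrable lebesgue (\<lambda>t. indicator {0<..<T} t *\<^sub>R (indicator {0..T} t *\<^sub>R ?g t))"
    by (rule integrable_mult_indicator) (use gi in \<open>simp_all add: integrable_lebesgue_on_iff\<close>)
   then show "integrable (lebesgue_on {0<..<T}) ?g"
    unfolding integrable_lebesgue_on_iff[of "{0<..<T}", simplified]
    by (rule Bochner_Integration.integrable_cong[OF refl, THEN iffD1, rotated]) (auto split: split_indicator)
   fix \<phi> assume \<phi>: "\<phi> \<in> test_functions {0<..<T}"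
   have pi: "integrable L (\<lambda>t. f t * \<phi> t)" if f: "integrable L f" for f :: "real => real"
   proof -
    obtain B where B: "!!t. \<bar>\<phi> t\<bar> <= B" using test_function_bounded[OF \<phi>] by blast
    note [measurable] = borel_measurable_integrable[OF f] test_function_measurable_L[OF \<phi>]
    show ?thesis
    proof (rule Bochner_Integration.integrable_bound)
     show "integrable L (\<lambda>t. f t * B)" using f by simp
     show "AE t in L. norm (f t * \<phi> t) <= norm (f t * B)"
      using B by (intro AE_I2) (auto simp: abs_mult intro!: mult_left_mono intro: order_trans[OF _ abs_ge_self])
    qed measurable
   qed
   have "(LINT t|lebesgue_on {0<..<T}. ?g t * \<phi> t) = (LINT t|L. ?g t * \<phi> t)"
    unfolding integral_lebesgue_on_eq[of "{0..T}", simplified] integral_lebesgue_on_eq[of "{0<..<T}", simplified]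
    using test_function_zero_outside[OF \<phi>]
    by (intro Bochner_Integration.integral_cong) (auto split: split_indicator)
   also have "... = (LINT t|L. \<phi> t * P c (v t)) - (LINT t|L. \<phi> t * P c (w t))"
    using pi[OF vi] pi[OF wi] by (simp add: right_diff_distrib mult.commute)
   also have "... = 0"
    using functional_weak_derivative[OF p u v \<phi>] functional_weak_derivative[OF p u w \<phi>] by simp
   finally show "(LINT t|lebesgue_on {0<..<T}. ?g t * \<phi> t) = 0" .
  qed simp
  then have ae: "AE t in lebesgue. t \<in> {0<..<T} --> ?g t = 0" by (simp add: AE_lebesgue_on_iff)
  have ends: "AE t in lebesgue. t \<notin> {0, T}"
   by (rule AE_I'[of "{0, T}"]) (auto simp: negligible_iff_null_sets[symmetric])
  have "AE t in lebesgue. t \<in> {0..T} --> ?g t = 0" using ae ends by eventually_elim auto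
  then have "AE t in L. ?g t = 0" by (simp add: AE_lebesgue_on_iff)
  then show "AE t in L. P c (v t - w t) = 0"
   using AE_space by eventually_elim (simp add: functional_diff[OF p] carr_bochner_L2_in[OF v(1)] carr_bochner_L2_in[OF w(1)])
 qed
 then show ?thesis using AE_space
 proof eventually_elim
  case (elim t)
  note t = \<open>t \<in> space L\<close>
  let ?z = "v t - w t"
  have z: "?z \<in> carr X" by (rule carr_diff[OF carr_bochner_L2_in[OF v(1) t] carr_bochner_L2_in[OF w(1) t]])
  \<comment> \<open>The norming functional of ?c vanishes at ?z, so |?c|^2 is its value at ?c - ?z.
    Hence |?c| <= |?z - ?c|, and the triangle inequality gives |?z| <= 2 |?z - ?c|.\<close>
  have le: "nrm X ?z <= 2 * (nrm X (v t - s n t) + nrm X (w t - r n t))" for n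
  proof -
   let ?c = "s n t - r n t"
   have c: "?c \<in> carr X" by (rule carr_diff[OF sc[OF t] rc[OF t]])
   have "?c \<in> ?C" using t by (intro UN_I[of n] image_eqI[of _ _ "(s n t, r n t)"]) auto
   then have P0: "P ?c ?z = 0" using elim(1) by blast
   note d = carr_diff[OF z c]
   have "(nrm X ?c)\<^sup>2 = - P ?c (?z - ?c)" using functional_diff[OF P(1)[OF c] z c] P0 P(2)[OF c] by simp
   also have "... <= nrm X ?c * nrm X (?z - ?c)" using functional_le[OF P(1)[OF c] d] by simp
   finally have "nrm X ?c <= nrm X (?z - ?c)"
    using nrm_nonneg[OF c] nrm_nonneg[OF d] by (cases "nrm X ?c = 0") (simp_all add: power2_eq_square)
   moreover have "nrm X ?z <= nrm X (?z - ?c) + nrm X ?c" using nrm_triangle[OF d c] by simp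
   moreover have "nrm X (?z - ?c) <= nrm X (v t - s n t) + nrm X (w t - r n t)"
   proof -
    have eq: "?z - ?c = (v t - s n t) + (- (w t - r n t))" by simp
    note vs = carr_diff[OF carr_bochner_L2_in[OF v(1) t] sc[OF t, of n]] and wr = carr_diff[OF carr_bochner_L2_in[OF w(1) t] rc[OF t, of n]]
    show ?thesis unfolding eq using nrm_triangle[OF vs carr_uminus[OF wr]] unfolding nrm_uminus[OF wr] .
   qed
   ultimately show ?thesis by simp
  qed
  have "(\<lambda>n. 2 * (nrm X (v t - s n t) + nrm X (w t - r n t))) \<longlonglongrightarrow> 2 * (0 + 0)"
   by (intro tendsto_mult_left tendsto_add s(2)[rule_format] r(2)[rule_format] t)
  then have "nrm X ?z <= 2 * (0 + 0)" by (rule LIMSEQ_le_const) (use le in auto)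
  then show ?case using nrm_nonneg[OF z] by simp
 qed
qed

text \<open>Fix \<open>t\<close> and take a functional that norms the difference at this time. Along
  it both functions are scalar primitives of their weak derivatives, and one factor of the norm
  cancels.\<close>

lemma weak_time_derivative_bound:
 assumes u: "u \<in> time_H1 T X" and v: "v \<in> carr Z" "has_weak_time_derivative T X u v"
  and u': "u' \<in> time_H1 T X" and v': "v' \<in> carr Z" "has_weak_time_derivative T X u' v'"
  and zero: "nrm X (u 0 - u' 0) = 0" and t: "t \<in> {0..T}"
 shows "nrm X (u t - u' t) <= primitive (\<lambda>s. nrm X (v s - v' s)) t"
proof -
 have uZ: "u \<in> carr Z" and u'Z: "u' \<in> carr Z" using u u' by (simp_all add: time_H1_def)
 have uc: "u s \<in> carr X" and u'c: "u' s \<in> carr X" and vc: "v s \<in> carr X" and v'c: "v' s \<in> carr X" if "s \<in> {0..T}" for s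
  using carr_bochner_L2_in[OF uZ] carr_bochner_L2_in[OF u'Z] carr_bochner_L2_in[OF v(1)] carr_bochner_L2_in[OF v'(1)] that
  unfolding space_L by blast+
 let ?c = "u t - u' t"
 have c: "?c \<in> carr X" by (rule carr_diff[OF uc[OF t] u'c[OF t]])
 obtain p where p: "bounded_functional p (nrm X ?c)" "p ?c = (nrm X ?c)\<^sup>2" using norming[OF c] by blast
 have cont: "continuous_on {0..T} (\<lambda>s. p (f s))" if f: "f \<in> time_H1 T X" for f
  unfolding continuous_on_def
 proof
  fix s assume s: "s \<in> {0..T}"
  have fZ: "f \<in> carr Z" using f by (simp add: time_H1_def)
  have fc: "f s \<in> carr X" if "s \<in> {0..T}" for s using carr_bochner_L2_in[OF fZ] that unfolding space_L by blast
  have "((\<lambda>r. nrm X (f r - f s)) \<longlongrightarrow> 0) (at s within {0..T})" using f s by (simp add: time_H1_def)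
  from tendsto_mult_left[OF this, of "nrm X ?c"] have 0: "((\<lambda>r. nrm X ?c * nrm X (f r - f s)) \<longlongrightarrow> 0) (at s within {0..T})" by simp
  have "((\<lambda>r. p (f r) - p (f s)) \<longlongrightarrow> 0) (at s within {0..T})"
  proof (rule Lim_null_comparison[OF _ 0])
   show "\<forall>\<^sub>F r in at s within {0..T}. norm (p (f r) - p (f s)) <= nrm X ?c * nrm X (f r - f s)"
    unfolding eventually_at_filter
   proof (intro always_eventually allI impI)
    fix r assume "r \<in> {0..T}"
    then show "norm (p (f r) - p (f s)) <= nrm X ?c * nrm X (f r - f s)"
     using functional_le[OF p(1) carr_diff[OF fc fc[OF s]]] functional_diff[OF p(1) fc fc[OF s]] by simp
   qed
  qed
  then show "((\<lambda>r. p (f r)) \<longlongrightarrow> p (f s)) (at s within {0..T})" by (simp only: LIM_zero_iff)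
 qed
 have pv: "integrable L (\<lambda>s. p (v s))" and pv': "integrable L (\<lambda>s. p (v' s))"
  using mem_L2_functional[OF p(1) v(1)] mem_L2_functional[OF p(1) v'(1)] mem_L2_integrable_finite[OF _ finite_measure_L] by auto
 have w: "p (f t) = p (f 0) + primitive (\<lambda>s. p (g s)) t"
  if f: "f \<in> time_H1 T X" and g: "g \<in> carr Z" "has_weak_time_derivative T X f g" for f g
 proof (rule weak_derivative_primitive[OF cont[OF f] _ _ t])
  show "integrable L (\<lambda>s. p (g s))" by (rule mem_L2_integrable_finite[OF mem_L2_functional[OF p(1) g(1)] finite_measure_L])
  fix \<phi> assume "\<phi> \<in> test_functions {0<..<T}"
  moreover have "f \<in> carr Z" using f by (simp add: time_H1_def)
  ultimately show "(LINT t|L. deriv \<phi> t * p (f t)) = - (LINT t|L. \<phi> t * p (g t))"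
   using g by (intro functional_weak_derivative[OF p(1)])
 qed
 have T0: "0 \<in> {0..T}" using T_pos by simp
 have "p (u 0) - p (u' 0) = 0"
  using functional_le[OF p(1) carr_diff[OF uc[OF T0] u'c[OF T0]]] functional_diff[OF p(1) uc[OF T0] u'c[OF T0]] zero by simp
 then have "(nrm X ?c)\<^sup>2 = primitive (\<lambda>s. p (v s)) t - primitive (\<lambda>s. p (v' s)) t"
  using w[OF u v] w[OF u' v'] functional_diff[OF p(1) uc[OF t] u'c[OF t]] p(2) by simp
 also have "... = primitive (\<lambda>s. p (v s) - p (v' s)) t"
  unfolding primitive_def using primitive_integrable[OF pv, of t] primitive_integrable[OF pv', of t]
  by (simp add: scaleR_diff_right del: real_scaleR_def)
 also have "... <= primitive (\<lambda>s. nrm X ?c * nrm X (v s - v' s)) t"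
 proof (rule primitive_mono)
  show "integrable L (\<lambda>s. nrm X ?c * nrm X (v s - v' s))"
   using mem_L2_integrable_finite[OF mem_L2_nrm_diff[OF v(1) v'(1)] finite_measure_L] by simp
  show "AE s in L. s <= t --> p (v s) - p (v' s) <= nrm X ?c * nrm X (v s - v' s)"
  proof (rule AE_I2, rule impI)
   fix s assume "s \<in> space L"
   then have s: "s \<in> {0..T}" by (simp add: space_L)
   show "p (v s) - p (v' s) <= nrm X ?c * nrm X (v s - v' s)"
    using functional_le[OF p(1) carr_diff[OF vc[OF s] v'c[OF s]]] functional_diff[OF p(1) vc[OF s] v'c[OF s]] by simp
  qed
 qed (use pv pv' in simp)
 also have "... = nrm X ?c * primitive (\<lambda>s. nrm X (v s - v' s)) t"
  by (rule primitive_mult_left)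
 finally have le: "(nrm X ?c)\<^sup>2 <= nrm X ?c * primitive (\<lambda>s. nrm X (v s - v' s)) t" .
 show ?thesis
 proof (cases "nrm X ?c = 0")
  case True
  have "0 <= primitive (\<lambda>s. nrm X (v s - v' s)) t"
   unfolding primitive_def
   by (rule integral_nonneg_AE, rule AE_I2) (simp add: space_L nrm_nonneg carr_diff vc v'c)
  then show ?thesis using True by simp
 next
  case False
  then have "nrm X ?c > 0" using nrm_nonneg[OF c] by simp
  then show ?thesis using le by (simp add: power2_eq_square)
 qed
qed

end

section \<open>Pathwise Picard iteration and uniqueness\<close>

section \<open>An evolution equation in the Hilbert space\<close>

context time_interval
begin

lemma primitive_diff:
 assumes "integrable L f" "integrable L g"
 shows "primitive (\<lambda>s. f s - g s) t = primitive f t - primitive g t"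
 unfolding primitive_def scaleR_diff_right
 by (rule Bochner_Integration.integral_diff[OF primitive_integrable[OF assms(1)] primitive_integrable[OF assms(2)]])

lemma norm_primitive_diff_le:
 fixes z :: "real => 'b::{banach, second_countable_topology}"
 assumes z: "integrable L z" and g: "integrable L g" and le: "!!s. s \<in> {0..T} ==> norm (z s) <= g s" and st: "s <= t"
 shows "norm (primitive z t - primitive z s) <= primitive g t - primitive g s"
proof -
 let ?i = "\<lambda>r. (if r <= t then 1 else 0) - (if r <= s then 1 else 0) :: real"
 note zt = primitive_integrable[OF z, of t] and zs = primitive_integrable[OF z, of s]
 note gt = primitive_integrable[OF g, of t] and gs = primitive_integrable[OF g, of s]
 have "primitive z t - primitive z s = (LINT r|L. ?i r *\<^sub>R z r)"
  unfolding primitive_def scaleR_diff_left by (rule Bochner_Integration.integral_diff[OF zt zs, symmetric])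
 also have "norm ... <= (LINT r|L. norm (?i r *\<^sub>R z r))" by (rule integral_norm_bound)
 also have "... <= (LINT r|L. ?i r *\<^sub>R g r)"
 proof (rule integral_mono_AE)
  show "integrable L (\<lambda>r. norm (?i r *\<^sub>R z r))"
   unfolding scaleR_diff_left by (intro integrable_norm Bochner_Integration.integrable_diff zt zs)
  show "integrable L (\<lambda>r. ?i r *\<^sub>R g r)"
   unfolding scaleR_diff_left by (intro Bochner_Integration.integrable_diff gt gs)
  show "AE r in L. norm (?i r *\<^sub>R z r) <= ?i r *\<^sub>R g r"
   using le st by (intro AE_I2) (auto simp: space_restrict_space)
 qed
 also have "... = primitive g t - primitive g s"
  unfolding primitive_def scaleR_diff_left by (rule Bochner_Integration.integral_diff[OF gt gs])
 finally show ?thesis .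
qed

lemma norm_primitive_le:
 fixes z :: "real => 'b::{banach, second_countable_topology}"
 assumes z: "integrable L z" and g: "integrable L g" and le: "!!s. s \<in> {0..T} ==> norm (z s) <= g s"
 shows "norm (primitive z t) <= primitive g t"
proof -
 have "norm (primitive z t) <= (LINT r|L. norm ((if r <= t then 1 else 0 :: real) *\<^sub>R z r))"
  unfolding primitive_def by (rule integral_norm_bound)
 also have "... <= primitive g t"
  unfolding primitive_def
 proof (rule integral_mono_AE)
  show "AE r in L. norm ((if r <= t then 1 else 0 :: real) *\<^sub>R z r) <= (if r <= t then 1 else 0) *\<^sub>R g r"
   using le by (intro AE_I2) (auto simp: space_restrict_space)
 qed (intro integrable_norm primitive_integrable z g)+
 finally show ?thesis .
qed

lemma primitive_le_integral:
 fixes g :: "real => real"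
 assumes g: "integrable L g" and nonneg: "!!s. s \<in> {0..T} ==> 0 <= g s"
 shows "primitive g t <= (LINT s|L. g s)"
 unfolding primitive_def
proof (rule integral_mono_AE[OF primitive_integrable[OF g] g])
 show "AE r in L. (if r <= t then 1 else 0) *\<^sub>R g r <= g r"
  using nonneg by (intro AE_I2) (auto simp: space_restrict_space)
qed

end

text \<open>The growth bound \<open>\<rho>\<close> does not depend on \<open>\<omega>\<close>, so that the iteration
 can be carried out for each \<open>\<omega>\<close> separately.\<close>

locale hilbert_evolution = hilbert_nspace X J + time_interval T
 for X :: "'v::real_vector nspace" and J :: "'v => 'h::{real_inner, banach, second_countable_topology}" and T :: real +
 fixes M :: "'w measure" and R :: "real \<times> 'w => 'h => 'h" and \<Lambda> :: real and \<rho> :: "real => real"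
 assumes prob_M: "prob_space M" and separable_M: "separable_L2 M"
  and R_in: "!!z g. z \<in> space (L \<Otimes>\<^sub>M M) ==> R z g \<in> G"
  and R_lipschitz: "!!z g h. z \<in> space (L \<Otimes>\<^sub>M M) ==> norm (R z g - R z h) <= \<Lambda> * norm (g - h)"
  and \<Lambda>: "\<Lambda> \<ge> 0"
  and R_measurable: "!!U. U \<in> borel_measurable (L \<Otimes>\<^sub>M M) ==> (\<lambda>z. R z (U z)) \<in> borel_measurable (L \<Otimes>\<^sub>M M)"
  and R_zero: "!!t \<omega>. t \<in> {0..T} ==> \<omega> \<in> space M ==> norm (R (t, \<omega>) 0) <= \<rho> t"
  and \<rho>: "mem_L2 L \<rho>"
begin

sublocale M: prob_space M by (rule prob_M)

abbreviation "Y \<equiv> bochner_L2 X M"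

sublocale Y: linear_nspace Y by (rule linear_nspace_bochner_L2)

lemma space_P: "space (L \<Otimes>\<^sub>M M) = {0..T} \<times> space M" by (simp add: space_pair_measure space_restrict_space)

lemma in_P: "t \<in> {0..T} ==> \<omega> \<in> space M ==> (t, \<omega>) \<in> space (L \<Otimes>\<^sub>M M)" by (simp add: space_P)

text \<open>The inner product with \<open>c\<close> under the expectation, bounded by
  Cauchy-Schwarz.\<close>

lemma norming_bochner_L2:
 assumes c: "c \<in> carr Y"
 shows "\<exists>p. Y.bounded_functional p (nrm Y c) \<and> p c = (nrm Y c)\<^sup>2"
proof -
 define p where "p x = (LINT \<omega>|M. J (x \<omega>) \<bullet> J (c \<omega>))" for x
 have cm: "mem_L2 M (\<lambda>\<omega>. J (c \<omega>))" by (rule carr_bochner_L2D(2)[OF c])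
 have int: "integrable M (\<lambda>\<omega>. J (x \<omega>) \<bullet> J (c \<omega>))" if "x \<in> carr Y" for x
  by (rule mem_L2_integrable_inner[OF carr_bochner_L2D(2)[OF that] cm])
 have "Y.bounded_functional p (nrm Y c)" unfolding Y.bounded_functional_def
 proof (intro conjI ballI allI)
  show "0 <= nrm Y c" by (rule Y.nrm_nonneg[OF c])
  fix x assume x: "x \<in> carr Y"
  show "p (a *\<^sub>R x) = a * p x" for a
  proof -
   have "p (a *\<^sub>R x) = (LINT \<omega>|M. a * (J (x \<omega>) \<bullet> J (c \<omega>)))" unfolding p_def
    by (rule Bochner_Integration.integral_cong[OF refl]) (simp add: scaleR_fun_def J_scaleR carr_bochner_L2D(1)[OF x])
   then show ?thesis by (simp add: p_def)
  qed
  have "\<bar>p x\<bar> <= (LINT \<omega>|M. norm (J (x \<omega>) \<bullet> J (c \<omega>)))" unfolding p_def using integral_norm_bound[of M "\<lambda>\<omega>. J (x \<omega>) \<bullet> J (c \<omega>)"] by simp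
  also have "... <= (LINT \<omega>|M. norm (J (x \<omega>)) * norm (J (c \<omega>)))"
   by (rule integral_mono_AE[OF integrable_norm[OF int[OF x]] mem_L2_integrable_norm_mult[OF carr_bochner_L2D(2)[OF x] cm]])
    (simp add: Cauchy_Schwarz_ineq2)
  also have "... <= nrm Y c * nrm Y x"
   unfolding nrm_bochner_L2_carr[OF x] nrm_bochner_L2_carr[OF c]
   using L2_Cauchy_Schwarz[OF carr_bochner_L2D(2)[OF x] cm] by (simp add: mult.commute)
  finally show "\<bar>p x\<bar> <= nrm Y c * nrm Y x" .
  fix y assume y: "y \<in> carr Y"
  have "p (x + y) = (LINT \<omega>|M. J (x \<omega>) \<bullet> J (c \<omega>) + J (y \<omega>) \<bullet> J (c \<omega>))" unfolding p_def
   by (rule Bochner_Integration.integral_cong[OF refl])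
    (simp add: J_add inner_add_left carr_bochner_L2D(1)[OF x] carr_bochner_L2D(1)[OF y])
  then show "p (x + y) = p x + p y" using int[OF x] int[OF y] by (simp add: p_def)
 qed
 moreover have "p c = (nrm Y c)\<^sup>2"
  unfolding p_def nrm_bochner_L2_carr[OF c] L2norm_power2 by (simp add: power2_norm_eq_inner)
 ultimately show ?thesis by blast
qed

sublocale TY: normed_time_nspace T Y
 by unfold_locales (rule norming_bochner_L2)

abbreviation "solves_with u v \<equiv> u \<in> time_H1 T Y \<and> nrm Y (u 0) = 0 \<and> v \<in> carr (bochner_L2 Y L) \<and>
 has_weak_time_derivative T Y u v \<and> (AE t in L. AE \<omega> in M. J (v t \<omega>) = R (t, \<omega>) (J (u t \<omega>)))"

theorem solution_unique:
 assumes u: "solves_with u v" and u': "solves_with u' v'" and t: "t \<in> {0..T}"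
 shows "nrm Y (u t - u' t) = 0"
proof -
 have uH: "u \<in> time_H1 T Y" and u'H: "u' \<in> time_H1 T Y" and v: "v \<in> carr (bochner_L2 Y L)" "has_weak_time_derivative T Y u v"
  and v': "v' \<in> carr (bochner_L2 Y L)" "has_weak_time_derivative T Y u' v'" using u u' by simp_all
 have uZ: "u \<in> carr (bochner_L2 Y L)" and u'Z: "u' \<in> carr (bochner_L2 Y L)" using uH u'H by (simp_all add: time_H1_def)
 note c = Y.carr_bochner_L2_in[OF uZ, unfolded TY.space_L] Y.carr_bochner_L2_in[OF u'Z, unfolded TY.space_L]
  Y.carr_bochner_L2_in[OF v(1), unfolded TY.space_L] Y.carr_bochner_L2_in[OF v'(1), unfolded TY.space_L]
 have T0: "0 \<in> {0..T}" using T_pos by simp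
 define m where "m s = nrm Y (u s - u' s)" for s
 define d where "d s = nrm Y (v s - v' s)" for s
 have mi: "integrable L m" and di: "integrable L d" unfolding m_def[abs_def] d_def[abs_def]
  by (rule mem_L2_integrable_finite[OF Y.mem_L2_nrm_diff[OF uZ u'Z] finite_measure_L],
    rule mem_L2_integrable_finite[OF Y.mem_L2_nrm_diff[OF v(1) v'(1)] finite_measure_L])
 have m0: "0 <= m s" and d0: "0 <= d s" if "s \<in> {0..T}" for s
  unfolding m_def d_def by (rule Y.nrm_nonneg[OF Y.carr_diff[OF c(1)[OF that] c(2)[OF that]]],
   rule Y.nrm_nonneg[OF Y.carr_diff[OF c(3)[OF that] c(4)[OF that]]])
 have "nrm Y (u 0 - u' 0) <= nrm Y (u 0) + nrm Y (u' 0)"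
  using Y.nrm_triangle[OF c(1)[OF T0] Y.carr_uminus[OF c(2)[OF T0]]] Y.nrm_uminus[OF c(2)[OF T0]] by simp
 then have zero: "nrm Y (u 0 - u' 0) = 0" using u u' m0[OF T0] by (simp add: m_def)
 have md: "m s <= primitive d s" if "s \<in> {0..T}" for s
  using TY.weak_time_derivative_bound[OF uH v u'H v' zero that] unfolding m_def d_def .
 have "AE s in L. AE \<omega> in M. J (v s \<omega>) = R (s, \<omega>) (J (u s \<omega>))" "AE s in L. AE \<omega> in M. J (v' s \<omega>) = R (s, \<omega>) (J (u' s \<omega>))"
  using u u' by simp_all
 \<comment> \<open>The Lipschitz bound holds on almost every path and is integrated over
   \<omega>.\<close>
 then have ae: "AE s in L. d s <= \<Lambda> * m s"
  using AE_space
 proof eventually_elim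
  case (elim s)
  then have s: "s \<in> {0..T}" by (simp add: TY.space_L)
  note dc = Y.carr_diff[OF c(3)[OF s] c(4)[OF s]] and mc = Y.carr_diff[OF c(1)[OF s] c(2)[OF s]]
  have "d s <= L2norm M (\<lambda>\<omega>. \<Lambda> *\<^sub>R J ((u s - u' s) \<omega>))"
   unfolding d_def nrm_bochner_L2_carr[OF dc]
  proof (rule L2norm_mono[OF mem_L2_scaleR[OF carr_bochner_L2D(2)[OF mc]] mem_L2_measurable[OF carr_bochner_L2D(2)[OF dc]]])
   show "AE \<omega> in M. norm (J ((v s - v' s) \<omega>)) <= norm (\<Lambda> *\<^sub>R J ((u s - u' s) \<omega>))"
    using elim(1,2) AE_space
   proof eventually_elim
    case (elim \<omega>)
    note C = carr_bochner_L2D(1)[OF c(1)[OF s] elim(3)] carr_bochner_L2D(1)[OF c(2)[OF s] elim(3)]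
     carr_bochner_L2D(1)[OF c(3)[OF s] elim(3)] carr_bochner_L2D(1)[OF c(4)[OF s] elim(3)]
    have "norm (R (s, \<omega>) (J (u s \<omega>)) - R (s, \<omega>) (J (u' s \<omega>))) <= \<Lambda> * norm (J (u s \<omega>) - J (u' s \<omega>))"
     by (rule R_lipschitz[OF in_P[OF s elim(3)]])
    then show ?case using \<Lambda> C elim(1,2) by (simp add: J_diff)
   qed
  qed
  also have "... = \<Lambda> * m s" unfolding m_def nrm_bochner_L2_carr[OF mc] L2norm_scaleR using \<Lambda> by simp
  finally show ?case .
 qed
 have "m t = 0"
 proof (rule gronwall_zero[OF mi m0 _ _ \<Lambda> t])
  fix s assume s: "s \<in> {0..T}"
  have "primitive d s <= (LINT r|L. d r)" by (rule primitive_le_integral[OF di d0])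
  then show "m s <= (LINT r|L. d r)" using md[OF s] by simp
  have "primitive d s <= primitive (\<lambda>r. \<Lambda> * m r) s"
   by (rule primitive_mono[OF di]) (use mi ae in \<open>auto elim: eventually_mono\<close>)
  also have "... = \<Lambda> * primitive m s" by (rule primitive_mult_left)
  finally show "m s <= \<Lambda> * primitive m s" using md[OF s] by simp
 qed
 then show ?thesis by (simp add: m_def)
qed

primrec picard :: "nat => real \<times> 'w => 'h" where
 "picard 0 = (\<lambda>z. 0)"
| "picard (Suc k) = (\<lambda>z. primitive (\<lambda>s. R (s, snd z) (picard k (s, snd z))) (fst z))"

text \<open>In its cut-off form the primitive is a parameter integral over a triple product, so
  joint measurability in time and \<omega> is preserved.\<close>

lemma primitive_measurable:
 assumes V: "V \<in> borel_measurable (L \<Otimes>\<^sub>M M)"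
 shows "(\<lambda>z. primitive (\<lambda>s. V (s, snd z) :: 'h) (fst z)) \<in> borel_measurable (L \<Otimes>\<^sub>M M)"
proof -
 note [measurable] = V
 have [measurable]: "(\<lambda>x. fst (fst x)) \<in> borel_measurable ((L \<Otimes>\<^sub>M M) \<Otimes>\<^sub>M L)" "(\<lambda>x. snd x) \<in> borel_measurable ((L \<Otimes>\<^sub>M M) \<Otimes>\<^sub>M L)"
  by (rule measurable_compose[OF measurable_compose[OF measurable_fst measurable_fst] id_measurable_L],
    rule measurable_compose[OF measurable_snd id_measurable_L])
 have [measurable]: "(\<lambda>x. V (snd x, snd (fst x))) \<in> borel_measurable ((L \<Otimes>\<^sub>M M) \<Otimes>\<^sub>M L)"
  by (rule measurable_compose[OF measurable_Pair[OF measurable_snd measurable_compose[OF measurable_fst measurable_snd]] V])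
 have "(\<lambda>x. (if snd x <= fst (fst x) then 1 else 0) *\<^sub>R V (snd x, snd (fst x))) \<in> borel_measurable ((L \<Otimes>\<^sub>M M) \<Otimes>\<^sub>M L)"
  by measurable
 then have "(\<lambda>(z, s). (if s <= fst z then 1 else 0) *\<^sub>R V (s, snd z)) \<in> borel_measurable ((L \<Otimes>\<^sub>M M) \<Otimes>\<^sub>M L)"
  by (simp add: case_prod_beta)
 then show ?thesis unfolding primitive_def by (rule L.borel_measurable_lebesgue_integral)
qed

lemma picard_measurable: "picard k \<in> borel_measurable (L \<Otimes>\<^sub>M M)"
proof (induction k)
 case (Suc k)
 show ?case using primitive_measurable[OF R_measurable[OF Suc]] by simp
qed simp

lemma \<rho>_nonneg: "t \<in> {0..T} ==> 0 <= \<rho> t"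
proof -
 obtain \<omega> where "\<omega> \<in> space M" using M.not_empty by blast
 then show "t \<in> {0..T} ==> 0 <= \<rho> t" using R_zero[of t \<omega>] norm_ge_zero[of "R (t, \<omega>) 0"] by linarith
qed

lemma integrable_\<rho>: "integrable L \<rho>" by (rule mem_L2_integrable_finite[OF \<rho> finite_measure_L])

lemma R_growth:
 assumes "t \<in> {0..T}" "\<omega> \<in> space M"
 shows "norm (R (t, \<omega>) g) <= \<rho> t + \<Lambda> * norm g"
 using norm_triangle_ineq2[of "R (t, \<omega>) g" "R (t, \<omega>) 0"] R_lipschitz[OF in_P[OF assms], of g 0] R_zero[OF assms] by simp

lemma R_section_integrable:
 assumes W: "W \<in> borel_measurable (L \<Otimes>\<^sub>M M)" and \<omega>: "\<omega> \<in> space M"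
  and B: "!!t. t \<in> {0..T} ==> norm (W (t, \<omega>)) <= B"
 shows "integrable L (\<lambda>s. R (s, \<omega>) (W (s, \<omega>)))"
proof (rule Bochner_Integration.integrable_bound)
 show "integrable L (\<lambda>s. \<rho> s + \<Lambda> * B)" using integrable_\<rho> by simp
 show "(\<lambda>s. R (s, \<omega>) (W (s, \<omega>))) \<in> borel_measurable L" by (rule measurable_Pair1[OF R_measurable[OF W] \<omega>])
 show "AE s in L. norm (R (s, \<omega>) (W (s, \<omega>))) <= norm (\<rho> s + \<Lambda> * B)"
 proof (rule AE_I2)
  fix s assume "s \<in> space L"
  then have s: "s \<in> {0..T}" by (simp add: TY.space_L)
  have "norm (R (s, \<omega>) (W (s, \<omega>))) <= \<rho> s + \<Lambda> * B"
   using R_growth[OF s \<omega>, of "W (s, \<omega>)"] mult_left_mono[OF B[OF s] \<Lambda>] by linarith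
  then show "norm (R (s, \<omega>) (W (s, \<omega>))) <= norm (\<rho> s + \<Lambda> * B)" by simp
 qed
qed

lemma picard_bounded:
 assumes \<omega>: "\<omega> \<in> space M" shows "\<exists>B. \<forall>t\<in>{0..T}. norm (picard k (t, \<omega>)) <= B"
proof (induction k)
 case (Suc k)
 then obtain B where B: "!!t. t \<in> {0..T} ==> norm (picard k (t, \<omega>)) <= B" by blast
 have B0: "0 <= B" using order_trans[OF norm_ge_zero B[of 0]] T_pos by simp
 have gi: "integrable L (\<lambda>s. \<rho> s + \<Lambda> * B)" using integrable_\<rho> by simp
 have "norm (picard (Suc k) (t, \<omega>)) <= (LINT s|L. \<rho> s + \<Lambda> * B)" if "t \<in> {0..T}" for t
 proof -
  have "norm (picard (Suc k) (t, \<omega>)) <= primitive (\<lambda>s. \<rho> s + \<Lambda> * B) t"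
   unfolding picard.simps fst_conv snd_conv
  proof (rule norm_primitive_le[OF R_section_integrable[OF picard_measurable \<omega> B] gi])
   fix s assume s: "s \<in> {0..T}"
   show "norm (R (s, \<omega>) (picard k (s, \<omega>))) <= \<rho> s + \<Lambda> * B"
    using R_growth[OF s \<omega>, of "picard k (s, \<omega>)"] mult_left_mono[OF B[OF s] \<Lambda>] by linarith
  qed
  also have "... <= (LINT s|L. \<rho> s + \<Lambda> * B)"
   using \<rho>_nonneg B0 \<Lambda> by (intro primitive_le_integral[OF gi]) simp
  finally show ?thesis .
 qed
 then show ?case by blast
qed auto

lemma picard_integrable: "\<omega> \<in> space M ==> integrable L (\<lambda>s. R (s, \<omega>) (picard k (s, \<omega>)))"
proof -
 assume \<omega>: "\<omega> \<in> space M"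
 obtain B where "\<forall>t\<in>{0..T}. norm (picard k (t, \<omega>)) <= B" using picard_bounded[OF \<omega>] by (rule exE)
 then show ?thesis by (intro R_section_integrable[OF picard_measurable \<omega>]) (rule bspec)
qed

text \<open>The first increment is bounded by the integral of \<rho>, for all times and paths; each
  further step integrates the previous bound and gains from the factorial.\<close>

lemma picard_step:
 assumes \<omega>: "\<omega> \<in> space M" and t: "t \<in> {0..T}"
 shows "norm (picard (Suc k) (t, \<omega>) - picard k (t, \<omega>)) <= (LINT s|L. \<rho> s) * (\<Lambda> * t) ^ k / fact k"
 using t
proof (induction k arbitrary: t)
 case 0
 have "norm (picard 1 (t, \<omega>)) <= primitive \<rho> t"
  using R_section_integrable[of "\<lambda>z. 0" \<omega> 0] R_zero[OF _ \<omega>] \<omega>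
  by (simp, intro norm_primitive_le[OF _ integrable_\<rho>]) auto
 also have "... <= (LINT s|L. \<rho> s)" by (rule primitive_le_integral[OF integrable_\<rho> \<rho>_nonneg])
 finally show ?case by simp
next
 case (Suc k)
 note I = picard_integrable[OF \<omega>]
 let ?d = "\<lambda>s. norm (picard (Suc k) (s, \<omega>) - picard k (s, \<omega>))"
 have dm: "?d \<in> borel_measurable L"
  by (rule measurable_compose[OF borel_measurable_diff[OF measurable_Pair1[OF picard_measurable \<omega>] measurable_Pair1[OF picard_measurable \<omega>]] borel_measurable_norm])
 obtain B B' where B: "!!t. t \<in> {0..T} ==> norm (picard k (t, \<omega>)) <= B" "!!t. t \<in> {0..T} ==> norm (picard (Suc k) (t, \<omega>)) <= B'"
  using picard_bounded[OF \<omega>, of k] picard_bounded[OF \<omega>, of "Suc k"] by blast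
 have di: "integrable L ?d"
 proof (rule L.integrable_const_bound[OF _ dm, where B = "B' + B"], rule AE_I2)
  fix s assume "s \<in> space L"
  then show "norm (?d s) <= B' + B"
   using B[of s] norm_triangle_ineq4[of "picard (Suc k) (s, \<omega>)" "picard k (s, \<omega>)"] by (simp add: TY.space_L del: picard.simps)
 qed
 have "norm (picard (Suc (Suc k)) (t, \<omega>) - picard (Suc k) (t, \<omega>))
   = norm (primitive (\<lambda>s. R (s, \<omega>) (picard (Suc k) (s, \<omega>)) - R (s, \<omega>) (picard k (s, \<omega>))) t)"
  by (simp only: picard.simps(2)[of "Suc k"] picard.simps(2)[of k, THEN fun_cong, of "(t, \<omega>)"] fst_conv snd_conv primitive_diff[OF I I])
 also have "... <= primitive (\<lambda>s. \<Lambda> * ?d s) t"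
 proof (rule norm_primitive_le)
  show "integrable L (\<lambda>s. R (s, \<omega>) (picard (Suc k) (s, \<omega>)) - R (s, \<omega>) (picard k (s, \<omega>)))"
   by (intro Bochner_Integration.integrable_diff I)
  show "integrable L (\<lambda>s. \<Lambda> * ?d s)" using di by simp
  show "norm (R (s, \<omega>) (picard (Suc k) (s, \<omega>)) - R (s, \<omega>) (picard k (s, \<omega>))) <= \<Lambda> * ?d s" if "s \<in> {0..T}" for s
   by (rule R_lipschitz[OF in_P[OF that \<omega>]])
 qed
 also have "... = \<Lambda> * primitive ?d t" by (rule primitive_mult_left)
 also have "... <= (LINT s|L. \<rho> s) * (\<Lambda> * t) ^ Suc k / fact (Suc k)"
  by (rule primitive_iterate[OF di Suc.IH \<Lambda> Suc.prems])
 finally show ?case .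
qed

text \<open>The integral of \<rho> times exp(\<Lambda> T), a bound for all iterates that depends
  neither on \<omega> nor on the index.\<close>

definition E :: real where "E = (\<Sum>k. (LINT s|L. \<rho> s) * (inverse (fact k) * (\<Lambda> * T) ^ k))"

lemma integral_\<rho>_nonneg: "0 <= (LINT s|L. \<rho> s)"
 by (rule integral_nonneg_AE, rule AE_I2) (simp add: TY.space_L \<rho>_nonneg)

lemma picard_limit:
 assumes \<omega>: "\<omega> \<in> space M" and t: "t \<in> {0..T}"
 shows "convergent (\<lambda>k. picard k (t, \<omega>))" and "norm (picard k (t, \<omega>)) <= E"
proof -
 let ?b = "\<lambda>k. (LINT s|L. \<rho> s) * (inverse (fact k) * (\<Lambda> * T) ^ k)"
 let ?d = "\<lambda>k. picard (Suc k) (t, \<omega>) - picard k (t, \<omega>)"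
 have b: "summable ?b" by (intro summable_mult summable_exp)
 have b0: "0 <= ?b k" for k using integral_\<rho>_nonneg \<Lambda> T_pos by (intro mult_nonneg_nonneg zero_le_power) auto
 have db: "norm (?d k) <= ?b k" for k
 proof -
  have "(\<Lambda> * t) ^ k <= (\<Lambda> * T) ^ k" using t \<Lambda> by (intro power_mono mult_left_mono) auto
  then have "(LINT s|L. \<rho> s) * (\<Lambda> * t) ^ k / fact k <= ?b k"
   using integral_\<rho>_nonneg by (simp add: divide_inverse mult_ac mult_left_mono mult_right_mono)
  then show ?thesis using picard_step[OF \<omega> t, of k] by linarith
 qed
 have d: "summable ?d" by (rule summable_comparison_test'[OF b, of 0]) (rule db)
 have sum: "(\<Sum>k<n. ?d k) = picard n (t, \<omega>)" for n
  by (subst sum_lessThan_telescope) (simp del: picard.simps(2))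
 have "(\<lambda>n. picard n (t, \<omega>)) \<longlonglongrightarrow> suminf ?d" using summable_LIMSEQ[OF d] by (simp only: sum)
 then show "convergent (\<lambda>k. picard k (t, \<omega>))" by (rule convergentI)
 have "norm (\<Sum>i<k. ?d i) <= (\<Sum>i<k. ?b i)" by (rule sum_norm_le) (rule db)
 then have "norm (picard k (t, \<omega>)) <= (\<Sum>i<k. ?b i)" by (simp only: sum)
 also have "... <= E" unfolding E_def by (rule sum_le_suminf[OF b]) (simp_all add: b0)
 finally show "norm (picard k (t, \<omega>)) <= E" .
qed

definition W :: "real \<times> 'w => 'h" where "W z = lim (\<lambda>k. picard k z)"
definition V :: "real \<times> 'w => 'h" where "V z = R z (W z)"

lemma W_measurable: "W \<in> borel_measurable (L \<Otimes>\<^sub>M M)"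
 unfolding W_def[abs_def] by (rule borel_measurable_lim_metric) (rule picard_measurable)

lemma V_measurable: "V \<in> borel_measurable (L \<Otimes>\<^sub>M M)"
 unfolding V_def[abs_def] by (rule R_measurable[OF W_measurable])

context
 fixes \<omega> assumes \<omega>: "\<omega> \<in> space M"
begin

lemma picard_tendsto: "t \<in> {0..T} ==> (\<lambda>k. picard k (t, \<omega>)) \<longlonglongrightarrow> W (t, \<omega>)"
 using picard_limit(1)[OF \<omega>] unfolding W_def by (simp add: convergent_LIMSEQ_iff)

lemma norm_W_le: assumes t: "t \<in> {0..T}" shows "norm (W (t, \<omega>)) <= E"
 by (rule LIMSEQ_le_const2[OF tendsto_norm[OF picard_tendsto[OF t]]]) (intro exI allI impI picard_limit(2)[OF \<omega> t])

lemma norm_V_le: "t \<in> {0..T} ==> norm (V (t, \<omega>)) <= \<rho> t + \<Lambda> * E"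
 unfolding V_def using R_growth[OF _ \<omega>, of t "W (t, \<omega>)"] mult_left_mono[OF norm_W_le \<Lambda>, of t] by linarith

lemma V_integrable: "integrable L (\<lambda>s. V (s, \<omega>))"
 unfolding V_def by (rule R_section_integrable[OF W_measurable \<omega> norm_W_le])

text \<open>The limit is taken in the Picard recursion under the integral; the uniform bound
  \<open>E\<close> provides the integrable majorant \<rho> + \<Lambda> E.\<close>

lemma W_primitive:
 assumes t: "t \<in> {0..T}"
 shows "W (t, \<omega>) = primitive (\<lambda>s. V (s, \<omega>)) t"
proof -
 have "(\<lambda>k. primitive (\<lambda>s. R (s, \<omega>) (picard k (s, \<omega>))) t) \<longlonglongrightarrow> primitive (\<lambda>s. V (s, \<omega>)) t"
  unfolding primitive_def
 proof (rule integral_dominated_convergence[where w = "\<lambda>s. \<rho> s + \<Lambda> * E"])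
  show "(\<lambda>s. (if s <= t then 1 else 0) *\<^sub>R V (s, \<omega>)) \<in> borel_measurable L"
   by (rule borel_measurable_integrable[OF primitive_integrable[OF V_integrable]])
  show "(\<lambda>s. (if s <= t then 1 else 0) *\<^sub>R R (s, \<omega>) (picard k (s, \<omega>))) \<in> borel_measurable L" for k
   by (rule borel_measurable_integrable[OF primitive_integrable[OF picard_integrable[OF \<omega>]]])
  show "integrable L (\<lambda>s. \<rho> s + \<Lambda> * E)" using integrable_\<rho> by simp
  show "AE s in L. (\<lambda>k. (if s <= t then 1 else 0) *\<^sub>R R (s, \<omega>) (picard k (s, \<omega>))) \<longlonglongrightarrow> (if s <= t then 1 else 0) *\<^sub>R V (s, \<omega>)"
  proof (rule AE_I2, rule tendsto_scaleR[OF tendsto_const])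
   fix s assume "s \<in> space L"
   then have s: "s \<in> {0..T}" by (simp add: TY.space_L)
   have "(\<lambda>k. \<Lambda> * norm (picard k (s, \<omega>) - W (s, \<omega>))) \<longlonglongrightarrow> \<Lambda> * 0"
    by (intro tendsto_mult_left tendsto_norm_zero LIM_zero picard_tendsto[OF s])
   then have "(\<lambda>k. \<Lambda> * norm (picard k (s, \<omega>) - W (s, \<omega>))) \<longlonglongrightarrow> 0" by simp
   then have "(\<lambda>k. R (s, \<omega>) (picard k (s, \<omega>)) - V (s, \<omega>)) \<longlonglongrightarrow> 0"
    by (rule LIMSEQ_null_comparison[rotated]) (simp add: V_def R_lipschitz[OF in_P[OF s \<omega>]])
   then show "(\<lambda>k. R (s, \<omega>) (picard k (s, \<omega>))) \<longlonglongrightarrow> V (s, \<omega>)" by (rule LIM_zero_cancel)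
  qed
  show "AE s in L. norm ((if s <= t then 1 else 0) *\<^sub>R R (s, \<omega>) (picard k (s, \<omega>))) <= \<rho> s + \<Lambda> * E" for k
  proof (rule AE_I2)
   fix s assume "s \<in> space L"
   then have s: "s \<in> {0..T}" by (simp add: TY.space_L)
   have "norm (R (s, \<omega>) (picard k (s, \<omega>))) <= \<rho> s + \<Lambda> * E"
    using R_growth[OF s \<omega>, of "picard k (s, \<omega>)"] mult_left_mono[OF picard_limit(2)[OF \<omega> s] \<Lambda>, of k] by linarith
   moreover from this have "0 <= \<rho> s + \<Lambda> * E" using norm_ge_zero order_trans by blast
   ultimately show "norm ((if s <= t then 1 else 0) *\<^sub>R R (s, \<omega>) (picard k (s, \<omega>))) <= \<rho> s + \<Lambda> * E" by simp
  qed
 qed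
 moreover have "(\<lambda>k. picard (Suc k) (t, \<omega>)) \<longlonglongrightarrow> W (t, \<omega>)" by (rule LIMSEQ_Suc[OF picard_tendsto[OF t]])
 ultimately show ?thesis unfolding picard.simps fst_conv snd_conv by (rule LIMSEQ_unique[rotated])
qed

lemma V_in: "t \<in> {0..T} ==> V (t, \<omega>) \<in> G" unfolding V_def by (rule R_in[OF in_P[OF _ \<omega>]])

lemma W_in: assumes t: "t \<in> {0..T}" shows "W (t, \<omega>) \<in> G"
 unfolding W_primitive[OF t] primitive_def
proof (rule integral_in_closed_subspace[OF subspace_range closed_range], rule AE_I2)
 fix s assume "s \<in> space L"
 then show "(if s <= t then 1 else 0) *\<^sub>R V (s, \<omega>) \<in> G"
  by (intro subspace_scale[OF subspace_range] V_in) (simp add: TY.space_L)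
qed

end

end

context hilbert_evolution
begin

text \<open>A majorant independent of \<omega> passes unchanged to the norm of the random variable,
  because the total mass is 1.\<close>

lemma section_bochner_L2:
 fixes W' :: "real \<times> 'w => 'h"
 assumes W': "W' \<in> borel_measurable (L \<Otimes>\<^sub>M M)"
  and mem: "!!t \<omega>. t \<in> {0..T} ==> \<omega> \<in> space M ==> W' (t, \<omega>) \<in> G"
  and le: "!!t \<omega>. t \<in> {0..T} ==> \<omega> \<in> space M ==> norm (W' (t, \<omega>)) <= g t"
  and g: "mem_L2 L g"
 shows "!!t. t \<in> {0..T} ==> (\<lambda>\<omega>. K (W' (t, \<omega>))) \<in> carr Y"
  and "!!t. t \<in> {0..T} ==> nrm Y (\<lambda>\<omega>. K (W' (t, \<omega>))) <= g t"
  and "(\<lambda>t \<omega>. K (W' (t, \<omega>))) \<in> carr (bochner_L2 Y L)"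
proof -
 let ?f = "\<lambda>t \<omega>. K (W' (t, \<omega>))"
 have JW: "J (?f t \<omega>) = W' (t, \<omega>)" if "t \<in> {0..T}" "\<omega> \<in> space M" for t \<omega> by (rule J_K[OF mem[OF that]])
 have m: "mem_L2 M (\<lambda>\<omega>. W' (t, \<omega>))" if t: "t \<in> {0..T}" for t
 proof (rule mem_L2_bound)
  show "(\<lambda>\<omega>. W' (t, \<omega>)) \<in> borel_measurable M" by (rule measurable_Pair2[OF W']) (simp add: TY.space_L t[simplified])
  show "integrable M (\<lambda>\<omega>. (g t)\<^sup>2)" by simp
  show "AE \<omega> in M. (norm (W' (t, \<omega>)))\<^sup>2 <= (g t)\<^sup>2" by (rule AE_I2) (rule power_mono[OF le[OF t] norm_ge_zero])
 qed
 show c: "?f t \<in> carr Y" if t: "t \<in> {0..T}" for t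
 proof -
  have "mem_L2 M (\<lambda>\<omega>. J (?f t \<omega>)) \<longleftrightarrow> mem_L2 M (\<lambda>\<omega>. W' (t, \<omega>))" by (rule mem_L2_cong) (rule JW[OF t])
  then show ?thesis unfolding carr_bochner_L2 using m[OF t] K_carr[OF mem[OF t]] by blast
 qed
 obtain \<omega>0 where \<omega>0: "\<omega>0 \<in> space M" using M.not_empty by blast
 have g0: "0 <= g t" if "t \<in> {0..T}" for t by (rule order_trans[OF norm_ge_zero le[OF that \<omega>0]])
 show n: "nrm Y (?f t) <= g t" if t: "t \<in> {0..T}" for t
 proof -
  have "nrm Y (?f t) = L2norm M (\<lambda>\<omega>. W' (t, \<omega>))"
   unfolding nrm_bochner_L2_carr[OF c[OF t]] by (rule L2norm_cong) (rule JW[OF t])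
  also have "... <= L2norm M (\<lambda>\<omega>. g t)"
  proof (rule L2norm_mono[OF L2norm_const_prob(1)[OF prob_M] mem_L2_measurable[OF m[OF t]]], rule AE_I2)
   show "norm (W' (t, \<omega>)) <= norm (g t)" if "\<omega> \<in> space M" for \<omega> using le[OF t that] by simp
  qed
  also have "... = g t" unfolding L2norm_const_prob(2)[OF prob_M] using g0[OF t] by simp
  finally show ?thesis .
 qed
 have sm: "strongly_measurable Y L ?f"
  by (rule strongly_measurable_section[OF prob_M separable_M W']) (simp_all only: TY.space_L c JW)
 have "integrable L (\<lambda>t. (nrm Y (?f t))\<^sup>2)"
 proof (rule Bochner_Integration.integrable_bound[OF mem_L2_integrable[OF g]])
  show "(\<lambda>t. (nrm Y (?f t))\<^sup>2) \<in> borel_measurable L" using Y.nrm_measurable[OF sm] by simp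
  show "AE t in L. norm ((nrm Y (?f t))\<^sup>2) <= norm ((norm (g t))\<^sup>2)"
  proof (rule AE_I2)
   fix t assume "t \<in> space L"
   then have t: "t \<in> {0..T}" by (simp add: TY.space_L)
   show "norm ((nrm Y (?f t))\<^sup>2) <= norm ((norm (g t))\<^sup>2)" using power_mono[OF n[OF t] Y.nrm_nonneg[OF c[OF t]], of 2] by simp
  qed
 qed
 then show "?f \<in> carr (bochner_L2 Y L)" unfolding Y.carr_bochner_L2_iff using sm by (rule conjI[rotated])
qed

lemma has_bochner_integral_test_function:
 fixes W' :: "real \<times> 'w => 'h"
 assumes W': "W' \<in> borel_measurable (L \<Otimes>\<^sub>M M)"
  and mem: "!!t \<omega>. t \<in> {0..T} ==> \<omega> \<in> space M ==> W' (t, \<omega>) \<in> G"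
  and le: "!!t \<omega>. t \<in> {0..T} ==> \<omega> \<in> space M ==> norm (W' (t, \<omega>)) <= g t"
  and g: "mem_L2 L g" and \<theta>: "\<theta> \<in> test_functions S"
  and y: "!!\<omega>. \<omega> \<in> space M ==> y \<omega> \<in> carr X" "!!\<omega>. \<omega> \<in> space M ==> J (y \<omega>) = (LINT t|L. \<theta> t *\<^sub>R W' (t, \<omega>))"
 shows "has_bochner_integral_in Y L (\<lambda>t. \<theta> t *\<^sub>R (\<lambda>\<omega>. K (W' (t, \<omega>)))) y"
proof -
 let ?f = "\<lambda>t \<omega>. K (W' (t, \<omega>))"
 have c: "?f t \<in> carr Y" if "t \<in> {0..T}" for t by (rule section_bochner_L2(1)[OF W' mem le g that])
 have fZ: "?f \<in> carr (bochner_L2 Y L)" by (rule section_bochner_L2(3)[OF W' mem le g])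
 obtain B where B: "!!t. \<bar>\<theta> t\<bar> <= B" using test_function_bounded[OF \<theta>] by blast
 note [measurable] = test_function_measurable_L[OF \<theta>]
 have nm: "(\<lambda>t. nrm Y (?f t)) \<in> borel_measurable L" by (rule mem_L2_measurable[OF Y.mem_L2_nrm[OF fZ]])
 show ?thesis
 proof (rule has_bochner_integral_section[OF finite_measure_L prob_M separable_M, where W = "\<lambda>z. \<theta> (fst z) *\<^sub>R W' z"])
  have "(\<lambda>z. \<theta> (fst z)) \<in> borel_measurable (L \<Otimes>\<^sub>M M)" by (rule measurable_compose[OF measurable_fst]) measurable
  then show "(\<lambda>z. \<theta> (fst z) *\<^sub>R W' z) \<in> borel_measurable (L \<Otimes>\<^sub>M M)" using W' by (rule borel_measurable_scaleR)
  show "\<theta> t *\<^sub>R ?f t \<in> carr Y" if "t \<in> space L" for t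
   by (rule Y.carr_scaleR[OF c]) (use that in \<open>simp only: TY.space_L\<close>)
  show "J ((\<theta> t *\<^sub>R ?f t) \<omega>) = \<theta> (fst (t, \<omega>)) *\<^sub>R W' (t, \<omega>)" if "t \<in> space L" "\<omega> \<in> space M" for t \<omega>
  proof -
   have t: "t \<in> {0..T}" using that(1) by (simp only: TY.space_L)
   show ?thesis by (simp add: scaleR_fun_def J_scaleR K_carr[OF mem[OF t that(2)]] J_K[OF mem[OF t that(2)]])
  qed
  show "integrable L (\<lambda>t. (nrm Y (\<theta> t *\<^sub>R ?f t))\<^sup>2)"
  proof -
   have "integrable L (\<lambda>t. (\<theta> t * nrm Y (?f t))\<^sup>2)"
   proof (rule Bochner_Integration.integrable_bound)
    show "integrable L (\<lambda>t. B\<^sup>2 * (norm (nrm Y (?f t)))\<^sup>2)" using mem_L2_integrable[OF Y.mem_L2_nrm[OF fZ]] by simp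
    show "(\<lambda>t. (\<theta> t * nrm Y (?f t))\<^sup>2) \<in> borel_measurable L" using nm by measurable
    show "AE t in L. norm ((\<theta> t * nrm Y (?f t))\<^sup>2) <= norm (B\<^sup>2 * (norm (nrm Y (?f t)))\<^sup>2)"
     using power_mono[OF B abs_ge_zero, of _ 2] by (intro AE_I2) (simp add: power_mult_distrib mult_right_mono)
   qed
   moreover have eq: "(nrm Y (\<theta> t *\<^sub>R ?f t))\<^sup>2 = (\<theta> t * nrm Y (?f t))\<^sup>2" if "t \<in> space L" for t
   proof -
    have "t \<in> {0..T}" using that by (simp only: TY.space_L)
    then show ?thesis by (simp only: Y.nrm_scaleR[OF c] power_mult_distrib power2_abs)
   qed
   moreover have "integrable L (\<lambda>t. (nrm Y (\<theta> t *\<^sub>R ?f t))\<^sup>2) \<longleftrightarrow> integrable L (\<lambda>t. (\<theta> t * nrm Y (?f t))\<^sup>2)"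
    by (rule Bochner_Integration.integrable_cong[OF refl]) (rule eq)
   ultimately show ?thesis by (simp only:)
  qed
  show "y \<omega> \<in> carr X" if "\<omega> \<in> space M" for \<omega> by (rule y(1)[OF that])
  show "J (y \<omega>) = (LINT t|L. \<theta> (fst (t, \<omega>)) *\<^sub>R W' (t, \<omega>))" if "\<omega> \<in> space M" for \<omega> using y(2)[OF that] by simp
 qed
qed

definition u_sol :: "real => 'w => 'v" where "u_sol t \<omega> = K (W (t, \<omega>))"
definition v_sol :: "real => 'w => 'v" where "v_sol t \<omega> = K (V (t, \<omega>))"

lemma mem_L2_growth: "mem_L2 L (\<lambda>t. \<rho> t + \<Lambda> * E)" "mem_L2 L (\<lambda>t. E)"
 by (rule mem_L2_add[OF \<rho>]) (simp_all add: mem_L2_def)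

lemma u_sol_carr: "t \<in> {0..T} ==> u_sol t \<in> carr Y" and u_sol_bochner_L2: "u_sol \<in> carr (bochner_L2 Y L)"
 using section_bochner_L2(1,3)[OF W_measurable W_in norm_W_le mem_L2_growth(2)] unfolding u_sol_def[abs_def] by blast+

lemma v_sol_bochner_L2: "v_sol \<in> carr (bochner_L2 Y L)"
 using section_bochner_L2(3)[OF V_measurable V_in norm_V_le mem_L2_growth(1)] unfolding v_sol_def[abs_def] by blast

lemma J_u_sol: "t \<in> {0..T} ==> \<omega> \<in> space M ==> J (u_sol t \<omega>) = W (t, \<omega>)"
 and J_v_sol: "t \<in> {0..T} ==> \<omega> \<in> space M ==> J (v_sol t \<omega>) = V (t, \<omega>)"
 by (simp_all add: u_sol_def v_sol_def J_K W_in V_in)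

lemma u_sol_carr_pointwise: "t \<in> {0..T} ==> \<omega> \<in> space M ==> u_sol t \<omega> \<in> carr X"
 and v_sol_carr_pointwise: "t \<in> {0..T} ==> \<omega> \<in> space M ==> v_sol t \<omega> \<in> carr X"
 by (simp_all add: u_sol_def v_sol_def K_carr W_in V_in)

text \<open>Integration by parts is carried out for each \<omega>. Since the Bochner integrals are
  the pathwise ones, the lifted pathwise integral is the required value.\<close>

lemma u_sol_weak_derivative: "has_weak_time_derivative T Y u_sol v_sol"
 unfolding has_weak_time_derivative_def
proof (rule ballI)
 fix \<phi> assume \<phi>: "\<phi> \<in> test_functions {0<..<T}"
 define I where "I \<omega> = (LINT t|L. deriv \<phi> t *\<^sub>R W (t, \<omega>))" for \<omega>
 have I_in: "I \<omega> \<in> G" if \<omega>: "\<omega> \<in> space M" for \<omega>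
  unfolding I_def
 proof (rule integral_in_closed_subspace[OF subspace_range closed_range], rule AE_I2)
  fix s assume "s \<in> space L"
  then show "deriv \<phi> s *\<^sub>R W (s, \<omega>) \<in> G" by (intro subspace_scale[OF subspace_range] W_in[OF \<omega>]) (simp add: TY.space_L)
 qed
 have I_V: "- I \<omega> = (LINT t|L. \<phi> t *\<^sub>R V (t, \<omega>))" if \<omega>: "\<omega> \<in> space M" for \<omega>
 proof -
  have "I \<omega> = (LINT t|L. deriv \<phi> t *\<^sub>R primitive (\<lambda>s. V (s, \<omega>)) t)"
   unfolding I_def by (rule Bochner_Integration.integral_cong[OF refl]) (simp add: W_primitive[OF \<omega>] TY.space_L)
  also have "... = - (LINT t|L. \<phi> t *\<^sub>R V (t, \<omega>))" by (rule integral_by_parts[OF V_integrable[OF \<omega>] \<phi>])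
  finally show ?thesis by simp
 qed
 show "\<exists>y. has_bochner_integral_in Y L (\<lambda>t. deriv \<phi> t *\<^sub>R u_sol t) y \<and> has_bochner_integral_in Y L (\<lambda>t. \<phi> t *\<^sub>R v_sol t) (- y)"
 proof (rule exI[of _ "\<lambda>\<omega>. K (I \<omega>)"], rule conjI)
  show "has_bochner_integral_in Y L (\<lambda>t. deriv \<phi> t *\<^sub>R u_sol t) (\<lambda>\<omega>. K (I \<omega>))"
   unfolding u_sol_def[abs_def]
   by (rule has_bochner_integral_test_function[OF W_measurable W_in norm_W_le mem_L2_growth(2) deriv_test_function(3)[OF \<phi>]])
    (simp_all add: K_carr J_K I_in, simp add: I_def)
  show "has_bochner_integral_in Y L (\<lambda>t. \<phi> t *\<^sub>R v_sol t) (- (\<lambda>\<omega>. K (I \<omega>)))"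
   unfolding v_sol_def[abs_def]
   by (rule has_bochner_integral_test_function[OF V_measurable V_in norm_V_le mem_L2_growth(1) \<phi>])
    (simp_all add: K_carr J_K I_in carr_uminus J_uminus I_V)
 qed
qed

text \<open>For all \<omega> at once, increments are bounded by those of the primitive of \<rho> +
  \<Lambda> E, which is continuous; this gives continuity in the norm of random variables.\<close>

lemma u_sol_time_H1: "u_sol \<in> time_H1 T Y"
proof -
 let ?g = "\<lambda>s. \<rho> s + \<Lambda> * E"
 have gi: "integrable L ?g" by (rule mem_L2_integrable_finite[OF mem_L2_growth(1) finite_measure_L])
 have le: "nrm Y (u_sol s - u_sol t) <= \<bar>primitive ?g s - primitive ?g t\<bar>" if s: "s \<in> {0..T}" and t: "t \<in> {0..T}" for s t
 proof -
  note c = Y.carr_diff[OF u_sol_carr[OF s] u_sol_carr[OF t]]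
  let ?b = "\<bar>primitive ?g s - primitive ?g t\<bar>"
  have "L2norm M (\<lambda>\<omega>. J ((u_sol s - u_sol t) \<omega>)) <= L2norm M (\<lambda>\<omega>. ?b)"
  proof (rule L2norm_mono[OF L2norm_const_prob(1)[OF prob_M] mem_L2_measurable[OF carr_bochner_L2D(2)[OF c]]], rule AE_I2)
   fix \<omega> assume \<omega>: "\<omega> \<in> space M"
   have "J ((u_sol s - u_sol t) \<omega>) = W (s, \<omega>) - W (t, \<omega>)"
    using s t \<omega> by (simp add: J_diff u_sol_carr_pointwise J_u_sol)
   also have "... = primitive (\<lambda>r. V (r, \<omega>)) s - primitive (\<lambda>r. V (r, \<omega>)) t"
    by (simp only: W_primitive[OF \<omega> s] W_primitive[OF \<omega> t])
   finally have eq: "norm (J ((u_sol s - u_sol t) \<omega>)) = norm (primitive (\<lambda>r. V (r, \<omega>)) s - primitive (\<lambda>r. V (r, \<omega>)) t)" by simp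
   show "norm (J ((u_sol s - u_sol t) \<omega>)) <= norm ?b"
   proof (cases "t <= s")
    case True
    show ?thesis unfolding eq using norm_primitive_diff_le[OF V_integrable[OF \<omega>] gi norm_V_le[OF \<omega>] True] by simp
   next
    case False
    then have st: "s <= t" by simp
    show ?thesis unfolding eq norm_minus_commute[of "primitive (\<lambda>r. V (r, \<omega>)) s"]
     using norm_primitive_diff_le[OF V_integrable[OF \<omega>] gi norm_V_le[OF \<omega>] st] by simp
   qed
  qed
  then show ?thesis unfolding nrm_bochner_L2_carr[OF c] L2norm_const_prob(2)[OF prob_M] by simp
 qed
 have "((\<lambda>s. nrm Y (u_sol s - u_sol t)) \<longlongrightarrow> 0) (at t within {0..T})" if t: "t \<in> {0..T}" for t
 proof (rule Lim_null_comparison)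
  have "(primitive ?g \<longlongrightarrow> primitive ?g t) (at t within {0..T})"
   using continuous_on_primitive(1)[OF gi] t by (simp add: continuous_on_def)
  then show "((\<lambda>s. \<bar>primitive ?g s - primitive ?g t\<bar>) \<longlongrightarrow> 0) (at t within {0..T})"
   by (intro tendsto_rabs_zero) (rule LIM_zero)
  show "\<forall>\<^sub>F s in at t within {0..T}. norm (nrm Y (u_sol s - u_sol t)) <= \<bar>primitive ?g s - primitive ?g t\<bar>"
   unfolding eventually_at_filter
  proof (intro always_eventually allI impI)
   fix s assume s: "s \<in> {0..T}"
   show "norm (nrm Y (u_sol s - u_sol t)) <= \<bar>primitive ?g s - primitive ?g t\<bar>"
    using le[OF s t] Y.nrm_nonneg[OF Y.carr_diff[OF u_sol_carr[OF s] u_sol_carr[OF t]]] by simp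
  qed
 qed
 then show ?thesis
  unfolding time_H1_def using u_sol_bochner_L2 v_sol_bochner_L2 u_sol_weak_derivative by blast
qed

lemma u_sol_0: "nrm Y (u_sol 0) = 0"
proof -
 have T0: "0 \<in> {0..T}" using T_pos by simp
 have "W (0, \<omega>) = 0" if \<omega>: "\<omega> \<in> space M" for \<omega>
 proof -
  have "integrable L (\<lambda>s. norm (V (s, \<omega>)))" using V_integrable[OF \<omega>] by simp
  then have "primitive (\<lambda>s. norm (V (s, \<omega>))) 0 = 0" by (rule continuous_on_primitive(2))
  moreover have "norm (primitive (\<lambda>s. V (s, \<omega>)) 0) <= primitive (\<lambda>s. norm (V (s, \<omega>))) 0"
   using V_integrable[OF \<omega>] by (intro norm_primitive_le) simp_all
  ultimately show ?thesis unfolding W_primitive[OF \<omega> T0] by simp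
 qed
 then have "L2norm M (\<lambda>\<omega>. J (u_sol 0 \<omega>)) = L2norm M (\<lambda>\<omega>. 0 :: 'h)"
  by (intro L2norm_cong) (simp add: J_u_sol[OF T0])
 then show ?thesis unfolding nrm_bochner_L2_carr[OF u_sol_carr[OF T0]] by (simp add: L2norm_zero)
qed

lemma solution_exists: "solves_with u_sol v_sol"
proof (intro conjI u_sol_time_H1 u_sol_0 v_sol_bochner_L2 u_sol_weak_derivative AE_I2)
 fix t \<omega> assume "t \<in> space L" "\<omega> \<in> space M"
 then show "J (v_sol t \<omega>) = R (t, \<omega>) (J (u_sol t \<omega>))" by (simp add: TY.space_L J_u_sol J_v_sol V_def)
qed

lemma solution_strongly_measurable:
 "strongly_measurable X (L \<Otimes>\<^sub>M M) (\<lambda>(t, \<omega>). u_sol t \<omega>)" "strongly_measurable X (L \<Otimes>\<^sub>M M) (\<lambda>(t, \<omega>). v_sol t \<omega>)"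
proof -
 have 1: "(\<lambda>z. J (case z of (t, \<omega>) => u_sol t \<omega>)) \<in> borel_measurable (L \<Otimes>\<^sub>M M)"
  by (rule measurable_cong[THEN iffD2, OF _ W_measurable]) (auto simp: space_P J_u_sol)
 have 2: "(\<lambda>z. J (case z of (t, \<omega>) => v_sol t \<omega>)) \<in> borel_measurable (L \<Otimes>\<^sub>M M)"
  by (rule measurable_cong[THEN iffD2, OF _ V_measurable]) (auto simp: space_P J_v_sol)
 show "strongly_measurable X (L \<Otimes>\<^sub>M M) (\<lambda>(t, \<omega>). u_sol t \<omega>)" "strongly_measurable X (L \<Otimes>\<^sub>M M) (\<lambda>(t, \<omega>). v_sol t \<omega>)"
  unfolding strongly_measurable_iff using 1 2 by (auto simp: space_P u_sol_carr_pointwise v_sol_carr_pointwise)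
qed

end

section \<open>The velocity as minimiser of a perturbed convex functional\<close>

section \<open>Convex functionals depending on a parameter\<close>

text \<open>\<open>P\<close> is the dissipation and \<open>B\<close> the bilinear form of the
  energy, both as functions of gradients; \<eta> and \<zeta> stand for the gradients of the rate and
  of the value of the boundary datum. The midpoint constant c/4 is the one of a functional that
  stays convex after subtracting c |g|^2.\<close>

locale dissipative_evolution = hilbert_nspace X J + time_interval T
 for X :: "'v::real_vector nspace" and J :: "'v => 'h::{real_inner, banach, second_countable_topology}" and T :: real +
 fixes M :: "'w measure" and P :: "'w => 'h => real" and B :: "'w => 'h => 'h => real"
  and c C m \<beta> :: real and \<eta> \<zeta> :: "real => 'h"
 assumes prob: "prob_space M" and sep: "separable_L2 M"
  and P_midconvex: "!!\<omega>. \<omega> \<in> space M ==> uniformly_midconvex_on (c / 4) UNIV (P \<omega>)"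
  and P_continuous: "!!\<omega>. \<omega> \<in> space M ==> continuous_on UNIV (P \<omega>)"
  and P_measurable: "!!g. (\<lambda>\<omega>. P \<omega> g) \<in> borel_measurable M"
  and P_nonneg: "!!\<omega> g. \<omega> \<in> space M ==> 0 <= P \<omega> g"
  and P_zero: "!!\<omega>. \<omega> \<in> space M ==> P \<omega> 0 = 0"
  and P_growth: "!!\<omega> g. \<omega> \<in> space M ==> P \<omega> g <= C * (m + (norm g)\<^sup>2)"
  and B_add: "!!\<omega> f g h. \<omega> \<in> space M ==> B \<omega> (f + g) h = B \<omega> f h + B \<omega> g h"
   "!!\<omega> f g h. \<omega> \<in> space M ==> B \<omega> f (g + h) = B \<omega> f g + B \<omega> f h"
  and B_scaleR: "!!\<omega> r g h. \<omega> \<in> space M ==> B \<omega> (r *\<^sub>R g) h = r * B \<omega> g h"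
   "!!\<omega> r g h. \<omega> \<in> space M ==> B \<omega> g (r *\<^sub>R h) = r * B \<omega> g h"
  and B_bound: "!!\<omega> g h. \<omega> \<in> space M ==> \<bar>B \<omega> g h\<bar> <= \<beta> * norm g * norm h"
  and B_measurable: "!!g h. (\<lambda>\<omega>. B \<omega> g h) \<in> borel_measurable M"
  and c: "c > 0" and C: "C \<ge> 0" and m: "m \<ge> 0" and \<beta>: "\<beta> \<ge> 0"
  and \<eta>: "mem_L2 L \<eta>" and \<zeta>: "mem_L2 L \<zeta>"
begin

text \<open>With \<open>u\<close> the gradient of the current state, the minimiser in
  \<open>v\<close> is the gradient of the velocity.\<close>

definition F :: "real \<times> 'w => 'h => 'h => real" where
 "F z u v = P (snd z) (\<eta> (fst z) + v) + B (snd z) (\<zeta> (fst z) + u) v"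

definition rate :: "real \<times> 'w => 'h => 'h" where "rate z u = argmin G (F z u)"

lemma B_linear_left: "\<omega> \<in> space M ==> bounded_linear (\<lambda>g. B \<omega> g h)"
 by (rule bounded_linear_intro[where K = "\<beta> * norm h"]) (use B_bound in \<open>simp_all add: B_add B_scaleR mult_ac\<close>)

lemma B_linear_right:
 assumes \<omega>: "\<omega> \<in> space M" shows "bounded_linear (B \<omega> g)"
proof (rule bounded_linear_intro[where K = "\<beta> * norm g"])
 show "norm (B \<omega> g x) <= norm x * (\<beta> * norm g)" for x
  using B_bound[OF \<omega>, of g x] by (simp add: mult.commute[of "norm x"])
qed (simp_all add: B_add B_scaleR \<omega>)

text \<open>0 minimises \<open>P\<close>, so quadratic growth away from a minimiser is coercivity,
  with 2 (c/4) = c/2.\<close>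

lemma P_coercive:
 assumes \<omega>: "\<omega> \<in> space M" shows "P \<omega> g \<ge> c / 2 * (norm g)\<^sup>2"
proof -
 have "minimiser_on UNIV (P \<omega>) 0" using P_nonneg[OF \<omega>] P_zero[OF \<omega>] by (simp add: minimiser_on_def)
 from minimiser_growth[OF P_midconvex[OF \<omega>] subspace_UNIV this UNIV_I, of g] show ?thesis using P_zero[OF \<omega>] by simp
qed

context
 fixes z :: "real \<times> 'w" assumes z: "snd z \<in> space M"
begin

lemma F_midconvex: "uniformly_midconvex_on (c / 4) G (F z u)"
 unfolding uniformly_midconvex_on_def
proof (intro ballI)
 fix v w
 interpret b: bounded_linear "B (snd z) (\<zeta> (fst z) + u)" by (rule B_linear_right[OF z])
 let ?e = "\<eta> (fst z)"
 have mid: "?e + (1/2) *\<^sub>R (v + w) = (1/2) *\<^sub>R ((?e + v) + (?e + w))" by (simp add: scaleR_add_right flip: scaleR_left.add)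
 have "P (snd z) (?e + (1/2) *\<^sub>R (v + w)) <= (P (snd z) (?e + v) + P (snd z) (?e + w)) / 2 - c / 4 * (norm ((?e + v) - (?e + w)))\<^sup>2"
  unfolding mid using P_midconvex[OF z, unfolded uniformly_midconvex_on_def, THEN bspec, OF UNIV_I, THEN bspec, OF UNIV_I] .
 then show "F z u ((1/2) *\<^sub>R (v + w)) <= (F z u v + F z u w) / 2 - c / 4 * (norm (v - w))\<^sup>2"
  by (simp add: F_def b.scaleR b.add add_divide_distrib)
qed

lemma F_continuous: "continuous_on S (F z u)"
proof -
 have "continuous_on S (\<lambda>v. P (snd z) (\<eta> (fst z) + v))"
  by (rule continuous_on_compose2[OF P_continuous[OF z]]) (auto intro: continuous_intros)
 moreover have "continuous_on S (B (snd z) (\<zeta> (fst z) + u))" by (rule linear_continuous_on[OF B_linear_right[OF z]])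
 ultimately show ?thesis unfolding F_def[abs_def] by (rule continuous_on_add)
qed

text \<open>Coercivity is used at \<eta> + v, and the linear term is estimated through |v| <=
  |\<eta> + v| + |\<eta>|; completing the square gives a bound free of \<open>v\<close>.\<close>

lemma F_bounded_below: "F z u v \<ge> - ((\<beta> * norm (\<zeta> (fst z) + u))\<^sup>2 / (2 * c) + \<beta> * norm (\<zeta> (fst z) + u) * norm (\<eta> (fst z)))"
proof -
 let ?b = "\<beta> * norm (\<zeta> (fst z) + u)" and ?a = "norm (\<eta> (fst z) + v)" and ?e = "norm (\<eta> (fst z))"
 have b0: "?b \<ge> 0" using \<beta> by simp
 have "norm v <= ?a + ?e" using norm_triangle_ineq4[of "\<eta> (fst z) + v" "\<eta> (fst z)"] by simp
 then have "?b * norm v <= ?b * ?a + ?b * ?e" using b0 by (simp only: mult_left_mono flip: distrib_left)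
 moreover have "\<bar>B (snd z) (\<zeta> (fst z) + u) v\<bar> <= ?b * norm v" by (rule B_bound[OF z])
 moreover have "P (snd z) (\<eta> (fst z) + v) \<ge> c / 2 * ?a\<^sup>2" by (rule P_coercive[OF z])
 moreover have "c / 2 * ?a\<^sup>2 - ?b * ?a + ?b\<^sup>2 / (2 * c) = (c * ?a - ?b)\<^sup>2 / (2 * c)"
  using c by (simp add: power2_eq_square field_simps)
 moreover have "(c * ?a - ?b)\<^sup>2 / (2 * c) \<ge> 0" using c by simp
 ultimately show ?thesis unfolding F_def by linarith
qed

lemma F_minimiser: "minimiser_on G (F z u) (rate z u)"
 unfolding rate_def
 by (rule argmin_minimiser[OF minimiser_exists[OF F_midconvex _ subspace_range closed_range F_continuous]])
  (use c F_bounded_below in auto)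

lemma rate_eq_iff: "rate z u = v \<longleftrightarrow> minimiser_on G (F z u) v"
 using F_minimiser[of u] argmin_eq[OF F_midconvex _ subspace_range, of u v] c unfolding rate_def by auto

lemma rate_in: "rate z u \<in> G" using F_minimiser by (simp add: minimiser_on_def)

text \<open>Each minimiser is a competitor in the problem of the other. Adding the two growth
  inequalities cancels the dissipation, and only the form applied to u - w and the difference of the
  minimisers remains.\<close>

lemma rate_lipschitz: "norm (rate z u - rate z w) <= \<beta> / c * norm (u - w)"
proof -
 let ?v = "rate z u" and ?w = "rate z w" and ?\<omega> = "snd z"
 let ?d = "norm (?v - ?w)"
 have 1: "F z u ?w \<ge> F z u ?v + c / 2 * ?d\<^sup>2"
  using minimiser_growth[OF F_midconvex subspace_range F_minimiser rate_in, of u w] by (simp add: norm_minus_commute)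
 have 2: "F z w ?v \<ge> F z w ?w + c / 2 * ?d\<^sup>2"
  using minimiser_growth[OF F_midconvex subspace_range F_minimiser rate_in, of w u] by simp
 interpret r: bounded_linear "B ?\<omega> (u - w)" by (rule B_linear_right[OF z])
 have l: "B ?\<omega> (\<zeta> (fst z) + u) x - B ?\<omega> (\<zeta> (fst z) + w) x = B ?\<omega> (u - w) x" for x
  using linear_diff[OF bounded_linear.linear[OF B_linear_left[OF z, of x]], of "\<zeta> (fst z) + u" "\<zeta> (fst z) + w"] by simp
 have "c * ?d\<^sup>2 <= F z u ?w - F z u ?v + F z w ?v - F z w ?w" using 1 2 by simp
 also have "... = B ?\<omega> (u - w) ?w - B ?\<omega> (u - w) ?v" unfolding F_def l[symmetric] by simp
 also have "... = B ?\<omega> (u - w) (?w - ?v)" by (simp only: r.diff)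
 also have "... <= \<beta> * norm (u - w) * ?d" using B_bound[OF z, of "u - w" "?w - ?v"] by (simp add: norm_minus_commute)
 finally have "c * ?d * ?d <= \<beta> * norm (u - w) * ?d" by (simp add: power2_eq_square)
 then have "c * ?d <= \<beta> * norm (u - w)" using \<beta> by (cases "?d = 0") (auto simp: mult_le_cancel_right)
 then show ?thesis using c by (simp add: field_simps)
qed

text \<open>The competitor 0 costs at most the growth bound at \<eta>; Young's inequality absorbs
  the linear term into half of the quadratic one.\<close>

lemma rate_zero_le: "norm (rate z 0) <= sqrt (4 / c * (C * (m + (norm (\<eta> (fst z)))\<^sup>2) + \<beta>\<^sup>2 / c * (norm (\<zeta> (fst z)))\<^sup>2))"
proof -
 let ?v = "rate z 0" and ?e = "norm (\<eta> (fst z))" and ?s = "norm (\<zeta> (fst z))"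
 let ?x = "norm ?v"
 have "0 \<in> G" by (rule subspace_0[OF subspace_range])
 from minimiser_growth[OF F_midconvex subspace_range F_minimiser this, of 0]
 have "F z 0 0 \<ge> F z 0 ?v + c / 2 * ?x\<^sup>2" by simp
 moreover have "B (snd z) (\<zeta> (fst z)) 0 = 0" using B_scaleR(2)[OF z, of "\<zeta> (fst z)" 0] by simp
 moreover have "F z 0 ?v \<ge> - (\<beta> * ?s * ?x)"
  using P_nonneg[OF z, of "\<eta> (fst z) + ?v"] B_bound[OF z, of "\<zeta> (fst z)" ?v] by (simp add: F_def)
 ultimately have 1: "c / 2 * ?x\<^sup>2 <= C * (m + ?e\<^sup>2) + \<beta> * ?s * ?x"
  using P_growth[OF z, of "\<eta> (fst z)"] by (simp add: F_def)
 have "0 <= (c * ?x / 2 - \<beta> * ?s)\<^sup>2 / c" using c by simp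
 also have "... = c / 4 * ?x\<^sup>2 - \<beta> * ?s * ?x + \<beta>\<^sup>2 / c * ?s\<^sup>2" using c by (simp add: power2_eq_square field_simps)
 finally have "c / 4 * ?x\<^sup>2 <= C * (m + ?e\<^sup>2) + \<beta>\<^sup>2 / c * ?s\<^sup>2" using 1 by linarith
 then have "?x\<^sup>2 <= 4 / c * (C * (m + ?e\<^sup>2) + \<beta>\<^sup>2 / c * ?s\<^sup>2)" using c by (simp add: field_simps)
 then show ?thesis by (rule real_le_rsqrt)
qed

end

definition rate_bound :: "real => real" where
 "rate_bound t = sqrt (4 / c * (C * (m + (norm (\<eta> t))\<^sup>2) + \<beta>\<^sup>2 / c * (norm (\<zeta> t))\<^sup>2))"

lemma rate_measurable:
 assumes U: "U \<in> borel_measurable (L \<Otimes>\<^sub>M M)"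
 shows "(\<lambda>z. rate z (U z)) \<in> borel_measurable (L \<Otimes>\<^sub>M M)"
 unfolding rate_def
proof (rule argmin_measurable[where k = "c / 4" and m = "\<lambda>z. - ((\<beta> * norm (\<zeta> (fst z) + U z))\<^sup>2 / (2 * c) + \<beta> * norm (\<zeta> (fst z) + U z) * norm (\<eta> (fst z)))"])
 have [measurable]: "(\<lambda>z. \<eta> (fst z)) \<in> borel_measurable (L \<Otimes>\<^sub>M M)" "(\<lambda>z. \<zeta> (fst z)) \<in> borel_measurable (L \<Otimes>\<^sub>M M)"
  by (rule measurable_compose[OF measurable_fst mem_L2_measurable[OF \<eta>]], rule measurable_compose[OF measurable_fst mem_L2_measurable[OF \<zeta>]])
 note [measurable] = U
 fix v
 have "(\<lambda>z. P (snd z) (\<eta> (fst z) + v)) \<in> borel_measurable (L \<Otimes>\<^sub>M M)"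
  by (rule borel_measurable_Caratheodory[where M = M and f = P, OF P_measurable P_continuous measurable_snd]) measurable
 moreover have "(\<lambda>z. B (snd z) (\<zeta> (fst z) + U z) v) \<in> borel_measurable (L \<Otimes>\<^sub>M M)"
 proof (rule borel_measurable_Caratheodory[where M = M and f = "\<lambda>\<omega> g. B \<omega> g v", OF B_measurable _ measurable_snd])
  show "continuous_on UNIV (\<lambda>g. B \<omega> g v)" if "\<omega> \<in> space M" for \<omega> by (rule linear_continuous_on[OF B_linear_left[OF that]])
  show "(\<lambda>z. \<zeta> (fst z) + U z) \<in> borel_measurable (L \<Otimes>\<^sub>M M)" by measurable
 qed
 ultimately show "(\<lambda>z. F z (U z) v) \<in> borel_measurable (L \<Otimes>\<^sub>M M)" unfolding F_def by (rule borel_measurable_add)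
next
 fix z assume "z \<in> space (L \<Otimes>\<^sub>M M)"
 then have z: "snd z \<in> space M" by (auto simp: space_pair_measure)
 show "uniformly_midconvex_on (c / 4) G (F z (U z))" by (rule F_midconvex[OF z])
 show "continuous_on G (F z (U z))" by (rule F_continuous[OF z])
 show "- ((\<beta> * norm (\<zeta> (fst z) + U z))\<^sup>2 / (2 * c) + \<beta> * norm (\<zeta> (fst z) + U z) * norm (\<eta> (fst z))) <= F z (U z) v" for v
  by (rule F_bounded_below[OF z])
qed (use c subspace_range closed_range in auto)

lemma mem_L2_rate_bound: "mem_L2 L rate_bound"
proof (rule mem_L2_bound)
 note [measurable] = mem_L2_measurable[OF \<eta>] mem_L2_measurable[OF \<zeta>]
 show "rate_bound \<in> borel_measurable L" unfolding rate_bound_def[abs_def] by measurable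
 show "integrable L (\<lambda>t. 4 / c * (C * (m + (norm (\<eta> t))\<^sup>2) + \<beta>\<^sup>2 / c * (norm (\<zeta> t))\<^sup>2))"
  using mem_L2_integrable[OF \<eta>] mem_L2_integrable[OF \<zeta>] by simp
 show "AE t in L. (norm (rate_bound t))\<^sup>2 <= 4 / c * (C * (m + (norm (\<eta> t))\<^sup>2) + \<beta>\<^sup>2 / c * (norm (\<zeta> t))\<^sup>2)"
  using c C m by (intro AE_I2) (simp add: rate_bound_def)
qed

sublocale hilbert_evolution X J T M rate "\<beta> / c" rate_bound
proof (intro hilbert_evolution.intro hilbert_evolution_axioms.intro hilbert_nspace_axioms time_interval_axioms)
 show "rate z g \<in> G" if "z \<in> space (L \<Otimes>\<^sub>M M)" for z g using that by (intro rate_in) (auto simp: space_pair_measure)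
 show "norm (rate z g - rate z h) <= \<beta> / c * norm (g - h)" if "z \<in> space (L \<Otimes>\<^sub>M M)" for z g h
  using that by (intro rate_lipschitz) (auto simp: space_pair_measure)
 show "norm (rate (t, \<omega>) 0) <= rate_bound t" if "t \<in> {0..T}" "\<omega> \<in> space M" for t \<omega>
  using rate_zero_le[of "(t, \<omega>)"] that by (simp add: rate_bound_def)
qed (use prob sep rate_measurable mem_L2_rate_bound c \<beta> in simp_all)

end

section \<open>Random convex integrands, their repair on null sets, and the induced
  functionals\<close>

section \<open>Integral functionals with random integrands\<close>

lemma sigma_finite_lebesgue: "sigma_finite_measure (lebesgue :: 'a::euclidean_space measure)"
proof
 obtain A :: "'a set set" where A: "countable A" "A \<subseteq> sets lborel" "\<Union> A = space lborel" "\<forall>a\<in>A. emeasure lborel a \<noteq> \<infinity>"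
  using lborel.sigma_finite_countable by blast
 show "\<exists>A. countable A \<and> A \<subseteq> sets lebesgue \<and> \<Union> A = space (lebesgue :: 'a measure) \<and> (\<forall>a\<in>A. emeasure lebesgue a \<noteq> \<infinity>)"
  using A sets_completionI_sets[of _ "lborel :: 'a measure"] by (intro exI[of _ A]) (auto simp: subset_eq)
qed

lemma AE_lebesgue_scale:
 fixes Q :: "'a::euclidean_space => bool"
 assumes Q: "AE x in lebesgue. Q x" and e: "e \<noteq> 0"
 shows "AE x in lebesgue. Q (x /\<^sub>R e)"
proof -
 obtain N where N1: "N \<in> null_sets lebesgue" and N0: "{x \<in> space lebesgue. \<not> Q x} \<subseteq> N"
  using Q unfolding eventually_ae_filter by (rule bexE)
 have N: "x \<in> N" if "\<not> Q x" for x using subsetD[OF N0, of x] that by simp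
 have "negligible ((\<lambda>x. e *\<^sub>R x) ` N)"
 proof (rule negligible_differentiable_image_negligible[OF order_refl])
  show "negligible N" using N1 by (simp add: negligible_iff_null_sets)
  show "(\<lambda>x. e *\<^sub>R x) differentiable_on N" unfolding differentiable_on_def differentiable_def
   by (intro ballI exI[of _ "\<lambda>h. e *\<^sub>R h"]) (auto intro!: derivative_eq_intros)
 qed
 moreover have "{x. \<not> Q (x /\<^sub>R e)} \<subseteq> (\<lambda>x. e *\<^sub>R x) ` N"
 proof
  fix x assume "x \<in> {x. \<not> Q (x /\<^sub>R e)}"
  then have "x /\<^sub>R e \<in> N" by (intro N) simp
  then show "x \<in> (\<lambda>x. e *\<^sub>R x) ` N" using e by (intro image_eqI[of _ _ "x /\<^sub>R e"]) simp_all
 qed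
 ultimately show ?thesis by (intro AE_I'[of "(\<lambda>x. e *\<^sub>R x) ` N"]) (simp_all add: negligible_iff_null_sets)
qed

text \<open>Polarisation on unit vectors: four times the form is a difference of two quadratic
  values between 0 and 4 \<beta>, because |\<xi> + \<eta>| and |\<xi> - \<eta>| are at most 2.
  Nonnegativity keeps the constant at \<beta>.\<close>

lemma symmetric_form_bound:
 fixes m :: "real^'n^'n"
 assumes sym: "transpose m = m" and bounds: "!!\<xi>. 0 <= \<xi> \<bullet> (m *v \<xi>) \<and> \<xi> \<bullet> (m *v \<xi>) <= \<beta> * (norm \<xi>)\<^sup>2"
 shows "\<eta> \<bullet> (m *v \<xi>) = \<xi> \<bullet> (m *v \<eta>)" and "\<bar>\<eta> \<bullet> (m *v \<xi>)\<bar> <= \<beta> * norm \<xi> * norm \<eta>"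
proof -
 show s: "\<eta> \<bullet> (m *v \<xi>) = \<xi> \<bullet> (m *v \<eta>)" for \<eta> \<xi>
  using dot_lmul_matrix[of \<eta> m \<xi>] vector_transpose_matrix[of \<eta> m] sym by (simp add: inner_commute)
 have unit: "\<bar>\<eta> \<bullet> (m *v \<xi>)\<bar> <= \<beta>" if "norm \<xi> = 1" "norm \<eta> = 1" for \<xi> \<eta>
 proof -
  have pol: "4 * (\<eta> \<bullet> (m *v \<xi>)) = (\<xi> + \<eta>) \<bullet> (m *v (\<xi> + \<eta>)) - (\<xi> - \<eta>) \<bullet> (m *v (\<xi> - \<eta>))"
   using s[of \<xi> \<eta>] by (simp add: matrix_vector_right_distrib matrix_vector_mult_diff_distrib inner_add_left inner_diff_left inner_add_right inner_diff_right)
  have "0 <= \<beta>" using bounds[of \<xi>] that by simp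
  moreover have "(norm (\<xi> + \<eta>))\<^sup>2 <= 2\<^sup>2" using norm_triangle_ineq[of \<xi> \<eta>] that by (intro power_mono) auto
  moreover have "(norm (\<xi> - \<eta>))\<^sup>2 <= 2\<^sup>2" using norm_triangle_ineq4[of \<xi> \<eta>] that by (intro power_mono) auto
  ultimately have "\<beta> * (norm (\<xi> + \<eta>))\<^sup>2 <= \<beta> * 4" "\<beta> * (norm (\<xi> - \<eta>))\<^sup>2 <= \<beta> * 4" by (simp_all add: mult_left_mono)
  then show ?thesis using pol bounds[of "\<xi> + \<eta>"] bounds[of "\<xi> - \<eta>"] by linarith
 qed
 show "\<bar>\<eta> \<bullet> (m *v \<xi>)\<bar> <= \<beta> * norm \<xi> * norm \<eta>"
 proof (cases "\<xi> = 0 \<or> \<eta> = 0")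
  case False
  have "\<eta> \<bullet> (m *v \<xi>) = (norm \<eta> *\<^sub>R sgn \<eta>) \<bullet> (m *v (norm \<xi> *\<^sub>R sgn \<xi>))" using False by (simp add: sgn_div_norm)
  also have "... = norm \<eta> * norm \<xi> * (sgn \<eta> \<bullet> (m *v sgn \<xi>))" by (simp add: matrix_vector_mult_scaleR mult.left_commute)
  finally have "\<bar>\<eta> \<bullet> (m *v \<xi>)\<bar> = norm \<eta> * norm \<xi> * \<bar>sgn \<eta> \<bullet> (m *v sgn \<xi>)\<bar>" by (simp add: abs_mult)
  also have "... <= norm \<eta> * norm \<xi> * \<beta>" using False by (intro mult_left_mono unit) (simp_all add: norm_sgn)
  finally show ?thesis by (simp add: mult_ac)
 qed (auto simp: matrix_vector_mult_0_right)
qed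

locale random_integrands = bounded_open D for D :: "(real^'n) set" +
 fixes M :: "'w measure" and A :: "'w => real^'n => real^'n^'n" and \<psi> :: "'w => real^'n => real^'n => real"
  and \<epsilon> \<alpha> \<beta> c C :: real
 assumes prob: "prob_space M" and \<epsilon>: "\<epsilon> > 0" and \<alpha>: "\<alpha> > 0" and c: "c > 0" and C: "C > 0"
  and A_measurable: "(\<lambda>(\<omega>, x). A \<omega> x) \<in> borel_measurable (M \<Otimes>\<^sub>M lebesgue)"
  and A_symmetric: "AE (\<omega>, x) in M \<Otimes>\<^sub>M lebesgue. transpose (A \<omega> x) = A \<omega> x"
  and A_bounds: "AE (\<omega>, x) in M \<Otimes>\<^sub>M lebesgue. \<forall>\<xi>.
     \<alpha> * (norm \<xi>)\<^sup>2 <= \<xi> \<bullet> (A \<omega> x *v \<xi>) \<and> \<xi> \<bullet> (A \<omega> x *v \<xi>) <= \<beta> * (norm \<xi>)\<^sup>2"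
  and psi_measurable: "\<forall>\<xi>. (\<lambda>(\<omega>, x). \<psi> \<omega> x \<xi>) \<in> borel_measurable (M \<Otimes>\<^sub>M lebesgue)"
  and psi_nonneg: "\<forall>\<omega>\<in>space M. \<forall>x \<xi>. \<psi> \<omega> x \<xi> \<ge> 0"
  and psi_zero: "\<forall>\<omega>\<in>space M. \<forall>x. \<psi> \<omega> x 0 = 0"
  and psi_convex: "AE (\<omega>, x) in M \<Otimes>\<^sub>M lebesgue. convex_on UNIV (\<lambda>\<xi>. \<psi> \<omega> x \<xi> - c * (norm \<xi>)\<^sup>2)"
  and psi_growth: "\<forall>\<xi>. AE (\<omega>, x) in M \<Otimes>\<^sub>M lebesgue. \<psi> \<omega> x \<xi> <= C * (1 + (norm \<xi>)\<^sup>2)"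
begin

sublocale M: prob_space M by (rule prob)
sublocale lebesgue: sigma_finite_measure "lebesgue :: (real^'n) measure" by (rule sigma_finite_lebesgue)
sublocale P: pair_sigma_finite M "lebesgue :: (real^'n) measure" ..

definition regular :: "'w => real^'n => bool" where
 "regular \<omega> x \<longleftrightarrow> transpose (A \<omega> x) = A \<omega> x \<and>
  (\<forall>\<xi>. 0 <= \<xi> \<bullet> (A \<omega> x *v \<xi>) \<and> \<xi> \<bullet> (A \<omega> x *v \<xi>) <= \<beta> * (norm \<xi>)\<^sup>2) \<and>
  convex_on UNIV (\<lambda>\<xi>. \<psi> \<omega> x \<xi> - c * (norm \<xi>)\<^sup>2) \<and> (\<forall>\<xi>. \<psi> \<omega> x \<xi> <= C * (1 + (norm \<xi>)\<^sup>2))"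

text \<open>The growth condition comes with a separate null set for each \<xi>. It is taken for a
  countable dense set of \<xi> and extended by the continuity that convexity provides.\<close>

lemma AE_regular: "AE (\<omega>, x) in M \<Otimes>\<^sub>M lebesgue. regular \<omega> x"
proof -
 obtain Q :: "(real^'n) set" where Q: "countable Q" "UNIV \<subseteq> closure Q" using separable[of UNIV] by metis
 have "AE z in M \<Otimes>\<^sub>M lebesgue. \<forall>\<xi>\<in>Q. \<psi> (fst z) (snd z) \<xi> <= C * (1 + (norm \<xi>)\<^sup>2)"
  using psi_growth by (intro AE_ball_countable[OF Q(1), THEN iffD2] ballI) (simp add: case_prod_beta)
 with A_symmetric A_bounds psi_convex show ?thesis
 proof eventually_elim
  case (elim z)
  obtain \<omega> x where z: "z = (\<omega>, x)" by (cases z)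
  have cx: "convex_on UNIV (\<lambda>\<xi>. \<psi> \<omega> x \<xi> - c * (norm \<xi>)\<^sup>2)" using elim by (simp add: z)
  have "continuous_on UNIV (\<lambda>\<xi>. (\<psi> \<omega> x \<xi> - c * (norm \<xi>)\<^sup>2) + c * (norm \<xi>)\<^sup>2)"
   by (intro continuous_on_add convex_on_continuous[OF open_UNIV cx] continuous_intros)
  then have "continuous_on UNIV (\<psi> \<omega> x)" by simp
  then have "closed {\<xi>. \<psi> \<omega> x \<xi> <= C * (1 + (norm \<xi>)\<^sup>2)}"
   by (intro closed_Collect_le continuous_intros)
  moreover have "Q \<subseteq> {\<xi>. \<psi> \<omega> x \<xi> <= C * (1 + (norm \<xi>)\<^sup>2)}" using elim by (auto simp: z)
  ultimately have "closure Q \<subseteq> {\<xi>. \<psi> \<omega> x \<xi> <= C * (1 + (norm \<xi>)\<^sup>2)}" by (intro closure_minimal)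
  then have "\<psi> \<omega> x \<xi> <= C * (1 + (norm \<xi>)\<^sup>2)" for \<xi> using Q(2) by auto
  moreover have "0 <= \<xi> \<bullet> (A \<omega> x *v \<xi>) \<and> \<xi> \<bullet> (A \<omega> x *v \<xi>) <= \<beta> * (norm \<xi>)\<^sup>2" for \<xi>
  proof -
   have "\<alpha> * (norm \<xi>)\<^sup>2 <= \<xi> \<bullet> (A \<omega> x *v \<xi>) \<and> \<xi> \<bullet> (A \<omega> x *v \<xi>) <= \<beta> * (norm \<xi>)\<^sup>2" using elim by (simp add: z)
   moreover have "0 <= \<alpha> * (norm \<xi>)\<^sup>2" using \<alpha> by simp
   ultimately show ?thesis by linarith
  qed
  ultimately show ?case using elim(1) cx unfolding z regular_def prod.case by blast
 qed
qed

text \<open>A measurable null set fixed once and for all. The set of irregular points need not be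
  measurable itself, whereas integrands modified on \<open>N\<close> remain measurable.\<close>

definition N :: "('w \<times> (real^'n)) set" where
 "N = (SOME N. N \<in> null_sets (M \<Otimes>\<^sub>M lebesgue) \<and> (\<forall>\<omega>\<in>space M. \<forall>x. (\<omega>, x) \<notin> N --> regular \<omega> x))"

lemma N: "N \<in> null_sets (M \<Otimes>\<^sub>M lebesgue)" "!!\<omega> x. \<omega> \<in> space M ==> (\<omega>, x) \<notin> N ==> regular \<omega> x"
proof -
 obtain N' where N': "N' \<in> null_sets (M \<Otimes>\<^sub>M lebesgue)" "{z \<in> space (M \<Otimes>\<^sub>M lebesgue). \<not> (case z of (\<omega>, x) => regular \<omega> x)} \<subseteq> N'"
  using AE_regular unfolding eventually_ae_filter by (rule bexE)
 have "regular \<omega> x" if "\<omega> \<in> space M" "(\<omega>, x) \<notin> N'" for \<omega> x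
  using subsetD[OF N'(2), of "(\<omega>, x)"] that by (auto simp: space_pair_measure)
 then have "\<exists>N. N \<in> null_sets (M \<Otimes>\<^sub>M lebesgue) \<and> (\<forall>\<omega>\<in>space M. \<forall>x. (\<omega>, x) \<notin> N --> regular \<omega> x)"
  using N'(1) by (intro exI[of _ N'] conjI ballI allI impI)
 from someI_ex[OF this, folded N_def] have "N \<in> null_sets (M \<Otimes>\<^sub>M lebesgue) \<and> (\<forall>\<omega>\<in>space M. \<forall>x. (\<omega>, x) \<notin> N --> regular \<omega> x)" .
 then show "N \<in> null_sets (M \<Otimes>\<^sub>M lebesgue)" "!!\<omega> x. \<omega> \<in> space M ==> (\<omega>, x) \<notin> N ==> regular \<omega> x" by simp_all
qed

text \<open>Outside \<open>D\<close> and at exceptional points the integrands are replaced by ones that satisfy the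
 assumptions everywhere; gradients of functions on \<open>D\<close> vanish outside \<open>D\<close>.\<close>

definition good :: "'w => real^'n => bool" where "good \<omega> x \<longleftrightarrow> x \<in> D \<and> (\<omega>, x /\<^sub>R \<epsilon>) \<notin> N"
definition f :: "'w => real^'n => real^'n => real" where
 "f \<omega> x \<xi> = (if good \<omega> x then \<psi> \<omega> (x /\<^sub>R \<epsilon>) \<xi> else c * (norm \<xi>)\<^sup>2)"
definition a :: "'w => real^'n => real^'n^'n" where "a \<omega> x = (if good \<omega> x then A \<omega> (x /\<^sub>R \<epsilon>) else 0)"

lemma AE_good: "AE \<omega> in M. AE x in lebesgue. x \<in> D --> good \<omega> x"
proof -
 have "AE z in M \<Otimes>\<^sub>M lebesgue. z \<notin> N" by (rule AE_not_in[OF N(1)])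
 then have "AE \<omega> in M. AE x in lebesgue. (\<omega>, x) \<notin> N" by (rule P.AE_pair)
 then show ?thesis
 proof eventually_elim
  case (elim \<omega>)
  have "AE x in lebesgue. (\<omega>, x /\<^sub>R \<epsilon>) \<notin> N" using AE_lebesgue_scale[OF elim] \<epsilon> by simp
  then show ?case by eventually_elim (simp add: good_def)
 qed
qed

lemma scale_measurable: "(\<lambda>z. (fst z, snd z /\<^sub>R \<epsilon>)) \<in> M \<Otimes>\<^sub>M lebesgue \<rightarrow>\<^sub>M M \<Otimes>\<^sub>M lebesgue"
 by (intro measurable_Pair measurable_fst measurable_compose[OF measurable_snd lebesgue_measurable_scaling])

lemma good_measurable [measurable]: "Measurable.pred (M \<Otimes>\<^sub>M lebesgue) (\<lambda>z. good (fst z) (snd z))"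
proof -
 have "Measurable.pred (M \<Otimes>\<^sub>M lebesgue) (\<lambda>z. z \<in> N)" by (rule pred_sets2[OF null_setsD2[OF N(1)] measurable_ident_sets[OF refl]])
 then have [measurable]: "Measurable.pred (M \<Otimes>\<^sub>M lebesgue) (\<lambda>z. (fst z, snd z /\<^sub>R \<epsilon>) \<in> N)" by (rule measurable_compose[OF scale_measurable])
 have [measurable]: "Measurable.pred (M \<Otimes>\<^sub>M lebesgue) (\<lambda>z. snd z \<in> D)"
  by (rule pred_sets2[OF _ measurable_snd]) (rule D_sets)
 show ?thesis unfolding good_def by measurable
qed

lemma f_measurable: "(\<lambda>z. f (fst z) (snd z) \<xi>) \<in> borel_measurable (M \<Otimes>\<^sub>M lebesgue)"
proof -
 have [measurable]: "(\<lambda>z. \<psi> (fst z) (snd z /\<^sub>R \<epsilon>) \<xi>) \<in> borel_measurable (M \<Otimes>\<^sub>M lebesgue)"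
  using measurable_compose[OF scale_measurable psi_measurable[rule_format, of \<xi>]] by simp
 show ?thesis unfolding f_def by measurable
qed

lemma a_measurable: "(\<lambda>z. a (fst z) (snd z)) \<in> borel_measurable (M \<Otimes>\<^sub>M lebesgue)"
proof -
 have [measurable]: "(\<lambda>z. A (fst z) (snd z /\<^sub>R \<epsilon>)) \<in> borel_measurable (M \<Otimes>\<^sub>M lebesgue)"
  using measurable_compose[OF scale_measurable A_measurable] by simp
 show ?thesis unfolding a_def by measurable
qed

context
 fixes \<omega> assumes \<omega>: "\<omega> \<in> space M"
begin

lemma f_convex_diff: "convex_on UNIV (\<lambda>\<xi>. f \<omega> x \<xi> - c * (norm \<xi>)\<^sup>2)"
 using N(2)[OF \<omega>, of "x /\<^sub>R \<epsilon>"] by (cases "good \<omega> x") (auto simp: f_def good_def regular_def convex_on_def)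

lemma f_continuous: "continuous_on UNIV (f \<omega> x)"
proof -
 have "continuous_on UNIV (\<lambda>\<xi>. (f \<omega> x \<xi> - c * (norm \<xi>)\<^sup>2) + c * (norm \<xi>)\<^sup>2)"
  by (intro continuous_on_add convex_on_continuous[OF open_UNIV f_convex_diff] continuous_intros)
 then show ?thesis by simp
qed

lemma f_nonneg: "0 <= f \<omega> x \<xi>" using psi_nonneg \<omega> c by (simp add: f_def)
lemma f_zero: "f \<omega> x 0 = 0" using psi_zero \<omega> by (simp add: f_def)

text \<open>The constant term occurs only on \<open>D\<close>, where it is integrable, since the
  replacement c |\<xi>|^2 vanishes with \<xi>. The sum of both constants covers both cases.\<close>

lemma f_le: "f \<omega> x \<xi> <= (C + c) * (indicator D x + (norm \<xi>)\<^sup>2)"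
proof (cases "good \<omega> x")
 case True
 then have "f \<omega> x \<xi> <= C * (1 + (norm \<xi>)\<^sup>2)" "x \<in> D" using N(2)[OF \<omega>, of "x /\<^sub>R \<epsilon>"] by (auto simp: f_def good_def regular_def)
 moreover have "C * (1 + (norm \<xi>)\<^sup>2) <= (C + c) * (1 + (norm \<xi>)\<^sup>2)" using c by (intro mult_right_mono) auto
 ultimately show ?thesis by simp
next
 case False
 have "c * (norm \<xi>)\<^sup>2 <= (C + c) * (indicator D x + (norm \<xi>)\<^sup>2)" using c C by (intro mult_mono) (auto split: split_indicator)
 then show ?thesis using False by (simp add: f_def)
qed

lemma f_convex: assumes "0 <= u" "0 <= v" "u + v = 1"
 shows "f \<omega> x (u *\<^sub>R \<xi> + v *\<^sub>R \<eta>) <= u * f \<omega> x \<xi> + v * f \<omega> x \<eta> - c * u * v * (norm (\<xi> - \<eta>))\<^sup>2"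
proof -
 have "f \<omega> x (u *\<^sub>R \<xi> + v *\<^sub>R \<eta>) - c * (norm (u *\<^sub>R \<xi> + v *\<^sub>R \<eta>))\<^sup>2
   <= u * (f \<omega> x \<xi> - c * (norm \<xi>)\<^sup>2) + v * (f \<omega> x \<eta> - c * (norm \<eta>)\<^sup>2)"
  using f_convex_diff[of x] assms unfolding convex_on_def by blast
 moreover have "(norm (u *\<^sub>R \<xi> + v *\<^sub>R \<eta>))\<^sup>2 = u * (norm \<xi>)\<^sup>2 + v * (norm \<eta>)\<^sup>2 - u * v * (norm (\<xi> - \<eta>))\<^sup>2"
 proof -
  have v: "v = 1 - u" using assms by simp
  show ?thesis unfolding v power2_norm_eq_inner
   by (simp add: inner_add_left inner_add_right inner_diff_left inner_diff_right inner_commute algebra_simps)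
 qed
 ultimately show ?thesis by (simp add: algebra_simps)
qed

lemma a_bound: "\<bar>\<eta> \<bullet> (a \<omega> x *v \<xi>)\<bar> <= \<bar>\<beta>\<bar> * norm \<xi> * norm \<eta>"
proof (cases "good \<omega> x")
 case True
 then have "regular \<omega> (x /\<^sub>R \<epsilon>)" using N(2)[OF \<omega>] by (simp add: good_def)
 then have "\<bar>\<eta> \<bullet> (a \<omega> x *v \<xi>)\<bar> <= \<beta> * norm \<xi> * norm \<eta>"
  using True symmetric_form_bound(2)[of "a \<omega> x" \<beta>] by (simp add: regular_def a_def)
 also have "... <= \<bar>\<beta>\<bar> * norm \<xi> * norm \<eta>" by (intro mult_right_mono) auto
 finally show ?thesis .
qed (simp add: a_def matrix_vector_mult_0)

lemma a_symmetric: "\<eta> \<bullet> (a \<omega> x *v \<xi>) = \<xi> \<bullet> (a \<omega> x *v \<eta>)"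
proof (cases "good \<omega> x")
 case True
 then have "regular \<omega> (x /\<^sub>R \<epsilon>)" using N(2)[OF \<omega>] by (simp add: good_def)
 then have "transpose (a \<omega> x) = a \<omega> x" "!!\<xi>. 0 <= \<xi> \<bullet> (a \<omega> x *v \<xi>) \<and> \<xi> \<bullet> (a \<omega> x *v \<xi>) <= \<beta> * (norm \<xi>)\<^sup>2"
  using True by (simp_all add: regular_def a_def)
 then show ?thesis by (rule symmetric_form_bound(1))
next
 case False
 then have "a \<omega> x = 0" by (simp add: a_def)
 then show ?thesis by (simp only: matrix_vector_mult_0 inner_zero_right)
qed

end

lemma f_joint:
 assumes h: "h \<in> borel_measurable lebesgue"
 shows "(\<lambda>z. f (fst z) (snd z) (h (snd z))) \<in> borel_measurable (M \<Otimes>\<^sub>M lebesgue)"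
proof (rule borel_measurable_Caratheodory[where f = "\<lambda>z. f (fst z) (snd z)" and M = "M \<Otimes>\<^sub>M lebesgue" and p = "\<lambda>z. z"])
 show "continuous_on UNIV (f (fst z) (snd z))" if "z \<in> space (M \<Otimes>\<^sub>M lebesgue)" for z
  using that by (intro f_continuous) (auto simp: space_pair_measure)
qed (use f_measurable measurable_compose[OF measurable_snd h] in simp_all)

lemma a_joint:
 assumes g: "g \<in> borel_measurable lebesgue" and h: "h \<in> borel_measurable lebesgue"
 shows "(\<lambda>z. h (snd z) \<bullet> (a (fst z) (snd z) *v g (snd z))) \<in> borel_measurable (M \<Otimes>\<^sub>M lebesgue)"
proof -
 have [measurable]: "(\<lambda>z. h (snd z) $ i) \<in> borel_measurable (M \<Otimes>\<^sub>M lebesgue)" "(\<lambda>z. g (snd z) $ i) \<in> borel_measurable (M \<Otimes>\<^sub>M lebesgue)" for i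
  by (rule measurable_compose[OF measurable_compose[OF measurable_snd h]], rule borel_measurable_continuous_onI, intro continuous_intros,
    rule measurable_compose[OF measurable_compose[OF measurable_snd g]], rule borel_measurable_continuous_onI, intro continuous_intros)
 have [measurable]: "(\<lambda>z. a (fst z) (snd z) $ i $ j) \<in> borel_measurable (M \<Otimes>\<^sub>M lebesgue)" for i j
  by (rule measurable_compose[OF a_measurable], rule borel_measurable_continuous_onI, intro continuous_intros)
 show ?thesis unfolding inner_vec_def matrix_vector_mult_def by simp
qed

lemma section_measurable:
 assumes "(\<lambda>z. F (fst z) (snd z)) \<in> borel_measurable (M \<Otimes>\<^sub>M lebesgue)" "\<omega> \<in> space M"
 shows "F \<omega> \<in> borel_measurable lebesgue"
 using measurable_Pair2[OF assms] by simp

definition P_fun :: "'w => (real^'n, real^'n) l2 => real" where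
 "P_fun \<omega> g = (LINT x|lebesgue. f \<omega> x (l2_fun g x))"
definition B_fun :: "'w => (real^'n, real^'n) l2 => (real^'n, real^'n) l2 => real" where
 "B_fun \<omega> g h = (LINT x|lebesgue. l2_fun h x \<bullet> (a \<omega> x *v l2_fun g x))"

lemma P_fun_measurable: "(\<lambda>\<omega>. P_fun \<omega> g) \<in> borel_measurable M"
 unfolding P_fun_def using f_joint[OF mem_L2_measurable[OF l2_fun_mem]]
 by (intro lebesgue.borel_measurable_lebesgue_integral) (simp add: case_prod_beta)

lemma B_fun_measurable: "(\<lambda>\<omega>. B_fun \<omega> g h) \<in> borel_measurable M"
 unfolding B_fun_def using a_joint[OF mem_L2_measurable[OF l2_fun_mem] mem_L2_measurable[OF l2_fun_mem]]
 by (intro lebesgue.borel_measurable_lebesgue_integral) (simp add: case_prod_beta)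

context
 fixes \<omega> assumes \<omega>: "\<omega> \<in> space M"
begin

lemma f_section: "h \<in> borel_measurable lebesgue ==> (\<lambda>x. f \<omega> x (h x)) \<in> borel_measurable lebesgue"
 by (rule section_measurable[where F = "\<lambda>\<omega> x. f \<omega> x (h x)", OF f_joint \<omega>])

lemma a_section: "g \<in> borel_measurable lebesgue ==> h \<in> borel_measurable lebesgue ==> (\<lambda>x. h x \<bullet> (a \<omega> x *v g x)) \<in> borel_measurable lebesgue"
 by (rule section_measurable[where F = "\<lambda>\<omega> x. h x \<bullet> (a \<omega> x *v g x)", OF a_joint \<omega>])

lemma l2_measurable: "l2_fun g \<in> borel_measurable lebesgue" by (rule mem_L2_measurable[OF l2_fun_mem])

lemma majorant: "integrable lebesgue (\<lambda>x. (C + c) * (indicator D x + (norm (l2_fun g x))\<^sup>2))"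
 "(LINT x|lebesgue. (C + c) * (indicator D x + (norm (l2_fun g x))\<^sup>2)) = (C + c) * (measure lebesgue D + (norm g)\<^sup>2)"
proof -
 have 1: "integrable lebesgue (indicat_real D)"
  by (rule integrable_real_indicator[OF D_sets])
   (use fmeasurableD2[OF D_lmeasurable] in \<open>simp only: less_top[symmetric] infinity_ennreal_def not_False_eq_True\<close>)
 have 2: "integrable lebesgue (\<lambda>x. (norm (l2_fun g x))\<^sup>2)" by (rule mem_L2_integrable[OF l2_fun_mem])
 show "integrable lebesgue (\<lambda>x. (C + c) * (indicator D x + (norm (l2_fun g x))\<^sup>2))"
  using 1 2 by (intro integrable_mult_right Bochner_Integration.integrable_add)
 show "(LINT x|lebesgue. (C + c) * (indicator D x + (norm (l2_fun g x))\<^sup>2)) = (C + c) * (measure lebesgue D + (norm g)\<^sup>2)"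
  using 1 2 by (simp add: norm_l2[of g] L2norm_power2)
qed

lemma f_integrable: "integrable lebesgue (\<lambda>x. f \<omega> x (l2_fun g x))"
 by (rule Bochner_Integration.integrable_bound[OF majorant(1)[of g] f_section[OF l2_measurable]])
  (use f_le[OF \<omega>] f_nonneg[OF \<omega>] in \<open>auto intro!: AE_I2 intro: order_trans[OF _ abs_ge_self]\<close>)

lemma P_fun_nonneg: "0 <= P_fun \<omega> g" unfolding P_fun_def by (rule Bochner_Integration.integral_nonneg) (rule f_nonneg[OF \<omega>])

lemma P_fun_growth: "P_fun \<omega> g <= (C + c) * (measure lebesgue D + (norm g)\<^sup>2)"
 unfolding P_fun_def majorant(2)[symmetric] by (rule integral_mono[OF f_integrable majorant(1)]) (rule f_le[OF \<omega>])

lemma P_fun_cong: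
 assumes h: "h \<in> borel_measurable lebesgue" and ae: "AE x in lebesgue. f \<omega> x (l2_fun g x) = h x"
 shows "P_fun \<omega> g = (LINT x|lebesgue. h x)"
 unfolding P_fun_def by (rule integral_cong_AE[OF f_section[OF l2_measurable] h ae])

lemma P_fun_zero: "P_fun \<omega> 0 = 0"
proof -
 have "P_fun \<omega> 0 = (LINT x|(lebesgue :: (real^'n) measure). 0)"
 proof (rule P_fun_cong)
  have "AE x in lebesgue. l2_fun (0 :: (real^'n, real^'n) l2) x = 0" by (rule l2_fun_zero)
  then show "AE x in lebesgue. f \<omega> x (l2_fun 0 x) = 0" by eventually_elim (simp add: f_zero[OF \<omega>])
 qed simp
 then show ?thesis by simp
qed

lemma P_fun_convex: assumes uv: "0 <= u" "0 <= v" "u + v = 1"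
 shows "P_fun \<omega> (u *\<^sub>R g + v *\<^sub>R h) <= u * P_fun \<omega> g + v * P_fun \<omega> h - c * u * v * (norm (g - h))\<^sup>2"
proof -
 have i: "integrable lebesgue (\<lambda>x. (norm (l2_fun (g - h) x))\<^sup>2)" by (rule mem_L2_integrable[OF l2_fun_mem])
 have "P_fun \<omega> (u *\<^sub>R g + v *\<^sub>R h) <= (LINT x|lebesgue. u * f \<omega> x (l2_fun g x) + v * f \<omega> x (l2_fun h x) - c * u * v * (norm (l2_fun (g - h) x))\<^sup>2)"
  unfolding P_fun_def
 proof (rule integral_mono_AE[OF f_integrable])
  show "integrable lebesgue (\<lambda>x. u * f \<omega> x (l2_fun g x) + v * f \<omega> x (l2_fun h x) - c * u * v * (norm (l2_fun (g - h) x))\<^sup>2)"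
   by (intro Bochner_Integration.integrable_diff Bochner_Integration.integrable_add integrable_mult_right f_integrable i)
  show "AE x in lebesgue. f \<omega> x (l2_fun (u *\<^sub>R g + v *\<^sub>R h) x) <= u * f \<omega> x (l2_fun g x) + v * f \<omega> x (l2_fun h x) - c * u * v * (norm (l2_fun (g - h) x))\<^sup>2"
   using l2_fun_add[of "u *\<^sub>R g" "v *\<^sub>R h"] l2_fun_scaleR[of u g] l2_fun_scaleR[of v h] l2_fun_diff[of g h]
   by eventually_elim (use f_convex[OF \<omega> uv] in simp)
 qed
 also have "... = u * P_fun \<omega> g + v * P_fun \<omega> h - c * u * v * (norm (g - h))\<^sup>2"
  using f_integrable i by (simp add: P_fun_def norm_l2[of "g - h"] L2norm_power2)
 finally show ?thesis .
qed

lemma P_fun_midconvex: "uniformly_midconvex_on (c / 4) UNIV (P_fun \<omega>)"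
 unfolding uniformly_midconvex_on_def
proof (intro ballI)
 fix g h
 show "P_fun \<omega> ((1/2) *\<^sub>R (g + h)) <= (P_fun \<omega> g + P_fun \<omega> h) / 2 - c / 4 * (norm (g - h))\<^sup>2"
  using P_fun_convex[of "1/2" "1/2" g h] by (simp add: scaleR_add_right add_divide_distrib)
qed

text \<open>A convex function that is bounded on a ball is continuous there, and the growth
  condition bounds it on every ball.\<close>

lemma P_fun_continuous: "continuous_on UNIV (P_fun \<omega>)"
proof -
 have "continuous_on (ball 0 r) (P_fun \<omega>)" for r
 proof (rule convex_on_bounded_continuous[where b = "(C + c) * (measure lebesgue D + r\<^sup>2)"])
  have "P_fun \<omega> (u *\<^sub>R g + v *\<^sub>R h) <= u * P_fun \<omega> g + v * P_fun \<omega> h" if "0 <= u" "0 <= v" "u + v = 1" for u v g h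
  proof -
   have "0 <= c * u * v * (norm (g - h))\<^sup>2" using c that by simp
   then show ?thesis using P_fun_convex[OF that, of g h] by linarith
  qed
  then show "convex_on (ball 0 r) (P_fun \<omega>)" unfolding convex_on_def by (simp add: convex_ball)
  show "\<forall>g\<in>ball 0 r. \<bar>P_fun \<omega> g\<bar> <= (C + c) * (measure lebesgue D + r\<^sup>2)"
  proof
   fix g :: "(real^'n, real^'n) l2" assume "g \<in> ball 0 r"
   then have "(norm g)\<^sup>2 <= r\<^sup>2" by (intro power_mono) auto
   then have "(C + c) * (measure lebesgue D + (norm g)\<^sup>2) <= (C + c) * (measure lebesgue D + r\<^sup>2)" using c C by (intro mult_left_mono) auto
   then show "\<bar>P_fun \<omega> g\<bar> <= (C + c) * (measure lebesgue D + r\<^sup>2)" using P_fun_growth[of g] P_fun_nonneg[of g] by simp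
  qed
 qed simp
 then have "isCont (P_fun \<omega>) g" for g
  using continuous_on_eq_continuous_at[OF open_ball[of 0 "norm g + 1"], of "P_fun \<omega>"] by simp
 then show ?thesis by (simp add: continuous_on_eq_continuous_at)
qed

lemma B_integrable: "integrable lebesgue (\<lambda>x. l2_fun h x \<bullet> (a \<omega> x *v l2_fun g x))"
proof (rule Bochner_Integration.integrable_bound[OF _ a_section[OF l2_measurable l2_measurable]])
 show "integrable lebesgue (\<lambda>x. \<bar>\<beta>\<bar> * (norm (l2_fun g x) * norm (l2_fun h x)))"
  by (rule integrable_mult_right) (rule mem_L2_integrable_norm_mult[OF l2_fun_mem l2_fun_mem])
qed (use a_bound[OF \<omega>] in \<open>auto intro!: AE_I2 simp: abs_mult mult.assoc\<close>)

lemma B_fun_bound: "\<bar>B_fun \<omega> g h\<bar> <= \<bar>\<beta>\<bar> * norm g * norm h"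
proof -
 have "\<bar>B_fun \<omega> g h\<bar> <= (LINT x|lebesgue. norm (l2_fun h x \<bullet> (a \<omega> x *v l2_fun g x)))"
  unfolding B_fun_def using integral_norm_bound[of lebesgue "\<lambda>x. l2_fun h x \<bullet> (a \<omega> x *v l2_fun g x)"] by simp
 also have "... <= (LINT x|lebesgue. \<bar>\<beta>\<bar> * (norm (l2_fun g x) * norm (l2_fun h x)))"
  by (rule integral_mono[OF integrable_norm[OF B_integrable] integrable_mult_right[OF mem_L2_integrable_norm_mult[OF l2_fun_mem l2_fun_mem]]])
   (use a_bound[OF \<omega>] in \<open>simp add: mult.assoc\<close>)
 also have "... <= \<bar>\<beta>\<bar> * (norm g * norm h)"
  using L2_Cauchy_Schwarz[OF l2_fun_mem l2_fun_mem, of g h] by (simp add: norm_l2[of g] norm_l2[of h] mult_left_mono)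
 finally show ?thesis by (simp add: mult.assoc)
qed

lemma B_fun_symmetric: "B_fun \<omega> g h = B_fun \<omega> h g"
 unfolding B_fun_def by (rule Bochner_Integration.integral_cong[OF refl]) (rule a_symmetric[OF \<omega>])

lemma B_fun_right:
 "B_fun \<omega> g (h + k) = B_fun \<omega> g h + B_fun \<omega> g k" "B_fun \<omega> g (r *\<^sub>R h) = r * B_fun \<omega> g h"
proof -
 have "B_fun \<omega> g (h + k) = (LINT x|lebesgue. l2_fun h x \<bullet> (a \<omega> x *v l2_fun g x) + l2_fun k x \<bullet> (a \<omega> x *v l2_fun g x))"
  unfolding B_fun_def
 proof (rule integral_cong_AE[OF a_section[OF l2_measurable l2_measurable] borel_measurable_add[OF a_section[OF l2_measurable l2_measurable] a_section[OF l2_measurable l2_measurable]]])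
  show "AE x in lebesgue. l2_fun (h + k) x \<bullet> (a \<omega> x *v l2_fun g x) = l2_fun h x \<bullet> (a \<omega> x *v l2_fun g x) + l2_fun k x \<bullet> (a \<omega> x *v l2_fun g x)"
   using l2_fun_add[of h k] by eventually_elim (simp add: inner_add_left)
 qed
 then show "B_fun \<omega> g (h + k) = B_fun \<omega> g h + B_fun \<omega> g k" using B_integrable by (simp add: B_fun_def)
 have "B_fun \<omega> g (r *\<^sub>R h) = (LINT x|lebesgue. r * (l2_fun h x \<bullet> (a \<omega> x *v l2_fun g x)))"
  unfolding B_fun_def
 proof (rule integral_cong_AE[OF a_section[OF l2_measurable l2_measurable] borel_measurable_times[OF borel_measurable_const a_section[OF l2_measurable l2_measurable]]])
  show "AE x in lebesgue. l2_fun (r *\<^sub>R h) x \<bullet> (a \<omega> x *v l2_fun g x) = r * (l2_fun h x \<bullet> (a \<omega> x *v l2_fun g x))"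
   using l2_fun_scaleR[of r h] by eventually_elim simp
 qed
 then show "B_fun \<omega> g (r *\<^sub>R h) = r * B_fun \<omega> g h" by (simp add: B_fun_def)
qed

lemma B_fun_left:
 "B_fun \<omega> (g + h) k = B_fun \<omega> g k + B_fun \<omega> h k" "B_fun \<omega> (r *\<^sub>R g) k = r * B_fun \<omega> g k"
 by (simp_all only: B_fun_symmetric[of _ k] B_fun_right)

end

end

section \<open>From the minimisation problem to the subdifferential inclusion\<close>

section \<open>The evolution inclusion\<close>

lemma time_derivative_weak:
 assumes "u \<in> time_H1 T X"
 shows "time_derivative T X u \<in> carr (bochner_L2 X (lebesgue_on {0..T}))" "has_weak_time_derivative T X u (time_derivative T X u)"
proof -
 have "\<exists>v. v \<in> carr (bochner_L2 X (lebesgue_on {0..T})) \<and> has_weak_time_derivative T X u v"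
  using assms unfolding time_H1_def by blast
 from someI_ex[OF this, folded time_derivative_def]
 show "time_derivative T X u \<in> carr (bochner_L2 X (lebesgue_on {0..T}))" "has_weak_time_derivative T X u (time_derivative T X u)" by simp_all
qed

context bounded_open
begin

lemma l2_fun_grad_extend: "u \<in> carr (H1 D) ==> AE x in lebesgue. l2_fun (grad u) x = indicator D x *\<^sub>R weak_gradient D u x"
 unfolding grad_def l2_on_def by (rule l2_fun_of[OF mem_L2_extend[OF D_sets weak_gradient(1)]])

lemma hilbert_nspace_H1_zero_on:
 assumes "lipschitz_domain D"
 shows "hilbert_nspace (H1_zero_on D \<Gamma>) grad"
proof
 show "0 \<in> carr (H1_zero_on D \<Gamma>)" by (rule H1_zero_on_zero)
 show "closed (grad ` carr (H1_zero_on D \<Gamma>))"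
  by (rule closed_grad_H1_zero_on[OF poincare_set_lipschitz_domain[OF bounded_D assms]])
 fix u assume u: "u \<in> carr (H1_zero_on D \<Gamma>)"
 note uH = H1_zero_on_sub[OF u]
 show "c *\<^sub>R u \<in> carr (H1_zero_on D \<Gamma>)" for c by (rule H1_zero_on_scaleR[OF u])
 show "nrm (H1_zero_on D \<Gamma>) (c *\<^sub>R u) = \<bar>c\<bar> * nrm (H1_zero_on D \<Gamma>) u" for c
  unfolding nrm_H1_zero_on[OF uH] nrm_H1_zero_on[OF H1_scaleR(1)[OF uH]] H1_scaleR(3)[OF uH] by simp
 show "nrm (H1_zero_on D \<Gamma>) u = norm (grad u)" by (rule nrm_H1_zero_on[OF uH])
 show "grad (c *\<^sub>R u) = c *\<^sub>R grad u" for c by (rule H1_scaleR(3)[OF uH])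
 fix v assume v: "v \<in> carr (H1_zero_on D \<Gamma>)"
 note vH = H1_zero_on_sub[OF v]
 show "u + v \<in> carr (H1_zero_on D \<Gamma>)" by (rule H1_zero_on_add[OF u v])
 show "grad (u + v) = grad u + grad v" by (rule H1_add(3)[OF uH vH])
 show "nrm (H1_zero_on D \<Gamma>) (u + v) <= nrm (H1_zero_on D \<Gamma>) u + nrm (H1_zero_on D \<Gamma>) v"
  unfolding nrm_H1_zero_on[OF uH] nrm_H1_zero_on[OF vH] nrm_H1_zero_on[OF H1_add(1)[OF uH vH]] H1_add(3)[OF uH vH]
  by (rule norm_triangle_ineq)
qed

lemma norm_grad_le_nrm_H1: "u \<in> carr (H1 D) ==> norm (grad u) <= nrm (H1 D) u"
 using norm_snd_le[of "grad u" "l2_on D u"] by (simp add: nrm_H1 H1_pair_def)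

text \<open>The full H^1 norm dominates that of the gradient, so simple approximations in H^1 yield
  simple approximations of the gradients.\<close>

lemma mem_L2_grad:
 assumes w: "w \<in> carr (bochner_L2 (H1 D) N)"
 shows "mem_L2 N (\<lambda>t. grad (w t))"
proof (rule mem_L2_bound)
 have sm: "strongly_measurable (H1 D) N w" and int: "integrable N (\<lambda>t. (nrm (H1 D) (w t))\<^sup>2)"
  using w by (simp_all add: bochner_L2_def)
 have wc: "w t \<in> carr (H1 D)" if "t \<in> space N" for t using sm that by (simp add: strongly_measurable_def)
 obtain s where s: "\<forall>n. simple_function N (s n) \<and> s n ` space N \<subseteq> carr (H1 D)"
  "\<forall>x\<in>space N. (\<lambda>n. nrm (H1 D) (w x - s n x)) \<longlonglongrightarrow> 0"
  using sm[unfolded strongly_measurable_def] by (elim conjE exE)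
 have sc: "s n t \<in> carr (H1 D)" if "t \<in> space N" for n t by (rule subsetD[OF s(1)[rule_format, THEN conjunct2] imageI[OF that]])
 show "(\<lambda>t. grad (w t)) \<in> borel_measurable N"
 proof (rule borel_measurable_LIMSEQ_metric)
  show "(\<lambda>t. grad (s n t)) \<in> borel_measurable N" for n
   using simple_function_compose[OF s(1)[rule_format, THEN conjunct1], of grad n]
   by (intro borel_measurable_simple_function) (simp add: comp_def)
  fix t assume t: "t \<in> space N"
  have "norm (grad (w t) - grad (s n t)) <= nrm (H1 D) (w t - s n t)" for n
   using norm_grad_le_nrm_H1[OF H1_diff(1)[OF wc[OF t] sc[OF t, of n]]] unfolding H1_diff(3)[OF wc[OF t] sc[OF t]] .
  then have "(\<lambda>n. grad (w t) - grad (s n t)) \<longlonglongrightarrow> 0" by (rule LIMSEQ_null_comparison) (rule s(2)[rule_format, OF t])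
  from tendsto_diff[OF tendsto_const[of "grad (w t)"] this] show "(\<lambda>n. grad (s n t)) \<longlonglongrightarrow> grad (w t)" by simp
 qed
 show "integrable N (\<lambda>t. (nrm (H1 D) (w t))\<^sup>2)" by (rule int)
 show "AE t in N. (norm (grad (w t)))\<^sup>2 <= (nrm (H1 D) (w t))\<^sup>2"
  by (rule AE_I2) (rule power_mono[OF norm_grad_le_nrm_H1[OF wc] norm_ge_zero])
qed

end

locale evolution_problem = random_integrands D M A \<psi> \<epsilon> \<alpha> \<beta> c C
 for D :: "(real^'n) set" and M :: "'w measure" and A \<psi> \<epsilon> \<alpha> \<beta> c C +
 fixes T :: real and \<Gamma>N :: "(real^'n) set" and y :: "real => real^'n => real"
 assumes T_positive: "T > 0" and lipschitz: "lipschitz_domain D" and separable: "separable_L2 M"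
  and y: "y \<in> time_H1 T (H1 D)"
begin

abbreviation "X \<equiv> H1_zero_on D \<Gamma>N"
abbreviation "y' \<equiv> time_derivative T (H1 D) y"

lemma y_L2: "y \<in> carr (bochner_L2 (H1 D) (lebesgue_on {0..T}))" using y by (simp add: time_H1_def)

lemma y_H1: "t \<in> {0..T} ==> y t \<in> carr (H1 D)" and y'_H1: "t \<in> {0..T} ==> y' t \<in> carr (H1 D)"
 using y_L2 time_derivative_weak(1)[OF y] by (simp_all add: bochner_L2_def strongly_measurable_def space_restrict_space)

text \<open>The constant C + c covers the replaced integrand as well, and the 1 in the growth
  condition integrates to the measure of \<open>D\<close>.\<close>

sublocale DE: dissipative_evolution X grad T M P_fun B_fun c "C + c" "measure lebesgue D" "\<bar>\<beta>\<bar>" "\<lambda>t. grad (y' t)" "\<lambda>t. grad (y t)"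
proof (intro dissipative_evolution.intro dissipative_evolution_axioms.intro)
 show "hilbert_nspace X grad" by (rule hilbert_nspace_H1_zero_on[OF lipschitz])
 show "time_interval T" by (rule time_interval.intro[OF T_positive])
 show "mem_L2 (lebesgue_on {0..T}) (\<lambda>t. grad (y' t))" by (rule mem_L2_grad[OF time_derivative_weak(1)[OF y]])
 show "mem_L2 (lebesgue_on {0..T}) (\<lambda>t. grad (y t))" by (rule mem_L2_grad[OF y_L2])
 show "0 < c" by (rule c)
 show "0 <= C + c" using c C by simp
qed (simp_all only: prob separable P_fun_midconvex P_fun_continuous P_fun_measurable P_fun_nonneg P_fun_zero P_fun_growth
   B_fun_left B_fun_right B_fun_bound B_fun_measurable abs_ge_zero measure_nonneg)

lemma X_H1: "v \<in> carr X ==> v \<in> carr (H1 D)" by (rule H1_zero_on_sub)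

context
 fixes t \<omega> assumes t: "t \<in> {0..T}" and \<omega>: "\<omega> \<in> space M" and good: "AE x in lebesgue. x \<in> D --> good \<omega> x"
begin

lemma Psi_eq:
 assumes v: "v \<in> carr X"
 shows "Psi D \<psi> \<epsilon> (y' t) \<omega> v = P_fun \<omega> (grad (y' t) + grad v)"
proof -
 let ?g = "grad (y' t) + grad v"
 let ?h = "\<lambda>x. indicator D x *\<^sub>R \<psi> \<omega> (x /\<^sub>R \<epsilon>) (weak_gradient D (y' t) x + weak_gradient D v x)"
 \<comment> \<open>Outside \<open>D\<close> both gradients vanish and the replaced integrand is 0 at
   0, so the integral over the whole space agrees with that over \<open>D\<close>.\<close>
 have ae: "AE x in lebesgue. f \<omega> x (l2_fun ?g x) = ?h x"
  using good l2_fun_add[of "grad (y' t)" "grad v"] l2_fun_grad_extend[OF y'_H1[OF t]] l2_fun_grad_extend[OF X_H1[OF v]]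
 proof eventually_elim
  case (elim x)
  show ?case
  proof (cases "x \<in> D")
   case True then show ?thesis using elim by (simp add: f_def)
  next
   case False then show ?thesis using elim by (simp add: f_zero[OF \<omega>])
  qed
 qed
 have "P_fun \<omega> ?g = (LINT x|lebesgue. ?h x)"
  by (rule P_fun_cong[OF \<omega> borel_measurable_AE[OF f_section[OF \<omega> l2_measurable[OF \<omega>]] ae] ae])
 then show ?thesis unfolding Psi_def integral_lebesgue_on_eq[OF D_sets] by simp
qed

lemma Phi_eq:
 assumes u: "u \<in> carr X"
 shows "Phi D A \<epsilon> (y t) \<omega> u = 1 / 2 * B_fun \<omega> (grad (y t) + grad u) (grad (y t) + grad u)"
proof -
 note yu = H1_add[OF y_H1[OF t] X_H1[OF u]]
 let ?w = "weak_gradient D (y t + u)"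
 let ?g = "grad (y t + u)"
 let ?h = "\<lambda>x. indicator D x *\<^sub>R (?w x \<bullet> (A \<omega> (x /\<^sub>R \<epsilon>) *v ?w x))"
 have ae: "AE x in lebesgue. l2_fun ?g x \<bullet> (a \<omega> x *v l2_fun ?g x) = ?h x"
  using good l2_fun_grad_extend[OF yu(1)]
 proof eventually_elim
  case (elim x) then show ?case by (cases "x \<in> D") (simp_all add: a_def)
 qed
 have m: "(\<lambda>x. l2_fun ?g x \<bullet> (a \<omega> x *v l2_fun ?g x)) \<in> borel_measurable lebesgue"
  by (rule a_section[OF \<omega> l2_measurable[OF \<omega>] l2_measurable[OF \<omega>]])
 have "B_fun \<omega> ?g ?g = (LINT x|lebesgue. ?h x)"
  unfolding B_fun_def by (rule integral_cong_AE[OF m borel_measurable_AE[OF m ae] ae])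
 then show ?thesis unfolding Phi_def integral_lebesgue_on_eq[OF D_sets] yu(3) by simp
qed

context
 fixes u assumes u: "u \<in> carr X"
begin

abbreviation "q0 \<equiv> \<lambda>w. B_fun \<omega> (grad (y t) + grad u) (grad w)"

lemma q0_dual: "q0 \<in> dual X" "(\<lambda>w. - q0 w) \<in> dual X"
proof -
 have "\<bar>q0 w\<bar> <= (\<bar>\<beta>\<bar> * norm (grad (y t) + grad u)) * nrm X w" if "w \<in> carr X" for w
  using B_fun_bound[OF \<omega>] by (simp add: DE.nrm_J[OF that])
 then have b: "\<exists>K. \<forall>w\<in>carr X. \<bar>q0 w\<bar> <= K * nrm X w" by blast
 show "q0 \<in> dual X" unfolding dual_def
  using b by (simp add: DE.J_add DE.J_scaleR B_fun_right[OF \<omega>])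
 show "(\<lambda>w. - q0 w) \<in> dual X" unfolding dual_def
  using b by (simp add: DE.J_add DE.J_scaleR B_fun_right[OF \<omega>])
qed

text \<open>Along each line the energy is a quadratic polynomial, so the difference quotient is its
  linear part plus \<open>h\<close> times a constant.\<close>

lemma Phi_gateaux: "has_gateaux_derivative X (Phi D A \<epsilon> (y t) \<omega>) q0 u"
 unfolding has_gateaux_derivative_def
proof (intro conjI ballI q0_dual)
 fix w assume w: "w \<in> carr X"
 let ?g = "grad (y t) + grad u"
 have eq: "(Phi D A \<epsilon> (y t) \<omega> (u + h *\<^sub>R w) - Phi D A \<epsilon> (y t) \<omega> u) / h = q0 w + h * (B_fun \<omega> (grad w) (grad w) / 2)" if "h \<noteq> 0" for h
 proof -
  have uw: "u + h *\<^sub>R w \<in> carr X" by (intro DE.carr_add DE.carr_scaleR u w)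
  have "grad (u + h *\<^sub>R w) = grad u + h *\<^sub>R grad w" using DE.J_add[OF u DE.carr_scaleR[OF w]] DE.J_scaleR[OF w] by simp
  then have "Phi D A \<epsilon> (y t) \<omega> (u + h *\<^sub>R w) = 1 / 2 * B_fun \<omega> (?g + h *\<^sub>R grad w) (?g + h *\<^sub>R grad w)"
   unfolding Phi_eq[OF uw] by (simp add: add.assoc)
  also have "... = 1 / 2 * B_fun \<omega> ?g ?g + h * q0 w + h * (h * (B_fun \<omega> (grad w) (grad w) / 2))"
   using B_fun_symmetric[OF \<omega>, of "grad w" ?g]
   by (simp only: B_fun_left(1)[OF \<omega>, of ?g "h *\<^sub>R grad w"] B_fun_left(2)[OF \<omega>, of h "grad w"] B_fun_right(1)[OF \<omega>, of _ ?g "h *\<^sub>R grad w"]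
     B_fun_right(2)[OF \<omega>, of _ h "grad w"]) (simp add: algebra_simps)
  finally have "Phi D A \<epsilon> (y t) \<omega> (u + h *\<^sub>R w) - Phi D A \<epsilon> (y t) \<omega> u = h * (q0 w + h * (B_fun \<omega> (grad w) (grad w) / 2))"
   unfolding Phi_eq[OF u] by (simp add: distrib_left)
  then show ?thesis using that by simp
 qed
 have "((\<lambda>h. q0 w + h * (B_fun \<omega> (grad w) (grad w) / 2)) \<longlongrightarrow> q0 w + 0 * (B_fun \<omega> (grad w) (grad w) / 2)) (at 0)"
  by (intro tendsto_intros)
 then have lim: "((\<lambda>h. q0 w + h * (B_fun \<omega> (grad w) (grad w) / 2)) \<longlongrightarrow> q0 w) (at 0)" by simp
 have "\<forall>\<^sub>F h in at 0. q0 w + h * (B_fun \<omega> (grad w) (grad w) / 2) = (Phi D A \<epsilon> (y t) \<omega> (u + h *\<^sub>R w) - Phi D A \<epsilon> (y t) \<omega> u) / h"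
  unfolding eventually_at_filter by (intro always_eventually allI impI) (rule eq[symmetric])
 then show "((\<lambda>h. (Phi D A \<epsilon> (y t) \<omega> (u + h *\<^sub>R w) - Phi D A \<epsilon> (y t) \<omega> u) / h) \<longlongrightarrow> q0 w) (at 0)"
  using lim by (rule Lim_transform_eventually[rotated])
qed

lemma Phi_gateaux_unique:
 assumes "has_gateaux_derivative X (Phi D A \<epsilon> (y t) \<omega>) q u" "w \<in> carr X"
 shows "q w = q0 w"
 using assms Phi_gateaux unfolding has_gateaux_derivative_def by (elim conjE) (rule tendsto_unique[OF trivial_limit_at], erule (1) bspec, erule (1) bspec)

text \<open>The Gateaux derivative is unique, so p is the negative of \<open>q0\<close> on the
  space. The subgradient inequality for it says exactly that \<open>v\<close> minimises the
  dissipation plus the linear term \<open>q0\<close>, and in terms of gradients this is the problem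
  that defines \<open>rate\<close>.\<close>

lemma inclusion_iff_rate:
 assumes v: "v \<in> carr X"
 shows "(\<exists>p \<in> subdifferential X (Psi D \<psi> \<epsilon> (y' t) \<omega>) v. \<exists>q. has_gateaux_derivative X (Phi D A \<epsilon> (y t) \<omega>) q u \<and> (\<forall>w\<in>carr X. p w + q w = 0))
  \<longleftrightarrow> DE.rate (t, \<omega>) (grad u) = grad v"
proof -
 let ?F = "DE.F (t, \<omega>) (grad u)"
 have F: "?F (grad w) = Psi D \<psi> \<epsilon> (y' t) \<omega> w + q0 w" if "w \<in> carr X" for w
  unfolding DE.F_def Psi_eq[OF that] by simp
 have qd: "q0 (w - v) = q0 w - q0 v" if w: "w \<in> carr X" for w
 proof -
  have "grad w = grad (w - v) + grad v" using DE.J_diff[OF w v] by simp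
  then show ?thesis using B_fun_right(1)[OF \<omega>, of _ "grad (w - v)" "grad v"] by simp
 qed
 have min: "DE.rate (t, \<omega>) (grad u) = grad v \<longleftrightarrow> (\<forall>w\<in>carr X. ?F (grad v) <= ?F (grad w))"
  using DE.rate_eq_iff[of "(t, \<omega>)" "grad u" "grad v"] \<omega> v by (simp add: minimiser_on_def)
 show ?thesis unfolding min
 proof
  assume "\<exists>p \<in> subdifferential X (Psi D \<psi> \<epsilon> (y' t) \<omega>) v. \<exists>q. has_gateaux_derivative X (Phi D A \<epsilon> (y t) \<omega>) q u \<and> (\<forall>w\<in>carr X. p w + q w = 0)"
  then obtain p q where p: "p \<in> subdifferential X (Psi D \<psi> \<epsilon> (y' t) \<omega>) v"
   and q: "has_gateaux_derivative X (Phi D A \<epsilon> (y t) \<omega>) q u" and pq: "!!w. w \<in> carr X ==> p w + q w = 0" by blast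
  show "\<forall>w\<in>carr X. ?F (grad v) <= ?F (grad w)"
  proof
   fix w assume w: "w \<in> carr X"
   have "p (w - v) = - (q0 w - q0 v)"
    using pq[OF DE.carr_diff[OF w v]] Phi_gateaux_unique[OF q DE.carr_diff[OF w v]] qd[OF w] by linarith
   moreover have "Psi D \<psi> \<epsilon> (y' t) \<omega> w \<ge> Psi D \<psi> \<epsilon> (y' t) \<omega> v + p (w - v)" using p w by (simp add: subdifferential_def)
   ultimately show "?F (grad v) <= ?F (grad w)" unfolding F[OF v] F[OF w] by linarith
  qed
 next
  assume le: "\<forall>w\<in>carr X. ?F (grad v) <= ?F (grad w)"
  have "(\<lambda>w. - q0 w) \<in> subdifferential X (Psi D \<psi> \<epsilon> (y' t) \<omega>) v"
   unfolding subdifferential_def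
  proof (intro CollectI conjI ballI q0_dual(2))
   fix w assume w: "w \<in> carr X"
   have "?F (grad v) <= ?F (grad w)" using le w by blast
   then show "Psi D \<psi> \<epsilon> (y' t) \<omega> w \<ge> Psi D \<psi> \<epsilon> (y' t) \<omega> v + - q0 (w - v)" unfolding F[OF v] F[OF w] qd[OF w] by linarith
  qed
  then show "\<exists>p \<in> subdifferential X (Psi D \<psi> \<epsilon> (y' t) \<omega>) v. \<exists>q. has_gateaux_derivative X (Phi D A \<epsilon> (y t) \<omega>) q u \<and> (\<forall>w\<in>carr X. p w + q w = 0)"
   using Phi_gateaux by (intro bexI[of _ "\<lambda>w. - q0 w"] exI[of _ q0]) simp_all
 qed
qed

end

end

lemma grad_eq_if_nrm_zero: "u \<in> carr X ==> v \<in> carr X ==> nrm X (u - v) = 0 ==> grad u = grad v"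
 using DE.nrm_J[OF DE.carr_diff, of u v] DE.J_diff[of u v] by simp

text \<open>Fubini turns a null set of pairs into null sets of \<omega> for almost every time.
  Outside them the joint representatives differ from \<open>u\<close> and its derivative by seminorm
  0, hence have the same gradients.\<close>

lemma solves_if_is_solution:
 assumes "is_solution T D \<Gamma>N M A \<psi> \<epsilon> y u"
 shows "DE.solves_with u (time_derivative T DE.Y u)"
proof -
 interpret LM: pair_sigma_finite DE.L M ..
 let ?v = "time_derivative T DE.Y u"
 have u: "u \<in> time_H1 T DE.Y" "nrm DE.Y (u 0) = 0"
  and ex: "\<exists>U V. joint_representative T X M u U \<and> joint_representative T X M ?v V \<and>
      (AE (t, \<omega>) in DE.L \<Otimes>\<^sub>M M.
        \<exists>p \<in> subdifferential X (Psi D \<psi> \<epsilon> (y' t) \<omega>) (V (t, \<omega>)).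
        \<exists>q. has_gateaux_derivative X (Phi D A \<epsilon> (y t) \<omega>) q (U (t, \<omega>)) \<and> (\<forall>w\<in>carr X. p w + q w = 0))"
  using assms unfolding is_solution_def Let_def by simp_all
 obtain U V where U: "joint_representative T X M u U" and V: "joint_representative T X M ?v V"
  and ae: "AE (t, \<omega>) in DE.L \<Otimes>\<^sub>M M.
        \<exists>p \<in> subdifferential X (Psi D \<psi> \<epsilon> (y' t) \<omega>) (V (t, \<omega>)).
        \<exists>q. has_gateaux_derivative X (Phi D A \<epsilon> (y t) \<omega>) q (U (t, \<omega>)) \<and> (\<forall>w\<in>carr X. p w + q w = 0)"
  using ex by (elim exE conjE)
 have Uc: "U z \<in> carr X" and Vc: "V z \<in> carr X" if "z \<in> space (DE.L \<Otimes>\<^sub>M M)" for z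
  using U V that by (simp_all add: joint_representative_def strongly_measurable_def)
 note v = time_derivative_weak[OF u(1)]
 have uZ: "u \<in> carr (bochner_L2 DE.Y DE.L)" using u(1) by (simp add: time_H1_def)
 have "AE t in DE.L. AE \<omega> in M. grad (?v t \<omega>) = DE.rate (t, \<omega>) (grad (u t \<omega>))"
  using LM.AE_pair[OF ae] U[unfolded joint_representative_def, THEN conjunct2] V[unfolded joint_representative_def, THEN conjunct2] AE_space
 proof eventually_elim
  case (elim t)
  then have t: "t \<in> {0..T}" by (simp add: DE.TY.space_L)
  show ?case using elim(1-3) AE_good AE_space
  proof eventually_elim
   case (elim \<omega>)
   note z = DE.in_P[OF t elim(5)]
   have uc: "u t \<omega> \<in> carr X" and vc: "?v t \<omega> \<in> carr X"
    using DE.carr_bochner_L2D(1)[OF DE.Y.carr_bochner_L2_in[OF uZ, unfolded DE.TY.space_L, OF t] elim(5)]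
     DE.carr_bochner_L2D(1)[OF DE.Y.carr_bochner_L2_in[OF v(1), unfolded DE.TY.space_L, OF t] elim(5)] .
   have "DE.rate (t, \<omega>) (grad (U (t, \<omega>))) = grad (V (t, \<omega>))"
    using inclusion_iff_rate[OF t elim(5,4) Uc[OF z] Vc[OF z]] elim(1) by simp
   then show ?case
    using grad_eq_if_nrm_zero[OF Uc[OF z] uc elim(2)] grad_eq_if_nrm_zero[OF Vc[OF z] vc elim(3)] by simp
  qed
 qed
 then show ?thesis using u v by simp
qed

lemma u_sol_is_solution: "is_solution T D \<Gamma>N M A \<psi> \<epsilon> y DE.u_sol"
proof -
 let ?v = "time_derivative T DE.Y DE.u_sol"
 let ?U = "\<lambda>(t, \<omega>). DE.u_sol t \<omega>" and ?V = "\<lambda>(t, \<omega>). DE.v_sol t \<omega>"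
 note v = time_derivative_weak[OF DE.u_sol_time_H1]
 have nrm0: "nrm X 0 = 0" using DE.nrm_scaleR[OF DE.carr_zero, of 0] by simp
 have U: "joint_representative T X M DE.u_sol ?U"
  unfolding joint_representative_def using DE.solution_strongly_measurable(1) by (simp add: nrm0)
 \<comment> \<open>\<open>time_derivative\<close> is an unspecified choice of weak derivative. By
   uniqueness it agrees with \<open>v_sol\<close> for almost every time, so \<open>v_sol\<close>
   yields its joint representative.\<close>
 have "AE t in DE.L. nrm DE.Y (DE.v_sol t - ?v t) = 0"
  by (rule DE.TY.weak_time_derivative_unique[OF DE.u_sol_bochner_L2 DE.v_sol_bochner_L2 DE.u_sol_weak_derivative v])
 then have "AE t in DE.L. AE \<omega> in M. nrm X (?V (t, \<omega>) - ?v t \<omega>) = 0"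
  using AE_space
 proof eventually_elim
  case (elim t)
  note dc = DE.Y.carr_diff[OF DE.Y.carr_bochner_L2_in[OF DE.v_sol_bochner_L2 elim(2)] DE.Y.carr_bochner_L2_in[OF v(1) elim(2)]]
  have "AE \<omega> in M. grad ((DE.v_sol t - ?v t) \<omega>) = 0"
   using elim(1) unfolding DE.nrm_bochner_L2_carr[OF dc] L2norm_eq_0_iff[OF DE.carr_bochner_L2D(2)[OF dc]] .
  then show ?case using AE_space
  proof eventually_elim
   case (elim \<omega>)
   then show ?case using DE.nrm_J[OF DE.carr_bochner_L2D(1)[OF dc elim(2)]] by simp
  qed
 qed
 then have V: "joint_representative T X M ?v ?V"
  unfolding joint_representative_def using DE.solution_strongly_measurable(2) by blast
 obtain N where N: "N \<in> null_sets M" "{\<omega>\<in>space M. \<not> (AE x in lebesgue. x \<in> D --> good \<omega> x)} \<subseteq> N"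
  using AE_good unfolding eventually_ae_filter by (rule bexE)
 \<comment> \<open>The exceptional pairs are enclosed in a rectangle over a null set of \<omega>, so
   the set where the inclusion fails need not be shown measurable.\<close>
 have "{0..T} \<times> N \<in> null_sets (DE.L \<Otimes>\<^sub>M M)"
 proof (rule null_setsI)
  have s: "{0..T} \<in> sets DE.L" "N \<in> sets M" using N(1) sets.top[of DE.L] by (auto simp: DE.TY.space_L)
  show "{0..T} \<times> N \<in> sets (DE.L \<Otimes>\<^sub>M M)" by (rule pair_measureI[OF s])
  show "emeasure (DE.L \<Otimes>\<^sub>M M) ({0..T} \<times> N) = 0" using N(1) by (simp add: M.emeasure_pair_measure_Times[OF s] null_setsD1)
 qed
 then have ae: "AE (t, \<omega>) in DE.L \<Otimes>\<^sub>M M.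
        \<exists>p \<in> subdifferential X (Psi D \<psi> \<epsilon> (y' t) \<omega>) (?V (t, \<omega>)).
        \<exists>q. has_gateaux_derivative X (Phi D A \<epsilon> (y t) \<omega>) q (?U (t, \<omega>)) \<and> (\<forall>w\<in>carr X. p w + q w = 0)"
 proof (rule AE_I', intro subsetI)
  fix z assume z: "z \<in> {z \<in> space (DE.L \<Otimes>\<^sub>M M). \<not> (case z of (t, \<omega>) =>
        \<exists>p \<in> subdifferential X (Psi D \<psi> \<epsilon> (y' t) \<omega>) (?V (t, \<omega>)).
        \<exists>q. has_gateaux_derivative X (Phi D A \<epsilon> (y t) \<omega>) q (?U (t, \<omega>)) \<and> (\<forall>w\<in>carr X. p w + q w = 0))}"
  obtain t \<omega> where eq: "z = (t, \<omega>)" by (cases z)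
  have t: "t \<in> {0..T}" and \<omega>: "\<omega> \<in> space M" using z by (simp_all add: eq DE.space_P)
  have "\<not> (AE x in lebesgue. x \<in> D --> good \<omega> x)"
  proof
   assume g: "AE x in lebesgue. x \<in> D --> good \<omega> x"
   have "DE.rate (t, \<omega>) (grad (DE.u_sol t \<omega>)) = grad (DE.v_sol t \<omega>)"
    using t \<omega> by (simp add: DE.J_u_sol DE.J_v_sol DE.V_def)
   then show False
    using z inclusion_iff_rate[OF t \<omega> g DE.u_sol_carr_pointwise[OF t \<omega>] DE.v_sol_carr_pointwise[OF t \<omega>]] by (simp add: eq)
  qed
  then show "z \<in> {0..T} \<times> N" using N(2) t \<omega> by (auto simp: eq)
 qed
 show ?thesis unfolding is_solution_def Let_def
  by (intro conjI exI[of _ ?U] exI[of _ ?V] DE.u_sol_time_H1 DE.u_sol_0 U V ae)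
qed

end

theorem theorem1:
  fixes T \<epsilon> :: real
    and D \<Gamma>D \<Gamma>N :: "(real^'n) set"
    and M :: "'w measure"
    and \<tau> :: "real^'n \<Rightarrow> 'w \<Rightarrow> 'w"
    and A :: "'w \<Rightarrow> real^'n \<Rightarrow> real^'n^'n"
    and A\<^sub>0 :: "'w \<Rightarrow> real^'n^'n"
    and \<alpha> \<beta> c C :: real
    and \<psi> :: "'w \<Rightarrow> real^'n \<Rightarrow> real^'n \<Rightarrow> real"
    and \<psi>\<^sub>0 :: "'w \<Rightarrow> real^'n \<Rightarrow> real"
    and y :: "real \<Rightarrow> real^'n \<Rightarrow> real"
  assumes "T > 0"
    and "bounded D" and "lipschitz_domain D"
    and "frontier D = \<Gamma>D \<union> \<Gamma>N" and "\<Gamma>D \<inter> \<Gamma>N = {}"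
    and "openin (top_of_set (frontier D)) \<Gamma>D" and "openin (top_of_set (frontier D)) \<Gamma>N"
    and "\<Gamma>D \<noteq> {}" and "capacity \<Gamma>D \<noteq> 0"
    and "prob_space M" and "separable_L2 M" and "ergodic_dynamical_system M \<tau>"
    and A_measurable: "(\<lambda>(\<omega>, x). A \<omega> x) \<in> borel_measurable (M \<Otimes>\<^sub>M lebesgue)"
    and A0_measurable: "A\<^sub>0 \<in> borel_measurable M"
    and A_stationary: "\<forall>x. AE \<omega> in M. A \<omega> x = A\<^sub>0 (\<tau> x \<omega>)"
    and A_symmetric: "AE (\<omega>, x) in M \<Otimes>\<^sub>M lebesgue. transpose (A \<omega> x) = A \<omega> x"
    and "0 < \<alpha>" and "\<alpha> \<le> \<beta>"
    and A_bounds: "AE (\<omega>, x) in M \<Otimes>\<^sub>M lebesgue. \<forall>\<xi>.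
           \<alpha> * (norm \<xi>)\<^sup>2 \<le> \<xi> \<bullet> (A \<omega> x *v \<xi>) \<and> \<xi> \<bullet> (A \<omega> x *v \<xi>) \<le> \<beta> * (norm \<xi>)\<^sup>2"
    and psi_measurable: "\<forall>\<xi>. (\<lambda>(\<omega>, x). \<psi> \<omega> x \<xi>) \<in> borel_measurable (M \<Otimes>\<^sub>M lebesgue)"
    and psi_stationary: "\<forall>\<xi> x. AE \<omega> in M. \<psi> \<omega> x \<xi> = \<psi>\<^sub>0 (\<tau> x \<omega>) \<xi>"
    and psi_nonneg: "\<forall>\<omega>\<in>space M. \<forall>x \<xi>. \<psi> \<omega> x \<xi> \<ge> 0"
    and psi_zero: "\<forall>\<omega>\<in>space M. \<forall>x. \<psi> \<omega> x 0 = 0"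
    and "c > 0"
    and psi_convex: "AE (\<omega>, x) in M \<Otimes>\<^sub>M lebesgue. convex_on UNIV (\<lambda>\<xi>. \<psi> \<omega> x \<xi> - c * (norm \<xi>)\<^sup>2)"
    and "C > 0"
    and psi_growth: "\<forall>\<xi>. AE (\<omega>, x) in M \<Otimes>\<^sub>M lebesgue. \<psi> \<omega> x \<xi> \<le> C * (1 + (norm \<xi>)\<^sup>2)"
    and "\<epsilon> > 0"
    and "y \<in> time_H1 T (H1 D)"
  shows "\<exists>u. is_solution T D \<Gamma>N M A \<psi> \<epsilon> y u \<and>
             (\<forall>u'. is_solution T D \<Gamma>N M A \<psi> \<epsilon> y u' \<longrightarrow>
                   (\<forall>t\<in>{0..T}. nrm (bochner_L2 (H1_zero_on D \<Gamma>N) M) (u' t - u t) = 0))"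
proof -
 have D: "open D" using assms(3) by (simp add: lipschitz_domain_def)
 interpret evolution_problem D M A \<psi> \<epsilon> \<alpha> \<beta> c C T \<Gamma>N y
  by (intro evolution_problem.intro evolution_problem_axioms.intro random_integrands.intro
    random_integrands_axioms.intro bounded_open.intro D assms)
 have "nrm (bochner_L2 (H1_zero_on D \<Gamma>N) M) (u' t - DE.u_sol t) = 0"
  if "is_solution T D \<Gamma>N M A \<psi> \<epsilon> y u'" "t \<in> {0..T}" for u' t
  by (rule DE.solution_unique[OF solves_if_is_solution[OF that(1)] DE.solution_exists that(2)])
 then show ?thesis using u_sol_is_solution by blast
qed

end
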